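(* Let $R$ be an F-finite local ring of prime characteristic $p>0$ and depth $t$, $M$ a finite $R$-module, and $r$ an integer with $0\le r\le t$ such that $M$ satisfies $(\widetilde S_r)$ and, if $r<t$, $\operatorname{Ext}_R^i(M,R)=0$ for all $1\le i\le t-r$. Let $N\ne0$ be a finite $R$-module such that $\operatorname{pd}_R N\le t-r$. Suppose any one of the following: (1) There is an integer $\ell\ge1$ such that $\operatorname{Ext}_R^i(\operatorname{Hom}_R(M,N),R^{(e)})=0$ for all $i=\ell,\ldots,\ell+t$ and infinitely many $e$. (2) $\operatorname{Tor}^R_j(\operatorname{Hom}_R(M,N),R^{(e)})=0$ for all $j\gg0$ and $p^e\gg0$. Then $M$ is free.
   Context: Rings are commutative Noetherian; finite means finitely generated. For $e\ge1$, $R^{(e)}$ denotes $R$ viewed as an $R$-module via the $e$-th iterate of Frobenius $F^e\colon R\to R$, $a\mapsto a^{p^e}$. $R$ is F-finite if $R^{(e)}$ is a finite $R$-module for some (equivalently every) $e\ge1$. A finite $R$-module $M$ satisfies $(\widetilde S_n)$ if $\operatorname{depth}_{R_{\mathfrak p}}M_{\mathfrak p}\ge\min\{n,\operatorname{depth}R_{\mathfrak p}\}$ for all $\mathfrak p\in\operatorname{Spec}(R)$, with $\operatorname{depth}0=\infty$. $\operatorname{pd}$ is projective dimension. *)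

theory Defs
  imports "HOL-Algebra.Algebra" "HOL-Library.Extended_Nat"
begin

text \<open>
  Modules are records of type \<^typ>\<open>('a, 'b) module\<close>, which extend ring records. The fields
  \<^const>\<open>monoid.mult\<close> and \<^const>\<open>monoid.one\<close> of a module play no role (the locale \<^locale>\<open>module\<close> does not
  constrain them) and are left undefined in most constructions below.
\<close>

section \<open>Rings\<close>

locale local_noetherian_ring = cring R + noetherian_ring R for R (structure) +
  assumes unique_maximal: "\<exists>!m. maximalideal m R"

definition max_ideal :: "'a ring \<Rightarrow> 'a set" where
  "max_ideal R = (THE m. maximalideal m R)"

definition has_char :: "'a ring \<Rightarrow> nat \<Rightarrow> bool" where
  "has_char R p \<longleftrightarrow> (\<forall>n::nat. [n] \<cdot>\<^bsub>R\<^esub> \<one>\<^bsub>R\<^esub> = \<zero>\<^bsub>R\<^esub> \<longleftrightarrow> p dvd n)"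


section \<open>Basic constructions with modules\<close>

definition zero_module :: "('a, 'b) module \<Rightarrow> bool" where
  "zero_module M \<longleftrightarrow> carrier M = {\<zero>\<^bsub>M\<^esub>}"

definition ring_module :: "'a ring \<Rightarrow> ('a, 'a) module" where
  "ring_module R =
     \<lparr>carrier = carrier R, monoid.mult = monoid.mult R, monoid.one = \<one>\<^bsub>R\<^esub>,
      ring.zero = \<zero>\<^bsub>R\<^esub>, ring.add = ring.add R, smult = monoid.mult R\<rparr>"

text \<open>\<open>R\<^sup>(\<^sup>e\<^sup>)\<close>: the ring \<open>R\<close> with scalars acting through the \<open>e\<close>-th iterate of Frobenius.\<close>

definition frobenius_module :: "'a ring \<Rightarrow> nat \<Rightarrow> nat \<Rightarrow> ('a, 'a) module" where
  "frobenius_module R p e =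
     (ring_module R)\<lparr>smult := (\<lambda>a x. (a [^]\<^bsub>R\<^esub> (p ^ e)) \<otimes>\<^bsub>R\<^esub> x)\<rparr>"

definition module_span :: "'a ring \<Rightarrow> ('a, 'b) module \<Rightarrow> 'b set \<Rightarrow> 'b set" where
  "module_span R M S = \<Inter>{H. submodule H R M \<and> S \<subseteq> H}"

definition finite_module :: "'a ring \<Rightarrow> ('a, 'b) module \<Rightarrow> bool" where
  "finite_module R M \<longleftrightarrow> (\<exists>S. finite S \<and> S \<subseteq> carrier M \<and> module_span R M S = carrier M)"

definition F_finite :: "'a ring \<Rightarrow> nat \<Rightarrow> bool" where
  "F_finite R p \<longleftrightarrow> (\<exists>e\<ge>1. finite_module R (frobenius_module R p e))"

definition quot_module :: "('a, 'b) module \<Rightarrow> 'b set \<Rightarrow> ('a, 'b set) module" where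
  "quot_module M H =
     \<lparr>carrier = a_rcosets\<^bsub>M\<^esub> H, monoid.mult = undefined, monoid.one = undefined,
      ring.zero = H, ring.add = set_add M,
      smult = (\<lambda>a Z. \<Union>x\<in>Z. H +>\<^bsub>M\<^esub> (a \<odot>\<^bsub>M\<^esub> x))\<rparr>"

text \<open>Linear maps are extensional, so that the elements of \<open>Hom\<^sub>R(M, N)\<close> are determined by their
  values on the carrier of \<open>M\<close>.\<close>

definition lin_maps :: "'a ring \<Rightarrow> ('a, 'b) module \<Rightarrow> ('a, 'c) module \<Rightarrow> ('b \<Rightarrow> 'c) set" where
  "lin_maps R M N = {f \<in> carrier M \<rightarrow>\<^sub>E carrier N.
     (\<forall>x\<in>carrier M. \<forall>y\<in>carrier M. f (x \<oplus>\<^bsub>M\<^esub> y) = f x \<oplus>\<^bsub>N\<^esub> f y) \<and>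
     (\<forall>a\<in>carrier R. \<forall>x\<in>carrier M. f (a \<odot>\<^bsub>M\<^esub> x) = a \<odot>\<^bsub>N\<^esub> f x)}"

definition lin_kernel :: "('a, 'b) module \<Rightarrow> ('a, 'c) module \<Rightarrow> ('b \<Rightarrow> 'c) \<Rightarrow> 'b set" where
  "lin_kernel M N f = {x \<in> carrier M. f x = \<zero>\<^bsub>N\<^esub>}"

definition hom_module ::
    "'a ring \<Rightarrow> ('a, 'b) module \<Rightarrow> ('a, 'c) module \<Rightarrow> ('a, 'b \<Rightarrow> 'c) module" where
  "hom_module R M N =
     \<lparr>carrier = lin_maps R M N, monoid.mult = undefined, monoid.one = undefined,
      ring.zero = (\<lambda>x\<in>carrier M. \<zero>\<^bsub>N\<^esub>),
      ring.add = (\<lambda>f g. \<lambda>x\<in>carrier M. f x \<oplus>\<^bsub>N\<^esub> g x),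
      smult = (\<lambda>a f. \<lambda>x\<in>carrier M. a \<odot>\<^bsub>N\<^esub> f x)\<rparr>"

text \<open>The free module on a set \<open>Z\<close>: finitely supported functions, extended by zero outside \<open>Z\<close>.\<close>

definition free_module_on :: "'a ring \<Rightarrow> 'x set \<Rightarrow> ('a, 'x \<Rightarrow> 'a) module" where
  "free_module_on R Z =
     \<lparr>carrier = {c. (\<forall>x. c x \<in> carrier R) \<and> {x. c x \<noteq> \<zero>\<^bsub>R\<^esub>} \<subseteq> Z \<and> finite {x. c x \<noteq> \<zero>\<^bsub>R\<^esub>}},
      monoid.mult = undefined, monoid.one = undefined,
      ring.zero = (\<lambda>_. \<zero>\<^bsub>R\<^esub>),
      ring.add = (\<lambda>c d x. c x \<oplus>\<^bsub>R\<^esub> d x),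
      smult = (\<lambda>a c x. a \<otimes>\<^bsub>R\<^esub> c x)\<rparr>"

definition free_gen :: "'a ring \<Rightarrow> 'x \<Rightarrow> 'x \<Rightarrow> 'a" where
  "free_gen R x = (\<lambda>y. if y = x then \<one>\<^bsub>R\<^esub> else \<zero>\<^bsub>R\<^esub>)"

text \<open>A module is free if it has a basis: a subset such that every element is a linear combination
  of it with unique coefficients.\<close>

definition free_module :: "'a ring \<Rightarrow> ('a, 'b) module \<Rightarrow> bool" where
  "free_module R M \<longleftrightarrow> (\<exists>B\<subseteq>carrier M.
     bij_betw (\<lambda>c. \<Oplus>\<^bsub>M\<^esub>b\<in>{b. c b \<noteq> \<zero>\<^bsub>R\<^esub>}. c b \<odot>\<^bsub>M\<^esub> b)
       (carrier (free_module_on R B)) (carrier M))"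


section \<open>Tensor products\<close>

definition tensor_rel ::
    "'a ring \<Rightarrow> ('a, 'b) module \<Rightarrow> ('a, 'c) module \<Rightarrow> ('b \<times> 'c \<Rightarrow> 'a) set" where
  "tensor_rel R M N =
     (let F = free_module_on R (carrier M \<times> carrier N); g = (\<lambda>x y. free_gen R (x, y)) in
      module_span R F
       ({g (x \<oplus>\<^bsub>M\<^esub> x') y \<ominus>\<^bsub>F\<^esub> (g x y \<oplus>\<^bsub>F\<^esub> g x' y) | x x' y.
           x \<in> carrier M \<and> x' \<in> carrier M \<and> y \<in> carrier N} \<union>
        {g x (y \<oplus>\<^bsub>N\<^esub> y') \<ominus>\<^bsub>F\<^esub> (g x y \<oplus>\<^bsub>F\<^esub> g x y') | x y y'.
           x \<in> carrier M \<and> y \<in> carrier N \<and> y' \<in> carrier N} \<union>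
        {g (a \<odot>\<^bsub>M\<^esub> x) y \<ominus>\<^bsub>F\<^esub> a \<odot>\<^bsub>F\<^esub> g x y | a x y.
           a \<in> carrier R \<and> x \<in> carrier M \<and> y \<in> carrier N} \<union>
        {g x (a \<odot>\<^bsub>N\<^esub> y) \<ominus>\<^bsub>F\<^esub> a \<odot>\<^bsub>F\<^esub> g x y | a x y.
           a \<in> carrier R \<and> x \<in> carrier M \<and> y \<in> carrier N}))"

definition tensor_module ::
    "'a ring \<Rightarrow> ('a, 'b) module \<Rightarrow> ('a, 'c) module \<Rightarrow> ('a, ('b \<times> 'c \<Rightarrow> 'a) set) module" where
  "tensor_module R M N =
     quot_module (free_module_on R (carrier M \<times> carrier N)) (tensor_rel R M N)"

text \<open>For \<open>f : M \<rightarrow> M'\<close> the map \<open>f \<otimes> N : M \<otimes> N \<rightarrow> M' \<otimes> N\<close>: the linear extension of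
  \<open>(x, y) \<mapsto> (f x, y)\<close> to the free modules, passed to the quotients.\<close>

definition tensor_map ::
    "'a ring \<Rightarrow> ('a, 'b) module \<Rightarrow> ('a, 'c) module \<Rightarrow> ('b \<Rightarrow> 'b') \<Rightarrow> ('a, 'b') module
      \<Rightarrow> ('b \<times> 'c \<Rightarrow> 'a) set \<Rightarrow> ('b' \<times> 'c \<Rightarrow> 'a) set" where
  "tensor_map R M N f M' =
     (\<lambda>Z \<in> carrier (tensor_module R M N). \<Union>c\<in>Z.
        tensor_rel R M' N +>\<^bsub>free_module_on R (carrier M' \<times> carrier N)\<^esub>
          (\<lambda>(x', y). \<Oplus>\<^bsub>R\<^esub>x\<in>{x. c (x, y) \<noteq> \<zero>\<^bsub>R\<^esub> \<and> f x = x'}. c (x, y)))"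


section \<open>Projective resolutions, projective dimension, Ext and Tor\<close>

text \<open>
  Projectivity is the lifting property against surjections \<open>A \<rightarrow> B\<close>. A definition cannot quantify
  over all types of \<open>A\<close> and \<open>B\<close>; the two types chosen suffice, since they include the surjection
  from the free module on the carrier of \<open>P\<close> onto \<open>P\<close>, and if that one splits then \<open>P\<close> is a direct
  summand of a free module and lifts against all surjections.
\<close>

definition projective_module :: "'a ring \<Rightarrow> ('a, 'b) module \<Rightarrow> bool" where
  "projective_module R P \<longleftrightarrow> module R P \<and>
     (\<forall>(A :: ('a, 'b \<Rightarrow> 'a) module) (B :: ('a, 'b) module) f g.
        module R A \<and> module R B \<and> f \<in> lin_maps R A B \<and> f ` carrier A = carrier B \<and>
        g \<in> lin_maps R P B \<longrightarrow>
        (\<exists>h \<in> lin_maps R P A. \<forall>x\<in>carrier P. f (h x) = g x))"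

text \<open>\<open>\<dots> \<rightarrow> P 2 \<rightarrow> P 1 \<rightarrow> P 0 \<rightarrow> M \<rightarrow> 0\<close> with differentials \<open>d n : P (n + 1) \<rightarrow> P n\<close> and
  augmentation \<open>\<epsilon> : P 0 \<rightarrow> M\<close>.\<close>

definition proj_resolution ::
    "'a ring \<Rightarrow> ('a, 'b) module \<Rightarrow> (nat \<Rightarrow> ('a, 'x) module) \<Rightarrow> (nat \<Rightarrow> 'x \<Rightarrow> 'x) \<Rightarrow> ('x \<Rightarrow> 'b) \<Rightarrow> bool"
  where
  "proj_resolution R M P d \<epsilon> \<longleftrightarrow>
     (\<forall>n. projective_module R (P n)) \<and>
     (\<forall>n. d n \<in> lin_maps R (P (Suc n)) (P n)) \<and>
     \<epsilon> \<in> lin_maps R (P 0) M \<and>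
     \<epsilon> ` carrier (P 0) = carrier M \<and>
     d 0 ` carrier (P (Suc 0)) = lin_kernel (P 0) M \<epsilon> \<and>
     (\<forall>n. d (Suc n) ` carrier (P (Suc (Suc n))) = lin_kernel (P (Suc n)) (P n) (d n))"

text \<open>
  The modules in a resolution are taken in the type \<^typ>\<open>nat \<Rightarrow> 'a\<close>, which contains copies of all
  \<open>R\<^sup>n\<close> and their submodules. A finite module \<open>M\<close> over a Noetherian ring has a resolution
  by such modules, and it has one of length \<open>n\<close> whenever its projective dimension is at most \<open>n\<close>
  (an \<open>n\<close>-th syzygy in a resolution by finite free modules is then projective).
  The notions below are meant for such \<open>M\<close>.
\<close>

definition proj_dim :: "'a ring \<Rightarrow> ('a, 'b) module \<Rightarrow> enat" where
  "proj_dim R M = Inf {enat n | n.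
     \<exists>(P :: nat \<Rightarrow> ('a, nat \<Rightarrow> 'a) module) d \<epsilon>.
       proj_resolution R M P d \<epsilon> \<and> (\<forall>i>n. zero_module (P i))}"

definition chosen_resolution ::
    "'a ring \<Rightarrow> ('a, 'b) module \<Rightarrow>
      (nat \<Rightarrow> ('a, nat \<Rightarrow> 'a) module) \<times> (nat \<Rightarrow> (nat \<Rightarrow> 'a) \<Rightarrow> (nat \<Rightarrow> 'a))" where
  "chosen_resolution R M = (SOME (P, d). \<exists>\<epsilon>. proj_resolution R M P d \<epsilon>)"

definition ext_module ::
    "'a ring \<Rightarrow> nat \<Rightarrow> ('a, 'b) module \<Rightarrow> ('a, 'c) module \<Rightarrow> ('a, ((nat \<Rightarrow> 'a) \<Rightarrow> 'c) set) module"
  where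
  "ext_module R i M N =
     (let (P, d) = chosen_resolution R M;
          C = (\<lambda>n. hom_module R (P n) N);
          \<delta> = (\<lambda>n \<phi>. compose (carrier (P (Suc n))) \<phi> (d n))
      in quot_module ((C i)\<lparr>carrier := lin_kernel (C i) (C (Suc i)) (\<delta> i)\<rparr>)
           (case i of 0 \<Rightarrow> {\<zero>\<^bsub>C 0\<^esub>} | Suc j \<Rightarrow> \<delta> j ` carrier (C j)))"

definition tor_module ::
    "'a ring \<Rightarrow> nat \<Rightarrow> ('a, 'b) module \<Rightarrow> ('a, 'c) module \<Rightarrow>
      ('a, ((nat \<Rightarrow> 'a) \<times> 'c \<Rightarrow> 'a) set set) module" where
  "tor_module R i M N =
     (let (P, d) = chosen_resolution R M;
          C = (\<lambda>n. tensor_module R (P n) N);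
          \<delta> = (\<lambda>n. tensor_map R (P (Suc n)) N (d n) (P n))
      in quot_module
           ((C i)\<lparr>carrier :=
              (case i of 0 \<Rightarrow> carrier (C 0) | Suc j \<Rightarrow> lin_kernel (C (Suc j)) (C j) (\<delta> j))\<rparr>)
           (\<delta> i ` carrier (C (Suc i))))"


section \<open>Depth\<close>

definition seq_submodule :: "'a ring \<Rightarrow> ('a, 'b) module \<Rightarrow> 'a list \<Rightarrow> 'b set" where
  "seq_submodule R M xs = module_span R M {x \<odot>\<^bsub>M\<^esub> m | x m. x \<in> set xs \<and> m \<in> carrier M}"

definition regular_sequence :: "'a ring \<Rightarrow> ('a, 'b) module \<Rightarrow> 'a list \<Rightarrow> bool" where
  "regular_sequence R M xs \<longleftrightarrow> set xs \<subseteq> carrier R \<and>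
     (\<forall>i<length xs. let Q = quot_module M (seq_submodule R M (take i xs)) in
        \<forall>z\<in>carrier Q. xs ! i \<odot>\<^bsub>Q\<^esub> z = \<zero>\<^bsub>Q\<^esub> \<longrightarrow> z = \<zero>\<^bsub>Q\<^esub>) \<and>
     \<not> zero_module (quot_module M (seq_submodule R M xs))"

text \<open>Depth of a finite module over a local Noetherian ring, with \<open>depth 0 = \<infinity>\<close>.\<close>

definition depth :: "'a ring \<Rightarrow> ('a, 'b) module \<Rightarrow> enat" where
  "depth R M = (if zero_module M then \<infinity>
     else Sup {enat (length xs) | xs. set xs \<subseteq> max_ideal R \<and> regular_sequence R M xs})"


section \<open>Localization and the condition \<open>S\<close>-tilde\<close>

text \<open>The fraction \<open>m/s\<close>, as an equivalence class of pairs.\<close>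

definition loc_frac :: "'a ring \<Rightarrow> 'a set \<Rightarrow> ('a, 'b) module \<Rightarrow> 'b \<Rightarrow> 'a \<Rightarrow> ('b \<times> 'a) set" where
  "loc_frac R S M m s = {(m', s'). m' \<in> carrier M \<and> s' \<in> S \<and>
     (\<exists>u\<in>S. u \<odot>\<^bsub>M\<^esub> (s' \<odot>\<^bsub>M\<^esub> m) = u \<odot>\<^bsub>M\<^esub> (s \<odot>\<^bsub>M\<^esub> m'))}"

definition loc_module ::
    "'a ring \<Rightarrow> 'a set \<Rightarrow> ('a, 'b) module \<Rightarrow> (('a \<times> 'a) set, ('b \<times> 'a) set) module" where
  "loc_module R S M =
     \<lparr>carrier = {loc_frac R S M m s | m s. m \<in> carrier M \<and> s \<in> S},
      monoid.mult = undefined, monoid.one = undefined,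
      ring.zero = loc_frac R S M \<zero>\<^bsub>M\<^esub> \<one>\<^bsub>R\<^esub>,
      ring.add = (\<lambda>Z Y. \<Union>(m, s)\<in>Z. \<Union>(n, t)\<in>Y.
               loc_frac R S M (t \<odot>\<^bsub>M\<^esub> m \<oplus>\<^bsub>M\<^esub> s \<odot>\<^bsub>M\<^esub> n) (s \<otimes>\<^bsub>R\<^esub> t)),
      smult = (\<lambda>A Z. \<Union>(a, s)\<in>A. \<Union>(m, t)\<in>Z. loc_frac R S M (a \<odot>\<^bsub>M\<^esub> m) (s \<otimes>\<^bsub>R\<^esub> t))\<rparr>"

definition loc_ring :: "'a ring \<Rightarrow> 'a set \<Rightarrow> ('a \<times> 'a) set ring" where
  "loc_ring R S =
     (let L = loc_module R S (ring_module R) in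
      \<lparr>carrier = carrier L, monoid.mult = smult L, monoid.one = loc_frac R S (ring_module R) \<one>\<^bsub>R\<^esub> \<one>\<^bsub>R\<^esub>,
       ring.zero = \<zero>\<^bsub>L\<^esub>, ring.add = ring.add L\<rparr>)"

definition S_tilde :: "'a ring \<Rightarrow> nat \<Rightarrow> ('a, 'b) module \<Rightarrow> bool" where
  "S_tilde R n M \<longleftrightarrow> (\<forall>\<pp>. primeideal \<pp> R \<longrightarrow>
     (let S = carrier R - \<pp>; R\<^sub>\<pp> = loc_ring R S; M\<^sub>\<pp> = loc_module R S M in
      depth R\<^sub>\<pp> M\<^sub>\<pp> \<ge> min (enat n) (depth R\<^sub>\<pp> (ring_module R\<^sub>\<pp>))))"

end

(* Let q = t - r, let L be the minimal free resolution of M, and let K be the dual complex of L, truncated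
after degree q + 1 and continued to the left by a resolution G, minimal in positive degrees, of the kernel of
the map from the dual of L_0 to the dual of L_1. The vanishing of Ext makes K exact. Since pd N is at most q,
K tensored with N stays exact far enough to the left, so that the total complex of G and the minimal resolution
of N is a free resolution of Hom(M, N). Applying Frobenius raises its matrix entries to high powers. If xs is a
maximal regular sequence and u a socle element modulo xs, an ideal containing xs and maximal among those that
avoid u contains all high powers of each nonunit, so the Frobenius vanishing is impossible unless the resolution
vanishes somewhere; hence G, and with it K, is bounded. Localized at a prime, a bounded exact complex of free
modules splits above the depth of the ring, so the cohomology of the dual of K is annihilated by
ideals containing long regular sequences. These are regular on M by the Serre condition, and the acyclicity
lemma shows that 0 -> M -> G_0^* -> G_1^* -> ... -> 0 is exact. By minimality M is free. *)
theory Submission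
 imports Defs
begin

text \<open>Dividing by one element of a regular sequence costs one place of exactness. A maximal
  regular sequence has \<open>t\<close> elements, so \<open>t + 1\<close> consecutive vanishing
  groups leave one exact place modulo the sequence, and there a socle element is played off against
  high powers of nonunits. The same loss, read in the dual direction, drives the acyclicity lemma.
  The truncation of K after degree q + 1 is dictated by N: Tor with N vanishes above degree q, so K
  stays exact after tensoring from the dual of L_0 to the left. The obstacle is that Ext, Tor and
  projective dimension refer to arbitrary projective resolutions, whereas the argument is about
  matrix entries. A comparison of resolutions bridges the two; beyond it, modules serve as
  coefficients for fixed matrices. Neither quotient complexes nor localized complexes are formed: a
  statement modulo \<open>xs\<close> is about representatives, and a splitting over the ring
  localized at a prime is an identity over R, multiplied by an element outside the prime.\<close>

no_notation var (\<open>X\<index>\<close>)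

abbreviation mod_add ("_ +[_] _" [65, 0, 66] 65) where "x +[A] y \<equiv> x \<oplus>\<^bsub>A\<^esub> y"
abbreviation mod_minus ("_ -[_] _" [65, 0, 66] 65) where "x -[A] y \<equiv> x \<ominus>\<^bsub>A\<^esub> y"
abbreviation mod_neg ("\<ominus>[_] _" [0, 81] 80) where "\<ominus>[A] x \<equiv> \<ominus>\<^bsub>A\<^esub> x"
abbreviation mod_zero ("\<zero>[_]") where "\<zero>[A] \<equiv> \<zero>\<^bsub>A\<^esub>"
abbreviation mod_smult ("_ *[_] _" [70, 0, 71] 70) where "a *[A] x \<equiv> a \<odot>\<^bsub>A\<^esub> x"

section \<open>Matrices acting on vectors over a module\<close>

locale crng = cring R for R :: "'a ring" (structure)

locale rmod = module R M for R :: "'a ring" (structure) and M :: "('a, 'b) module" (structure)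

text \<open>Unlike in \<open>lin_maps\<close>, values outside the carrier are free, so that
  compositions and lambda terms qualify without restriction; \<open>lin_maps_lin\<close> and
  \<open>lin_lin_maps\<close> translate.\<close>

definition lin :: "'a ring => ('a, 'b) module => ('a, 'c) module => ('b => 'c) => bool" where
 "lin R A B f \<longleftrightarrow> f \<in> carrier A \<rightarrow> carrier B \<and>
   (\<forall>x\<in>carrier A. \<forall>y\<in>carrier A. f (x +[A] y) = f x +[B] f y) \<and>
   (\<forall>a\<in>carrier R. \<forall>x\<in>carrier A. f (a *[A] x) = a *[B] f x)"

text \<open>\<open>pw A X\<close> is \<open>A \<otimes> R\<^sup>X\<close>, and \<open>mm A X D Y\<close> is \<open>A \<otimes> D\<close>; vectors vanish outside their index set.\<close>

definition pw :: "('a, 'b) module => 'x set => ('a, 'x => 'b) module" where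
 "pw A X = \<lparr>carrier = {v. (\<forall>x\<in>X. v x \<in> carrier A) \<and> (\<forall>x. x \<notin> X --> v x = \<zero>[A])},
   monoid.mult = undefined, monoid.one = undefined, ring.zero = (\<lambda>_. \<zero>[A]),
   ring.add = (\<lambda>v w x. v x +[A] w x), smult = (\<lambda>a v x. a *[A] v x)\<rparr>"

abbreviation "vec A X \<equiv> carrier (pw A X)"

definition lc :: "('a, 'b) module => 'x set => ('x => 'a) => ('x => 'b) => 'b" where
 "lc A X v g = (\<Oplus>\<^bsub>A\<^esub>x\<in>X. v x *[A] g x)"

definition mm :: "('a, 'b) module => 'x set => ('y => 'x => 'a) => 'y set => ('x => 'b) => 'y => 'b" where
 "mm A X D Y v = (\<lambda>y. if y \<in> Y then lc A X (D y) v else \<zero>[A])"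

definition mat :: "'a ring => 'y set => 'x set => ('y => 'x => 'a) => bool" where
 "mat R Y X D \<longleftrightarrow> (\<forall>y\<in>Y. \<forall>x\<in>X. D y x \<in> carrier R)"

definition mmul :: "'a ring => 'y set => ('z => 'y => 'a) => ('y => 'x => 'a) => 'z => 'x => 'a" where
 "mmul R Y E D z x = (\<Oplus>\<^bsub>R\<^esub>y\<in>Y. E z y \<otimes>\<^bsub>R\<^esub> D y x)"

definition tp :: "('y => 'x => 'a) => 'x => 'y => 'a" where "tp D x y = D y x"

text \<open>A complex of finite free modules is stored as matrices only, \<open>D i\<close> leading
  from degree \<open>Suc i\<close> to degree \<open>i\<close>. Tensoring it with \<open>A\<close> or
  applying Hom into \<open>A\<close> then changes nothing but the module from which vectors take
  their entries: \<open>dif\<close> and \<open>cod\<close> are the two differentials.\<close>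

abbreviation "dif A X D i \<equiv> mm A (X (Suc i)) (D i) (X i)"
abbreviation "cod A X D i \<equiv> mm A (X i) (tp (D i)) (X (Suc i))"

lemma matD: "mat R Y X D ==> y \<in> Y ==> x \<in> X ==> D y x \<in> carrier R" by (simp add: mat_def)

lemma mat_tp[simp]: "mat R X Y (tp D) \<longleftrightarrow> mat R Y X D" by (auto simp: mat_def tp_def)

lemma pw_sel[simp]: "\<zero>[pw A X] = (\<lambda>_. \<zero>[A])" "v +[pw A X] w = (\<lambda>x. v x +[A] w x)"
 "a *[pw A X] v = (\<lambda>x. a *[A] v x)"
 by (simp_all add: pw_def)

lemma pwI: "(\<And>x. x \<in> X ==> v x \<in> carrier A) ==> (\<And>x. x \<notin> X ==> v x = \<zero>[A]) ==> v \<in> vec A X"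
 by (simp add: pw_def)

lemma pwD: "v \<in> vec A X ==> x \<in> X ==> v x \<in> carrier A" by (simp add: pw_def)
lemma pw0: "v \<in> vec A X ==> x \<notin> X ==> v x = \<zero>[A]" by (simp add: pw_def)

lemma pw_ext: "v \<in> vec A X ==> w \<in> vec A X ==> (\<And>x. x \<in> X ==> v x = w x) ==> v = w"
 by (rule ext) (metis pw0)

lemmas rmodI = moduleI[THEN rmod.intro]

lemma (in rmod) pw_all: "v \<in> vec M X ==> v x \<in> carrier M"
 by (metis pwD pw0 M.zero_closed)

lemma (in rmod) rmod_pw: "rmod R (pw M X)"
proof (rule rmodI)
 show "cring R" by (rule R.is_cring)
 show "abelian_group (pw M X)"
 proof (rule abelian_groupI)
  fix v assume v: "v \<in> vec M X"
  show "\<exists>y\<in>vec M X. y +[pw M X] v = \<zero>[pw M X]"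
  proof (rule bexI[of _ "\<lambda>x. \<ominus>[M] v x"])
   show "(\<lambda>x. \<ominus>[M] v x) \<in> vec M X" using v by (auto simp: pw_def)
  qed (rule ext, simp add: pw_all[OF v] M.l_neg)
  show "\<zero>[pw M X] +[pw M X] v = v" by (rule ext) (simp add: pw_all[OF v])
  fix w assume w: "w \<in> vec M X"
  show "v +[pw M X] w \<in> vec M X" using pw_all[OF v] pw_all[OF w] pw0[OF v] pw0[OF w] by (intro pwI) auto
  show "v +[pw M X] w = w +[pw M X] v" by (simp add: pw_all[OF v] pw_all[OF w] M.a_comm)
  fix u assume u: "u \<in> vec M X"
  show "v +[pw M X] w +[pw M X] u = v +[pw M X] (w +[pw M X] u)"
   by (simp add: pw_all[OF v] pw_all[OF w] pw_all[OF u] M.a_assoc)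
 qed (auto intro: pwI)
 fix a b v w assume a: "a \<in> carrier R" and b: "b \<in> carrier R" and v: "v \<in> vec M X" and w: "w \<in> vec M X"
 show "a *[pw M X] v \<in> vec M X" using a pw_all[OF v] pw0[OF v] by (intro pwI) auto
 show "(a \<oplus> b) *[pw M X] v = a *[pw M X] v +[pw M X] b *[pw M X] v"
  using a b pw_all[OF v] by (simp add: smult_l_distr)
 show "a *[pw M X] (v +[pw M X] w) = a *[pw M X] v +[pw M X] a *[pw M X] w"
  using a pw_all[OF v] pw_all[OF w] by (simp add: smult_r_distr)
 show "(a \<otimes> b) *[pw M X] v = a *[pw M X] (b *[pw M X] v)"
  using a b pw_all[OF v] by (simp add: smult_assoc1)
next
 fix v assume v: "v \<in> vec M X"
 show "\<one> *[pw M X] v = v" using pw_all[OF v] by simp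
qed

lemma (in rmod) pw_neg: "v \<in> vec M X ==> \<ominus>[pw M X] v = (\<lambda>x. \<ominus>[M] v x)"
proof -
 interpret P: rmod R "pw M X" by (rule rmod_pw)
 assume v: "v \<in> vec M X"
 have c: "(\<lambda>x. \<ominus>[M] v x) \<in> vec M X" using v by (auto simp: pw_def)
 have "v +[pw M X] (\<lambda>x. \<ominus>[M] v x) = \<zero>[pw M X]" by (rule ext) (simp add: pw_all[OF v] M.r_neg)
 then show ?thesis using P.minus_equality[OF _ v c] v c by (metis P.a_comm)
qed

lemma (in rmod) pw_minus: "v \<in> vec M X ==> w \<in> vec M X ==> v -[pw M X] w = (\<lambda>x. v x -[M] w x)"
 by (simp add: a_minus_def pw_neg)

lemma (in crng) rm_sel[simp]: "carrier (ring_module R) = carrier R" "\<zero>[ring_module R] = \<zero>"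
 "x +[ring_module R] y = x \<oplus> y" "a *[ring_module R] y = a \<otimes> y"
 by (simp_all add: ring_module_def)

lemma (in crng) rm_finsum: "finsum (ring_module R) f X = finsum R f X"
 by (simp add: finsum_def finprod_def ring_module_def)

lemma (in crng) rm_neg: "\<ominus>[ring_module R] x = \<ominus> x"
 by (simp add: a_inv_def m_inv_def ring_module_def)

lemma (in crng) rm_minus: "x -[ring_module R] y = x \<ominus> y"
 by (simp add: a_minus_def rm_neg)

lemma (in crng) rmod_rm: "rmod R (ring_module R)"
proof (rule rmodI)
 show "cring R" ..
 show "abelian_group (ring_module R)"
 proof (rule abelian_groupI)
  fix x assume "x \<in> carrier (ring_module R)"
  then show "\<exists>y\<in>carrier (ring_module R). y +[ring_module R] x = \<zero>[ring_module R]"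
   by (intro bexI[of _ "\<ominus> x"]) (simp_all add: l_neg)
 qed (simp_all add: a_ac)
qed (auto simp: l_distr r_distr m_assoc)

lemma (in crng) pw_free: "finite X ==> pw (ring_module R) X = free_module_on R X"
proof -
 assume X: "finite X"
 have "{v. (\<forall>x\<in>X. v x \<in> carrier R) \<and> (\<forall>x. x \<notin> X --> v x = \<zero>)} =
  {c. (\<forall>x. c x \<in> carrier R) \<and> {x. c x \<noteq> \<zero>} \<subseteq> X \<and> finite {x. c x \<noteq> \<zero>}}"
  using X by (auto intro: finite_subset)
 then show ?thesis by (simp add: pw_def free_module_on_def)
qed

lemma linI: "(\<And>x. x \<in> carrier A ==> f x \<in> carrier B) ==>
 (\<And>x y. x \<in> carrier A ==> y \<in> carrier A ==> f (x +[A] y) = f x +[B] f y) ==>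
 (\<And>a x. a \<in> carrier R ==> x \<in> carrier A ==> f (a *[A] x) = a *[B] f x) ==> lin R A B f"
 by (simp add: lin_def)

lemma lin_closed: "lin R A B f ==> x \<in> carrier A ==> f x \<in> carrier B" by (auto simp: lin_def)
lemma lin_add: "lin R A B f ==> x \<in> carrier A ==> y \<in> carrier A ==> f (x +[A] y) = f x +[B] f y" by (auto simp: lin_def)
lemma lin_smult: "lin R A B f ==> a \<in> carrier R ==> x \<in> carrier A ==> f (a *[A] x) = a *[B] f x" by (auto simp: lin_def)

lemma lin_comp: "lin R A B f ==> lin R B C g ==> lin R A C (\<lambda>x. g (f x))"
 by (rule linI) (simp_all add: lin_closed lin_add lin_smult)

context
 fixes R :: "'a ring" and A :: "('a, 'b) module" and B :: "('a, 'c) module" and f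
 assumes A: "rmod R A" and B: "rmod R B" and f: "lin R A B f"
begin
interpretation A: rmod R A by (rule A)
interpretation B: rmod R B by (rule B)

lemma lin_zero: "f \<zero>[A] = \<zero>[B]"
 by (metis A.R.zero_closed A.zero_closed A.smult_l_null B.smult_l_null lin_smult[OF f] lin_closed[OF f])

lemma lin_neg: "x \<in> carrier A ==> f (\<ominus>[A] x) = \<ominus>[B] f x"
 by (metis A.a_inv_closed A.l_neg B.minus_equality lin_add[OF f] lin_closed[OF f] lin_zero)

lemma lin_minus: "x \<in> carrier A ==> y \<in> carrier A ==> f (x -[A] y) = f x -[B] f y"
 by (simp add: a_minus_def lin_neg lin_add[OF f])

lemma lin_finsum: "g \<in> X \<rightarrow> carrier A ==> f (finsum A g X) = finsum B (\<lambda>x. f (g x)) X"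
proof (induct X rule: infinite_finite_induct)
 case (insert x F) then show ?case using lin_add[OF f] lin_closed[OF f] by (simp add: Pi_def)
qed (auto simp: lin_zero)

lemma lin_lc: "v \<in> X \<rightarrow> carrier R ==> g \<in> X \<rightarrow> carrier A ==> f (lc A X v g) = lc B X v (\<lambda>x. f (g x))"
 unfolding lc_def
 by (subst lin_finsum) (auto intro!: B.finsum_cong' lin_closed[OF f] lin_smult[OF f] simp: Pi_def)

text \<open>Naturality of a matrix in its coefficients, which makes the squares of the double
  complexes below commute.\<close>

lemma lin_mm: "mat R Y X D ==> v \<in> X \<rightarrow> carrier A ==> (\<lambda>y. f (mm A X D Y v y)) = mm B X D Y (\<lambda>x. f (v x))"
 by (auto simp: mm_def lin_zero mat_def Pi_def intro!: ext lin_lc)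

end

context rmod begin

lemma lc_closed[simp, intro]: "v \<in> X \<rightarrow> carrier R ==> g \<in> X \<rightarrow> carrier M ==> lc M X v g \<in> carrier M"
 unfolding lc_def by (intro M.finsum_closed) auto

lemma lc_cong: "(\<And>x. x \<in> X ==> v x = v' x) ==> (\<And>x. x \<in> X ==> g x = g' x) ==>
  v' \<in> X \<rightarrow> carrier R ==> g' \<in> X \<rightarrow> carrier M ==> lc M X v g = lc M X v' g'"
 unfolding lc_def by (intro M.finsum_cong') auto

lemma lc_add_l: "v \<in> X \<rightarrow> carrier R ==> w \<in> X \<rightarrow> carrier R ==> g \<in> X \<rightarrow> carrier M ==>
 lc M X (\<lambda>x. v x \<oplus> w x) g = lc M X v g +[M] lc M X w g"
proof -
 assume *: "v \<in> X \<rightarrow> carrier R" "w \<in> X \<rightarrow> carrier R" "g \<in> X \<rightarrow> carrier M"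
 have "lc M X (\<lambda>x. v x \<oplus> w x) g = (\<Oplus>\<^bsub>M\<^esub>x\<in>X. v x *[M] g x +[M] w x *[M] g x)"
  unfolding lc_def using * by (intro M.finsum_cong') (auto simp: Pi_def smult_l_distr)
 also have "\<dots> = lc M X v g +[M] lc M X w g" unfolding lc_def using * by (intro M.finsum_addf) auto
 finally show ?thesis .
qed

lemma lc_add_r: "v \<in> X \<rightarrow> carrier R ==> h \<in> X \<rightarrow> carrier M ==> g \<in> X \<rightarrow> carrier M ==>
 lc M X v (\<lambda>x. g x +[M] h x) = lc M X v g +[M] lc M X v h"
proof -
 assume *: "v \<in> X \<rightarrow> carrier R" "h \<in> X \<rightarrow> carrier M" "g \<in> X \<rightarrow> carrier M"
 have "lc M X v (\<lambda>x. g x +[M] h x) = (\<Oplus>\<^bsub>M\<^esub>x\<in>X. v x *[M] g x +[M] v x *[M] h x)"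
  unfolding lc_def using * by (intro M.finsum_cong') (auto simp: Pi_def smult_r_distr)
 also have "\<dots> = lc M X v g +[M] lc M X v h" unfolding lc_def using * by (intro M.finsum_addf) auto
 finally show ?thesis .
qed

lemma lc_smult_l: "finite X ==> a \<in> carrier R ==> v \<in> X \<rightarrow> carrier R ==> g \<in> X \<rightarrow> carrier M ==>
 lc M X (\<lambda>x. a \<otimes> v x) g = a *[M] lc M X v g"
 unfolding lc_def by (subst finsum_smult_ldistr) (auto intro!: M.finsum_cong' smult_assoc1 simp: Pi_def)

lemma lc_smult_r: "finite X ==> a \<in> carrier R ==> v \<in> X \<rightarrow> carrier R ==> g \<in> X \<rightarrow> carrier M ==>
 lc M X v (\<lambda>x. a *[M] g x) = a *[M] lc M X v g"
 unfolding lc_def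
 by (subst finsum_smult_ldistr) (auto intro!: M.finsum_cong' simp: Pi_def smult_assoc1[symmetric] R.m_comm)

lemma lc_zero_l: "g \<in> X \<rightarrow> carrier M ==> lc M X (\<lambda>_. \<zero>) g = \<zero>[M]"
 unfolding lc_def by (rule M.add.finprod_one_eqI) (simp add: Pi_def)

lemma lc_zero_r: "v \<in> X \<rightarrow> carrier R ==> lc M X v (\<lambda>_. \<zero>[M]) = \<zero>[M]"
 unfolding lc_def by (rule M.add.finprod_one_eqI) (simp add: Pi_def)

lemma lc_empty[simp]: "lc M {} v g = \<zero>[M]" by (simp add: lc_def)

lemma lc_insert: "finite X ==> x \<notin> X ==> v \<in> insert x X \<rightarrow> carrier R ==> g \<in> insert x X \<rightarrow> carrier M ==>
 lc M (insert x X) v g = v x *[M] g x +[M] lc M X v g"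
 unfolding lc_def by (subst M.finsum_insert) auto

lemma lc_gen: "finite X ==> x \<in> X ==> g \<in> X \<rightarrow> carrier M ==> lc M X (free_gen R x) g = g x"
proof -
 assume *: "finite X" "x \<in> X" "g \<in> X \<rightarrow> carrier M"
 have "lc M X (free_gen R x) g = (\<Oplus>\<^bsub>M\<^esub>y\<in>X. if y = x then g y else \<zero>[M])"
  unfolding lc_def free_gen_def using * by (intro M.finsum_cong') (auto simp: Pi_def)
 also have "\<dots> = g x" using * by (intro M.add.finprod_singleton_swap) auto
 finally show ?thesis .
qed

lemma finsum_swap: "finite X ==> finite Y ==> (\<And>x y. x \<in> X ==> y \<in> Y ==> f x y \<in> carrier M) ==>
 (\<Oplus>\<^bsub>M\<^esub>x\<in>X. \<Oplus>\<^bsub>M\<^esub>y\<in>Y. f x y) = (\<Oplus>\<^bsub>M\<^esub>y\<in>Y. \<Oplus>\<^bsub>M\<^esub>x\<in>X. f x y)"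
proof (induct X rule: finite_induct)
 case empty then show ?case by (simp add: M.add.finprod_one_eqI)
next
 case (insert a X)
 have "(\<Oplus>\<^bsub>M\<^esub>x\<in>insert a X. \<Oplus>\<^bsub>M\<^esub>y\<in>Y. f x y) = (\<Oplus>\<^bsub>M\<^esub>y\<in>Y. f a y) +[M] (\<Oplus>\<^bsub>M\<^esub>y\<in>Y. \<Oplus>\<^bsub>M\<^esub>x\<in>X. f x y)"
  using insert by (subst M.finsum_insert) (auto simp: Pi_def)
 also have "\<dots> = (\<Oplus>\<^bsub>M\<^esub>y\<in>Y. f a y +[M] (\<Oplus>\<^bsub>M\<^esub>x\<in>X. f x y))"
  using insert by (subst M.finsum_addf) (auto simp: Pi_def)
 also have "\<dots> = (\<Oplus>\<^bsub>M\<^esub>y\<in>Y. \<Oplus>\<^bsub>M\<^esub>x\<in>insert a X. f x y)"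
  using insert by (intro M.finsum_cong') (auto simp: Pi_def)
 finally show ?case .
qed

lemma finsum_smult_r: "finite Y ==> v \<in> Y \<rightarrow> carrier R ==> x \<in> carrier M ==>
 (\<Oplus>y\<in>Y. v y) *[M] x = (\<Oplus>\<^bsub>M\<^esub>y\<in>Y. v y *[M] x)"
 by (induct Y rule: finite_induct) (auto simp: Pi_def smult_l_distr)

lemma lc_lc: "finite X ==> finite Y ==> v \<in> Y \<rightarrow> carrier R ==> (\<And>y x. y \<in> Y ==> x \<in> X ==> D y x \<in> carrier R) ==> g \<in> X \<rightarrow> carrier M ==>
 lc M Y v (\<lambda>y. lc M X (D y) g) = lc M X (\<lambda>x. \<Oplus>y\<in>Y. v y \<otimes> D y x) g"
proof -
 assume *: "finite X" "finite Y" "v \<in> Y \<rightarrow> carrier R" "\<And>y x. y \<in> Y ==> x \<in> X ==> D y x \<in> carrier R" "g \<in> X \<rightarrow> carrier M"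
 have "lc M Y v (\<lambda>y. lc M X (D y) g) = (\<Oplus>\<^bsub>M\<^esub>y\<in>Y. \<Oplus>\<^bsub>M\<^esub>x\<in>X. v y *[M] (D y x *[M] g x))"
  unfolding lc_def using * by (intro M.finsum_cong') (auto simp: Pi_def intro!: finsum_smult_ldistr)
 also have "\<dots> = (\<Oplus>\<^bsub>M\<^esub>x\<in>X. \<Oplus>\<^bsub>M\<^esub>y\<in>Y. v y *[M] (D y x *[M] g x))"
  using * by (intro finsum_swap) (auto simp: Pi_def)
 also have "\<dots> = lc M X (\<lambda>x. \<Oplus>y\<in>Y. v y \<otimes> D y x) g"
  unfolding lc_def using *
  by (intro M.finsum_cong') (auto simp: Pi_def finsum_smult_r smult_assoc1 intro!: M.finsum_cong')
 finally show ?thesis .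
qed

lemma mm_closed[simp, intro]: "mat R Y X D ==> v \<in> X \<rightarrow> carrier M ==> mm M X D Y v \<in> vec M Y"
 by (auto intro!: pwI lc_closed simp: mm_def mat_def Pi_def)

lemma mm_lin: "finite X ==> mat R Y X D ==> lin R (pw M X) (pw M Y) (mm M X D Y)"
proof (rule linI)
 fix v w a assume "finite X" "mat R Y X D" and v: "v \<in> vec M X"
 note * = pw_all[OF v] \<open>finite X\<close> matD[OF \<open>mat R Y X D\<close>]
 show "mm M X D Y v \<in> vec M Y" using * \<open>mat R Y X D\<close> by auto
 show "mm M X D Y (v +[pw M X] w) = mm M X D Y v +[pw M Y] mm M X D Y w" if "w \<in> vec M X"
  using * pw_all[OF that] by (auto simp: mm_def intro!: ext lc_add_r)
 show "mm M X D Y (a *[pw M X] v) = a *[pw M Y] mm M X D Y v" if "a \<in> carrier R"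
  using * that by (auto simp: mm_def intro!: ext lc_smult_r)
qed

lemma mm_mm: "finite X ==> finite Y ==> mat R Y X D ==> mat R Z Y E ==> v \<in> X \<rightarrow> carrier M ==>
  mm M Y E Z (mm M X D Y v) = mm M X (mmul R Y E D) Z v"
proof (rule ext)
 fix z assume *: "finite X" "finite Y" "mat R Y X D" "mat R Z Y E" "v \<in> X \<rightarrow> carrier M"
 show "mm M Y E Z (mm M X D Y v) z = mm M X (mmul R Y E D) Z v z"
 proof (cases "z \<in> Z")
  case True
  have "lc M Y (E z) (mm M X D Y v) = lc M Y (E z) (\<lambda>y. lc M X (D y) v)"
   using * True by (intro lc_cong) (auto simp: mm_def mat_def intro!: lc_closed)
  also have "\<dots> = lc M X (\<lambda>x. \<Oplus>y\<in>Y. E z y \<otimes> D y x) v"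
   using * True by (intro lc_lc) (auto simp: mat_def)
  finally show ?thesis using True by (simp add: mm_def mmul_def[abs_def])
 qed (simp add: mm_def)
qed

lemma mm_cong: "(\<And>y x. y \<in> Y ==> x \<in> X ==> D y x = D' y x) ==> (\<And>x. x \<in> X ==> v x = v' x) ==> mat R Y X D' ==>
 v' \<in> X \<rightarrow> carrier M ==> mm M X D Y v = mm M X D' Y v'"
 by (auto simp: mm_def mat_def intro!: ext lc_cong)

lemma mm_zero_mat: "(\<And>y x. y \<in> Y ==> x \<in> X ==> D y x = \<zero>) ==> v \<in> X \<rightarrow> carrier M ==> mm M X D Y v = (\<lambda>_. \<zero>[M])"
 by (subst mm_cong[where D' = "\<lambda>_ _. \<zero>" and v' = v]) (auto simp: mat_def mm_def lc_zero_l)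

lemma mm_zero: "mat R Y X D ==> mm M X D Y (\<lambda>_. \<zero>[M]) = (\<lambda>_. \<zero>[M])"
 by (auto simp: mm_def mat_def intro!: ext lc_zero_r)

end

context crng begin

lemma mmul_closed[simp, intro]: "mat R Z Y E ==> mat R Y X D ==> z \<in> Z ==> x \<in> X ==> mmul R Y E D z x \<in> carrier R"
 unfolding mmul_def by (intro finsum_closed) (auto simp: mat_def)

lemma mat_mmul[simp, intro]: "mat R Z Y E ==> mat R Y X D ==> mat R Z X (mmul R Y E D)"
 unfolding mat_def[of R Z X] by (intro ballI mmul_closed)

lemma mmul_tp: "mat R Z Y E ==> mat R Y X D ==> z \<in> Z ==> x \<in> X ==> mmul R Y (tp D) (tp E) x z = mmul R Y E D z x"
 unfolding mmul_def tp_def by (intro finsum_cong') (auto simp: mat_def m_comm)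

lemma gen_pw: "x \<in> X ==> free_gen R x \<in> vec (ring_module R) X"
 by (auto simp: free_gen_def intro!: pwI)

lemma gen_closed[simp]: "free_gen R x y \<in> carrier R" by (simp add: free_gen_def)

lemma lc_rm: "lc (ring_module R) X v g = (\<Oplus>x\<in>X. v x \<otimes> g x)"
 by (simp add: lc_def rm_finsum)

lemma lc_rm_comm: "v \<in> X \<rightarrow> carrier R ==> g \<in> X \<rightarrow> carrier R ==> lc (ring_module R) X v g = lc (ring_module R) X g v"
 unfolding lc_rm by (intro finsum_cong') (auto intro: m_comm)

lemma mm_gen: "finite X ==> mat R Y X D ==> x \<in> X ==> y \<in> Y ==> mm (ring_module R) X D Y (free_gen R x) y = D y x"
proof -
 interpret A: rmod R "ring_module R" by (rule rmod_rm)
 assume "finite X" "mat R Y X D" "x \<in> X" "y \<in> Y"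
 then show ?thesis by (simp add: mm_def) (subst lc_rm_comm, auto simp: mat_def intro!: A.lc_gen)
qed

end

section \<open>Finite free resolutions\<close>

definition gens :: "'a ring => ('a, 'b) module => 'x set => ('x => 'b) => bool" where
 "gens R A X g \<longleftrightarrow> g \<in> X \<rightarrow> carrier A \<and> (\<forall>a\<in>carrier A. \<exists>v\<in>vec (ring_module R) X. a = lc A X v g)"

text \<open>Exactness at the middle index set \<open>Y\<close>; the equivalence covers both that the
  composite vanishes and that every cycle is a boundary.\<close>

definition exat :: "('a, 'b) module => 'x set => ('y => 'x => 'a) => 'y set => ('z => 'y => 'a) => 'z set => bool" where
 "exat A X D Y E Z \<longleftrightarrow> (\<forall>v\<in>vec A Y.
   mm A Y E Z v = (\<lambda>_. \<zero>[A]) \<longleftrightarrow> (\<exists>w\<in>vec A X. v = mm A X D Y w))"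

text \<open>The index is that of the lowest term, so the exact place is degree \<open>Suc i\<close>;
  degree 0 is never claimed.\<close>

abbreviation "exa A X D i \<equiv> exat A (X (Suc (Suc i))) (D (Suc i)) (X (Suc i)) (D i) (X i)"

locale lnr = local_noetherian_ring R for R :: "'a ring" (structure)

sublocale lnr \<subseteq> crng ..

text \<open>In a Noetherian ring the union of a nonempty chain of ideals already belongs to the
  chain, which is the bound that Zorn's lemma asks for.\<close>

lemma (in noetherian_ring) ideal_maximal_exists:
 assumes "S \<noteq> {}" "S \<subseteq> {I. ideal I R}"
 shows "\<exists>I\<in>S. \<forall>J\<in>S. I \<subseteq> J --> J = I"
proof (rule subset_Zorn)
 fix C assume C: "subset.chain S C"
 show "\<exists>U\<in>S. \<forall>x\<in>C. x \<subseteq> U"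
 proof (cases "C = {}")
  case True then show ?thesis using assms by auto
 next
  case False
  have "subset.chain {I. ideal I R} C" using C assms(2) by (auto simp: subset.chain_def)
  then have "\<Union>C \<in> C" using False ideal_chain_is_trivial by blast
  then show ?thesis using C by (auto simp: subset.chain_def)
 qed
qed

lemma (in cring) ideal_comb:
 assumes "I \<subseteq> carrier R" "\<zero> \<in> I" "\<And>x y. x \<in> I ==> y \<in> I ==> x \<oplus> y \<in> I"
  "\<And>a x. a \<in> carrier R ==> x \<in> I ==> a \<otimes> x \<in> I"
 shows "ideal I R"
proof (rule idealI)
 show "ring R" ..
 show "subgroup I (add_monoid R)"
 proof (rule add.subgroupI)
  fix a assume a: "a \<in> I"
  have "\<ominus> a = (\<ominus> \<one>) \<otimes> a" using a assms(1) by (subst l_minus) auto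
  then show "\<ominus> a \<in> I" using a assms(4) by simp
 qed (use assms in auto)
 fix a x assume "a \<in> I" "x \<in> carrier R"
 then show "x \<otimes> a \<in> I" "a \<otimes> x \<in> I" using assms(1,4) m_comm[of a x] by auto
qed

context lnr begin

abbreviation "mx \<equiv> max_ideal R"

lemma mx_maximal: "maximalideal mx R"
 unfolding max_ideal_def by (rule theI'[OF unique_maximal])

lemma mx_unique: "maximalideal I R ==> I = mx"
 using unique_maximal mx_maximal by blast

lemma mx_ideal: "ideal mx R" using mx_maximal maximalideal.axioms(1) by blast

lemma mx_prime: "primeideal mx R" using maximalideal_prime[OF mx_maximal] .

lemma mx_sub: "a \<in> mx ==> a \<in> carrier R" using ideal.Icarr[OF mx_ideal] .

lemma one_notin_mx: "\<one> \<notin> mx"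
 using mx_ideal maximalideal.I_notcarr[OF mx_maximal] ideal.one_imp_carrier by blast

lemma ideal_le_mx:
 assumes "ideal I R" "\<one> \<notin> I" shows "I \<subseteq> mx"
proof -
 let ?S = "{J. ideal J R \<and> I \<subseteq> J \<and> \<one> \<notin> J}"
 obtain J where J: "J \<in> ?S" "\<And>K. K \<in> ?S ==> J \<subseteq> K ==> K = J"
  using ideal_maximal_exists[of ?S] assms by auto
 have "maximalideal J R"
 proof (rule maximalidealI)
  show "ideal J R" "carrier R \<noteq> J" using J by auto
  fix K assume K: "ideal K R" "J \<subseteq> K" "K \<subseteq> carrier R"
  show "K = J \<or> K = carrier R" using J K ideal.one_imp_carrier[OF K(1)] by blast
 qed
 then show ?thesis using J mx_unique by auto
qed

lemma unit_if_notin_mx: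
 assumes "a \<in> carrier R" "a \<notin> mx" shows "\<exists>b\<in>carrier R. b \<otimes> a = \<one>"
proof (rule ccontr)
 assume *: "\<not> ?thesis"
 have "\<one> \<notin> PIdl a" using * by (auto simp: cgenideal_def)
 then have "PIdl a \<subseteq> mx" using ideal_le_mx cgenideal_ideal assms(1) by blast
 then show False using assms cgenideal_self by blast
qed

lemma mx_add: "a \<in> mx ==> b \<in> mx ==> a \<oplus> b \<in> mx"
 by (simp add: additive_subgroup.a_closed mx_ideal ideal.axioms(1))
lemma mx_mult_r: "a \<in> mx ==> b \<in> carrier R ==> a \<otimes> b \<in> mx"
 by (simp add: mx_ideal ideal.I_r_closed)
lemma mx_mult_l: "a \<in> mx ==> b \<in> carrier R ==> b \<otimes> a \<in> mx"
 by (simp add: mx_ideal ideal.I_l_closed)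
lemma mx_zero: "\<zero> \<in> mx" by (simp add: additive_subgroup.zero_closed mx_ideal ideal.axioms(1))

end

section \<open>Submodules, spans and finite generation\<close>

context rmod begin

lemma sub_zero: "submodule H R M ==> \<zero>[M] \<in> H"
 using subgroup.one_closed[OF submodule.axioms(1)] by fastforce

lemma submodule_inter: "\<H> \<noteq> {} ==> (\<And>H. H \<in> \<H> ==> submodule H R M) ==> submodule (\<Inter>\<H>) R M"
proof (rule submoduleI)
 assume *: "\<H> \<noteq> {}" "\<And>H. H \<in> \<H> ==> submodule H R M"
 note E = submoduleE[OF *(2)]
 show "\<Inter>\<H> \<subseteq> carrier M" using * E(1) by blast
 show "\<zero>[M] \<in> \<Inter>\<H>" using sub_zero[OF *(2)] by blast
qed (auto dest: submoduleE(3-5))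

lemma sub_car: "submodule H R M ==> x \<in> H ==> x \<in> carrier M" using submoduleE(1) by blast
lemma sub_add: "submodule H R M ==> x \<in> H ==> y \<in> H ==> x +[M] y \<in> H" using submoduleE(5) by blast
lemma sub_minus: "submodule H R M ==> x \<in> H ==> y \<in> H ==> x -[M] y \<in> H"
 unfolding a_minus_def using submoduleE(5,3) by blast
lemma sub_smult: "submodule H R M ==> a \<in> carrier R ==> x \<in> H ==> a *[M] x \<in> H" using submoduleE(4) by blast
lemma sub_finsum: "submodule H R M ==> f \<in> X \<rightarrow> H ==> finsum M f X \<in> H"
proof (induct X rule: infinite_finite_induct)
 case (insert x F)
 then have "f \<in> F \<rightarrow> carrier M" "f x \<in> carrier M" using sub_car by blast+
 then show ?case using insert by (simp add: sub_add)
qed (simp_all add: sub_zero)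

lemma span_submodule: "S \<subseteq> carrier M ==> submodule (module_span R M S) R M"
 unfolding module_span_def using carrier_is_submodule by (intro submodule_inter) blast+

lemma span_superset: "S \<subseteq> module_span R M S" unfolding module_span_def by blast

lemma span_least: "submodule H R M ==> S \<subseteq> H ==> module_span R M S \<subseteq> H" unfolding module_span_def by blast

lemma span_mono: "S \<subseteq> T ==> module_span R M S \<subseteq> module_span R M T" unfolding module_span_def by blast

lemma subI_comb:
 assumes "H \<subseteq> carrier M" "\<zero>[M] \<in> H" "\<And>x y. x \<in> H ==> y \<in> H ==> x +[M] y \<in> H"
  "\<And>a x. a \<in> carrier R ==> x \<in> H ==> a *[M] x \<in> H"
 shows "submodule H R M"
proof (rule submoduleI)
 fix a assume a: "a \<in> H"
 have "\<ominus>[M] a = (\<ominus> \<one>) *[M] a" using a assms(1) by (subst smult_l_minus) auto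
 then show "\<ominus>[M] a \<in> H" using a assms(4) by simp
qed (use assms in auto)

lemma span_insert:
 assumes S: "S \<subseteq> carrier M" and s: "s \<in> carrier M" and x: "x \<in> module_span R M (insert s S)"
 shows "\<exists>c\<in>carrier R. \<exists>a\<in>module_span R M S. x = c *[M] s +[M] a"
proof -
 let ?A = "module_span R M S"
 note A = span_submodule[OF S]
 let ?H = "{c *[M] s +[M] a | c a. c \<in> carrier R \<and> a \<in> ?A}"
 have "submodule ?H R M"
 proof (rule subI_comb)
  show "?H \<subseteq> carrier M" using s sub_car[OF A] by auto
  show "\<zero>[M] \<in> ?H" using s sub_zero[OF A] by (intro CollectI exI[of _ \<zero>] exI[of _ "\<zero>[M]"]) auto
  fix x y assume "x \<in> ?H" "y \<in> ?H"
  then obtain c a d b where *: "x = c *[M] s +[M] a" "y = d *[M] s +[M] b" "c \<in> carrier R" "d \<in> carrier R" "a \<in> ?A" "b \<in> ?A"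
   by blast
  then have "x +[M] y = (c \<oplus> d) *[M] s +[M] (a +[M] b)"
   using s sub_car[OF A] by (simp add: smult_l_distr M.a_ac)
  then show "x +[M] y \<in> ?H" using * sub_add[OF A] by blast
 next
  fix r x assume r: "r \<in> carrier R" and "x \<in> ?H"
  then obtain c a where *: "x = c *[M] s +[M] a" "c \<in> carrier R" "a \<in> ?A" by blast
  then have "r *[M] x = (r \<otimes> c) *[M] s +[M] (r *[M] a)"
   using r s sub_car[OF A] by (simp add: smult_r_distr smult_assoc1)
  then show "r *[M] x \<in> ?H" using * r sub_smult[OF A] by blast
 qed
 moreover have "insert s S \<subseteq> ?H"
 proof -
  have "s = \<one> *[M] s +[M] \<zero>[M]" using s by simp
  then have 1: "s \<in> ?H" using sub_zero[OF A] by blast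
  have "y \<in> ?H" if "y \<in> S" for y
  proof -
   have "y = \<zero> *[M] s +[M] y" using s that S by auto
   then show ?thesis using that span_superset by blast
  qed
  then show ?thesis using 1 by blast
 qed
 ultimately have "x \<in> ?H" using x span_least by blast
 then show ?thesis by blast
qed

lemma lc_in_sub: "submodule H R M ==> v \<in> X \<rightarrow> carrier R ==> g \<in> X \<rightarrow> H ==> lc M X v g \<in> H"
 unfolding lc_def by (intro sub_finsum) (auto simp: Pi_def sub_smult)

lemma pw_Pi: "v \<in> vec M X ==> v \<in> Y \<rightarrow> carrier M" by (simp add: pw_all Pi_def)

lemma span_image_lc:
 "finite X ==> g \<in> X \<rightarrow> carrier M ==> x \<in> module_span R M (g ` X) ==> \<exists>v\<in>vec (ring_module R) X. x = lc M X v g"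
proof (induct X arbitrary: x rule: finite_induct)
 case empty
 have "submodule {\<zero>[M]} R M" by (rule subI_comb) auto
 then have "x = \<zero>[M]" using empty span_least by fastforce
 then show ?case by (auto simp: pw_def ring_module_def)
next
 case (insert i X)
 from insert(5) obtain c a where ca: "c \<in> carrier R" "a \<in> module_span R M (g ` X)" "x = c *[M] g i +[M] a"
  using span_insert[of "g ` X" "g i" x] insert(4) by (auto simp: Pi_def image_subset_iff)
 obtain v where v: "v \<in> vec (ring_module R) X" "a = lc M X v g" using insert(3)[OF _ ca(2)] insert(4) by auto
 interpret crng R ..
 interpret rm: rmod R "ring_module R" by (rule rmod_rm)
 have vR: "v y \<in> carrier R" for y using rm.pw_all[OF v(1)] by simp
 have "lc M X (v(i := c)) g = lc M X v g"
  using insert vR by (intro lc_cong) (auto simp: Pi_def)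
 then have "x = lc M (insert i X) (v(i := c)) g"
  using insert vR ca v by (subst lc_insert) (auto simp: Pi_def)
 moreover have "v(i := c) \<in> vec (ring_module R) (insert i X)"
  using v ca by (auto simp: pw_def)
 ultimately show ?case by blast
qed

lemma gens_span: "gens R M X g ==> module_span R M (g ` X) = carrier M"
proof
 assume g: "gens R M X g"
 then have c: "g ` X \<subseteq> carrier M" by (auto simp: gens_def)
 show "module_span R M (g ` X) \<subseteq> carrier M" using span_submodule[OF c] submoduleE(1) by blast
 interpret crng R ..
 interpret rm: rmod R "ring_module R" by (rule rmod_rm)
 show "carrier M \<subseteq> module_span R M (g ` X)"
 proof
  fix a assume "a \<in> carrier M"
  then obtain v where "v \<in> vec (ring_module R) X" "a = lc M X v g" using g unfolding gens_def by blast
  then show "a \<in> module_span R M (g ` X)"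
   using span_superset[of "g ` X"] rm.pw_all by (auto intro!: lc_in_sub[OF span_submodule[OF c]] simp: Pi_def)
 qed
qed

lemma gens_iff: "finite X ==> gens R M X g \<longleftrightarrow> g \<in> X \<rightarrow> carrier M \<and> module_span R M (g ` X) = carrier M"
 using gens_span[of X g] span_image_lc[of X g] unfolding gens_def by blast

lemma finite_moduleI: "finite X ==> gens R M X g ==> finite_module R M"
 using gens_iff unfolding finite_module_def by (metis finite_imageI funcset_image)

lemma finite_module_gens: "finite_module R M ==> \<exists>X g. finite (X :: nat set) \<and> gens R M X g"
proof -
 assume "finite_module R M"
 then obtain S where S: "finite S" "S \<subseteq> carrier M" "module_span R M S = carrier M" by (auto simp: finite_module_def)
 obtain h n where h: "S = h ` {i::nat. i < n}" using finite_imp_nat_seg_image_inj_on[OF S(1)] by metis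
 have "gens R M {i. i < n} h" by (subst gens_iff) (use S h in auto)
 then show ?thesis by auto
qed

text \<open>The coefficients at \<open>s\<close> of elements of \<open>U\<close>, read modulo
  \<open>A\<close>, as in the proof of Hilbert's basis theorem. In \<open>fg_sub\<close> it is used
  for \<open>U\<close> and for the span of the chosen generators.\<close>

lemma coef_ideal:
 assumes A: "submodule A R M" and U: "submodule U R M" and s: "s \<in> carrier M"
 shows "ideal {c \<in> carrier R. \<exists>a\<in>A. c *[M] s +[M] a \<in> U} R" (is "ideal ?I R")
proof (rule R.ideal_comb)
  show "?I \<subseteq> carrier R" by auto
  have "\<zero> *[M] s +[M] \<zero>[M] \<in> U" using s sub_zero[OF U] by simp
  then show "\<zero> \<in> ?I" using sub_zero[OF A] by blast
 next
  fix c d assume "c \<in> ?I" "d \<in> ?I"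
  then obtain a b where ab: "c \<in> carrier R" "a \<in> A" "c *[M] s +[M] a \<in> U" "d \<in> carrier R" "b \<in> A" "d *[M] s +[M] b \<in> U" by blast
  have "(c \<oplus> d) *[M] s +[M] (a +[M] b) = (c *[M] s +[M] a) +[M] (d *[M] s +[M] b)"
   using ab s sub_car[OF A] by (simp add: smult_l_distr M.a_ac)
  then show "c \<oplus> d \<in> ?I" using ab sub_add[OF U ab(3,6)] sub_add[OF A ab(2,5)] by (auto intro!: bexI[of _ "a +[M] b"])
 next
 fix x c assume x: "x \<in> carrier R" and "c \<in> ?I"
 then obtain a where a: "c \<in> carrier R" "a \<in> A" "c *[M] s +[M] a \<in> U" by blast
 have "(x \<otimes> c) *[M] s +[M] (x *[M] a) = x *[M] (c *[M] s +[M] a)"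
  using a s x sub_car[OF A] by (simp add: smult_r_distr smult_assoc1)
 then show "x \<otimes> c \<in> ?I" using a x sub_smult[OF U x a(3)] sub_smult[OF A x a(2)] by (auto intro!: bexI[of _ "x *[M] a"])
qed

text \<open>Induction on the generating set: elements of \<open>U\<close> whose coefficients at
  \<open>s\<close> generate the coefficient ideal, together with generators of the part of
  \<open>U\<close> inside the span of \<open>S\<close>, generate \<open>U\<close>.\<close>

lemma fg_sub:
 assumes N: "noetherian_ring R"
 shows "finite S ==> S \<subseteq> carrier M ==> submodule U R M ==> U \<subseteq> module_span R M S ==>
  \<exists>T. finite T \<and> T \<subseteq> U \<and> U = module_span R M T"
proof (induct S arbitrary: U rule: finite_induct)
 case empty
 have z: "submodule {\<zero>[M]} R M" by (rule subI_comb) auto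
 then have "U \<subseteq> {\<zero>[M]}" using empty span_least[OF z, of "{}"] by blast
 then have "U \<subseteq> module_span R M {}" using empty by blast
 moreover have "module_span R M {} \<subseteq> U" using empty(2) span_least by blast
 ultimately show ?case by blast
next
 case (insert s S)
 interpret noetherian_ring R by fact
 have s: "s \<in> carrier M" and S: "S \<subseteq> carrier M" using insert by auto
 let ?A = "module_span R M S"
 note A = span_submodule[OF S]
 note U = \<open>submodule U R M\<close>
 let ?I = "{c \<in> carrier R. \<exists>a\<in>?A. c *[M] s +[M] a \<in> U}"
 have I: "ideal ?I R" by (rule coef_ideal[OF A U s])
 obtain C where C: "C \<subseteq> carrier R" "finite C" "?I = Idl C" using finetely_gen[OF I] by blast
 have "C \<subseteq> ?I" using C genideal_self by simp
 then have "\<forall>c\<in>C. \<exists>u\<in>U. \<exists>a\<in>?A. u = c *[M] s +[M] a" by blast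
 then obtain u where u: "\<forall>c\<in>C. u c \<in> U \<and> (\<exists>a\<in>?A. u c = c *[M] s +[M] a)" by metis
 let ?V = "U \<inter> ?A"
 have "submodule ?V R M" using submodule_inter[of "{U, ?A}"] U A by auto
 then obtain T where T: "finite T" "T \<subseteq> ?V" "?V = module_span R M T" using insert(3)[OF S, of ?V] by auto
 let ?T = "u ` C \<union> T"
 have TU: "?T \<subseteq> U" using u T by blast
 then have Tc: "?T \<subseteq> carrier M" using sub_car[OF U] by blast
 note P = span_submodule[OF Tc]
 let ?J = "{c \<in> carrier R. \<exists>a\<in>?A. c *[M] s +[M] a \<in> module_span R M ?T}"
 \<comment> \<open>Every coefficient at \<open>s\<close> that occurs in \<open>U\<close> also occurs
   in the span of \<open>?T\<close>; the difference of two elements with the same coefficient has no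
   \<open>s\<close>-part and falls into \<open>?V\<close>.\<close>
 have "Idl C \<subseteq> ?J"
 proof (rule genideal_minimal)
  show "C \<subseteq> ?J" using u C(1) span_superset[of ?T] by fastforce
  show "ideal ?J R" by (rule coef_ideal[OF A P s])
 qed
 then have IJ: "?I \<subseteq> ?J" using C(3) by simp
 have "U \<subseteq> module_span R M ?T"
 proof
  fix x assume x: "x \<in> U"
  then obtain c a where ca: "c \<in> carrier R" "a \<in> ?A" "x = c *[M] s +[M] a" using span_insert[OF S s] insert by blast
  then have "c \<in> ?J" using IJ x by blast
  then obtain b where b: "b \<in> ?A" "c *[M] s +[M] b \<in> module_span R M ?T" by blast
  let ?y = "c *[M] s +[M] b"
  have cc: "c *[M] s \<in> carrier M" "a \<in> carrier M" "b \<in> carrier M" using ca b s sub_car[OF A] by auto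
  have "?y \<in> U" using b(2) span_least[OF U TU] by blast
  then have "x -[M] ?y \<in> U" using x sub_minus[OF U] by blast
  moreover have "x -[M] ?y = a -[M] b"
   using cc unfolding ca(3) a_minus_def by (simp add: M.minus_add M.a_ac M.r_neg M.r_neg1 M.r_neg2)
  ultimately have "x -[M] ?y \<in> ?V" using sub_minus[OF A ca(2) b(1)] by simp
  then have "x -[M] ?y \<in> module_span R M ?T" using T(3) span_mono[of T ?T] by blast
  then have "?y +[M] (x -[M] ?y) \<in> module_span R M ?T" using sub_add[OF P b(2)] by blast
  moreover have "?y +[M] (x -[M] ?y) = x" using cc sub_car[OF U x] unfolding a_minus_def
   by (simp add: M.a_lcomm M.r_neg)
  ultimately show "x \<in> module_span R M ?T" by simp
 qed
 moreover have "module_span R M ?T \<subseteq> U" using span_least[OF U TU] .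
 ultimately show ?case using TU T(1) C(2) by (intro exI[of _ ?T]) auto
qed

end

text \<open>Degree 0 carries no condition, so this is a resolution of the cokernel of
  \<open>D 0\<close>; \<open>res_of\<close> identifies that cokernel with \<open>A\<close>.\<close>

definition res :: "'a ring => (nat => 'x set) => (nat => 'x => 'x => 'a) => bool" where
 "res R X D \<longleftrightarrow> (\<forall>i. finite (X i)) \<and> (\<forall>i. mat R (X i) (X (Suc i)) (D i)) \<and>
   (\<forall>i. exa (ring_module R) X D i)"

definition res_of :: "'a ring => ('a, 'b) module => (nat => 'x set) => ('x => 'b) => (nat => 'x => 'x => 'a) => bool" where
 "res_of R A X g D \<longleftrightarrow> res R X D \<and> gens R A (X 0) g \<and> (\<forall>v\<in>vec (ring_module R) (X 0).
   lc A (X 0) v g = \<zero>[A] \<longleftrightarrow> (\<exists>w\<in>vec (ring_module R) (X 1). v = mm (ring_module R) (X 1) (D 0) (X 0) w))"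

lemma (in rmod) pw_lc:
 assumes "v \<in> X \<rightarrow> carrier R" "g \<in> X \<rightarrow> vec M Y" "y \<in> Y"
 shows "lc (pw M Y) X v g y = lc M X v (\<lambda>x. g x y)"
proof -
 have "lin R (pw M Y) M (\<lambda>u. u y)" by (rule linI) (auto simp: assms pwD)
 from lin_lc[OF rmod_pw rmod_axioms this assms(1,2)] show ?thesis .
qed

context crng begin

abbreviation "rm \<equiv> ring_module R"

lemma pwR: "v \<in> vec rm X ==> v x \<in> carrier R"
 using rmod.pw_all[OF rmod_rm] by simp

lemma pwR_Pi[simp]: "v \<in> vec rm X ==> v \<in> Y \<rightarrow> carrier R" by (simp add: pwR)

lemma lc_pw_mm:
 assumes "v \<in> X \<rightarrow> carrier R" "g \<in> X \<rightarrow> vec rm Y"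
 shows "lc (pw rm Y) X v g = mm rm X (\<lambda>y x. g x y) Y v"
proof (rule pw_ext[where X = Y])
 interpret rm: rmod R rm by (rule rmod_rm)
 interpret P: rmod R "pw rm Y" by (rule rm.rmod_pw)
 show "lc (pw rm Y) X v g \<in> vec rm Y" using assms by blast
 have g: "\<And>x y. x \<in> X ==> g x y \<in> carrier R" using assms(2) by (auto intro: pwR)
 then show "mm rm X (\<lambda>y x. g x y) Y v \<in> vec rm Y" using assms(1) by (intro rm.mm_closed) (auto simp: mat_def)
 fix y assume y: "y \<in> Y"
 show "lc (pw rm Y) X v g y = mm rm X (\<lambda>y x. g x y) Y v y"
  unfolding rm.pw_lc[OF assms y] using y assms(1) g by (simp add: mm_def) (rule lc_rm_comm, auto)
qed

lemma gens_pw_rm: "finite X ==> gens R (pw rm X) X (free_gen R)"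
 unfolding gens_def
proof (intro conjI ballI)
 assume X: "finite X"
 interpret rm: rmod R rm by (rule rmod_rm)
 show 1: "free_gen R \<in> X \<rightarrow> vec rm X" by (auto intro: gen_pw)
 fix a assume a: "a \<in> vec rm X"
 have "a = lc (pw rm X) X a (free_gen R)"
 proof (rule pw_ext[OF a])
  interpret P: rmod R "pw rm X" by (rule rm.rmod_pw)
  show "lc (pw rm X) X a (free_gen R) \<in> vec rm X" using a 1 by auto
  fix x assume x: "x \<in> X"
  have "lc (pw rm X) X a (free_gen R) x = lc rm X a (\<lambda>y. free_gen R y x)" using a 1 x by (subst rm.pw_lc) auto
  also have "\<dots> = lc rm X (free_gen R x) a"
   using a pwR[OF a] by (subst lc_rm_comm) (auto intro!: rm.lc_cong simp: free_gen_def)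
  also have "\<dots> = a x" using X x a by (subst rm.lc_gen) auto
  finally show "a x = lc (pw rm X) X a (free_gen R) x" ..
 qed
 then show "\<exists>v\<in>vec rm X. a = lc (pw rm X) X v (free_gen R)" using a by blast
qed

end

lemma (in rmod) sub_gens:
 assumes N: "noetherian_ring R" and M: "finite_module R M" and U: "submodule U R M"
 shows "finite_module R (M\<lparr>carrier := U\<rparr>)"
proof -
 obtain S where S: "finite S" "S \<subseteq> carrier M" "module_span R M S = carrier M" using M by (auto simp: finite_module_def)
 obtain T where T: "finite T" "T \<subseteq> U" "U = module_span R M T"
  using fg_sub[OF N S(1,2) U] S(3) sub_car[OF U] by auto
 interpret U: rmod R "M\<lparr>carrier := U\<rparr>" by (rule rmod.intro[OF submodule.submodule_is_module[OF U module_axioms]])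
 have "module_span R (M\<lparr>carrier := U\<rparr>) T = U"
 proof
  show "module_span R (M\<lparr>carrier := U\<rparr>) T \<subseteq> U"
   using U.span_least[OF U.carrier_is_submodule] T by auto
  have 1: "submodule (module_span R (M\<lparr>carrier := U\<rparr>) T) R (M\<lparr>carrier := U\<rparr>)" using T by (intro U.span_submodule) auto
  have "submodule (module_span R (M\<lparr>carrier := U\<rparr>) T) R M"
  proof (rule subI_comb)
   show "module_span R (M\<lparr>carrier := U\<rparr>) T \<subseteq> carrier M" using U.sub_car[OF 1] sub_car[OF U] by auto
  qed (use U.sub_zero[OF 1] U.sub_add[OF 1] U.sub_smult[OF 1] in simp_all)
  then show "U \<subseteq> module_span R (M\<lparr>carrier := U\<rparr>) T" using T(3) span_least U.span_superset by metis
 qed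
 then show ?thesis unfolding finite_module_def using T by auto
qed

section \<open>Minimal generators and minimal free resolutions\<close>

context lnr begin

lemma noeth: "noetherian_ring R" ..

text \<open>Take a generating family of least cardinality. In a relation with a coefficient outside
  \<open>mx\<close> that coefficient is a unit, and the corresponding generator could be expressed
  by the others.\<close>

lemma min_gens:
 assumes A: "rmod R A" and fin: "finite_module R A"
 shows "\<exists>X g. finite (X :: nat set) \<and> gens R A X g \<and>
  (\<forall>v\<in>vec rm X. lc A X v g = \<zero>[A] --> (\<forall>x\<in>X. v x \<in> mx))"
proof -
 interpret A: rmod R A by (rule A)
 let ?P = "\<lambda>n. \<exists>X g. finite (X :: nat set) \<and> gens R A X g \<and> card X = n"
 define n where "n = (LEAST n. ?P n)"
 have "\<exists>n. ?P n" using A.finite_module_gens[OF fin] by blast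
 then have n: "?P n" "\<And>k. k < n ==> \<not> ?P k" unfolding n_def by (rule LeastI_ex) (rule not_less_Least)
 then obtain X g where X: "finite (X :: nat set)" "gens R A X g" "card X = n" by blast
 have g: "g \<in> X \<rightarrow> carrier A" using X by (simp add: gens_def)
 have "v x \<in> mx" if v: "v \<in> vec rm X" and 0: "lc A X v g = \<zero>[A]" and x: "x \<in> X" for v x
 proof (rule ccontr)
  assume "v x \<notin> mx"
  then obtain b where b: "b \<in> carrier R" "b \<otimes> v x = \<one>" using unit_if_notin_mx pwR[OF v] by blast
  let ?X = "X - {x}" and ?S = "module_span R A (g ` (X - {x}))"
  have gc: "g ` ?X \<subseteq> carrier A" using g by auto
  note S = A.span_submodule[OF gc]
  have Xi: "insert x ?X = X" using x by auto
  have l: "lc A ?X v g \<in> ?S"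
   using A.span_superset[of "g ` ?X"] v by (intro A.lc_in_sub[OF S]) auto
  have "lc A X v g = v x *[A] g x +[A] lc A ?X v g"
   using A.lc_insert[of ?X x v g] X(1) g v x by (simp add: Xi insert_absorb Pi_def pwR)
  then have "v x *[A] g x = \<ominus>[A] lc A ?X v g"
   using 0 A.sub_car[OF S l] g x pwR[OF v] by (metis A.M.minus_equality PiE A.smult_closed)
  then have "v x *[A] g x \<in> ?S" using l A.submoduleE(3)[OF S] by simp
  then have "b *[A] (v x *[A] g x) \<in> ?S" using b A.sub_smult[OF S] by blast
  moreover have "b *[A] (v x *[A] g x) = g x"
   using b g x pwR[OF v] by (subst A.smult_assoc1[symmetric]) (auto simp: Pi_def)
  ultimately have "g ` X \<subseteq> ?S" using A.span_superset[of "g ` ?X"] by auto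
  then have "module_span R A (g ` X) \<subseteq> ?S" using A.span_least[OF S] by blast
  then have "?S = carrier A" using A.gens_span[OF X(2)] A.sub_car[OF S] by auto
  then have "gens R A ?X g" using X(1) g by (subst A.gens_iff) auto
  moreover have "card ?X < n" using X x by (metis card_Diff1_less)
  ultimately show False using n(2) X(1) by blast
 qed
 then show ?thesis using X by blast
qed

text \<open>The columns of \<open>D\<close> are minimal generators of \<open>U\<close>. The last
  conjunct is kept because it forces the entries of the next matrix of a resolution into
  \<open>mx\<close>.\<close>

lemma min_step:
 assumes Y: "finite Y" and U: "submodule U R (pw rm Y)"
 shows "\<exists>X D. finite (X :: nat set) \<and> mat R Y X D \<and> (\<forall>u. u \<in> U \<longleftrightarrow> (\<exists>v\<in>vec rm X. u = mm rm X D Y v)) \<and>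
  (\<forall>v\<in>vec rm X. mm rm X D Y v = (\<lambda>_. \<zero>) --> (\<forall>x\<in>X. v x \<in> mx))"
proof -
 interpret rm: rmod R rm by (rule rmod_rm)
 interpret P: rmod R "pw rm Y" by (rule rm.rmod_pw)
 interpret U: rmod R "(pw rm Y)\<lparr>carrier := U\<rparr>" by (rule rmod.intro[OF submodule.submodule_is_module[OF U P.module_axioms]])
 have "finite_module R ((pw rm Y)\<lparr>carrier := U\<rparr>)"
  using P.finite_moduleI[OF Y gens_pw_rm[OF Y]] by (rule P.sub_gens[OF noeth _ U])
 from min_gens[OF U.rmod_axioms this] obtain X g where X: "finite (X :: nat set)" "gens R ((pw rm Y)\<lparr>carrier := U\<rparr>) X g"
  "\<And>v. v \<in> vec rm X ==> lc ((pw rm Y)\<lparr>carrier := U\<rparr>) X v g = (\<lambda>_. \<zero>) --> (\<forall>x\<in>X. v x \<in> mx)"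
  by auto
 have g: "g \<in> X \<rightarrow> U" using X(2) by (auto simp: gens_def)
 then have g': "g \<in> X \<rightarrow> vec rm Y" using P.sub_car[OF U] by blast
 let ?D = "\<lambda>y x. g x y"
 have D: "mat R Y X ?D" using g' pwR[of "g _" Y] by (auto simp: mat_def Pi_def)
 have "lin R ((pw rm Y)\<lparr>carrier := U\<rparr>) (pw rm Y) (\<lambda>u. u)" using P.sub_car[OF U] by (auto intro!: linI)
 then have L: "lc ((pw rm Y)\<lparr>carrier := U\<rparr>) X v g = mm rm X ?D Y v" if "v \<in> vec rm X" for v
  using lin_lc[OF U.rmod_axioms P.rmod_axioms, of "\<lambda>u. u" v X g] lc_pw_mm[of v X g Y] that g g' by auto
 have "u \<in> U \<longleftrightarrow> (\<exists>v\<in>vec rm X. u = mm rm X ?D Y v)" for u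
 proof
  assume "u \<in> U"
  then obtain v where v: "v \<in> vec rm X" "u = lc ((pw rm Y)\<lparr>carrier := U\<rparr>) X v g"
   using X(2) unfolding gens_def by auto
  then show "\<exists>v\<in>vec rm X. u = mm rm X ?D Y v" unfolding L[OF v(1)] by blast
 next
  assume "\<exists>v\<in>vec rm X. u = mm rm X ?D Y v"
  then obtain v where v: "v \<in> vec rm X" "u = mm rm X ?D Y v" by blast
  then have "u = lc ((pw rm Y)\<lparr>carrier := U\<rparr>) X v g" by (simp only: L)
  then show "u \<in> U" using v U.lc_closed[of v X g] g by auto
 qed
 then show ?thesis using X(1,3) D L by (intro exI[of _ X] exI[of _ ?D]) auto
qed

lemma ker_sub:
 assumes Y: "finite Y" and E: "mat R Z Y E"
 shows "submodule {v \<in> vec rm Y. mm rm Y E Z v = (\<lambda>_. \<zero>)} R (pw rm Y)"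
proof -
 interpret rm: rmod R rm by (rule rmod_rm)
 interpret P: rmod R "pw rm Y" by (rule rm.rmod_pw)
 have l: "lin R (pw rm Y) (pw rm Z) (mm rm Y E Z)" using rm.mm_lin[OF Y E] .
 have z: "mm rm Y E Z (\<lambda>_. \<zero>) = (\<lambda>_. \<zero>)" using rm.mm_zero[OF E] by simp
 show ?thesis
  by (rule P.subI_comb) (use z lin_add[OF l] lin_smult[OF l] P.M.add.m_closed P.smult_closed P.M.zero_closed in auto)
qed

text \<open>Dependent choice iterates \<open>min_step\<close>, each state recording a matrix with
  its two index sets. The matrix \<open>D 0\<close> is exempt from minimality, since
  \<open>U\<close> need not lie in \<open>mx\<close> times the free module.\<close>

lemma res_tail:
 assumes Y: "finite Y" and U: "submodule U R (pw rm Y)"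
 obtains X D where "res R X D" "X 0 = (Y :: nat set)"
  "\<And>u. u \<in> U \<longleftrightarrow> (\<exists>v\<in>vec rm (X 1). u = mm rm (X 1) (D 0) (X 0) v)"
  "\<And>i y x. y \<in> X (Suc i) ==> x \<in> X (Suc (Suc i)) ==> D (Suc i) y x \<in> mx"
proof -
 interpret rm: rmod R rm by (rule rmod_rm)
 let ?P = "\<lambda>i (Y1 :: nat set, D, X :: nat set). finite Y1 \<and> finite X \<and> mat R Y1 X D \<and>
   (\<forall>v\<in>vec rm X. mm rm X D Y1 v = (\<lambda>_. \<zero>) --> (\<forall>x\<in>X. v x \<in> mx)) \<and>
   (i = (0::nat) --> Y1 = Y \<and> (\<forall>u. u \<in> U \<longleftrightarrow> (\<exists>v\<in>vec rm X. u = mm rm X D Y1 v)))"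
 let ?Q = "\<lambda>i (Y1 :: nat set, D, X :: nat set) (Y' :: nat set, D', X' :: nat set). Y' = X \<and> exat rm X' D' Y' D Y1"
 have "\<exists>f. \<forall>n. ?P n (f n) \<and> ?Q n (f n) (f (Suc n))"
 proof (rule dependent_nat_choice)
  show "\<exists>x. ?P 0 x" using min_step[OF Y U] Y by auto
 next
  fix s n assume P: "?P n s"
  obtain Y' D X where s: "s = (Y', D, X)" by (cases s)
  from P s have *: "finite Y'" "finite X" "mat R Y' X D" by auto
  from min_step[OF *(2) ker_sub[OF *(2,3)]] obtain X' D' where
   "finite (X' :: nat set)" "mat R X X' D'"
   "\<And>u. u \<in> {v \<in> vec rm X. mm rm X D Y' v = (\<lambda>_. \<zero>)} \<longleftrightarrow> (\<exists>v\<in>vec rm X'. u = mm rm X' D' X v)"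
   "\<forall>v\<in>vec rm X'. mm rm X' D' X v = (\<lambda>_. \<zero>) --> (\<forall>x\<in>X'. v x \<in> mx)" by blast
  then show "\<exists>y. ?P (Suc n) y \<and> ?Q n s y"
   using * s by (intro exI[of _ "(X, D', X')"]) (auto simp: exat_def)
 qed
 then obtain f where "\<forall>n. ?P n (f n) \<and> ?Q n (f n) (f (Suc n))" by (rule exE)
 then have f: "?P n (f n)" "?Q n (f n) (f (Suc n))" for n by (simp_all only: simp_thms)
 define X where "X n = fst (f n)" for n
 define D where "D n = fst (snd (f n))" for n
 have fe: "f n = (X n, D n, X (Suc n))" for n
 proof -
  have "snd (snd (f n)) = fst (f (Suc n))" using f(2)[of n] by (simp add: case_prod_beta)
  then show ?thesis unfolding X_def D_def by (metis prod.collapse)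
 qed
 have f1: "?P n (X n, D n, X (Suc n))" and f2: "?Q n (X n, D n, X (Suc n)) (X (Suc n), D (Suc n), X (Suc (Suc n)))" for n
  using f(1)[of n] f(2)[of n] by (simp_all only: fe)
 have 1: "finite (X n)" "mat R (X n) (X (Suc n)) (D n)"
  "\<And>v. v \<in> vec rm (X (Suc n)) ==> dif rm X D n v = (\<lambda>_. \<zero>) ==> \<forall>x\<in>X (Suc n). v x \<in> mx"
  "exa rm X D n" for n
 proof -
  show "finite (X n)" using f1[of n, unfolded prod.case] by (elim conjE)
  show "mat R (X n) (X (Suc n)) (D n)" using f1[of n, unfolded prod.case] by (elim conjE)
  show "\<forall>x\<in>X (Suc n). v x \<in> mx" if "v \<in> vec rm (X (Suc n))" "dif rm X D n v = (\<lambda>_. \<zero>)" for v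
   using f1[of n, unfolded prod.case] that by (elim conjE) (drule bspec, assumption, drule mp, assumption+)
  show "exa rm X D n" using f2[of n, unfolded prod.case] by (elim conjE)
 qed
 \<comment> \<open>A column is the image of a basis vector, hence a cycle for the previous matrix,
   and cycles have entries in \<open>mx\<close>.\<close>
 have "D (Suc i) y x \<in> mx" if "y \<in> X (Suc i)" "x \<in> X (Suc (Suc i))" for i y x
 proof -
  have g: "free_gen R x \<in> vec rm (X (Suc (Suc i)))" by (rule gen_pw[OF that(2)])
  let ?w = "dif rm X D (Suc i) (free_gen R x)"
  have w: "?w \<in> vec rm (X (Suc i))" using g 1(2)[of "Suc i"] by (intro rm.mm_closed) auto
  then have "dif rm X D i ?w = (\<lambda>_. \<zero>)" using 1(4)[of i] g by (auto simp: exat_def)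
  then have "?w y \<in> mx" using 1(3)[OF w] that by blast
  then show ?thesis using mm_gen[OF 1(1) 1(2)[of "Suc i"]] that by simp
 qed
 moreover have "X 0 = Y" "u \<in> U \<longleftrightarrow> (\<exists>v\<in>vec rm (X 1). u = mm rm (X 1) (D 0) (X 0) v)" for u
  using f1[of 0, unfolded prod.case] by (auto elim!: conjE simp only: One_nat_def simp_thms)
 moreover have "res R X D" using 1 unfolding res_def by blast
 ultimately show ?thesis using that by blast
qed

text \<open>The submodule handed to \<open>res_tail\<close> consists of the relations among minimal
  generators, which have entries in \<open>mx\<close>; so \<open>D 0\<close> is minimal as
  well.\<close>

lemma min_res:
 assumes A: "rmod R A" and fin: "finite_module R A"
 obtains X g D where "res_of R A (X :: nat => nat set) g D"
  "\<And>i y x. y \<in> X i ==> x \<in> X (Suc i) ==> D i y x \<in> mx"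
proof -
 interpret A: rmod R A by (rule A)
 interpret rm: rmod R rm by (rule rmod_rm)
 obtain Y g where Y: "finite (Y :: nat set)" "gens R A Y g"
  "\<And>v. v \<in> vec rm Y ==> lc A Y v g = \<zero>[A] ==> \<forall>x\<in>Y. v x \<in> mx" using min_gens[OF A fin] by blast
 have g: "g \<in> Y \<rightarrow> carrier A" using Y(2) by (simp add: gens_def)
 interpret P: rmod R "pw rm Y" by (rule rm.rmod_pw)
 let ?U = "{v \<in> vec rm Y. lc A Y v g = \<zero>[A]}"
 have "submodule ?U R (pw rm Y)"
 proof (rule P.subI_comb)
  show "\<zero>[pw rm Y] \<in> ?U" using P.M.zero_closed A.lc_zero_l[OF g] by simp
  fix x y assume xy: "x \<in> ?U" "y \<in> ?U"
  have "lc A Y (\<lambda>i. x i \<oplus> y i) g = \<zero>[A]" using xy g by (subst A.lc_add_l) (auto simp: pwR)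
  then show "x +[pw rm Y] y \<in> ?U" using xy P.M.add.m_closed[of x y] by simp
 next
  fix a x assume xy: "a \<in> carrier R" "x \<in> ?U"
  have "lc A Y (\<lambda>i. a \<otimes> x i) g = \<zero>[A]" using xy g Y(1) by (subst A.lc_smult_l) (auto simp: pwR)
  then show "a *[pw rm Y] x \<in> ?U" using xy P.smult_closed[of a x] by simp
 qed auto
 then obtain X D where X: "res R X D" "X 0 = Y"
   "\<And>u. u \<in> ?U \<longleftrightarrow> (\<exists>v\<in>vec rm (X 1). u = mm rm (X 1) (D 0) (X 0) v)"
   "\<And>i y x. y\<in>X (Suc i) ==> x\<in>X (Suc (Suc i)) ==> D (Suc i) y x \<in> mx"
  by (rule res_tail[OF Y(1)]) (rule that)
 have "res_of R A X g D" unfolding res_of_def using X Y(2) by auto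
 moreover have "D i y x \<in> mx" if "y \<in> X i" "x \<in> X (Suc i)" for i y x
 proof (cases i)
  case 0
  have f: "finite (X 1)" "mat R (X 0) (X 1) (D 0)" using X(1) by (auto simp: res_def)
  let ?w = "mm rm (X 1) (D 0) (X 0) (free_gen R x)"
  have "free_gen R x \<in> vec rm (X 1)" using that 0 gen_pw by auto
  then have "?w \<in> ?U" by (subst X(3)) blast
  then have "?w y \<in> mx" using Y(3)[of ?w] that 0 X(2) by blast
  then show ?thesis using mm_gen[OF f] that 0 by simp
 next
  case (Suc j) then show ?thesis using X(4) that by blast
 qed
 ultimately show ?thesis using that by blast
qed

end

section \<open>Regular sequences and depth\<close>

text \<open>The part of regularity that passes to powers and localizations:
  \<open>regular_sequence\<close> also asks for a nonzero quotient, which may be lost there.\<close>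

definition wreg :: "'a ring => ('a, 'b) module => 'a list => bool" where
 "wreg R A xs \<longleftrightarrow> set xs \<subseteq> carrier R \<and> (\<forall>i<length xs. \<forall>a\<in>carrier A.
   xs ! i *[A] a \<in> seq_submodule R A (take i xs) --> a \<in> seq_submodule R A (take i xs))"

lemma quot_sel: "carrier (quot_module G H) = a_rcosets\<^bsub>G\<^esub> H" "\<zero>[quot_module G H] = H"
 "a *[quot_module G H] Z = (\<Union>x\<in>Z. H +>\<^bsub>G\<^esub> (a *[G] x))"
 by (simp_all add: quot_module_def)

lemma a_rcosets_eq: "a_rcosets\<^bsub>G\<^esub> H = {H +>\<^bsub>G\<^esub> x | x. x \<in> carrier G}"
 by (auto simp: A_RCOSETS_def' )

text \<open>Stated for a bare record, because it is applied to cycles obtained by replacing a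
  carrier, whose module laws are not at hand.\<close>

lemma zero_quotD:
 assumes "zero_module (quot_module G H)" "x \<in> carrier G" "\<zero>[G] \<in> H" "\<zero>[G] +[G] x = x"
 shows "x \<in> H"
proof -
 have "H +>\<^bsub>G\<^esub> x = H" using assms(1,2) unfolding zero_module_def quot_sel a_rcosets_eq by blast
 moreover have "\<zero>[G] +[G] x \<in> H +>\<^bsub>G\<^esub> x" using assms(3) by (auto simp: a_r_coset_def')
 ultimately show ?thesis using assms(4) by simp
qed

context rmod begin

lemma minus_swap: "x \<in> carrier M ==> y \<in> carrier M ==> z \<in> carrier M ==> x -[M] z = ((x -[M] y) -[M] z) +[M] y"
proof -
 assume *: "x \<in> carrier M" "y \<in> carrier M" "z \<in> carrier M"
 have "((x -[M] y) -[M] z) +[M] y = (x +[M] \<ominus>[M] z) +[M] (y +[M] \<ominus>[M] y)"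
  unfolding a_minus_def using * by (simp only: M.a_ac M.a_inv_closed M.add.m_closed)
 then show ?thesis using * by (simp add: M.r_neg a_minus_def)
qed

lemma seq_gen_sub: "set xs \<subseteq> carrier R ==> {x *[M] m | x m. x \<in> set xs \<and> m \<in> carrier M} \<subseteq> carrier M"
 by auto

lemma seq_sub: "set xs \<subseteq> carrier R ==> submodule (seq_submodule R M xs) R M"
 unfolding seq_submodule_def by (rule span_submodule[OF seq_gen_sub])

lemma seq_Nil: "seq_submodule R M [] = {\<zero>[M]}"
proof
 have "submodule {\<zero>[M]} R M" by (rule subI_comb) auto
 then show "seq_submodule R M [] \<subseteq> {\<zero>[M]}" unfolding seq_submodule_def by (rule span_least) auto
 show "{\<zero>[M]} \<subseteq> seq_submodule R M []" using sub_zero[OF seq_sub[of "[]"]] by simp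
qed

lemma sum_sub:
 assumes V: "submodule V R M" and x: "x \<in> carrier R"
 shows "submodule {v +[M] x *[M] b | v b. v \<in> V \<and> b \<in> carrier M} R M" (is "submodule ?W R M")
proof (rule subI_comb)
 show "?W \<subseteq> carrier M" using sub_car[OF V] x by auto
 have "\<zero>[M] = \<zero>[M] +[M] x *[M] \<zero>[M]" using x by simp
 then show "\<zero>[M] \<in> ?W" using sub_zero[OF V] by blast
 fix y z assume "y \<in> ?W" "z \<in> ?W"
 then obtain v b w c where *: "v \<in> V" "b \<in> carrier M" "w \<in> V" "c \<in> carrier M"
  "y = v +[M] x *[M] b" "z = w +[M] x *[M] c" by blast
 have "y +[M] z = (v +[M] w) +[M] x *[M] (b +[M] c)"
  using * x sub_car[OF V] by (simp add: smult_r_distr M.a_ac)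
 then show "y +[M] z \<in> ?W" using * sub_add[OF V] M.add.m_closed[of b c] by blast
next
 fix a y assume a: "a \<in> carrier R" and "y \<in> ?W"
 then obtain v b where *: "v \<in> V" "b \<in> carrier M" "y = v +[M] x *[M] b" by blast
 have "a *[M] y = a *[M] v +[M] x *[M] (a *[M] b)"
  using * a x sub_car[OF V] by (simp add: smult_r_distr smult_assoc1[symmetric] R.m_comm)
 then show "a *[M] y \<in> ?W" using * sub_smult[OF V a] smult_closed[OF a] by blast
qed

lemma seq_snoc:
 assumes xs: "set xs \<subseteq> carrier R" and x: "x \<in> carrier R"
 shows "seq_submodule R M (xs @ [x]) = {v +[M] x *[M] b | v b. v \<in> seq_submodule R M xs \<and> b \<in> carrier M}"
  (is "?L = ?W")
proof
 have xx: "set (xs @ [x]) \<subseteq> carrier R" using xs x by simp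
 note V = seq_sub[OF xs] and L = seq_sub[OF xx]
 show "?L \<subseteq> ?W"
  unfolding seq_submodule_def[of R M "xs @ [x]"]
 proof (rule span_least[OF sum_sub[OF V x]], rule subsetI)
  fix y assume "y \<in> {x' *[M] m |x' m. x' \<in> set (xs @ [x]) \<and> m \<in> carrier M}"
  then obtain c m where *: "y = c *[M] m" "c \<in> set (xs @ [x])" "m \<in> carrier M" by blast
  show "y \<in> ?W"
  proof (cases "c \<in> set xs")
   case True
   then have "y \<in> {x' *[M] m |x' m. x' \<in> set xs \<and> m \<in> carrier M}" using * by auto
   then have y: "y \<in> seq_submodule R M xs" unfolding seq_submodule_def by (rule subsetD[OF span_superset])
   have "y = y +[M] x *[M] \<zero>[M]" using x sub_car[OF V y] by simp
   then show ?thesis using y M.zero_closed by blast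
  next
   case False
   then have "y = \<zero>[M] +[M] x *[M] m" using * x by simp
   then show ?thesis using sub_zero[OF V] *(3) by blast
  qed
 qed
 have 1: "seq_submodule R M xs \<subseteq> ?L" unfolding seq_submodule_def by (rule span_mono) auto
 have 2: "x *[M] b \<in> ?L" if "b \<in> carrier M" for b
 proof -
  have "x *[M] b \<in> {x' *[M] m |x' m. x' \<in> set (xs @ [x]) \<and> m \<in> carrier M}" using that by auto
  then show ?thesis unfolding seq_submodule_def by (rule subsetD[OF span_superset])
 qed
 show "?W \<subseteq> ?L" using 1 2 sub_add[OF L] by blast
qed

lemma wreg_Nil: "wreg R M []" by (simp add: wreg_def)

lemma wreg_snoc: "wreg R M (xs @ [x]) \<longleftrightarrow> wreg R M xs \<and> x \<in> carrier R \<and>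
  (\<forall>a\<in>carrier M. x *[M] a \<in> seq_submodule R M xs --> a \<in> seq_submodule R M xs)"
proof -
 have "(\<forall>i<length (xs @ [x]). P i) \<longleftrightarrow> (\<forall>i<length xs. P i) \<and> P (length xs)" for P by (auto simp: less_Suc_eq)
 then show ?thesis unfolding wreg_def by (auto simp: nth_append)
qed

lemma wreg_set: "wreg R M xs ==> set xs \<subseteq> carrier R" by (simp add: wreg_def)

lemma wreg_take: "wreg R M xs ==> wreg R M (take n xs)"
 unfolding wreg_def by (auto dest: in_set_takeD simp: min_def)

lemma coset_smult:
 assumes H: "submodule H R M" and c: "c \<in> carrier R" and a: "a \<in> carrier M"
 shows "c *[quot_module M H] (H +>\<^bsub>M\<^esub> a) = H +>\<^bsub>M\<^esub> (c *[M] a)"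
proof -
 have sg: "subgroup H (add_monoid M)" using H by (rule submodule.axioms)
 have "H +>\<^bsub>M\<^esub> (c *[M] x) = H +>\<^bsub>M\<^esub> (c *[M] a)" if xx: "x \<in> H +>\<^bsub>M\<^esub> a" for x
 proof -
  obtain h where h: "h \<in> H" "x = h +[M] a" using xx by (auto simp: a_r_coset_def')
  have "c *[M] x = c *[M] h +[M] c *[M] a" using h c a sub_car[OF H] by (simp add: smult_r_distr)
  then have "c *[M] x \<in> H +>\<^bsub>M\<^esub> (c *[M] a)" using sub_smult[OF H c h(1)] by (auto simp: a_r_coset_def')
  from M.a_repr_independence[OF this _ sg] show ?thesis using c a by simp
 qed
 moreover have "a \<in> H +>\<^bsub>M\<^esub> a" using sub_zero[OF H] a by (auto simp: a_r_coset_def' intro!: bexI[of _ "\<zero>[M]"])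
 ultimately show ?thesis unfolding quot_sel by blast
qed

lemma coset_eq_iff: "submodule H R M ==> a \<in> carrier M ==> H +>\<^bsub>M\<^esub> a = H \<longleftrightarrow> a \<in> H"
 using M.a_coset_join1 M.a_coset_join2 submodule.axioms(1) by metis

lemma regular_sequence_iff:
 "regular_sequence R M xs \<longleftrightarrow> wreg R M xs \<and> seq_submodule R M xs \<noteq> carrier M"
proof (cases "set xs \<subseteq> carrier R")
 case True
 have 1: "(\<forall>z\<in>carrier (quot_module M H). c *[quot_module M H] z = \<zero>[quot_module M H] --> z = \<zero>[quot_module M H])
  \<longleftrightarrow> (\<forall>a\<in>carrier M. c *[M] a \<in> H --> a \<in> H)" (is "?l \<longleftrightarrow> ?r") if H: "submodule H R M" and c: "c \<in> carrier R" for H c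
 proof -
  have "?l \<longleftrightarrow> (\<forall>a\<in>carrier M. c *[quot_module M H] (H +>\<^bsub>M\<^esub> a) = H --> H +>\<^bsub>M\<^esub> a = H)"
   unfolding quot_sel(1,2) a_rcosets_eq by auto
  also have "\<dots> \<longleftrightarrow> ?r" using coset_smult[OF H c] coset_eq_iff[OF H] smult_closed[OF c] by simp
  finally show ?thesis .
 qed
 have 2: "zero_module (quot_module M H) \<longleftrightarrow> H = carrier M" if H: "submodule H R M" for H
 proof -
  have "zero_module (quot_module M H) \<longleftrightarrow> (\<forall>a\<in>carrier M. H +>\<^bsub>M\<^esub> a = H)"
   unfolding zero_module_def quot_sel a_rcosets_eq using M.zero_closed by auto
  also have "\<dots> \<longleftrightarrow> H = carrier M" using coset_eq_iff[OF H] sub_car[OF H] by auto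
  finally show ?thesis .
 qed
 have s: "set (take i xs) \<subseteq> carrier R" for i using True by (auto dest: in_set_takeD)
 have "xs ! i \<in> carrier R" if "i < length xs" for i using True that by auto
 then show ?thesis unfolding regular_sequence_def wreg_def Let_def
  using True 1[OF seq_sub[OF s]] 2[OF seq_sub[OF True]] by simp
qed (auto simp: regular_sequence_def wreg_def)

lemma seq_pw:
 "set xs \<subseteq> carrier R ==> v \<in> vec M X ==>
  v \<in> seq_submodule R (pw M X) xs \<longleftrightarrow> (\<forall>x\<in>X. v x \<in> seq_submodule R M xs)"
proof (induct xs arbitrary: v rule: rev_induct)
 case Nil
 interpret P: rmod R "pw M X" by (rule rmod_pw)
 show ?case unfolding P.seq_Nil seq_Nil using pw0[OF Nil(2)] by auto
next
 case (snoc c xs)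
 interpret P: rmod R "pw M X" by (rule rmod_pw)
 have c: "c \<in> carrier R" "set xs \<subseteq> carrier R" using snoc by auto
 note V = seq_sub[OF c(2)]
 show ?case unfolding P.seq_snoc[OF c(2,1)] seq_snoc[OF c(2,1)]
 proof
  assume "v \<in> {va +[pw M X] c *[pw M X] b |va b. va \<in> seq_submodule R (pw M X) xs \<and> b \<in> vec M X}"
  then obtain w b where *: "w \<in> seq_submodule R (pw M X) xs" "b \<in> vec M X" "v = (\<lambda>x. w x +[M] c *[M] b x)" by auto
  have "w \<in> vec M X" by (rule P.sub_car[OF P.seq_sub[OF c(2)] *(1)])
  then have "\<forall>x\<in>X. w x \<in> seq_submodule R M xs" using snoc(1)[OF c(2)] * by blast
  then show "\<forall>x\<in>X. v x \<in> {v +[M] c *[M] b |v b. v \<in> seq_submodule R M xs \<and> b \<in> carrier M}"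
   using *(3) pw_all[OF *(2)] by auto
 next
  assume "\<forall>x\<in>X. v x \<in> {v +[M] c *[M] b |v b. v \<in> seq_submodule R M xs \<and> b \<in> carrier M}"
  then have "\<forall>x\<in>X. \<exists>w b. v x = w +[M] c *[M] b \<and> w \<in> seq_submodule R M xs \<and> b \<in> carrier M" by blast
  then obtain w b where wb: "\<forall>x\<in>X. v x = w x +[M] c *[M] b x \<and> w x \<in> seq_submodule R M xs \<and> b x \<in> carrier M" by metis
  let ?w = "\<lambda>x. if x \<in> X then w x else \<zero>[M]" and ?b = "\<lambda>x. if x \<in> X then b x else \<zero>[M]"
  have b: "?b \<in> vec M X" using wb by (intro pwI) auto
  have w: "?w \<in> vec M X" using wb sub_car[OF V] by (intro pwI) auto
  then have "?w \<in> seq_submodule R (pw M X) xs" using wb snoc(1)[OF c(2)] by simp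
  moreover have "v = ?w +[pw M X] c *[pw M X] ?b" using wb c pw0[OF snoc(3)] by auto
  ultimately show "v \<in> {va +[pw M X] c *[pw M X] b |va b. va \<in> seq_submodule R (pw M X) xs \<and> b \<in> vec M X}"
   using b by blast
 qed
qed

lemma wreg_pw: "wreg R M xs ==> wreg R (pw M X) xs"
proof (induct xs rule: rev_induct)
 case Nil show ?case by (simp add: wreg_def)
next
 case (snoc c xs)
 interpret P: rmod R "pw M X" by (rule rmod_pw)
 have w: "wreg R M xs" "c \<in> carrier R" "\<And>a. a \<in> carrier M ==> c *[M] a \<in> seq_submodule R M xs ==> a \<in> seq_submodule R M xs"
  using snoc(2) wreg_snoc by auto
 note s = seq_pw[OF wreg_set[OF w(1)], where X = X]
 show ?case unfolding P.wreg_snoc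
 proof (intro conjI ballI impI)
  show "wreg R (pw M X) xs" by (rule snoc(1)[OF w(1)])
  show "c \<in> carrier R" by (rule w)
  fix a assume a: "a \<in> vec M X" and "c *[pw M X] a \<in> seq_submodule R (pw M X) xs"
  then have "\<forall>x\<in>X. c *[M] a x \<in> seq_submodule R M xs" using s[OF P.smult_closed[OF w(2) a]] by simp
  then show "a \<in> seq_submodule R (pw M X) xs" using s[OF a] w(3) pwD[OF a] by blast
 qed
qed

end

text \<open>Exactness at \<open>B\<close> after reduction modulo \<open>VB\<close> and
  \<open>VC\<close>, on representatives. Only the passage from cycles to boundaries is
  recorded.\<close>

definition exm :: "('a, 'b) module => ('b => 'c) => ('a, 'c) module => 'c set => ('c => 'd) => 'd set => bool" where
 "exm A f B VB g VC \<longleftrightarrow> (\<forall>b\<in>carrier B. g b \<in> VC --> (\<exists>a\<in>carrier A. b -[B] f a \<in> VB))"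

lemma exmD: "exm A f B VB g VC ==> b \<in> carrier B ==> g b \<in> VC ==> \<exists>a\<in>carrier A. b -[B] f a \<in> VB"
 by (simp add: exm_def)

text \<open>If \<open>g b\<close> is x times \<open>c\<close> modulo \<open>VC\<close>, then x times
  \<open>h c\<close> lies in \<open>VE\<close>, so \<open>h c\<close> does by regularity, and
  exactness at \<open>C\<close> makes \<open>c\<close> a boundary \<open>g b'\<close> modulo
  \<open>VC\<close>. Now \<open>b\<close> minus x times \<open>b'\<close> is a cycle modulo
  \<open>VC\<close>, and exactness at \<open>B\<close> finishes.\<close>

lemma reduce_step:
 assumes B: "rmod R B" and C: "rmod R C" and E: "rmod R E"
  and f: "f \<in> carrier A \<rightarrow> carrier B" and g: "lin R B C g" and h: "lin R C E h"
  and VB: "submodule VB R B" and VC: "submodule VC R C" and VE: "submodule VE R E"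
  and hg: "\<And>b. b \<in> carrier B ==> h (g b) = \<zero>[E]" and hV: "\<And>c. c \<in> VC ==> h c \<in> VE"
  and x: "x \<in> carrier R" and reg: "\<And>e. e \<in> carrier E ==> x *[E] e \<in> VE ==> e \<in> VE"
  and e1: "exm A f B VB g VC" and e2: "exm B g C VC h VE"
 shows "exm A f B {v +[B] x *[B] b | v b. v \<in> VB \<and> b \<in> carrier B} g {v +[C] x *[C] b | v b. v \<in> VC \<and> b \<in> carrier C}"
 unfolding exm_def
proof (intro ballI impI)
 interpret B: rmod R B by (rule B)
 interpret C: rmod R C by (rule C)
 interpret E: rmod R E by (rule E)
 fix b assume b: "b \<in> carrier B" and "g b \<in> {v +[C] x *[C] b | v b. v \<in> VC \<and> b \<in> carrier C}"
 then obtain v c where vc: "g b = v +[C] x *[C] c" "v \<in> VC" "c \<in> carrier C" by blast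
 have v: "v \<in> carrier C" using C.sub_car[OF VC vc(2)] .
 have hc: "h c \<in> carrier E" "h v \<in> carrier E" using lin_closed[OF h] vc v by auto
 have "h (g b) = h v +[E] x *[E] h c" unfolding vc(1) using lin_add[OF h] lin_smult[OF h] v vc(3) x by simp
 then have "\<zero>[E] = h v +[E] x *[E] h c" using hg[OF b] by simp
 then have "x *[E] h c = \<ominus>[E] h v" using hc x by (metis E.M.minus_equality E.M.a_comm E.smult_closed)
 then have "x *[E] h c \<in> VE" using E.submoduleE(3)[OF VE hV[OF vc(2)]] by simp
 then have "h c \<in> VE" using reg hc(1) by blast
 then obtain b' where b': "b' \<in> carrier B" "c -[C] g b' \<in> VC" using exmD[OF e2 vc(3)] by blast
 have gb': "g b' \<in> carrier C" using lin_closed[OF g b'(1)] .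
 have "g (b -[B] x *[B] b') = g b -[C] x *[C] g b'"
  using lin_minus[OF B C g] lin_smult[OF g] b b' x by simp
 also have "\<dots> = v +[C] x *[C] (c -[C] g b')"
  unfolding vc(1) a_minus_def using v vc(3) gb' x by (simp add: C.smult_r_distr C.smult_r_minus C.M.a_assoc)
 also have "\<dots> \<in> VC" using C.sub_add[OF VC vc(2) C.sub_smult[OF VC x b'(2)]] .
 finally obtain a where a: "a \<in> carrier A" "(b -[B] x *[B] b') -[B] f a \<in> VB" using exmD[OF e1] b b' x by (meson B.M.minus_closed B.smult_closed)
 have fa: "f a \<in> carrier B" using f a(1) by blast
 have "b -[B] f a = ((b -[B] x *[B] b') -[B] f a) +[B] x *[B] b'"
  by (rule B.minus_swap) (use b b' x fa in auto)
 then show "\<exists>a\<in>carrier A. b -[B] f a \<in> {v +[B] x *[B] b |v b. v \<in> VB \<and> b \<in> carrier B}"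
  using a b'(1) by blast
qed

lemma lin_seq:
 assumes A: "rmod R A" and B: "rmod R B" and f: "lin R A B f" and xs: "set xs \<subseteq> carrier R"
  and a: "a \<in> seq_submodule R A xs"
 shows "f a \<in> seq_submodule R B xs"
 using xs a
proof (induct xs arbitrary: a rule: rev_induct)
 interpret A: rmod R A by (rule A)
 interpret B: rmod R B by (rule B)
 { case Nil then show ?case using lin_zero[OF A B f] by (simp add: A.seq_Nil B.seq_Nil) }
 case (snoc c xs)
 have c: "set xs \<subseteq> carrier R" "c \<in> carrier R" using snoc by auto
 from snoc(3) obtain v b where vb: "a = v +[A] c *[A] b" "v \<in> seq_submodule R A xs" "b \<in> carrier A"
  unfolding A.seq_snoc[OF c] by blast
 have "f a = f v +[B] c *[B] f b" unfolding vb(1)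
  using lin_add[OF f] lin_smult[OF f] vb c A.sub_car[OF A.seq_sub[OF c(1)]] by simp
 then show ?case unfolding B.seq_snoc[OF c] using snoc(1)[OF c(1) vb(2)] lin_closed[OF f vb(3)] by blast
qed

text \<open>\<open>reduce_step\<close> at one place consumes exactness at the place below, so each
  element of \<open>xs\<close> raises the lower bound by one while \<open>hi\<close> stays.\<close>

lemma reduce_seq:
 assumes C: "\<And>j. rmod R (C j)" and d: "\<And>j. lin R (C (Suc j)) (C j) (d j)"
  and dd: "\<And>j c. lo \<le> j ==> j < hi ==> c \<in> carrier (C (Suc (Suc j))) ==> d j (d (Suc j) c) = \<zero>[C j]"
  and ex: "\<And>j. lo \<le> j ==> j < hi ==> exm (C (Suc (Suc j))) (d (Suc j)) (C (Suc j)) {\<zero>[C (Suc j)]} (d j) {\<zero>[C j]}"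
  and w: "\<And>j. wreg R (C j) xs"
 shows "lo + length xs \<le> j ==> j < hi ==>
  exm (C (Suc (Suc j))) (d (Suc j)) (C (Suc j)) (seq_submodule R (C (Suc j)) xs) (d j) (seq_submodule R (C j) xs)"
 using w
proof (induct xs arbitrary: j rule: rev_induct)
 case Nil
 then show ?case using ex[of j] by (simp add: rmod.seq_Nil[OF C])
next
 case (snoc c xs)
 then obtain i where j: "j = Suc i" by (cases j) auto
 interpret Cm: rmod R "C k" for k by (rule C)
 have w: "wreg R (C k) xs" "c \<in> carrier R" "\<And>a. a \<in> carrier (C k) ==> c *[C k] a \<in> seq_submodule R (C k) xs ==> a \<in> seq_submodule R (C k) xs" for k
  using snoc(4)[of k] Cm.wreg_snoc[of k xs c] by auto
 note s = Cm.wreg_set[OF w(1)]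
 show ?case unfolding Cm.seq_snoc[OF s w(2)] j
 proof (rule reduce_step[where E = "C i" and h = "d i" and VE = "seq_submodule R (C i) xs"])
  show "d (Suc (Suc i)) \<in> carrier (C (Suc (Suc (Suc i)))) \<rightarrow> carrier (C (Suc (Suc i)))" using lin_closed[OF d] by blast
  show "d i (d (Suc i) b) = \<zero>[C i]" if "b \<in> carrier (C (Suc (Suc i)))" for b
   using dd[of i b] that snoc(2,3) j by simp
  show "exm (C (Suc (Suc (Suc i)))) (d (Suc (Suc i))) (C (Suc (Suc i))) (seq_submodule R (C (Suc (Suc i))) xs) (d (Suc i)) (seq_submodule R (C (Suc i)) xs)"
   using snoc(1)[of "Suc i"] snoc(2,3) j w(1) by simp
  show "exm (C (Suc (Suc i))) (d (Suc i)) (C (Suc i)) (seq_submodule R (C (Suc i)) xs) (d i) (seq_submodule R (C i) xs)"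
   using snoc(1)[of i] snoc(2,3) j w(1) by simp
 qed (use C d Cm.seq_sub[OF s] lin_seq[OF C C d s] w in auto)
qed

lemma (in rmod) reduce_mat:
 assumes X: "\<And>j. finite (X j)" and D: "\<And>j. mat R (X j) (X (Suc j)) (D j)"
  and ex: "\<And>j. lo \<le> j ==> j < hi ==> exa M X D j"
  and w: "wreg R M xs" and j: "lo + length xs \<le> j" "j < hi"
  and v: "v \<in> vec M (X (Suc j))" and Dv: "\<And>y. y \<in> X j ==> dif M X D j v y \<in> seq_submodule R M xs"
 shows "\<exists>w\<in>vec M (X (Suc (Suc j))). \<forall>y\<in>X (Suc j).
   v y -[M] dif M X D (Suc j) w y \<in> seq_submodule R M xs"
proof -
 let ?C = "\<lambda>j. pw M (X j)" and ?d = "\<lambda>j. dif M X D j"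
 interpret P: rmod R "?C k" for k by (rule rmod_pw)
 note l = mm_lin[OF X D]
 have "exm (?C (Suc (Suc j))) (?d (Suc j)) (?C (Suc j)) (seq_submodule R (?C (Suc j)) xs) (?d j) (seq_submodule R (?C j) xs)"
 proof (rule reduce_seq[where C = ?C and d = ?d and lo = lo and hi = hi])
  show "?d j (?d (Suc j) c) = \<zero>[?C j]" if "lo \<le> j" "j < hi" "c \<in> carrier (?C (Suc (Suc j)))" for j c
   using ex[OF that(1,2)] that(3) lin_closed[OF l that(3)] unfolding exat_def by auto
  show "exm (?C (Suc (Suc j))) (?d (Suc j)) (?C (Suc j)) {\<zero>[?C (Suc j)]} (?d j) {\<zero>[?C j]}" if "lo \<le> j" "j < hi" for j
   unfolding exm_def
  proof (intro ballI impI)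
   note ej = ex[OF that]
   fix b assume b: "b \<in> carrier (?C (Suc j))" "?d j b \<in> {\<zero>[?C j]}"
   then obtain w where w: "w \<in> carrier (?C (Suc (Suc j)))" "b = ?d (Suc j) w" using ej unfolding exat_def by auto
   then have "b -[?C (Suc j)] ?d (Suc j) w = \<zero>[?C (Suc j)]" using b(1) by (simp add: a_minus_def P.M.r_neg del: pw_sel)
   then show "\<exists>a\<in>carrier (?C (Suc (Suc j))). b -[?C (Suc j)] ?d (Suc j) a \<in> {\<zero>[?C (Suc j)]}" using w(1) by blast
  qed
 qed (use j rmod_pw l wreg_pw[OF w] in auto)
 note e = this
 have "?d j v \<in> seq_submodule R (?C j) xs"
  using seq_pw[OF wreg_set[OF w] lin_closed[OF l v]] Dv by blast
 from e[unfolded exm_def, rule_format, OF v this] obtain w' where w': "w' \<in> carrier (?C (Suc (Suc j)))"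
  "v -[?C (Suc j)] ?d (Suc j) w' \<in> seq_submodule R (?C (Suc j)) xs" by (rule bexE)
 have c: "?d (Suc j) w' \<in> carrier (?C (Suc j))" using lin_closed[OF l w'(1)] .
 then have "v -[?C (Suc j)] ?d (Suc j) w' \<in> carrier (?C (Suc j))" using v P.M.minus_closed by blast
 then have "\<forall>y\<in>X (Suc j). (v -[?C (Suc j)] ?d (Suc j) w') y \<in> seq_submodule R M xs"
  by (rule iffD1[OF seq_pw[OF wreg_set[OF w]] w'(2)])
 then show ?thesis using w'(1) unfolding pw_minus[OF v c] by (rule bexI)
qed

lemma (in abelian_group) r_neg3: "x \<in> carrier G ==> y \<in> carrier G ==> x \<oplus> (y \<oplus> \<ominus> x) = y"
 by (metis a_comm a_inv_closed r_neg1 r_neg2 add.m_closed)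

section \<open>Associated primes, prime avoidance and socle elements\<close>

context lnr begin

lemma rm_sub_ideal: "submodule J R rm \<longleftrightarrow> ideal J R"
proof
 interpret rm: rmod R rm by (rule rmod_rm)
 assume J: "submodule J R rm"
 show "ideal J R" by (rule ideal_comb) (use rm.sub_car[OF J] rm.sub_zero[OF J] rm.sub_add[OF J] rm.sub_smult[OF J] in auto)
next
 interpret rm: rmod R rm by (rule rmod_rm)
 assume J: "ideal J R"
 interpret ideal J R by (rule J)
 show "submodule J R rm" by (rule rm.subI_comb) (use I_l_closed a_subset in auto)
qed

lemma ann_ideal:
 assumes A: "rmod R A" and V: "submodule V R A" and a: "a \<in> carrier A"
 shows "ideal {c \<in> carrier R. c *[A] a \<in> V} R"
proof -
 interpret A: rmod R A by (rule A)
 show ?thesis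
  by (rule ideal_comb) (use a A.sub_zero[OF V] A.sub_add[OF V] A.sub_smult[OF V] in \<open>auto simp: A.smult_l_distr A.smult_assoc1\<close>)
qed

text \<open>Associated primes modulo \<open>V\<close>: if y b is outside \<open>V\<close>, its
  annihilator contains that of \<open>b\<close> and hence equals it by maximality, so x y b in
  \<open>V\<close> gives x b in \<open>V\<close>.\<close>

lemma max_ann:
 assumes A: "rmod R A" and V: "submodule V R A" and a: "a \<in> carrier A" "a \<notin> V"
 obtains b where "b \<in> carrier A" "b \<notin> V" "{c \<in> carrier R. c *[A] a \<in> V} \<subseteq> {c \<in> carrier R. c *[A] b \<in> V}"
  "\<And>d. d \<in> carrier A ==> d \<notin> V ==> {c \<in> carrier R. c *[A] b \<in> V} \<subseteq> {c \<in> carrier R. c *[A] d \<in> V} ==>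
    {c \<in> carrier R. c *[A] d \<in> V} = {c \<in> carrier R. c *[A] b \<in> V}"
  "primeideal {c \<in> carrier R. c *[A] b \<in> V} R"
proof -
 interpret A: rmod R A by (rule A)
 let ?ann = "\<lambda>b. {c \<in> carrier R. c *[A] b \<in> V}"
 let ?S = "{?ann b | b. b \<in> carrier A \<and> b \<notin> V \<and> ?ann a \<subseteq> ?ann b}"
 have "?S \<noteq> {}" using a by blast
 moreover have "?S \<subseteq> {I. ideal I R}" using ann_ideal[OF A V] by blast
 ultimately obtain I where I: "I \<in> ?S" "\<And>J. J \<in> ?S ==> I \<subseteq> J ==> J = I" using ideal_maximal_exists by (metis (no_types, lifting))
 from I(1) obtain b where b: "I = ?ann b" "b \<in> carrier A" "b \<notin> V" "?ann a \<subseteq> ?ann b" by blast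
 have mx: "?ann d = ?ann b" if "d \<in> carrier A" "d \<notin> V" "?ann b \<subseteq> ?ann d" for d
  using I(2)[of "?ann d"] that b by blast
 have "primeideal (?ann b) R"
 proof (rule primeidealI)
  show "ideal (?ann b) R" by (rule ann_ideal[OF A V b(2)])
  show "cring R" ..
  have "\<one> \<notin> ?ann b" using b by simp
  then show "carrier R \<noteq> ?ann b" by blast
  fix x y assume xy: "x \<in> carrier R" "y \<in> carrier R" "x \<otimes> y \<in> ?ann b"
  show "x \<in> ?ann b \<or> y \<in> ?ann b"
  proof (cases "y *[A] b \<in> V")
   case False
   have "?ann b \<subseteq> ?ann (y *[A] b)"
   proof
    fix c assume c: "c \<in> ?ann b"
    then have "c *[A] (y *[A] b) = y *[A] (c *[A] b)"
     using xy b(2) by (simp add: A.smult_assoc1[symmetric] m_comm)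
    then show "c \<in> ?ann (y *[A] b)" using c A.sub_smult[OF V xy(2)] by auto
   qed
   then have "?ann (y *[A] b) = ?ann b" using mx[of "y *[A] b"] False xy b(2) by blast
   moreover have "x \<in> ?ann (y *[A] b)" using xy b(2) by (simp add: A.smult_assoc1)
   ultimately show ?thesis by blast
  qed (use xy in simp)
 qed
 then show ?thesis using that[of b] b mx by blast
qed

lemma prime_inter:
 "finite F ==> primeideal P R ==> (\<And>I. I \<in> F ==> ideal I R) ==> carrier R \<inter> \<Inter>F \<subseteq> P ==> \<exists>I\<in>F. I \<subseteq> P"
proof (induct F rule: finite_induct)
 case empty
 interpret P: primeideal P R by (rule empty(1))
 have "carrier R \<subseteq> P" using empty by simp
 then show ?case using P.I_notcarr P.a_subset by blast
next
 case (insert I F)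
 interpret P: primeideal P R by (rule insert(4))
 show ?case
 proof (rule ccontr)
  assume n: "\<not> ?thesis"
  then obtain a where a: "a \<in> I" "a \<notin> P" by blast
  have "\<not> carrier R \<inter> \<Inter>F \<subseteq> P" using n insert(3)[OF insert(4) insert(5)] by auto
  then obtain b where b: "b \<in> carrier R" "b \<in> \<Inter>F" "b \<notin> P" by blast
  have ac: "a \<in> carrier R" using ideal.Icarr[OF insert(5) a(1)] by simp
  have "a \<otimes> b \<in> I" using ideal.I_r_closed[OF insert(5) a(1) b(1)] by simp
  moreover have "a \<otimes> b \<in> J" if "J \<in> F" for J using ideal.I_l_closed[OF insert(5)] that b(2) ac by simp
  ultimately have "a \<otimes> b \<in> P" using insert(6) ac b(1) by auto
  then show False using P.I_prime[OF ac b(1)] a b by blast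
 qed
qed

lemma prime_avoidance:
 assumes "finite F" "\<And>P. P \<in> F ==> primeideal P R" "ideal I R" "I \<subseteq> \<Union>F"
 shows "\<exists>P\<in>F. I \<subseteq> P"
 using assms
proof (induct "card F" arbitrary: F rule: less_induct)
 case less
 interpret I: ideal I R by (rule less(4))
 have pid: "Q \<in> F ==> ideal Q R" for Q using less(3) primeideal.axioms(1) by blast
 show ?case
 proof (cases "\<exists>Q\<in>F. I \<subseteq> \<Union>(F - {Q})")
  case True
  then obtain Q where Q: "Q \<in> F" "I \<subseteq> \<Union>(F - {Q})" by blast
  have "card (F - {Q}) < card F" using Q(1) less(2) by (rule card_Diff1_less[rotated])
  from less(1)[OF this _ _ less(4) Q(2)] show ?thesis using less(2,3) by auto
 next
  case False
  show ?thesis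
  proof (rule ccontr)
   assume n: "\<not> ?thesis"
   have "\<zero> \<in> \<Union>F" using less(5) I.zero_closed by blast
   then obtain P where P: "P \<in> F" by blast
   interpret P: primeideal P R using less(3)[OF P] .
   have "\<not> carrier R \<inter> \<Inter>(insert I (F - {P})) \<subseteq> P"
   proof
    assume "carrier R \<inter> \<Inter>(insert I (F - {P})) \<subseteq> P"
    then obtain J where J: "J \<in> insert I (F - {P})" "J \<subseteq> P"
     using prime_inter[of "insert I (F - {P})" P] less(2,3,4) P pid by (metis DiffD1 finite_Diff finite_insert insert_iff)
    then have "J \<in> F" "J \<noteq> P" using n P by auto
    have "I \<subseteq> \<Union>(F - {J})" using less(5) J(2) P \<open>J \<noteq> P\<close> by blast
    then show False using False \<open>J \<in> F\<close> by blast
   qed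
   then obtain b where b: "b \<in> carrier R" "b \<in> I" "\<And>Q. Q \<in> F - {P} ==> b \<in> Q" "b \<notin> P" by blast
   obtain a where a: "a \<in> I" "a \<notin> \<Union>(F - {P})" using False P by blast
   then have aP: "a \<in> P" using less(5) by blast
   have ac: "a \<in> carrier R" using I.a_subset a by blast
   have "a \<oplus> b \<in> I" using a b I.a_closed by blast
   then obtain Q where Q: "Q \<in> F" "a \<oplus> b \<in> Q" using less(5) by blast
   interpret Q: primeideal Q R using less(3)[OF Q(1)] .
   show False
   proof (cases "Q = P")
    case True
    then have "(a \<oplus> b) \<oplus> \<ominus> a \<in> P" using Q(2) aP P.a_closed P.a_inv_closed by blast
    moreover have "(a \<oplus> b) \<oplus> \<ominus> a = b" using ac b(1) by (simp add: a_ac r_neg1 r_neg2 r_neg3)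
    ultimately show False using b(4) by simp
   next
    case False
    then have "b \<in> Q" using b(3) Q by blast
    then have "(a \<oplus> b) \<oplus> \<ominus> b \<in> Q" using Q(2) Q.a_closed Q.a_inv_closed by blast
    moreover have "(a \<oplus> b) \<oplus> \<ominus> b = a" using ac b(1) by (simp add: a_assoc r_neg)
    ultimately show False using a(2) False Q by auto
   qed
  qed
 qed
qed

text \<open>Finiteness of the set of maximal annihilators is the point. Let \<open>?W\<close> be the
  elements having such annihilators and choose a finite subset \<open>W\<close> with maximal span.
  The span contains all of \<open>?W\<close>, so the annihilator of each \<open>u\<close> in
  \<open>?W\<close> contains the intersection of those of \<open>W\<close>; being prime, it contains
  one of them and equals it. Prime avoidance applies to the finitely many primes that
  remain.\<close>

lemma zero_divisors_ann:
 assumes J: "ideal J R" and I: "ideal I R"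
  and zd: "\<And>a. a \<in> I ==> \<exists>u\<in>carrier R. u \<notin> J \<and> a \<otimes> u \<in> J"
 obtains u where "u \<in> carrier R" "u \<notin> J" "primeideal {c \<in> carrier R. c \<otimes> u \<in> J} R" "I \<subseteq> {c \<in> carrier R. c \<otimes> u \<in> J}"
proof -
 interpret rm: rmod R rm by (rule rmod_rm)
 let ?ann = "\<lambda>u. {c \<in> carrier R. c \<otimes> u \<in> J}"
 let ?W = "{u \<in> carrier R. u \<notin> J \<and> primeideal (?ann u) R \<and> (\<forall>d\<in>carrier R. d \<notin> J \<and> ?ann u \<subseteq> ?ann d --> ?ann d = ?ann u)}"
 have Js: "submodule J R rm" using J rm_sub_ideal by simp
 have cover: "\<exists>u\<in>?W. a \<in> ?ann u" if a: "a \<in> I" for a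
 proof -
  have ac: "a \<in> carrier R" using ideal.Icarr[OF I a] .
  obtain v where v: "v \<in> carrier R" "v \<notin> J" "a \<otimes> v \<in> J" using zd[OF a] by blast
  have v': "v \<in> carrier rm" using v by simp
  obtain b where b: "b \<in> carrier rm" "b \<notin> J" "{c \<in> carrier R. c *[rm] v \<in> J} \<subseteq> {c \<in> carrier R. c *[rm] b \<in> J}"
   "\<And>d. d \<in> carrier rm ==> d \<notin> J ==> {c \<in> carrier R. c *[rm] b \<in> J} \<subseteq> {c \<in> carrier R. c *[rm] d \<in> J} ==>
     {c \<in> carrier R. c *[rm] d \<in> J} = {c \<in> carrier R. c *[rm] b \<in> J}"
   "primeideal {c \<in> carrier R. c *[rm] b \<in> J} R" by (rule max_ann[OF rmod_rm Js v' v(2)]) (rule that)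
  then show ?thesis using ac v by (intro bexI[of _ b]) auto
 qed
 let ?S = "{module_span R rm W | W. finite W \<and> W \<subseteq> ?W}"
 have "?S \<subseteq> {I. ideal I R}" using rm.span_submodule rm_sub_ideal by auto
 moreover have "?S \<noteq> {}" by blast
 ultimately obtain B where B: "B \<in> ?S" "\<And>K. K \<in> ?S ==> B \<subseteq> K ==> K = B" using ideal_maximal_exists by (metis (no_types, lifting))
 then obtain W where W: "finite W" "W \<subseteq> ?W" "B = module_span R rm W" by blast
 have WB: "w \<in> B" if "w \<in> ?W" for w
 proof -
  have "module_span R rm (insert w W) \<in> ?S" using W that by blast
  moreover have "B \<subseteq> module_span R rm (insert w W)" unfolding W(3) by (rule rm.span_mono) blast
  ultimately have "module_span R rm (insert w W) = B" using B(2) by blast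
  then show ?thesis using rm.span_superset[of "insert w W"] by blast
 qed
 have Wann: "\<exists>w\<in>W. ?ann w = ?ann u" if u: "u \<in> ?W" for u
 proof -
  have "carrier R \<inter> \<Inter>(?ann ` W) \<subseteq> ?ann u"
  proof
   fix c assume c: "c \<in> carrier R \<inter> \<Inter>(?ann ` W)"
   let ?K = "{y \<in> carrier R. y \<otimes> c \<in> J}"
   have "ideal ?K R" using ann_ideal[OF rmod_rm Js, of c] c by simp
   then have "submodule ?K R rm" using rm_sub_ideal by simp
   moreover have "W \<subseteq> ?K"
   proof
    fix x assume x: "x \<in> W"
    then have "x \<in> carrier R" "c \<in> carrier R" "c \<otimes> x \<in> J" using W(2) c by auto
    then show "x \<in> ?K" by (simp add: m_comm)
   qed
   ultimately have "B \<subseteq> ?K" unfolding W(3) by (rule rm.span_least)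
   then show "c \<in> ?ann u" using WB[OF u] c by (auto simp: m_comm)
  qed
  then have "\<exists>I\<in>?ann ` W. I \<subseteq> ?ann u"
   using W u by (intro prime_inter) (auto intro: primeideal.axioms(1))
  then show ?thesis using W(2) u by auto
 qed
 have "I \<subseteq> \<Union>(?ann ` W)"
 proof
  fix a assume "a \<in> I"
  from cover[OF this] obtain u where u: "u \<in> ?W" "a \<in> ?ann u" by (rule bexE)
  from Wann[OF u(1)] obtain w where w: "w \<in> W" "?ann w = ?ann u" by (rule bexE)
  show "a \<in> \<Union>(?ann ` W)" by (rule UN_I[OF w(1)]) (use u(2) w(2) in simp)
 qed
 then have "\<exists>P\<in>?ann ` W. I \<subseteq> P" using W(1,2) by (intro prime_avoidance[OF _ _ I]) auto
 then obtain w where "w \<in> W" "I \<subseteq> ?ann w" by blast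
 moreover have "w \<in> ?W" using W(2) \<open>w \<in> W\<close> by (rule subsetD)
 ultimately show ?thesis using that[of w] by simp
qed

lemma seq_rm_ideal: "set xs \<subseteq> carrier R ==> ideal (seq_submodule R rm xs) R"
 using rmod.seq_sub[OF rmod_rm] rm_sub_ideal by blast

lemma seq_rm_sub:
 assumes "set xs \<subseteq> I" "ideal I R" shows "seq_submodule R rm xs \<subseteq> I"
proof -
 interpret I: ideal I R by (rule assms)
 have "submodule I R rm" using assms rm_sub_ideal by simp
 then show ?thesis unfolding seq_submodule_def
  by (rule rmod.span_least[OF rmod_rm]) (use assms(1) I.I_r_closed in auto)
qed

text \<open>The prime that stops the extension is an annihilator modulo \<open>xs\<close>; after
  localizing at it the ring has depth \<open>length xs\<close>, with \<open>u\<close> in the socle.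
  The splitting of bounded complexes starts from such a prime.\<close>

lemma reg_extend:
 assumes w: "wreg R rm xs" and I: "ideal I R"
  and max: "\<And>x. x \<in> I ==> \<not> wreg R rm (xs @ [x])"
 obtains u where "u \<in> carrier R" "u \<notin> seq_submodule R rm xs"
  "primeideal {c \<in> carrier R. c \<otimes> u \<in> seq_submodule R rm xs} R" "I \<subseteq> {c \<in> carrier R. c \<otimes> u \<in> seq_submodule R rm xs}"
proof -
 interpret rm: rmod R rm by (rule rmod_rm)
 show ?thesis
 proof (rule zero_divisors_ann[OF seq_rm_ideal[OF rm.wreg_set[OF w]] I])
  fix a assume a: "a \<in> I"
  then have "a \<in> carrier R" using ideal.Icarr[OF I] by blast
  then show "\<exists>u\<in>carrier R. u \<notin> seq_submodule R rm xs \<and> a \<otimes> u \<in> seq_submodule R rm xs"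
   using max[OF a] w unfolding rm.wreg_snoc by auto
 qed (rule that)
qed

text \<open>For a regular sequence of greatest length in \<open>mx\<close>, all of \<open>mx\<close>
  consists of zero divisors modulo \<open>xs\<close>, so \<open>mx\<close> annihilates some nonzero
  \<open>u\<close> modulo \<open>xs\<close>.\<close>

lemma depth_socle:
 assumes d: "depth R rm = enat t"
 obtains xs u where "length xs = t" "wreg R rm xs" "u \<in> carrier R" "u \<notin> seq_submodule R rm xs"
  "\<And>c. c \<in> mx ==> c \<otimes> u \<in> seq_submodule R rm xs"
proof -
 interpret rm: rmod R rm by (rule rmod_rm)
 let ?S = "{enat (length xs) | xs. set xs \<subseteq> mx \<and> regular_sequence R rm xs}"
 have S: "Sup ?S = enat t" using d unfolding depth_def by (auto split: if_splits)
 have iff: "regular_sequence R rm xs \<longleftrightarrow> wreg R rm xs" if "set xs \<subseteq> mx" for xs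
  using rm.regular_sequence_iff[of xs] seq_rm_sub[OF that mx_ideal] one_notin_mx by auto
 have "enat 0 \<in> ?S" using iff[of "[]"] rm.wreg_Nil by (auto intro!: exI[of _ "[]"])
 moreover have "finite ?S"
 proof (rule finite_subset)
  show "?S \<subseteq> enat ` {..t}"
  proof
   fix x assume x: "x \<in> ?S"
   then have "x \<le> enat t" using Sup_upper[of x ?S] unfolding S by simp
   then show "x \<in> enat ` {..t}" using x by auto
  qed
 qed simp
 \<comment> \<open>A finite nonempty set of extended naturals attains its supremum, so some sequence
   has length exactly \<open>t\<close>.\<close>
 ultimately have "Sup ?S \<in> ?S" by (metis (no_types, lifting) Max_in Sup_enat_def empty_iff)
 then obtain xs where xs: "length xs = t" "set xs \<subseteq> mx" "wreg R rm xs" using S iff by auto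
 have "\<not> wreg R rm (xs @ [x])" if x: "x \<in> mx" for x
 proof
  assume "wreg R rm (xs @ [x])"
  moreover have "set (xs @ [x]) \<subseteq> mx" using xs x by simp
  ultimately have "enat (Suc t) \<in> ?S" using iff[of "xs @ [x]"] xs(1) by (auto intro!: exI[of _ "xs @ [x]"])
  then have "enat (Suc t) \<le> enat t" using Sup_upper[of "enat (Suc t)" ?S] unfolding S by simp
  then show False by simp
 qed
 from reg_extend[OF xs(3) mx_ideal this] obtain u where
  "u \<in> carrier R" "u \<notin> seq_submodule R rm xs" "mx \<subseteq> {c \<in> carrier R. c \<otimes> u \<in> seq_submodule R rm xs}" by metis
 then show ?thesis using that[OF xs(1,3)] by blast
qed

text \<open>Choose \<open>Q\<close> maximal among the ideals containing \<open>J\<close> but not \<open>u\<close>. If \<open>a\<^sup>n \<notin> Q\<close> for all \<open>n\<close>, then for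
 \<open>n\<close> with \<open>(Q : a\<^sup>n) = (Q : a\<^sup>n\<^sup>+\<^sup>1)\<close> the relation \<open>u \<in> Q + (a\<^sup>n)\<close>, multiplied by \<open>a\<close>, gives \<open>u \<in> Q\<close>.\<close>

lemma socle_power:
 assumes J: "ideal J R" and u: "u \<in> carrier R" "u \<notin> J" and soc: "\<And>c. c \<in> mx ==> c \<otimes> u \<in> J"
 obtains Q where "ideal Q R" "J \<subseteq> Q" "u \<notin> Q" "\<And>a. a \<in> mx ==> \<exists>n::nat. \<forall>k\<ge>n. a [^] k \<in> Q"
proof -
 let ?S = "{Q. ideal Q R \<and> J \<subseteq> Q \<and> u \<notin> Q}"
 have "?S \<noteq> {}" using J u by blast
 then obtain Q where "Q \<in> ?S" and Qm: "\<And>K. K \<in> ?S ==> Q \<subseteq> K ==> K = Q" using ideal_maximal_exists[of ?S] by auto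
 then have Q: "ideal Q R" "J \<subseteq> Q" "u \<notin> Q" by auto
 interpret Q: ideal Q R by (rule Q)
 interpret rm: rmod R rm by (rule rmod_rm)
 have Qs: "submodule Q R rm" using Q rm_sub_ideal by simp
 have "\<exists>n::nat. \<forall>k\<ge>n. a [^] k \<in> Q" if a: "a \<in> mx" for a
 proof -
  have ac: "a \<in> carrier R" using mx_sub[OF a] .
  let ?c = "\<lambda>n::nat. {c \<in> carrier R. c \<otimes> a [^] n \<in> Q}"
  have "\<exists>I\<in>range ?c. \<forall>K\<in>range ?c. I \<subseteq> K --> K = I"
   using ann_ideal[OF rmod_rm Qs] ac by (intro ideal_maximal_exists) auto
  then obtain n where "\<forall>K\<in>range ?c. ?c n \<subseteq> K --> K = ?c n" by (elim bexE rangeE) simp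
  then have n: "?c n \<subseteq> ?c k ==> ?c k = ?c n" for k by auto
  have "?c n \<subseteq> ?c (Suc n)" using ac Q.I_r_closed by (auto simp: m_assoc[symmetric])
  then have cn: "?c (Suc n) = ?c n" using n by blast
  have "a [^] n \<in> Q"
  proof (rule ccontr)
   assume na: "a [^] n \<notin> Q"
   let ?K = "{v +[rm] (a [^] n) *[rm] b | v b. v \<in> Q \<and> b \<in> carrier rm}"
   have "ideal ?K R" using rm.sum_sub[OF Qs, of "a [^] n"] ac rm_sub_ideal by simp
   moreover have "Q \<subseteq> ?K"
   proof
    fix q assume "q \<in> Q"
    then have "q = q +[rm] (a [^] n) *[rm] \<zero>" using ac Q.Icarr by simp
    then show "q \<in> ?K" using \<open>q \<in> Q\<close> zero_closed by auto
   qed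
   moreover have "a [^] n \<in> ?K"
   proof -
    show ?thesis by (intro CollectI exI[of _ \<zero>] exI[of _ \<one>]) (use ac in simp)
   qed
   ultimately have "u \<in> ?K" using Qm[of ?K] Q(2) na by blast
   then obtain v b where vb: "u = v \<oplus> a [^] n \<otimes> b" "v \<in> Q" "b \<in> carrier R" by auto
   have vc: "v \<in> carrier R" using vb(2) Q.Icarr by blast
   have "a \<otimes> u \<in> Q" using soc[OF a] Q(2) by blast
   then have "a \<otimes> u \<oplus> \<ominus> (a \<otimes> v) \<in> Q" using Q.I_l_closed[OF vb(2) ac] Q.a_closed Q.a_inv_closed by blast
   moreover have "a \<otimes> u \<oplus> \<ominus> (a \<otimes> v) = b \<otimes> a [^] Suc n"
    unfolding vb(1) using ac vb(3) vc by (simp add: r_distr m_ac a_ac r_neg1 r_neg2 r_neg3)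
   ultimately have "b \<in> ?c (Suc n)" using vb(3) by simp
   then have "a [^] n \<otimes> b \<in> Q" using cn vb(3) ac by (auto simp: m_comm)
   then show False using vb Q.a_closed Q(3) by blast
  qed
  then have "a [^] k \<in> Q" if "k \<ge> n" for k
   using Q.I_r_closed[of "a [^] n" "a [^] (k - n)"] ac that by (simp add: nat_pow_mult)
  then show ?thesis by blast
 qed
 then show ?thesis using that Q by blast
qed

end

section \<open>Comparison with projective resolutions\<close>

definition lext :: "'a ring => ('a, 'b) module => ('z => 'b) => ('z => 'a) => 'b" where
 "lext R A a c = lc A {z. c z \<noteq> \<zero>[R]} c a"

context crng begin

lemma free_sel: "c \<in> carrier (free_module_on R Z) \<longleftrightarrow> (\<forall>x. c x \<in> carrier R) \<and> {x. c x \<noteq> \<zero>} \<subseteq> Z \<and> finite {x. c x \<noteq> \<zero>}"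
 "\<zero>[free_module_on R Z] = (\<lambda>_. \<zero>)" "c +[free_module_on R Z] d = (\<lambda>x. c x \<oplus> d x)"
 "a *[free_module_on R Z] c = (\<lambda>x. a \<otimes> c x)"
 by (simp_all add: free_module_on_def)

lemma free_add: "c \<in> carrier (free_module_on R Z) ==> d \<in> carrier (free_module_on R Z) ==> (\<lambda>x. c x \<oplus> d x) \<in> carrier (free_module_on R Z)"
proof -
 assume *: "c \<in> carrier (free_module_on R Z)" "d \<in> carrier (free_module_on R Z)"
 have "{x. c x \<oplus> d x \<noteq> \<zero>} \<subseteq> {x. c x \<noteq> \<zero>} \<union> {x. d x \<noteq> \<zero>}" by auto
 then show ?thesis using * unfolding free_sel by (auto intro: finite_subset)
qed

lemma free_smult: "a \<in> carrier R ==> c \<in> carrier (free_module_on R Z) ==> (\<lambda>x. a \<otimes> c x) \<in> carrier (free_module_on R Z)"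
proof -
 assume *: "a \<in> carrier R" "c \<in> carrier (free_module_on R Z)"
 then have "{x. a \<otimes> c x \<noteq> \<zero>} \<subseteq> {x. c x \<noteq> \<zero>}" by auto
 then show ?thesis using * unfolding free_sel by (auto intro: finite_subset)
qed

lemma free_val: "c \<in> carrier (free_module_on R Z) ==> c x \<in> carrier R" by (simp add: free_sel)

lemma rmod_free: "rmod R (free_module_on R Z)" (is "rmod R ?F")
proof (rule rmodI)
 show "cring R" ..
 show "abelian_group ?F"
 proof (rule abelian_groupI)
  fix c assume c: "c \<in> carrier ?F"
  have "(\<lambda>x. (\<ominus> \<one>) \<otimes> c x) \<in> carrier ?F" using free_smult[OF _ c, of "\<ominus> \<one>"] by simp
  moreover have "(\<lambda>x. (\<ominus> \<one>) \<otimes> c x) +[?F] c = \<zero>[?F]"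
   using free_val[OF c] by (simp add: free_sel l_minus l_neg)
  ultimately show "\<exists>y\<in>carrier ?F. y +[?F] c = \<zero>[?F]" by blast
  show "\<zero>[?F] +[?F] c = c" using free_val[OF c] by (simp add: free_sel)
  fix d assume d: "d \<in> carrier ?F"
  show "c +[?F] d \<in> carrier ?F" using free_add[OF c d] by (simp add: free_sel(3))
  show "c +[?F] d = d +[?F] c" using free_val[OF c] free_val[OF d] by (simp add: free_sel a_comm)
  fix e assume e: "e \<in> carrier ?F"
  show "c +[?F] d +[?F] e = c +[?F] (d +[?F] e)"
   using free_val[OF c] free_val[OF d] free_val[OF e] by (simp add: free_sel a_assoc)
 qed (simp add: free_sel)
 fix a b c d assume a: "a \<in> carrier R" and b: "b \<in> carrier R" and c: "c \<in> carrier ?F" and d: "d \<in> carrier ?F"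
 show "a *[?F] c \<in> carrier ?F" using free_smult[OF a c] by (simp add: free_sel(4))
 show "(a \<oplus> b) *[?F] c = a *[?F] c +[?F] b *[?F] c" using a b free_val[OF c] by (simp add: free_sel l_distr)
 show "a *[?F] (c +[?F] d) = a *[?F] c +[?F] a *[?F] d"
  using a free_val[OF c] free_val[OF d] by (simp add: free_sel r_distr)
 show "(a \<otimes> b) *[?F] c = a *[?F] (b *[?F] c)" using a b free_val[OF c] by (simp add: free_sel m_assoc)
next
 fix c assume c: "c \<in> carrier ?F"
 show "\<one> *[?F] c = c" using free_val[OF c] by (simp add: free_sel)
qed

lemma lext_fin:
 assumes A: "rmod R A" and F: "finite F" "{z. c z \<noteq> \<zero>} \<subseteq> F" and c: "\<And>z. c z \<in> carrier R" and a: "a \<in> F \<rightarrow> carrier A"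
 shows "lext R A a c = lc A F c a"
proof -
 interpret A: rmod R A by (rule A)
 show ?thesis unfolding lext_def lc_def
  by (rule A.M.add.finprod_mono_neutral_cong_left[OF F]) (use a c F(2) in \<open>auto simp: Pi_def\<close>)
qed

lemma lext_lin:
 assumes A: "rmod R A" and a: "a \<in> Z \<rightarrow> carrier A"
 shows "lin R (free_module_on R Z) A (lext R A a)"
proof (rule linI)
 interpret A: rmod R A by (rule A)
 fix c d r assume c: "c \<in> carrier (free_module_on R Z)"
 then have c': "\<And>z. c z \<in> carrier R" "{z. c z \<noteq> \<zero>} \<subseteq> Z" "finite {z. c z \<noteq> \<zero>}" by (auto simp: free_sel)
 have ca: "a \<in> {z. c z \<noteq> \<zero>} \<rightarrow> carrier A" using a c' by blast
 show "lext R A a c \<in> carrier A" unfolding lext_def by (rule A.lc_closed) (use c' ca in auto)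
 show "lext R A a (r *[free_module_on R Z] c) = r *[A] lext R A a c" if "r \<in> carrier R"
 proof -
  have "lext R A a (\<lambda>z. r \<otimes> c z) = lc A {z. c z \<noteq> \<zero>} (\<lambda>z. r \<otimes> c z) a" using c' ca that by (intro lext_fin[OF A]) auto
  also have "\<dots> = r *[A] lc A {z. c z \<noteq> \<zero>} c a" using c' ca that by (intro A.lc_smult_l) auto
  finally show ?thesis by (simp add: free_sel lext_def)
 qed
 show "lext R A a (c +[free_module_on R Z] d) = lext R A a c +[A] lext R A a d" if d: "d \<in> carrier (free_module_on R Z)"
 proof -
  have d': "\<And>z. d z \<in> carrier R" "{z. d z \<noteq> \<zero>} \<subseteq> Z" "finite {z. d z \<noteq> \<zero>}" using d by (auto simp: free_sel)
  let ?F = "{z. c z \<noteq> \<zero>} \<union> {z. d z \<noteq> \<zero>}"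
  have F: "finite ?F" "a \<in> ?F \<rightarrow> carrier A" using c' d' a by auto
  have "lext R A a (\<lambda>z. c z \<oplus> d z) = lc A ?F (\<lambda>z. c z \<oplus> d z) a" using c' d' by (intro lext_fin[OF A F(1) _ _ F(2)]) auto
  also have "\<dots> = lc A ?F c a +[A] lc A ?F d a" using c' d' F by (intro A.lc_add_l) auto
  also have "lc A ?F c a = lext R A a c" using c' by (intro lext_fin[OF A F(1) _ _ F(2), symmetric]) auto
  also have "lc A ?F d a = lext R A a d" using d' by (intro lext_fin[OF A F(1) _ _ F(2), symmetric]) auto
  finally show ?thesis by (simp add: free_sel)
 qed
qed

lemma gen_free: "z \<in> Z ==> free_gen R z \<in> carrier (free_module_on R Z)"
proof -
 have "{x. free_gen R z x \<noteq> \<zero>} \<subseteq> {z}" by (auto simp: free_gen_def)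
 then show "z \<in> Z ==> ?thesis" unfolding free_sel by (auto intro: finite_subset)
qed

lemma lext_gen:
 assumes A: "rmod R A" and z: "a z \<in> carrier A"
 shows "lext R A a (free_gen R z) = a z"
proof -
 interpret A: rmod R A by (rule A)
 have "lext R A a (free_gen R z) = lc A {z} (free_gen R z) a" using z by (intro lext_fin[OF A]) (auto simp: free_gen_def)
 then show ?thesis using A.lc_gen[of "{z}" z a] z by simp
qed

lemma lin_lext:
 assumes A: "rmod R A" and B: "rmod R B" and f: "lin R A B f" and a: "a \<in> Z \<rightarrow> carrier A"
  and c: "c \<in> carrier (free_module_on R Z)"
 shows "f (lext R A a c) = lext R B (\<lambda>z. f (a z)) c"
 unfolding lext_def by (rule lin_lc[OF A B f]) (use a c in \<open>auto simp: free_sel\<close>)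

lemma lext_cong:
 assumes A: "rmod R A" and a: "\<And>z. z \<in> Z ==> a z = b z" "b \<in> Z \<rightarrow> carrier A" and c: "c \<in> carrier (free_module_on R Z)"
 shows "lext R A a c = lext R A b c"
 unfolding lext_def by (rule rmod.lc_cong[OF A]) (use a c in \<open>auto simp: free_sel\<close>)

text \<open>A dual basis \<open>b\<close>, \<open>s\<close> reduces lifting to a choice of preimages
  of the values \<open>k (b z)\<close>, extended linearly along \<open>s\<close>. Asking only that
  the values of \<open>k\<close> lie in the image of \<open>f\<close> makes it applicable to
  differentials, which are onto the cycles only.\<close>

lemma dual_basis_lift:
 assumes A: "rmod R A" and B: "rmod R B" and Q: "rmod R Q"
  and b: "b \<in> Z \<rightarrow> carrier Q" and s: "lin R Q (free_module_on R Z) s" and bs: "\<And>q. q \<in> carrier Q ==> lext R Q b (s q) = q"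
  and f: "lin R A B f" and k: "lin R Q B k" and im: "\<And>q. q \<in> carrier Q ==> \<exists>a\<in>carrier A. f a = k q"
 shows "\<exists>h. lin R Q A h \<and> (\<forall>q\<in>carrier Q. f (h q) = k q)"
proof -
 have "\<forall>z\<in>Z. \<exists>a\<in>carrier A. f a = k (b z)" using im b by blast
 then obtain a where a: "\<And>z. z \<in> Z ==> a z \<in> carrier A \<and> f (a z) = k (b z)" by metis
 then have aA: "a \<in> Z \<rightarrow> carrier A" by blast
 let ?h = "\<lambda>q. lext R A a (s q)"
 have "lin R Q A ?h" by (rule lin_comp[OF s lext_lin[OF A aA]])
 moreover have "f (?h q) = k q" if q: "q \<in> carrier Q" for q
 proof -
  have sq: "s q \<in> carrier (free_module_on R Z)" by (rule lin_closed[OF s q])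
  have "f (?h q) = lext R B (\<lambda>z. f (a z)) (s q)" by (rule lin_lext[OF A B f aA sq])
  also have "\<dots> = lext R B (\<lambda>z. k (b z)) (s q)" by (rule lext_cong[OF B _ _ sq]) (use a b lin_closed[OF k] in auto)
  also have "\<dots> = k (lext R Q b (s q))" by (rule lin_lext[OF Q B k b sq, symmetric])
  finally show ?thesis using bs[OF q] by simp
 qed
 ultimately show ?thesis by blast
qed

lemma lin_maps_lin: "f \<in> lin_maps R A B ==> lin R A B f" by (auto simp: lin_maps_def lin_def)

lemma lin_lin_maps:
 assumes "rmod R A" "lin R A B f" shows "restrict f (carrier A) \<in> lin_maps R A B"
proof -
 interpret A: rmod R A by (rule assms(1))
 show ?thesis using assms(2) by (auto simp: lin_maps_def lin_def)
qed

lemma free_lift: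
 assumes A: "rmod R A" and B: "rmod R B" and X: "finite X"
  and f: "lin R A B f" and k: "lin R (pw rm X) B k" and im: "\<And>q. q \<in> vec rm X ==> \<exists>a\<in>carrier A. f a = k q"
 shows "\<exists>h. lin R (pw rm X) A h \<and> (\<forall>q\<in>vec rm X. f (h q) = k q)"
proof (rule dual_basis_lift[OF A B _ _ _ _ f k im])
 interpret rm: rmod R rm by (rule rmod_rm)
 show M: "rmod R (pw rm X)" by (rule rm.rmod_pw)
 show "lin R (pw rm X) (free_module_on R X) (\<lambda>x. x)" unfolding pw_free[OF X] by (rule linI) auto
 show g: "free_gen R \<in> X \<rightarrow> vec rm X" by (auto intro: gen_pw)
 fix q assume q: "q \<in> vec rm X"
 then have q': "{z. q z \<noteq> \<zero>} \<subseteq> X" using pw0[OF q] by auto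
 have "lext R (pw rm X) (free_gen R) q = lc (pw rm X) X q (free_gen R)"
  using q' X g by (intro lext_fin[OF M]) (auto simp: pwR[OF q])
 also have "\<dots> = mm rm X (\<lambda>y x. free_gen R x y) X q" by (rule lc_pw_mm) (use q g in auto)
 also have "\<dots> = q"
 proof (rule pw_ext[OF _ q])
  show "mm rm X (\<lambda>y x. free_gen R x y) X q \<in> vec rm X" using q by (intro rm.mm_closed) (auto simp: mat_def)
  fix x assume x: "x \<in> X"
  have "mm rm X (\<lambda>y x. free_gen R x y) X q x = lc rm X (free_gen R x) q"
   using x q by (simp add: mm_def) (rule rm.lc_cong, auto simp: free_gen_def)
  then show "mm rm X (\<lambda>y x. free_gen R x y) X q x = q x" using X x q by (simp add: rm.lc_gen)
 qed
 finally show "lext R (pw rm X) (free_gen R) q = q" .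
qed auto

text \<open>The definition of projectivity tests two fixed types, but the surjection from the free
  module on the carrier is among the tests; its section gives a dual basis, and
  \<open>dual_basis_lift\<close> has no restriction on types.\<close>

lemma projective_lift:
 fixes P :: "('a, 'd) module"
 assumes A: "rmod R A" and B: "rmod R B" and P: "projective_module R P"
  and f: "lin R A B f" and k: "lin R P B k" and im: "\<And>q. q \<in> carrier P ==> \<exists>a\<in>carrier A. f a = k q"
 shows "\<exists>h. lin R P A h \<and> (\<forall>q\<in>carrier P. f (h q) = k q)"
proof -
 have M: "rmod R P" using P by (simp add: projective_module_def rmod_def)
 interpret P: rmod R P by (rule M)
 let ?F = "free_module_on R (carrier P)"
 note F = rmod_free[of "carrier P"]
 have e: "lin R ?F P (lext R P (\<lambda>z. z))" by (rule lext_lin[OF M]) auto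
 let ?e = "restrict (lext R P (\<lambda>z. z)) (carrier ?F)"
 have "?e \<in> lin_maps R ?F P" by (rule lin_lin_maps[OF F e])
 moreover have "?e ` carrier ?F = carrier P"
 proof
  show "?e ` carrier ?F \<subseteq> carrier P" using lin_closed[OF e] by auto
  show "carrier P \<subseteq> ?e ` carrier ?F"
  proof
   fix p assume p: "p \<in> carrier P"
   then show "p \<in> ?e ` carrier ?F" using gen_free[OF p] lext_gen[OF M, of "\<lambda>z. z" p] by (auto intro!: image_eqI[of _ _ "free_gen R p"])
  qed
 qed
 moreover have "restrict (\<lambda>p. p) (carrier P) \<in> lin_maps R P P" by (rule lin_lin_maps[OF M]) (rule linI, auto)
 ultimately have "\<exists>h\<in>lin_maps R P ?F. \<forall>x\<in>carrier P. ?e (h x) = restrict (\<lambda>p. p) (carrier P) x"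
  using P F[unfolded rmod_def] unfolding projective_module_def by blast
 then obtain s where s: "s \<in> lin_maps R P ?F" "\<And>p. p \<in> carrier P ==> ?e (s p) = p" by auto
 have ls: "lin R P ?F s" by (rule lin_maps_lin[OF s(1)])
 show ?thesis
 proof (rule dual_basis_lift[OF A B M _ ls _ f k im])
  show "(\<lambda>z. z) \<in> carrier P \<rightarrow> carrier P" by auto
  show "lext R P (\<lambda>z. z) (s q) = q" if "q \<in> carrier P" for q using s(2)[OF that] lin_closed[OF ls that] by simp
 qed auto
qed

lemma projective_pw: "finite X ==> projective_module R (pw rm X)"
 unfolding projective_module_def
proof (intro conjI allI impI)
 assume X: "finite X"
 interpret rm: rmod R rm by (rule rmod_rm)
 show "module R (pw rm X)" by (rule rm.rmod_pw[unfolded rmod_def])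
 fix A :: "('a, ('b => 'a) => 'a) module" and B :: "('a, 'b => 'a) module" and f g
 assume *: "module R A \<and> module R B \<and> f \<in> lin_maps R A B \<and> f ` carrier A = carrier B \<and> g \<in> lin_maps R (pw rm X) B"
 then have g: "lin R (pw rm X) B g" and f: "lin R A B f" using lin_maps_lin by blast+
 have "\<exists>h. lin R (pw rm X) A h \<and> (\<forall>q\<in>vec rm X. f (h q) = g q)"
 proof (rule free_lift[OF _ _ X f g])
  fix q assume "q \<in> vec rm X"
  then have "g q \<in> f ` carrier A" using lin_closed[OF g] * by simp
  then show "\<exists>a\<in>carrier A. f a = g q" by auto
 qed (use * in \<open>auto intro: rmod.intro\<close>)
 then obtain h where h: "lin R (pw rm X) A h" "\<And>q. q \<in> vec rm X ==> f (h q) = g q" by blast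
 then show "\<exists>h\<in>lin_maps R (pw rm X) A. \<forall>x\<in>vec rm X. f (h x) = g x"
  using lin_lin_maps[OF rm.rmod_pw h(1)] by (intro bexI[of _ "restrict h (vec rm X)"]) auto
qed

end

lemma (in rmod) minus_twice:
 assumes "x \<in> carrier M" "y \<in> carrier M" "z \<in> carrier M"
 shows "y = x -[M] (((x -[M] y) -[M] z) +[M] z)"
proof -
 have "((x -[M] y) -[M] z) +[M] z = x -[M] y" using assms by (simp add: a_minus_def M.a_assoc M.l_neg)
 then show ?thesis using assms by (simp add: a_minus_def M.minus_add M.a_assoc[symmetric] M.r_neg)
qed

context crng begin

lemma lin_diff:
 assumes "rmod R A" "rmod R B" "lin R A B f" "lin R A B k" shows "lin R A B (\<lambda>x. f x -[B] k x)"
proof (rule linI)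
 interpret A: rmod R A by (rule assms(1))
 interpret B: rmod R B by (rule assms(2))
 note c = lin_closed[OF assms(3)] lin_closed[OF assms(4)]
 fix x y a assume x: "x \<in> carrier A"
 show "f x -[B] k x \<in> carrier B" using c x by simp
 show "f (x +[A] y) -[B] k (x +[A] y) = (f x -[B] k x) +[B] (f y -[B] k y)" if "y \<in> carrier A"
  using c x that lin_add[OF assms(3)] lin_add[OF assms(4)] by (simp add: a_minus_def B.M.minus_add B.M.a_ac)
 show "f (a *[A] x) -[B] k (a *[A] x) = a *[B] (f x -[B] k x)" if "a \<in> carrier R"
  using c x that lin_smult[OF assms(3)] lin_smult[OF assms(4)] by (simp add: a_minus_def B.smult_r_distr B.smult_r_minus)
qed

end

text \<open>\<open>P\<close> is a resolution about which nothing else is known, such as the one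
  chosen in the definition of Ext and Tor or one realizing the projective dimension;
  \<open>X\<close> and \<open>D\<close> give a finite free one with explicit matrices.\<close>

locale comparison = crng R for R :: "'a ring" (structure) +
 fixes H :: "('a, 'b) module" and P :: "nat => ('a, 'p) module" and d \<epsilon>
  and X :: "nat => 'x set" and g D
 assumes H: "rmod R H" and PR: "proj_resolution R H P d \<epsilon>" and TR: "res_of R H X g D"
begin

abbreviation "T i \<equiv> pw rm (X i)"
abbreviation "dT i \<equiv> dif rm X D i"
abbreviation "\<eta> v \<equiv> lc H (X 0) v g"
text \<open>Cycles, with the augmentation taking the role of the differential in degree 0; this lets
  the recursions below treat all degrees alike.\<close>

definition "ZT i v = (case i of 0 => \<eta> v = \<zero>[H] | Suc k => dT k v = \<zero>[T k])"
definition "ZP i p = (case i of 0 => \<epsilon> p = \<zero>[H] | Suc k => d k p = \<zero>[P k])"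

sublocale H: rmod R H by (rule H)

lemma mP: "rmod R (P i)" and pP: "projective_module R (P i)"
 using PR by (auto simp: proj_resolution_def projective_module_def rmod_def)
lemma mT: "rmod R (T i)" by (rule rmod.rmod_pw[OF rmod_rm])
lemma ld: "lin R (P (Suc i)) (P i) (d i)" and le: "lin R (P 0) H \<epsilon>"
 by (rule lin_maps_lin, use PR in \<open>simp add: proj_resolution_def\<close>)+
lemma finX: "finite (X i)" and matD: "mat R (X i) (X (Suc i)) (D i)" using TR by (auto simp: res_of_def res_def)
lemma lp: "lin R (T (Suc i)) (T i) (dT i)" by (rule rmod.mm_lin[OF rmod_rm finX matD])
lemma gX: "g \<in> X 0 \<rightarrow> carrier H" using TR by (auto simp: res_of_def gens_def)

lemma leta: "lin R (T 0) H \<eta>"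
proof (rule linI)
 fix v w a assume v: "v \<in> carrier (T 0)"
 show "\<eta> v \<in> carrier H" using v gX by auto
 show "\<eta> (v +[T 0] w) = \<eta> v +[H] \<eta> w" if "w \<in> carrier (T 0)" using v that gX H.lc_add_l[of v "X 0" w g] by simp
 show "\<eta> (a *[T 0] v) = a *[H] \<eta> v" if "a \<in> carrier R" using v that gX finX H.lc_smult_l[of "X 0" a v g] by simp
qed

lemma exT: "v \<in> carrier (T i) ==> ZT i v \<longleftrightarrow> (\<exists>w\<in>carrier (T (Suc i)). v = dT i w)"
 using TR unfolding res_of_def res_def exat_def ZT_def by (cases i) simp_all

lemma exP: "p \<in> carrier (P i) ==> ZP i p \<longleftrightarrow> (\<exists>w\<in>carrier (P (Suc i)). p = d i w)"
proof -
 assume p: "p \<in> carrier (P i)"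
 have "d i ` carrier (P (Suc i)) = {p \<in> carrier (P i). ZP i p}"
  using PR unfolding proj_resolution_def lin_kernel_def ZP_def by (cases i) simp_all
 then show ?thesis using p by (simp add: image_def set_eq_iff)
qed

lemma ZT_p: "w \<in> carrier (T (Suc i)) ==> ZT i (dT i w)" using exT lin_closed[OF lp] by blast
lemma ZP_d: "w \<in> carrier (P (Suc i)) ==> ZP i (d i w)" using exP lin_closed[OF ld] by blast

lemma eta_surj: "a \<in> carrier H ==> \<exists>v\<in>carrier (T 0). \<eta> v = a" using TR unfolding res_of_def gens_def by metis
lemma eps_surj: "a \<in> carrier H ==> \<exists>v\<in>carrier (P 0). \<epsilon> v = a" using PR unfolding proj_resolution_def by (metis imageE)

text \<open>The recursion carries only that cycles go to cycles: this involves one degree at a time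
  and is all that the lift to the next degree needs. The same holds for
  \<open>beta_ex\<close>.\<close>

lemma alpha_ex: "\<exists>\<alpha>. (\<forall>i. lin R (T i) (P i) (\<alpha> i)) \<and> (\<forall>v\<in>carrier (T 0). \<epsilon> (\<alpha> 0 v) = \<eta> v) \<and>
  (\<forall>i. \<forall>v\<in>carrier (T (Suc i)). d i (\<alpha> (Suc i) v) = \<alpha> i (dT i v))"
proof -
 let ?S = "\<lambda>i \<alpha>. lin R (T i) (P i) \<alpha> \<and> (\<forall>v\<in>carrier (T i). ZT i v --> ZP i (\<alpha> v)) \<and> (i = 0 --> (\<forall>v\<in>carrier (T 0). \<epsilon> (\<alpha> v) = \<eta> v))"
 let ?Q = "\<lambda>i \<alpha> \<beta>. \<forall>v\<in>carrier (T (Suc i)). d i (\<beta> v) = \<alpha> (dT i v)"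
 have "\<exists>\<alpha>. \<forall>i. ?S i (\<alpha> i) \<and> ?Q i (\<alpha> i) (\<alpha> (Suc i))"
 proof (rule dependent_nat_choice)
  obtain h where h: "lin R (T 0) (P 0) h" "\<forall>v\<in>carrier (T 0). \<epsilon> (h v) = \<eta> v"
   using free_lift[OF mP H finX le leta] eps_surj lin_closed[OF leta] by blast
  then show "\<exists>\<alpha>. ?S 0 \<alpha>" by (intro exI[of _ h]) (auto simp: ZT_def ZP_def)
 next
  fix \<alpha> i assume S: "?S i \<alpha>"
  then have a: "lin R (T i) (P i) \<alpha>" by simp
  have "\<exists>b\<in>carrier (P (Suc i)). d i b = \<alpha> (dT i v)" if v: "v \<in> carrier (T (Suc i))" for v
   using S ZT_p[OF v] lin_closed[OF lp v] exP lin_closed[OF a] by metis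
  from free_lift[OF mP mP finX ld lin_comp[OF lp a] this]
  obtain h where h: "lin R (T (Suc i)) (P (Suc i)) h" "\<forall>v\<in>carrier (T (Suc i)). d i (h v) = \<alpha> (dT i v)" by blast
  have "ZP (Suc i) (h v)" if v: "v \<in> carrier (T (Suc i))" "ZT (Suc i) v" for v
   using h(2) v lin_zero[OF mT mP a] by (simp add: ZT_def ZP_def)
  then show "\<exists>\<beta>. ?S (Suc i) \<beta> \<and> ?Q i \<alpha> \<beta>" using h by auto
 qed
 then obtain \<alpha> where "\<forall>i. ?S i (\<alpha> i) \<and> ?Q i (\<alpha> i) (\<alpha> (Suc i))" by (rule exE)
 then show ?thesis by (intro exI[of _ \<alpha>]) simp
qed

lemma beta_ex: "\<exists>\<beta>. (\<forall>i. lin R (P i) (T i) (\<beta> i)) \<and> (\<forall>v\<in>carrier (P 0). \<eta> (\<beta> 0 v) = \<epsilon> v) \<and>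
  (\<forall>i. \<forall>v\<in>carrier (P (Suc i)). dT i (\<beta> (Suc i) v) = \<beta> i (d i v))"
proof -
 let ?S = "\<lambda>i \<beta>. lin R (P i) (T i) \<beta> \<and> (\<forall>v\<in>carrier (P i). ZP i v --> ZT i (\<beta> v)) \<and> (i = 0 --> (\<forall>v\<in>carrier (P 0). \<eta> (\<beta> v) = \<epsilon> v))"
 let ?Q = "\<lambda>i \<alpha> \<beta>. \<forall>v\<in>carrier (P (Suc i)). dT i (\<beta> v) = \<alpha> (d i v)"
 have "\<exists>\<alpha>. \<forall>i. ?S i (\<alpha> i) \<and> ?Q i (\<alpha> i) (\<alpha> (Suc i))"
 proof (rule dependent_nat_choice)
  obtain h where h: "lin R (P 0) (T 0) h" "\<forall>v\<in>carrier (P 0). \<eta> (h v) = \<epsilon> v"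
   using projective_lift[OF mT H pP leta le] eta_surj lin_closed[OF le] by blast
  then show "\<exists>\<alpha>. ?S 0 \<alpha>" by (intro exI[of _ h]) (auto simp: ZT_def ZP_def)
 next
  fix \<alpha> i assume S: "?S i \<alpha>"
  then have a: "lin R (P i) (T i) \<alpha>" by simp
  have "\<exists>b\<in>carrier (T (Suc i)). dT i b = \<alpha> (d i v)" if v: "v \<in> carrier (P (Suc i))" for v
   using S ZP_d[OF v] lin_closed[OF ld v] exT lin_closed[OF a] by metis
  from projective_lift[OF mT mT pP lp lin_comp[OF ld a] this]
  obtain h where h: "lin R (P (Suc i)) (T (Suc i)) h" "\<forall>v\<in>carrier (P (Suc i)). dT i (h v) = \<alpha> (d i v)" by blast
  have "ZT (Suc i) (h v)" if v: "v \<in> carrier (P (Suc i))" "ZP (Suc i) v" for v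
   using h(2) v lin_zero[OF mP mT a] by (simp add: ZT_def ZP_def)
  then show "\<exists>\<beta>. ?S (Suc i) \<beta> \<and> ?Q i \<alpha> \<beta>" using h by auto
 qed
 then obtain \<alpha> where "\<forall>i. ?S i (\<alpha> i) \<and> ?Q i (\<alpha> i) (\<alpha> (Suc i))" by (rule exE)
 then show ?thesis by (intro exI[of _ \<alpha>]) simp
qed

text \<open>Only the value of the homotopy on cycles is needed as invariant: there \<open>h \<circ> dT\<close> vanishes.\<close>

lemma homotopy_ex:
 assumes t: "\<And>i. lin R (T i) (T i) (\<theta> i)" and t0: "\<And>v. v \<in> carrier (T 0) ==> \<eta> (\<theta> 0 v) = \<zero>[H]"
  and tc: "\<And>i v. v \<in> carrier (T (Suc i)) ==> dT i (\<theta> (Suc i) v) = \<theta> i (dT i v)"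
 shows "\<exists>h. (\<forall>i. lin R (T i) (T (Suc i)) (h i)) \<and> (\<forall>v\<in>carrier (T 0). \<theta> 0 v = dT 0 (h 0 v)) \<and>
  (\<forall>i. \<forall>v\<in>carrier (T (Suc i)). \<theta> (Suc i) v -[T (Suc i)] h i (dT i v) = dT (Suc i) (h (Suc i) v))"
proof -
 interpret T: rmod R "T i" for i by (rule mT)
 let ?S = "\<lambda>i h. lin R (T i) (T (Suc i)) h \<and> (\<forall>v\<in>carrier (T i). ZT i v --> \<theta> i v = dT i (h v)) \<and> (i = 0 --> (\<forall>v\<in>carrier (T 0). \<theta> 0 v = dT 0 (h v)))"
 let ?Q = "\<lambda>i h h'. \<forall>v\<in>carrier (T (Suc i)). \<theta> (Suc i) v -[T (Suc i)] h (dT i v) = dT (Suc i) (h' v)"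
 have "\<exists>h. \<forall>i. ?S i (h i) \<and> ?Q i (h i) (h (Suc i))"
 proof (rule dependent_nat_choice)
  have "\<exists>b\<in>carrier (T (Suc 0)). dT 0 b = \<theta> 0 v" if v: "v \<in> carrier (T 0)" for v
   using exT[of "\<theta> 0 v" 0] t0[OF v] lin_closed[OF t v] by (auto simp: ZT_def)
  from free_lift[OF mT mT finX lp t this] show "\<exists>h. ?S 0 h" by fastforce
 next
  fix h i assume S: "?S i h"
  then have h: "lin R (T i) (T (Suc i)) h" by simp
  let ?k = "\<lambda>v. \<theta> (Suc i) v -[T (Suc i)] h (dT i v)"
  have k: "lin R (T (Suc i)) (T (Suc i)) ?k" by (rule lin_diff[OF mT mT t lin_comp[OF lp h]])
  have "\<exists>b\<in>carrier (T (Suc (Suc i))). dT (Suc i) b = ?k v" if v: "v \<in> carrier (T (Suc i))" for v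
  proof -
   have c: "dT i v \<in> carrier (T i)" "\<theta> (Suc i) v \<in> carrier (T (Suc i))" "h (dT i v) \<in> carrier (T (Suc i))"
    using lin_closed[OF lp v] lin_closed[OF t v] lin_closed[OF h] by auto
   have "dT i (?k v) = dT i (\<theta> (Suc i) v) -[T i] dT i (h (dT i v))" using c by (intro lin_minus[OF mT mT lp]) auto
   also have "\<dots> = \<theta> i (dT i v) -[T i] \<theta> i (dT i v)" using S ZT_p[OF v] c tc[OF v] by metis
   also have "\<dots> = \<zero>[T i]" using lin_closed[OF t c(1)] by (simp add: a_minus_def T.M.r_neg del: pw_sel)
   finally have "ZT (Suc i) (?k v)" by (simp add: ZT_def)
   then show ?thesis using exT lin_closed[OF k v] by metis
  qed
  from free_lift[OF mT mT finX lp k this]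
  obtain h' where h': "lin R (T (Suc i)) (T (Suc (Suc i))) h'" "\<forall>v\<in>carrier (T (Suc i)). dT (Suc i) (h' v) = ?k v" by blast
  have "\<theta> (Suc i) v = dT (Suc i) (h' v)" if v: "v \<in> carrier (T (Suc i))" "ZT (Suc i) v" for v
  proof -
   have "dT i v = \<zero>[T i]" using v by (simp add: ZT_def)
   then have "h (dT i v) = \<zero>[T (Suc i)]" using lin_zero[OF mT mT h] by simp
   then show ?thesis using h'(2) v lin_closed[OF t v(1)] by (simp add: a_minus_def del: pw_sel)
  qed
  then have "?S (Suc i) h'" using h'(1) by (intro conjI ballI impI) auto
  moreover have "?Q i h h'" by (rule ballI) (rule h'(2)[rule_format, symmetric])
  ultimately have "?S (Suc i) h' \<and> ?Q i h h'" by (rule conjI)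
  then show "\<exists>h'. ?S (Suc i) h' \<and> ?Q i h h'" by (intro exI)
 qed
 then obtain h where "\<forall>i. ?S i (h i) \<and> ?Q i (h i) (h (Suc i))" by (rule exE)
 then show ?thesis by (intro exI[of _ h]) simp
qed

text \<open>Only the composite from \<open>T\<close> to \<open>P\<close> and back is compared with
  the identity; this half of the homotopy equivalence is enough to transport vanishing from
  \<open>P\<close> to \<open>T\<close>.\<close>

lemma compare:
 obtains \<alpha> \<beta> h where "\<And>i. lin R (T i) (P i) (\<alpha> i)" "\<And>i. lin R (P i) (T i) (\<beta> i)" "\<And>i. lin R (T i) (T (Suc i)) (h i)"
  "\<And>i v. v \<in> carrier (T (Suc i)) ==> d i (\<alpha> (Suc i) v) = \<alpha> i (dT i v)"
  "\<And>i v. v \<in> carrier (P (Suc i)) ==> dT i (\<beta> (Suc i) v) = \<beta> i (d i v)"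
  "\<And>i v. v \<in> carrier (T (Suc i)) ==> v = \<beta> (Suc i) (\<alpha> (Suc i) v) -[T (Suc i)] (dT (Suc i) (h (Suc i) v) +[T (Suc i)] h i (dT i v))"
proof -
 interpret T: rmod R "T i" for i by (rule mT)
 obtain \<alpha> where a: "\<And>i. lin R (T i) (P i) (\<alpha> i)" "\<And>v. v \<in> carrier (T 0) ==> \<epsilon> (\<alpha> 0 v) = \<eta> v"
  "\<And>i v. v \<in> carrier (T (Suc i)) ==> d i (\<alpha> (Suc i) v) = \<alpha> i (dT i v)" using alpha_ex by blast
 obtain \<beta> where b: "\<And>i. lin R (P i) (T i) (\<beta> i)" "\<And>v. v \<in> carrier (P 0) ==> \<eta> (\<beta> 0 v) = \<epsilon> v"
  "\<And>i v. v \<in> carrier (P (Suc i)) ==> dT i (\<beta> (Suc i) v) = \<beta> i (d i v)" using beta_ex by blast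
 let ?t = "\<lambda>i v. \<beta> i (\<alpha> i v) -[T i] v"
 have ba: "lin R (T i) (T i) (\<lambda>v. \<beta> i (\<alpha> i v))" for i by (rule lin_comp[OF a(1) b(1)])
 have id: "lin R (T i) (T i) (\<lambda>v. v)" for i by (rule linI) auto
 have t: "lin R (T i) (T i) (?t i)" for i by (rule lin_diff[OF mT mT ba id])
 have "\<eta> (?t 0 v) = \<zero>[H]" if v: "v \<in> carrier (T 0)" for v
 proof -
  have "\<eta> (?t 0 v) = \<eta> (\<beta> 0 (\<alpha> 0 v)) -[H] \<eta> v" by (rule lin_minus[OF mT H leta lin_closed[OF ba v] v])
  then show ?thesis using a(2)[OF v] b(2)[OF lin_closed[OF a(1) v]] lin_closed[OF leta v] by (simp add: a_minus_def H.M.r_neg)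
 qed
 moreover have "dT i (?t (Suc i) v) = ?t i (dT i v)" if v: "v \<in> carrier (T (Suc i))" for i v
 proof -
  have "dT i (?t (Suc i) v) = dT i (\<beta> (Suc i) (\<alpha> (Suc i) v)) -[T i] dT i v" by (rule lin_minus[OF mT mT lp lin_closed[OF ba v] v])
  then show ?thesis using a(3)[OF v] b(3)[OF lin_closed[OF a(1) v]] by simp
 qed
 ultimately obtain h where h: "\<And>i. lin R (T i) (T (Suc i)) (h i)"
  "\<And>i v. v \<in> carrier (T (Suc i)) ==> ?t (Suc i) v -[T (Suc i)] h i (dT i v) = dT (Suc i) (h (Suc i) v)"
  using homotopy_ex[of ?t, OF t] by blast
 have "v = \<beta> (Suc i) (\<alpha> (Suc i) v) -[T (Suc i)] (dT (Suc i) (h (Suc i) v) +[T (Suc i)] h i (dT i v))"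
  if v: "v \<in> carrier (T (Suc i))" for i v
 proof -
  have c: "\<beta> (Suc i) (\<alpha> (Suc i) v) \<in> carrier (T (Suc i))" "h i (dT i v) \<in> carrier (T (Suc i))"
   using lin_closed[OF ba v] lin_closed[OF h(1) lin_closed[OF lp v]] by auto
  show ?thesis unfolding h(2)[OF v, symmetric] by (rule T.minus_twice[OF c(1) v c(2)])
 qed
 from that[OF a(1) b(1) h(1) a(3) b(3) this] show ?thesis .
qed

end

section \<open>Transposed matrices, and Ext and projective dimension in terms of matrices\<close>

context crng begin

lemma pw_decomp: "finite X ==> v \<in> vec rm X ==> lc (pw rm X) X v (free_gen R) = v"
proof -
 assume X: "finite X" and v: "v \<in> vec rm X"
 interpret rm: rmod R rm by (rule rmod_rm)
 have g: "free_gen R \<in> X \<rightarrow> vec rm X" by (auto intro: gen_pw)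
 have "lc (pw rm X) X v (free_gen R) = mm rm X (\<lambda>y x. free_gen R x y) X v" by (rule lc_pw_mm) (use v g in auto)
 also have "\<dots> = v"
 proof (rule pw_ext[OF _ v])
  show "mm rm X (\<lambda>y x. free_gen R x y) X v \<in> vec rm X" using v by (intro rm.mm_closed) (auto simp: mat_def)
  fix x assume x: "x \<in> X"
  have "mm rm X (\<lambda>y x. free_gen R x y) X v x = lc rm X (free_gen R x) v"
   using x v by (simp add: mm_def) (rule rm.lc_cong, auto simp: free_gen_def)
  then show "mm rm X (\<lambda>y x. free_gen R x y) X v x = v x" using X x v by (simp add: rm.lc_gen)
 qed
 finally show ?thesis .
qed

lemma lin_free_lc:
 assumes A: "rmod R A" and X: "finite X" and k: "lin R (pw rm X) A k" and v: "v \<in> vec rm X"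
 shows "k v = lc A X v (\<lambda>x. k (free_gen R x))"
proof -
 have "k (lc (pw rm X) X v (free_gen R)) = lc A X v (\<lambda>x. k (free_gen R x))"
  by (rule lin_lc[OF rmod.rmod_pw[OF rmod_rm] A k]) (use v in \<open>auto intro: gen_pw\<close>)
 then show ?thesis using pw_decomp[OF X v] by simp
qed

lemma lc_lin:
 assumes A: "rmod R A" and X: "finite X" and g: "g \<in> X \<rightarrow> carrier A"
 shows "lin R (pw rm X) A (\<lambda>v. lc A X v g)"
proof (rule linI)
 interpret A: rmod R A by (rule A)
 fix v w a assume v: "v \<in> vec rm X"
 show "lc A X v g \<in> carrier A" using v g by auto
 show "lc A X (v +[pw rm X] w) g = lc A X v g +[A] lc A X w g" if "w \<in> vec rm X"
  using v that g A.lc_add_l[of v X w g] by simp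
 show "lc A X (a *[pw rm X] v) g = a *[A] lc A X v g" if "a \<in> carrier R"
  using v that g X A.lc_smult_l[of X a v g] by simp
qed

text \<open>Adjointness of a matrix and its transpose: evaluating a cochain \<open>c\<close> on a
  boundary becomes evaluating its coboundary.\<close>

lemma lc_mm:
 assumes A: "rmod R A" and X: "finite X" and Y: "finite Y" and D: "mat R Y X D" and w: "w \<in> X \<rightarrow> carrier R"
  and c: "c \<in> Y \<rightarrow> carrier A"
 shows "lc A Y (mm rm X D Y w) c = lc A X w (mm A Y (tp D) X c)"
proof -
 interpret A: rmod R A by (rule A)
 have "lc A X w (mm A Y (tp D) X c) = lc A X w (\<lambda>x. lc A Y (\<lambda>y. D y x) c)"
  using w c D by (intro A.lc_cong) (auto simp: mm_def tp_def[abs_def] mat_def Pi_def intro!: A.lc_closed)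
 also have "\<dots> = lc A Y (\<lambda>y. \<Oplus>x\<in>X. w x \<otimes> D y x) c"
  using w c D X Y by (intro A.lc_lc) (auto simp: mat_def)
 also have "\<dots> = lc A Y (mm rm X D Y w) c"
  using w c D by (intro A.lc_cong) (auto simp: mm_def lc_rm mat_def Pi_def m_comm intro!: finsum_cong' finsum_closed)
 finally show ?thesis ..
qed

text \<open>Tested on basis vectors, the vanishing of a composite becomes a property of the product
  matrix; in this form it passes to all coefficient modules and to transposes.\<close>

lemma zero_comp:
 assumes X: "finite X" and Y: "finite Y" and D: "mat R Y X D" and E: "mat R Z Y E"
  and 0: "\<And>v. v \<in> vec rm X ==> mm rm Y E Z (mm rm X D Y v) = (\<lambda>_. \<zero>)" and z: "z \<in> Z" "x \<in> X"
 shows "mmul R Y E D z x = \<zero>"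
proof -
 interpret rm: rmod R rm by (rule rmod_rm)
 have g: "free_gen R x \<in> vec rm X" by (rule gen_pw[OF z(2)])
 have "mm rm Y E Z (mm rm X D Y (free_gen R x)) = mm rm X (mmul R Y E D) Z (free_gen R x)"
  using X Y D E by (intro rm.mm_mm) auto
 then have "mm rm X (mmul R Y E D) Z (free_gen R x) z = \<zero>" using 0[OF g] by metis
 then show ?thesis using mm_gen[OF X mat_mmul[OF E D] z(2) z(1)] by simp
qed

lemma res_zero: "res R X D ==> z \<in> X i ==> x \<in> X (Suc (Suc i)) ==> mmul R (X (Suc i)) (D i) (D (Suc i)) z x = \<zero>"
proof -
 assume r: "res R X D" and z: "z \<in> X i" "x \<in> X (Suc (Suc i))"
 then have f: "\<And>i. finite (X i)" "\<And>i. mat R (X i) (X (Suc i)) (D i)" by (auto simp: res_def)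
 have e: "exa rm X D i" using r by (auto simp: res_def)
 show ?thesis
 proof (rule zero_comp[OF f(1,1,2,2) _ z])
  fix v assume v: "v \<in> vec rm (X (Suc (Suc i)))"
  then have "dif rm X D (Suc i) v \<in> vec rm (X (Suc i))"
   using rmod.mm_closed[OF rmod_rm f(2)] by simp
  then show "dif rm X D i (dif rm X D (Suc i) v) = (\<lambda>_. \<zero>)"
   using e v unfolding exat_def by auto
 qed
qed

lemma res_zero_tp:
 assumes A: "rmod R A" and r: "res R X D" and w: "w \<in> vec A (X i)"
 shows "cod A X D (Suc i) (cod A X D i w) = (\<lambda>_. \<zero>[A])"
proof -
 interpret A: rmod R A by (rule A)
 have f: "\<And>i. finite (X i)" "\<And>i. mat R (X i) (X (Suc i)) (D i)" using r by (auto simp: res_def)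
 have "cod A X D (Suc i) (cod A X D i w)
  = mm A (X i) (mmul R (X (Suc i)) (tp (D (Suc i))) (tp (D i))) (X (Suc (Suc i))) w"
  using f A.pw_Pi[OF w] by (intro A.mm_mm) auto
 also have "\<dots> = (\<lambda>_. \<zero>[A])" using A.pw_Pi[OF w] f
  by (intro A.mm_zero_mat) (auto simp: mmul_tp[OF f(2) f(2)] res_zero[OF r])
 finally show ?thesis .
qed

lemma res_zero_mm:
 assumes A: "rmod R A" and r: "res R X D" and w: "w \<in> vec A (X (Suc (Suc i)))"
 shows "dif A X D i (dif A X D (Suc i) w) = (\<lambda>_. \<zero>[A])"
proof -
 interpret A: rmod R A by (rule A)
 have f: "\<And>i. finite (X i)" "\<And>i. mat R (X i) (X (Suc i)) (D i)" using r by (auto simp: res_def)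
 have "dif A X D i (dif A X D (Suc i) w)
  = mm A (X (Suc (Suc i))) (mmul R (X (Suc i)) (D i) (D (Suc i))) (X i) w"
  using f A.pw_Pi[OF w] by (intro A.mm_mm) auto
 also have "\<dots> = (\<lambda>_. \<zero>[A])" using A.pw_Pi[OF w] by (intro A.mm_zero_mat) (auto simp: res_zero[OF r])
 finally show ?thesis .
qed

end

lemma (in lnr) mx_finsum: "f \<in> X \<rightarrow> mx ==> finsum R f X \<in> mx"
proof (induct X rule: infinite_finite_induct)
 case (insert x F)
 then have "f \<in> F \<rightarrow> carrier R" "f x \<in> carrier R" using mx_sub by blast+
 then show ?case using insert by (simp add: mx_add)
qed (simp_all add: mx_zero)

context comparison begin

lemma res_T: "res R X D" using TR by (simp add: res_of_def)

text \<open>A cocycle \<open>c\<close> is a linear form \<open>?f\<close> on \<open>T\<close>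
  vanishing on boundaries. Pulled back to \<open>P\<close> along \<beta>, it is \<psi> after
  \<open>d j\<close> by hypothesis. The homotopy identity then shows that \<open>?f\<close> is
  \<open>?k\<close> after \<open>dT j\<close>, where \<open>?k\<close> is \<psi>\<alpha> minus
  \<open>?f h\<close>, and the values of \<open>?k\<close> on basis vectors form the required
  cochain.\<close>

lemma ext_exact:
 assumes Y: "rmod R Y"
  and hyp: "\<And>\<phi>. lin R (P (Suc j)) Y \<phi> ==> (\<And>p. p \<in> carrier (P (Suc (Suc j))) ==> \<phi> (d (Suc j) p) = \<zero>[Y]) ==>
   \<exists>\<psi>. lin R (P j) Y \<psi> \<and> (\<forall>p\<in>carrier (P (Suc j)). \<phi> p = \<psi> (d j p))"
 shows "exat Y (X j) (tp (D j)) (X (Suc j)) (tp (D (Suc j))) (X (Suc (Suc j)))"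
 unfolding exat_def
proof (intro ballI iffI)
 fix c assume c: "c \<in> vec Y (X (Suc j))"
 interpret Y: rmod R Y by (rule Y)
 interpret T: rmod R "T i" for i by (rule mT)
 { assume "\<exists>w\<in>vec Y (X j). c = cod Y X D j w"
  then show "cod Y X D (Suc j) c = (\<lambda>_. \<zero>[Y])"
   using res_zero_tp[OF Y res_T] by auto }
 assume c0: "cod Y X D (Suc j) c = (\<lambda>_. \<zero>[Y])"
 note cP = Y.pw_Pi[OF c]
 let ?f = "\<lambda>v. lc Y (X (Suc j)) v c"
 have f: "lin R (T (Suc j)) Y ?f" by (rule lc_lin[OF Y finX cP])
 have f0: "?f (dT (Suc j) w) = \<zero>[Y]" if w: "w \<in> carrier (T (Suc (Suc j)))" for w
 proof -
  have "?f (dT (Suc j) w) = lc Y (X (Suc (Suc j))) w (cod Y X D (Suc j) c)"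
   by (rule lc_mm[OF Y finX finX matD _ cP]) (use w in auto)
  then show ?thesis using c0 w by (simp add: Y.lc_zero_r)
 qed
 obtain \<alpha> \<beta> h where a: "\<And>i. lin R (T i) (P i) (\<alpha> i)" and b: "\<And>i. lin R (P i) (T i) (\<beta> i)" and h: "\<And>i. lin R (T i) (T (Suc i)) (h i)"
  and ac: "\<And>i v. v \<in> carrier (T (Suc i)) ==> d i (\<alpha> (Suc i) v) = \<alpha> i (dT i v)"
  and bc: "\<And>i v. v \<in> carrier (P (Suc i)) ==> dT i (\<beta> (Suc i) v) = \<beta> i (d i v)"
  and hc: "\<And>i v. v \<in> carrier (T (Suc i)) ==> v = \<beta> (Suc i) (\<alpha> (Suc i) v) -[T (Suc i)] (dT (Suc i) (h (Suc i) v) +[T (Suc i)] h i (dT i v))"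
  by (rule compare) (rule that)
 obtain \<psi> where psi: "lin R (P j) Y \<psi>" "\<And>p. p \<in> carrier (P (Suc j)) ==> ?f (\<beta> (Suc j) p) = \<psi> (d j p)"
 proof -
  have "?f (\<beta> (Suc j) (d (Suc j) p)) = \<zero>[Y]" if p: "p \<in> carrier (P (Suc (Suc j)))" for p
   using f0[OF lin_closed[OF b p]] bc[OF p] by simp
  then show ?thesis using hyp[OF lin_comp[OF b f]] that by blast
 qed
 let ?k = "\<lambda>v. \<psi> (\<alpha> j v) -[Y] ?f (h j v)"
 have k: "lin R (T j) Y ?k" by (rule lin_diff[OF mT Y lin_comp[OF a psi(1)] lin_comp[OF h f]])
 have fk: "?f v = ?k (dT j v)" if v: "v \<in> carrier (T (Suc j))" for v
 proof -
  have c1: "\<beta> (Suc j) (\<alpha> (Suc j) v) \<in> carrier (T (Suc j))" using lin_closed[OF b lin_closed[OF a v]] .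
  have c2: "dT (Suc j) (h (Suc j) v) \<in> carrier (T (Suc j))" using lin_closed[OF lp lin_closed[OF h v]] .
  have c3: "h j (dT j v) \<in> carrier (T (Suc j))" using lin_closed[OF h lin_closed[OF lp v]] .
  have "?f v = ?f (\<beta> (Suc j) (\<alpha> (Suc j) v) -[T (Suc j)] (dT (Suc j) (h (Suc j) v) +[T (Suc j)] h j (dT j v)))"
   using hc[OF v] by simp
  also have "\<dots> = ?f (\<beta> (Suc j) (\<alpha> (Suc j) v)) -[Y] ?f (dT (Suc j) (h (Suc j) v) +[T (Suc j)] h j (dT j v))"
   by (rule lin_minus[OF mT Y f c1 T.M.add.m_closed[OF c2 c3]])
  also have "?f (dT (Suc j) (h (Suc j) v) +[T (Suc j)] h j (dT j v)) = ?f (dT (Suc j) (h (Suc j) v)) +[Y] ?f (h j (dT j v))"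
   by (rule lin_add[OF f c2 c3])
  also have "?f (dT (Suc j) (h (Suc j) v)) = \<zero>[Y]" by (rule f0[OF lin_closed[OF h v]])
  also have "?f (\<beta> (Suc j) (\<alpha> (Suc j) v)) = \<psi> (\<alpha> j (dT j v))" using psi(2)[OF lin_closed[OF a v]] ac[OF v] by simp
  finally show ?thesis using lin_closed[OF f c3] by simp
 qed
 let ?w = "\<lambda>y. if y \<in> X j then ?k (free_gen R y) else \<zero>[Y]"
 have w: "?w \<in> vec Y (X j)" using lin_closed[OF k gen_pw] by (intro pwI) auto
 have "c = cod Y X D j ?w"
 proof (rule pw_ext[OF c])
  show "cod Y X D j ?w \<in> vec Y (X (Suc j))"
   using matD Y.pw_Pi[OF w] by (intro Y.mm_closed) auto
  fix x assume x: "x \<in> X (Suc j)"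
  note g = gen_pw[OF x]
  have "c x = ?f (free_gen R x)" using Y.lc_gen[OF finX x cP] by simp
  also have "\<dots> = ?k (dT j (free_gen R x))" by (rule fk[OF g])
  also have "\<dots> = lc Y (X j) (dT j (free_gen R x)) (\<lambda>y. ?k (free_gen R y))"
   by (rule lin_free_lc[OF Y finX k lin_closed[OF lp g]])
  also have "\<dots> = lc Y (X j) (\<lambda>y. D j y x) ?w"
   by (rule Y.lc_cong) (use x w Y.pw_Pi[OF w] matD[of j] in \<open>auto simp: mm_gen[OF finX matD x] mat_def\<close>)
  finally show "c x = cod Y X D j ?w x" using x by (simp add: mm_def tp_def[abs_def])
 qed
 then show "\<exists>w\<in>vec Y (X j). c = cod Y X D j w" using w by blast
qed

text \<open>With \<open>P (Suc j)\<close> zero, the homotopy identity writes a basis vector of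
  \<open>T (Suc j)\<close> as minus a sum of two vectors with entries in the maximal ideal, by
  minimality of \<open>D\<close>; but one of its entries is \<open>\<one>\<close>.\<close>

lemma bounded_empty:
 assumes loc: "lnr R" and min: "\<And>i y x. y \<in> X i ==> x \<in> X (Suc i) ==> D i y x \<in> max_ideal R"
  and z: "zero_module (P (Suc j))"
 shows "X (Suc j) = {}"
proof (rule ccontr)
 interpret lnr R by (rule loc)
 interpret rm: rmod R rm by (rule rmod_rm)
 interpret T: rmod R "T i" for i by (rule mT)
 assume "X (Suc j) \<noteq> {}"
 then obtain x where x: "x \<in> X (Suc j)" by blast
 note g = gen_pw[OF x]
 obtain \<alpha> \<beta> h where a: "\<And>i. lin R (T i) (P i) (\<alpha> i)" and b: "\<And>i. lin R (P i) (T i) (\<beta> i)" and h: "\<And>i. lin R (T i) (T (Suc i)) (h i)"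
  and hc: "\<And>i v. v \<in> carrier (T (Suc i)) ==> v = \<beta> (Suc i) (\<alpha> (Suc i) v) -[T (Suc i)] (dT (Suc i) (h (Suc i) v) +[T (Suc i)] h i (dT i v))"
  by (rule compare) (rule that)
 let ?U = "{v \<in> carrier (T (Suc j)). \<forall>y\<in>X (Suc j). v y \<in> mx}"
 have U: "submodule ?U R (T (Suc j))"
  by (rule T.subI_comb) (use mx_zero mx_add mx_mult_l T.M.zero_closed[of "Suc j"] T.M.add.m_closed[where i="Suc j"] T.smult_closed[where i="Suc j"] in auto)
 have d1: "dif rm X D i v y \<in> mx" if "v \<in> carrier (T (Suc i))" "y \<in> X i" for v y i
  using that min by (simp add: mm_def lc_def rm_finsum) (rule mx_finsum, auto intro: mx_mult_r pwR)
 have "\<alpha> (Suc j) (free_gen R x) = \<zero>[P (Suc j)]" using z lin_closed[OF a g] by (simp add: zero_module_def)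
 then have 1: "\<beta> (Suc j) (\<alpha> (Suc j) (free_gen R x)) \<in> ?U" using lin_zero[OF mP mT b] T.sub_zero[OF U] by simp
 have 2: "dT (Suc j) (h (Suc j) (free_gen R x)) \<in> ?U" using d1 lin_closed[OF h g] lin_closed[OF lp lin_closed[OF h g]] by blast
 have 3: "h j (dT j (free_gen R x)) \<in> ?U"
 proof -
  have "h j (dT j (free_gen R x)) = lc (T (Suc j)) (X j) (dT j (free_gen R x)) (\<lambda>y. h j (free_gen R y))"
   by (rule lin_free_lc[OF mT finX h lin_closed[OF lp g]])
  also have "\<dots> \<in> ?U" unfolding lc_def
  proof (rule T.sub_finsum[OF U], rule Pi_I)
   fix y assume y: "y \<in> X j"
   have hy: "h j (free_gen R y) \<in> carrier (T (Suc j))" by (rule lin_closed[OF h gen_pw[OF y]])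
   have dm: "dT j (free_gen R x) y \<in> mx" by (rule d1[OF g y])
   show "dT j (free_gen R x) y *[T (Suc j)] h j (free_gen R y) \<in> ?U"
    using T.smult_closed[OF mx_sub[OF dm] hy] mx_mult_r[OF dm] pwR[OF hy] by simp
  qed
  finally show ?thesis .
 qed
 have "free_gen R x \<in> ?U" by (subst hc[OF g]) (rule T.sub_minus[OF U 1 T.sub_add[OF U 2 3]])
 then have "\<one> \<in> mx" using x by (auto simp: free_gen_def)
 then show False using one_notin_mx by blast
qed

end

context crng begin

lemma res_of_proj_resolution:
 assumes H: "rmod R H" and r: "res_of R H X g D"
 shows "proj_resolution R H (\<lambda>i. pw rm (X i)) (\<lambda>i. restrict (dif rm X D i) (vec rm (X (Suc i))))
  (restrict (\<lambda>v. lc H (X 0) v g) (vec rm (X 0)))"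
proof -
 have f: "\<And>i. finite (X i)" "\<And>i. mat R (X i) (X (Suc i)) (D i)" and g: "g \<in> X 0 \<rightarrow> carrier H" using r by (auto simp: res_of_def res_def gens_def)
 have M: "rmod R (pw rm (X i))" for i by (rule rmod.rmod_pw[OF rmod_rm])
 note l = rmod.mm_lin[OF rmod_rm f(1,2)]
 note e = lc_lin[OF H f(1) g]
 have ex: "dif rm X D i ` vec rm (X (Suc i)) = {v \<in> vec rm (X i). (case i of 0 => lc H (X 0) v g = \<zero>[H] | Suc k => dif rm X D k v = (\<lambda>_. \<zero>))}" for i
 proof -
  have "v \<in> dif rm X D i ` vec rm (X (Suc i)) \<longleftrightarrow> v \<in> vec rm (X i) \<and> (case i of 0 => lc H (X 0) v g = \<zero>[H] | Suc k => dif rm X D k v = (\<lambda>_. \<zero>))" for v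
  proof (cases "v \<in> vec rm (X i)")
   case True then show ?thesis using r unfolding res_of_def res_def exat_def by (cases i) (auto simp: image_def)
  next
   case False then show ?thesis using lin_closed[OF l] by auto
  qed
  then show ?thesis by blast
 qed
 show ?thesis unfolding proj_resolution_def
 proof (intro conjI allI)
  show "projective_module R (pw rm (X n))" for n by (rule projective_pw[OF f(1)])
  show "restrict (dif rm X D n) (vec rm (X (Suc n))) \<in> lin_maps R (pw rm (X (Suc n))) (pw rm (X n))" for n
   by (rule lin_lin_maps[OF M l])
  show "restrict (\<lambda>v. lc H (X 0) v g) (vec rm (X 0)) \<in> lin_maps R (pw rm (X 0)) H" by (rule lin_lin_maps[OF M e])
  show "restrict (\<lambda>v. lc H (X 0) v g) (vec rm (X 0)) ` vec rm (X 0) = carrier H"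
   using r lin_closed[OF e] unfolding res_of_def gens_def by (auto simp: image_def)
  show "restrict (dif rm X D 0) (vec rm (X (Suc 0))) ` vec rm (X (Suc 0)) =
   lin_kernel (pw rm (X 0)) H (restrict (\<lambda>v. lc H (X 0) v g) (vec rm (X 0)))"
   using ex[of 0] by (auto simp: lin_kernel_def)
  show "restrict (dif rm X D (Suc n)) (vec rm (X (Suc (Suc n)))) ` vec rm (X (Suc (Suc n))) =
   lin_kernel (pw rm (X (Suc n))) (pw rm (X n)) (restrict (dif rm X D n) (vec rm (X (Suc n))))" for n
   using ex[of "Suc n"] by (auto simp: lin_kernel_def)
 qed
qed

end

context lnr begin

text \<open>The \<open>SOME\<close> in the definition denotes a resolution because the minimal free
  one has its modules in the type \<open>nat => 'a\<close> and is a witness.\<close>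

lemma chosen_resolution_proj:
 assumes H: "rmod R H" and fin: "finite_module R H" and ch: "chosen_resolution R H = (P, d)"
 obtains \<epsilon> where "proj_resolution R H P d \<epsilon>"
proof -
 obtain X g D where r: "res_of R H (X :: nat => nat set) g D" by (rule min_res[OF H fin])
 have "\<exists>PD. case PD of (P, d) => \<exists>\<epsilon>. proj_resolution R H (P :: nat => ('a, nat => 'a) module) d \<epsilon>"
  by (rule exI, rule case_prodI, rule exI, rule res_of_proj_resolution[OF H r])
 from someI_ex[OF this] have "case chosen_resolution R H of (P, d) => \<exists>\<epsilon>. proj_resolution R H P d \<epsilon>"
  unfolding chosen_resolution_def .
 then show ?thesis using that ch by auto
qed

lemma ext_zero_exact:
 assumes H: "rmod R H" and fin: "finite_module R H" and r: "res_of R H X g D" and Y: "rmod R Y"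
  and 0: "zero_module (ext_module R (Suc j) H Y)"
 shows "exat Y (X j) (tp (D j)) (X (Suc j)) (tp (D (Suc j))) (X (Suc (Suc j)))"
proof -
 obtain P d where ch: "chosen_resolution R H = (P, d)" by (cases "chosen_resolution R H")
 obtain \<epsilon> where pr: "proj_resolution R H P d \<epsilon>" by (rule chosen_resolution_proj[OF H fin ch])
 interpret comparison R H P d \<epsilon> X g D by (intro comparison.intro comparison_axioms.intro crng_axioms H pr r)
 interpret Y: rmod R Y by (rule Y)
 interpret P: rmod R "P i" for i by (rule mP)
 let ?C = "\<lambda>n. hom_module R (P n) Y"
 let ?\<delta> = "\<lambda>n \<phi>. compose (carrier (P (Suc n))) \<phi> (d n)"
 have 1: "zero_module (quot_module ((?C (Suc j))\<lparr>carrier := lin_kernel (?C (Suc j)) (?C (Suc (Suc j))) (?\<delta> (Suc j))\<rparr>)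
      (?\<delta> j ` carrier (?C j)))" using 0 unfolding ext_module_def ch by simp
 show ?thesis
 proof (rule ext_exact[OF Y])
  fix \<phi> assume f: "lin R (P (Suc j)) Y \<phi>" and f0: "\<And>p. p \<in> carrier (P (Suc (Suc j))) ==> \<phi> (d (Suc j) p) = \<zero>[Y]"
  let ?f = "restrict \<phi> (carrier (P (Suc j)))"
  have fm: "?f \<in> lin_maps R (P (Suc j)) Y" by (rule lin_lin_maps[OF mP f])
  have z: "(\<lambda>x\<in>carrier (P j). \<zero>[Y]) \<in> lin_maps R (P j) Y"
   by (rule lin_lin_maps[OF mP]) (rule linI, auto)
  have "?f \<in> ?\<delta> j ` carrier (?C j)"
  proof (rule zero_quotD[OF 1])
   have "?\<delta> (Suc j) ?f = (\<lambda>x\<in>carrier (P (Suc (Suc j))). \<zero>[Y])"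
    using f0 lin_closed[OF ld] by (auto simp: compose_def intro!: restrict_ext)
   then show "?f \<in> carrier ((?C (Suc j))\<lparr>carrier := lin_kernel (?C (Suc j)) (?C (Suc (Suc j))) (?\<delta> (Suc j))\<rparr>)"
    using fm by (simp add: lin_kernel_def hom_module_def)
   have "?\<delta> j (\<lambda>x\<in>carrier (P j). \<zero>[Y]) = (\<lambda>x\<in>carrier (P (Suc j)). \<zero>[Y])"
    using lin_closed[OF ld] by (auto simp: compose_def intro!: restrict_ext)
   then show "\<zero>[(?C (Suc j))\<lparr>carrier := lin_kernel (?C (Suc j)) (?C (Suc (Suc j))) (?\<delta> (Suc j))\<rparr>] \<in> ?\<delta> j ` carrier (?C j)"
    using z by (auto simp: hom_module_def image_iff intro!: bexI[of _ "\<lambda>x\<in>carrier (P j). \<zero>[Y]"])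
   show "\<zero>[(?C (Suc j))\<lparr>carrier := lin_kernel (?C (Suc j)) (?C (Suc (Suc j))) (?\<delta> (Suc j))\<rparr>] +[(?C (Suc j))\<lparr>carrier := lin_kernel (?C (Suc j)) (?C (Suc (Suc j))) (?\<delta> (Suc j))\<rparr>] ?f = ?f"
    using lin_closed[OF f] by (auto simp: hom_module_def intro!: restrict_ext)
  qed
  then obtain \<psi> where psi: "\<psi> \<in> lin_maps R (P j) Y" "?f = ?\<delta> j \<psi>" by (auto simp: hom_module_def)
  have "\<phi> p = \<psi> (d j p)" if "p \<in> carrier (P (Suc j))" for p
   using fun_cong[OF psi(2), of p] that by (simp add: compose_def)
  then show "\<exists>\<psi>. lin R (P j) Y \<psi> \<and> (\<forall>p\<in>carrier (P (Suc j)). \<phi> p = \<psi> (d j p))" using lin_maps_lin[OF psi(1)] by blast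
 qed
qed

text \<open>The infimum is attained by a resolution vanishing above its length, and
  \<open>bounded_empty\<close> carries this over to the minimal one.\<close>

lemma proj_dim_empty:
 assumes H: "rmod R H" and r: "res_of R H X g D" and min: "\<And>i y x. y \<in> X i ==> x \<in> X (Suc i) ==> D i y x \<in> mx"
  and pd: "proj_dim R H \<le> enat n" and j: "j > n"
 shows "X j = {}"
proof -
 let ?S = "{enat n | n. \<exists>(P :: nat => ('a, nat => 'a) module) d \<epsilon>. proj_resolution R H P d \<epsilon> \<and> (\<forall>i>n. zero_module (P i))}"
 have le: "Inf ?S \<le> enat n" using pd unfolding proj_dim_def .
 have ne: "?S \<noteq> {}"
 proof
  assume "?S = {}" then have "Inf ?S = (Orderings.top :: enat)" by (simp only: Inf_empty)
  then show False using le by (simp add: top_enat_def)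
 qed
 have "Inf ?S \<in> ?S"
 proof -
  have "Inf ?S = (LEAST x. x \<in> ?S)" unfolding Inf_enat_def using ne by (simp only: if_False)
  then show ?thesis using ne by (metis (mono_tags, lifting) LeastI ex_in_conv)
 qed
 then obtain m and P :: "nat => ('a, nat => 'a) module" and d \<epsilon> where P: "Inf ?S = enat m" "proj_resolution R H P d \<epsilon>" "\<forall>i>m. zero_module (P i)" by blast
 have mn: "m \<le> n" using le P(1) by simp
 obtain i where i: "j = Suc i" using j by (cases j) auto
 interpret comparison R H P d \<epsilon> X g D by (intro comparison.intro comparison_axioms.intro crng_axioms H P(2) r)
 show ?thesis unfolding i by (rule bounded_empty) (use P(3) i j mn min lnr_axioms in auto)
qed

end

context rmod begin

text \<open>Computations in a tensor product are carried out on representatives in the free module,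
  chained by this relation.\<close>

definition cong_mod where "cong_mod V u w \<longleftrightarrow> u \<in> carrier M \<and> w \<in> carrier M \<and> u -[M] w \<in> V"

context
 fixes V assumes V: "submodule V R M"
begin

lemma cm_refl: "u \<in> carrier M ==> cong_mod V u u"
 using sub_zero[OF V] by (simp add: cong_mod_def a_minus_def M.r_neg)

lemma cm_trans: "cong_mod V u v ==> cong_mod V v w ==> cong_mod V u w"
proof -
 assume a: "cong_mod V u v" and b: "cong_mod V v w"
 have "(u -[M] v) +[M] (v -[M] w) \<in> V" using a b sub_add[OF V] by (simp add: cong_mod_def)
 moreover have "(u -[M] v) +[M] (v -[M] w) = u -[M] w"
  using a b by (simp add: cong_mod_def a_minus_def M.a_assoc M.r_neg1)
 ultimately show ?thesis using a b by (simp add: cong_mod_def)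
qed

lemma cm_sym: "cong_mod V u v ==> cong_mod V v u"
proof -
 assume a: "cong_mod V u v"
 have "\<ominus>[M] (u -[M] v) \<in> V" using a submoduleE(3)[OF V] by (simp add: cong_mod_def)
 moreover have "\<ominus>[M] (u -[M] v) = v -[M] u" using a by (simp add: cong_mod_def a_minus_def M.minus_add M.a_comm)
 ultimately show ?thesis using a by (simp add: cong_mod_def)
qed

lemma cm_add: "cong_mod V u v ==> cong_mod V u' v' ==> cong_mod V (u +[M] u') (v +[M] v')"
proof -
 assume a: "cong_mod V u v" and b: "cong_mod V u' v'"
 have "(u -[M] v) +[M] (u' -[M] v') \<in> V" using a b sub_add[OF V] by (simp add: cong_mod_def)
 moreover have "(u -[M] v) +[M] (u' -[M] v') = (u +[M] u') -[M] (v +[M] v')"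
  using a b by (simp add: cong_mod_def a_minus_def M.minus_add M.a_ac)
 ultimately show ?thesis using a b by (simp add: cong_mod_def)
qed

lemma cm_smult: "a \<in> carrier R ==> cong_mod V u v ==> cong_mod V (a *[M] u) (a *[M] v)"
proof -
 assume a: "a \<in> carrier R" and b: "cong_mod V u v"
 have "a *[M] (u -[M] v) \<in> V" using a b sub_smult[OF V] by (simp add: cong_mod_def)
 moreover have "a *[M] (u -[M] v) = a *[M] u -[M] a *[M] v"
  using a b by (simp add: cong_mod_def a_minus_def smult_r_distr smult_r_minus)
 ultimately show ?thesis using a b by (simp add: cong_mod_def)
qed

lemma cm_finsum: "(\<And>x. x \<in> X ==> cong_mod V (f x) (g x)) ==> cong_mod V (finsum M f X) (finsum M g X)"
proof (induct X rule: infinite_finite_induct)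
 case (insert x F)
 then have "f \<in> F \<rightarrow> carrier M" "g \<in> F \<rightarrow> carrier M" "f x \<in> carrier M" "g x \<in> carrier M" by (auto simp: cong_mod_def)
 then show ?case using insert by (simp add: cm_add)
qed (simp_all add: cm_refl)

lemma cm_zero: "cong_mod V u \<zero>[M] \<longleftrightarrow> u \<in> V"
proof -
 have "\<ominus>[M] \<zero>[M] = \<zero>[M]" using M.r_neg[of "\<zero>[M]"] M.l_zero[of "\<ominus>[M] \<zero>[M]"] by simp
 then have z: "x -[M] \<zero>[M] = x" if "x \<in> carrier M" for x using that unfolding a_minus_def by (simp only: M.r_zero)
 show ?thesis unfolding cong_mod_def using z sub_car[OF V] M.zero_closed by metis
qed

lemma cm_coset: "cong_mod V u w ==> V +>\<^bsub>M\<^esub> u = V +>\<^bsub>M\<^esub> w"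
proof -
 assume c: "cong_mod V u w"
 then have "u = (u -[M] w) +[M] w" by (simp add: cong_mod_def a_minus_def M.a_assoc M.l_neg)
 then have "u \<in> V +>\<^bsub>M\<^esub> w" using c unfolding a_r_coset_def' cong_mod_def by auto
 from M.a_repr_independence[OF this _ submodule.axioms(1)[OF V]] show ?thesis using c by (simp add: cong_mod_def)
qed

lemma coset_cm: "u \<in> carrier M ==> w \<in> carrier M ==> u \<in> V +>\<^bsub>M\<^esub> w ==> cong_mod V u w"
proof -
 assume u: "u \<in> carrier M" "w \<in> carrier M" "u \<in> V +>\<^bsub>M\<^esub> w"
 then obtain h where h: "h \<in> V" "u = h +[M] w" by (auto simp: a_r_coset_def')
 then have "u -[M] w = h" using sub_car[OF V h(1)] u by (simp add: a_minus_def M.a_assoc M.r_neg)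
 then show ?thesis using u h by (simp add: cong_mod_def)
qed

lemma coset_self: "u \<in> carrier M ==> u \<in> V +>\<^bsub>M\<^esub> u"
 using sub_zero[OF V] by (auto simp: a_r_coset_def' intro!: bexI[of _ "\<zero>[M]"])

lemma coset_carrier: "w \<in> carrier M ==> u \<in> V +>\<^bsub>M\<^esub> w ==> u \<in> carrier M"
 using sub_car[OF V] by (auto simp: a_r_coset_def')

end
end

section \<open>Tensor products\<close>

locale bimod = crng R for R :: "'a ring" (structure) +
 fixes M :: "('a, 'b) module" and N :: "('a, 'c) module"
 assumes M: "rmod R M" and N: "rmod R N"
begin

sublocale M: rmod R M by (rule M)
sublocale N: rmod R N by (rule N)

abbreviation "F \<equiv> free_module_on R (carrier M \<times> carrier N)"
abbreviation "rel \<equiv> tensor_rel R M N"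
abbreviation "ge x y \<equiv> free_gen R (x, y)"

sublocale F: rmod R F by (rule rmod_free)

lemma ge_F: "x \<in> carrier M ==> y \<in> carrier N ==> ge x y \<in> carrier F" by (rule gen_free) simp

text \<open>The generating set inside the \<open>let\<close> of \<open>tensor_rel\<close>, given a
  name so that it can be reasoned about.\<close>

definition "rels = {ge (x +[M] x') y -[F] (ge x y +[F] ge x' y) | x x' y.
      x \<in> carrier M \<and> x' \<in> carrier M \<and> y \<in> carrier N} \<union>
    {ge x (y +[N] y') -[F] (ge x y +[F] ge x y') | x y y'.
      x \<in> carrier M \<and> y \<in> carrier N \<and> y' \<in> carrier N} \<union>
    {ge (a *[M] x) y -[F] a *[F] ge x y | a x y.
      a \<in> carrier R \<and> x \<in> carrier M \<and> y \<in> carrier N} \<union>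
    {ge x (a *[N] y) -[F] a *[F] ge x y | a x y.
      a \<in> carrier R \<and> x \<in> carrier M \<and> y \<in> carrier N}"

lemma rel_span: "rel = module_span R F rels"
 unfolding tensor_rel_def rels_def Let_def ..

lemma rels_F: "rels \<subseteq> carrier F"
 unfolding rels_def using ge_F by (auto intro!: F.M.minus_closed F.M.add.m_closed F.smult_closed)

lemma rel_sub: "submodule rel R F" unfolding rel_span by (rule F.span_submodule[OF rels_F])

lemma rels_rel: "u \<in> rels ==> u \<in> rel" unfolding rel_span by (rule subsetD[OF F.span_superset])

lemma rel_least: "submodule U R F ==> (\<And>u. u \<in> rels ==> u \<in> U) ==> rel \<subseteq> U"
 unfolding rel_span by (rule F.span_least) auto

abbreviation "cg \<equiv> F.cong_mod rel"
lemmas cgs = F.cm_refl[OF rel_sub] F.cm_trans[OF rel_sub] F.cm_sym[OF rel_sub] F.cm_add[OF rel_sub] F.cm_smult[OF rel_sub] F.cm_finsum[OF rel_sub]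

lemma cg_add_l: "x \<in> carrier M ==> x' \<in> carrier M ==> y \<in> carrier N ==> cg (ge (x +[M] x') y) (ge x y +[F] ge x' y)"
 unfolding F.cong_mod_def by (intro conjI rels_rel ge_F F.M.add.m_closed) (auto simp: rels_def)
lemma cg_add_r: "x \<in> carrier M ==> y \<in> carrier N ==> y' \<in> carrier N ==> cg (ge x (y +[N] y')) (ge x y +[F] ge x y')"
 unfolding F.cong_mod_def by (intro conjI rels_rel ge_F F.M.add.m_closed) (auto simp: rels_def)
lemma cg_smult_l: "a \<in> carrier R ==> x \<in> carrier M ==> y \<in> carrier N ==> cg (ge (a *[M] x) y) (a *[F] ge x y)"
 unfolding F.cong_mod_def by (intro conjI rels_rel ge_F F.smult_closed) (auto simp: rels_def)
lemma cg_smult_r: "a \<in> carrier R ==> x \<in> carrier M ==> y \<in> carrier N ==> cg (ge x (a *[N] y)) (a *[F] ge x y)"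
 unfolding F.cong_mod_def by (intro conjI rels_rel ge_F F.smult_closed) (auto simp: rels_def)

lemma cg_zero_l: "y \<in> carrier N ==> cg (ge \<zero>[M] y) \<zero>[F]"
 using cg_smult_l[of \<zero> "\<zero>[M]" y] ge_F[of "\<zero>[M]" y] by simp
lemma cg_zero_r: "x \<in> carrier M ==> cg (ge x \<zero>[N]) \<zero>[F]"
 using cg_smult_r[of \<zero> x "\<zero>[N]"] ge_F[of x "\<zero>[N]"] by simp

lemma cg_lc_l: "finite X ==> v \<in> X \<rightarrow> carrier R ==> p \<in> X \<rightarrow> carrier M ==> y \<in> carrier N ==>
 cg (ge (lc M X v p) y) (lc F X v (\<lambda>x. ge (p x) y))"
proof (induct X rule: finite_induct)
 case empty then show ?case by (simp add: cg_zero_l)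
next
 case (insert x X)
 then have c: "v x \<in> carrier R" "p x \<in> carrier M" "v \<in> X \<rightarrow> carrier R" "p \<in> X \<rightarrow> carrier M" by auto
 have l: "lc M X v p \<in> carrier M" using c by auto
 have "lc M (insert x X) v p = v x *[M] p x +[M] lc M X v p" using insert by (intro M.lc_insert) auto
 moreover have "lc F (insert x X) v (\<lambda>x. ge (p x) y) = v x *[F] ge (p x) y +[F] lc F X v (\<lambda>x. ge (p x) y)"
  using insert ge_F by (intro F.lc_insert) auto
 moreover have "cg (ge (v x *[M] p x +[M] lc M X v p) y) (v x *[F] ge (p x) y +[F] lc F X v (\<lambda>x. ge (p x) y))"
  by (rule cgs(2)[OF cg_add_l cgs(4)[OF cg_smult_l]]) (use c l insert in auto)
 ultimately show ?case by simp
qed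

lemma cg_lc_r: "finite X ==> v \<in> X \<rightarrow> carrier R ==> p \<in> X \<rightarrow> carrier N ==> x \<in> carrier M ==>
 cg (ge x (lc N X v p)) (lc F X v (\<lambda>i. ge x (p i)))"
proof (induct X rule: finite_induct)
 case empty then show ?case by (simp add: cg_zero_r)
next
 case (insert i X)
 then have c: "v i \<in> carrier R" "p i \<in> carrier N" "v \<in> X \<rightarrow> carrier R" "p \<in> X \<rightarrow> carrier N" by auto
 have l: "lc N X v p \<in> carrier N" using c by auto
 have "lc N (insert i X) v p = v i *[N] p i +[N] lc N X v p" using insert by (intro N.lc_insert) auto
 moreover have "lc F (insert i X) v (\<lambda>i. ge x (p i)) = v i *[F] ge x (p i) +[F] lc F X v (\<lambda>i. ge x (p i))"
  using insert ge_F by (intro F.lc_insert) auto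
 moreover have "cg (ge x (v i *[N] p i +[N] lc N X v p)) (v i *[F] ge x (p i) +[F] lc F X v (\<lambda>i. ge x (p i)))"
  by (rule cgs(2)[OF cg_add_r cgs(4)[OF cg_smult_r]]) (use c l insert in auto)
 ultimately show ?case by simp
qed

text \<open>The universal property of the tensor product on representatives: bilinearity modulo
  \<open>V\<close> on generators suffices.\<close>

lemma rel_kill:
 assumes A: "rmod R A" and V: "submodule V R A" and L: "lin R F A L"
  and a1: "\<And>x x' y. x \<in> carrier M ==> x' \<in> carrier M ==> y \<in> carrier N ==> rmod.cong_mod A V (L (ge (x +[M] x') y)) (L (ge x y) +[A] L (ge x' y))"
  and a2: "\<And>x y y'. x \<in> carrier M ==> y \<in> carrier N ==> y' \<in> carrier N ==> rmod.cong_mod A V (L (ge x (y +[N] y'))) (L (ge x y) +[A] L (ge x y'))"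
  and s1: "\<And>a x y. a \<in> carrier R ==> x \<in> carrier M ==> y \<in> carrier N ==> rmod.cong_mod A V (L (ge (a *[M] x) y)) (a *[A] L (ge x y))"
  and s2: "\<And>a x y. a \<in> carrier R ==> x \<in> carrier M ==> y \<in> carrier N ==> rmod.cong_mod A V (L (ge x (a *[N] y))) (a *[A] L (ge x y))"
  and u: "u \<in> rel"
 shows "L u \<in> V"
proof -
 interpret A: rmod R A by (rule A)
 let ?U = "{u \<in> carrier F. L u \<in> V}"
 have U: "submodule ?U R F"
  by (rule F.subI_comb) (use lin_zero[OF rmod_free A L] lin_add[OF L] lin_smult[OF L] A.sub_zero[OF V] A.sub_add[OF V] A.sub_smult[OF V] in auto)
 have m: "L (p -[F] q) \<in> V" if "p \<in> carrier F" "q \<in> carrier F" "A.cong_mod V (L p) (L q)" for p q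
  using that lin_minus[OF rmod_free A L] by (simp add: A.cong_mod_def)
 have "rel \<subseteq> ?U"
 proof (rule rel_least[OF U])
  fix u assume u: "u \<in> rels"
  then have "L u \<in> V" unfolding rels_def
   by (elim UnE CollectE exE conjE; simp only:; intro m)
    (use ge_F lin_add[OF L] lin_smult[OF L] a1 a2 s1 s2 in \<open>auto intro!: F.M.add.m_closed F.smult_closed\<close>)
  then show "u \<in> ?U" using u rels_F by blast
 qed
 then show ?thesis using u by blast
qed

lemma tensor_sel: "carrier (tensor_module R M N) = {rel +>\<^bsub>F\<^esub> c | c. c \<in> carrier F}" "\<zero>[tensor_module R M N] = rel"
 "Z +[tensor_module R M N] W = Z <+>\<^bsub>F\<^esub> W"
 unfolding tensor_module_def quot_sel a_rcosets_eq by (simp_all add: quot_module_def)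

lemma tensor_zero_add: "c \<in> carrier F ==> rel <+>\<^bsub>F\<^esub> (rel +>\<^bsub>F\<^esub> c) = rel +>\<^bsub>F\<^esub> c"
proof -
 assume c: "c \<in> carrier F"
 have s: "subgroup rel (add_monoid F)" by (rule submodule.axioms(1)[OF rel_sub])
 interpret S: abelian_subgroup rel F by (rule abelian_subgroupI3) (auto simp: additive_subgroup_def s F.M.abelian_group_axioms)
 show ?thesis using c S.a_rcos_sum[of "\<zero>[F]" c] F.M.a_coset_add_zero[OF S.a_subset] by simp
qed

end

locale bimod_map = bimod R M N + M': bimod R M' N for R :: "'a ring" (structure) and M :: "('a, 'b) module" and N :: "('a, 'c) module" and M' :: "('a, 'd) module" +
 fixes f assumes f: "lin R M M' f"
begin

definition "push = lext R M'.F (\<lambda>(x, y). free_gen R (f x, y))"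

lemma push_lin: "lin R F M'.F push"
 unfolding push_def by (rule lext_lin[OF rmod_free]) (auto intro: M'.ge_F lin_closed[OF f])

lemma push_ge: "x \<in> carrier M ==> y \<in> carrier N ==> push (ge x y) = free_gen R (f x, y)"
 unfolding push_def using lext_gen[OF rmod_free, of "\<lambda>(x, y). free_gen R (f x, y)" "(x, y)"] M'.ge_F lin_closed[OF f] by simp

lemma push_rel: "u \<in> rel ==> push u \<in> M'.rel"
 by (rule rel_kill[OF rmod_free M'.rel_sub push_lin])
  (simp_all add: push_ge lin_closed[OF f] lin_add[OF f] lin_smult[OF f] M'.cg_add_l M'.cg_add_r M'.cg_smult_l M'.cg_smult_r)

text \<open>Reconciles the linear extension \<open>push\<close> with the sums over fibres by which
  \<open>tensor_map\<close> is written.\<close>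

lemma push_eval: "c \<in> carrier F ==> push c = (\<lambda>(x', y). \<Oplus>x\<in>{x. c (x, y) \<noteq> \<zero> \<and> f x = x'}. c (x, y))"
proof (rule ext, clarsimp)
 fix x' y assume c: "c \<in> carrier F"
 let ?S = "{z. c z \<noteq> \<zero>}"
 let ?h = "\<lambda>(x, y). free_gen R (f x, y)"
 have S: "finite ?S" "?S \<subseteq> carrier M \<times> carrier N" and cR: "\<And>z. c z \<in> carrier R" using c by (auto simp: free_sel)
 have hF: "?h \<in> ?S \<rightarrow> carrier M'.F" using S(2) M'.ge_F lin_closed[OF f] by auto
 have ev: "lin R M'.F rm (\<lambda>u. u (x', y))" by (rule linI) (auto simp: free_sel)
 have "push c (x', y) = lc rm ?S c (\<lambda>z. ?h z (x', y))"
  unfolding push_def lext_def using lin_lc[OF rmod_free rmod_rm ev _ hF, of c] cR by simp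
 also have "\<dots> = (\<Oplus>z\<in>?S. c z \<otimes> ?h z (x', y))" by (rule lc_rm)
 also have "\<dots> = (\<Oplus>z\<in>{z \<in> ?S. f (fst z) = x' \<and> snd z = y}. c z)"
  by (rule add.finprod_mono_neutral_cong_right) (use S cR in \<open>auto simp: free_gen_def\<close>)
 also have "{z \<in> ?S. f (fst z) = x' \<and> snd z = y} = (\<lambda>x. (x, y)) ` {x. c (x, y) \<noteq> \<zero> \<and> f x = x'}" by auto
 also have "(\<Oplus>z\<in>\<dots>. c z) = (\<Oplus>x\<in>{x. c (x, y) \<noteq> \<zero> \<and> f x = x'}. c (x, y))"
  by (rule add.finprod_reindex) (use cR in \<open>auto simp: inj_on_def\<close>)
 finally show "push c (x', y) = (\<Oplus>x\<in>{x. c (x, y) \<noteq> \<zero> \<and> f x = x'}. c (x, y))" .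
qed

text \<open>\<open>tensor_map\<close> takes a union over all representatives of a coset; it is a
  single coset because congruent representatives are pushed to congruent ones.\<close>

lemma tensor_map_coset: "c \<in> carrier F ==> tensor_map R M N f M' (rel +>\<^bsub>F\<^esub> c) = M'.rel +>\<^bsub>M'.F\<^esub> push c"
proof -
 assume c: "c \<in> carrier F"
 have "M'.rel +>\<^bsub>M'.F\<^esub> (\<lambda>(x', y). \<Oplus>x\<in>{x. u (x, y) \<noteq> \<zero> \<and> f x = x'}. u (x, y)) = M'.rel +>\<^bsub>M'.F\<^esub> push c" if u: "u \<in> rel +>\<^bsub>F\<^esub> c" for u
 proof -
  have uF: "u \<in> carrier F" by (rule F.coset_carrier[OF rel_sub c u])
  have "cg u c" by (rule F.coset_cm[OF rel_sub uF c u])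
  then have "push (u -[F] c) \<in> M'.rel" using push_rel by (simp add: F.cong_mod_def)
  then have "M'.cg (push u) (push c)"
   using lin_minus[OF rmod_free rmod_free push_lin uF c] lin_closed[OF push_lin] uF c by (simp add: M'.F.cong_mod_def)
  then show ?thesis unfolding push_eval[OF uF, symmetric] by (rule M'.F.cm_coset[OF M'.rel_sub])
 qed
 moreover have "rel +>\<^bsub>F\<^esub> c \<in> carrier (tensor_module R M N)" using c tensor_sel by auto
 moreover have "c \<in> rel +>\<^bsub>F\<^esub> c" by (rule F.coset_self[OF rel_sub c])
 ultimately show ?thesis unfolding tensor_map_def by (subst restrict_apply) auto
qed

end

lemma (in rmod) minus_eq_zeroD:
 assumes "x \<in> carrier M" "y \<in> carrier M" "x -[M] y = \<zero>[M]" shows "x = y"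
proof -
 have "(x -[M] y) +[M] y = x" using assms(1,2) by (simp add: a_minus_def M.a_assoc M.l_neg)
 then show ?thesis using assms by simp
qed

context comparison begin

text \<open>Send a cycle \<open>c\<close> to the tensor \<open>?z\<close>, the sum of \<alpha>(e_x)
  tensor c_x, which is a cycle in \<open>P\<close> tensor \<open>Y\<close> and so a boundary up to
  relations; bring the preimage back along \<beta> and correct by the homotopy. The hypothesis is
  phrased on representatives so that no quotient occurs in the computation.\<close>

lemma tor_exact:
 assumes Y: "rmod R Y"
  and hyp: "\<And>z. z \<in> carrier (free_module_on R (carrier (P (Suc j)) \<times> carrier Y)) ==>
   bimod_map.push R Y (P j) (d j) z \<in> tensor_rel R (P j) Y ==>
   \<exists>w\<in>carrier (free_module_on R (carrier (P (Suc (Suc j))) \<times> carrier Y)).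
    z -[free_module_on R (carrier (P (Suc j)) \<times> carrier Y)] bimod_map.push R Y (P (Suc j)) (d (Suc j)) w \<in> tensor_rel R (P (Suc j)) Y"
 shows "exa Y X D j"
 unfolding exat_def
proof (intro ballI iffI)
 fix c assume c: "c \<in> vec Y (X (Suc j))"
 interpret Y: rmod R Y by (rule Y)
 interpret T: rmod R "T i" for i by (rule mT)
 interpret P: rmod R "P i" for i by (rule mP)
 interpret rm: rmod R rm by (rule rmod_rm)
 { assume "\<exists>w\<in>vec Y (X (Suc (Suc j))). c = dif Y X D (Suc j) w"
  then show "dif Y X D j c = (\<lambda>_. \<zero>[Y])" using res_zero_mm[OF Y res_T] by auto }
 assume c0: "dif Y X D j c = (\<lambda>_. \<zero>[Y])"
 note cP = Y.pw_Pi[OF c]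
 obtain \<alpha> \<beta> h where a: "\<And>i. lin R (T i) (P i) (\<alpha> i)" and b: "\<And>i. lin R (P i) (T i) (\<beta> i)" and h: "\<And>i. lin R (T i) (T (Suc i)) (h i)"
  and ac: "\<And>i v. v \<in> carrier (T (Suc i)) ==> d i (\<alpha> (Suc i) v) = \<alpha> i (dT i v)"
  and bc: "\<And>i v. v \<in> carrier (P (Suc i)) ==> dT i (\<beta> (Suc i) v) = \<beta> i (d i v)"
  and hc: "\<And>i v. v \<in> carrier (T (Suc i)) ==> v = \<beta> (Suc i) (\<alpha> (Suc i) v) -[T (Suc i)] (dT (Suc i) (h (Suc i) v) +[T (Suc i)] h i (dT i v))"
  by (rule compare) (rule that)
 interpret B0: bimod_map R "P (Suc j)" Y "P j" "d j"
  by (intro bimod_map.intro bimod.intro bimod_axioms.intro bimod_map_axioms.intro crng_axioms mP Y ld)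
 interpret B1: bimod_map R "P (Suc (Suc j))" Y "P (Suc j)" "d (Suc j)"
  by (intro bimod_map.intro bimod.intro bimod_axioms.intro bimod_map_axioms.intro crng_axioms mP Y ld)
 let ?A = "\<lambda>x. \<alpha> (Suc j) (free_gen R x)"
 let ?Az = "\<lambda>y. \<alpha> j (free_gen R y)"
 let ?X = "X (Suc j)"
 have A: "?A \<in> ?X \<rightarrow> carrier (P (Suc j))" by (rule Pi_I) (rule lin_closed[OF a gen_pw])
 have A0: "?Az \<in> X j \<rightarrow> carrier (P j)" by (rule Pi_I) (rule lin_closed[OF a gen_pw])
 let ?z = "\<Oplus>\<^bsub>B0.F\<^esub>x\<in>?X. B0.ge (?A x) (c x)"
 have zF: "(\<lambda>x. B0.ge (?A x) (c x)) \<in> ?X \<rightarrow> carrier B0.F" using B0.ge_F A cP by (auto simp: Pi_def)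
 have z: "?z \<in> carrier B0.F" by (rule B0.F.M.finsum_closed[OF zF])
 have dA: "d j (?A x) = lc (P j) (X j) (\<lambda>y. D j y x) ?Az" if x: "x \<in> ?X" for x
 proof -
  have "d j (?A x) = \<alpha> j (dT j (free_gen R x))" by (rule ac[OF gen_pw[OF x]])
  also have "\<dots> = lc (P j) (X j) (dT j (free_gen R x)) ?Az" by (rule lin_free_lc[OF mP finX a lin_closed[OF lp gen_pw[OF x]]])
  also have "\<dots> = lc (P j) (X j) (\<lambda>y. D j y x) ?Az"
   by (rule P.lc_cong) (use x A0 matD[of j] in \<open>auto simp: mm_gen[OF finX matD x] mat_def\<close>)
  finally show ?thesis .
 qed
 \<comment> \<open>The value of \<open>d j\<close> on \<alpha>(e_x) is expanded in the images of the
   basis of \<open>T j\<close>; after interchanging the sums and moving the scalars across the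
   tensor sign, the right-hand factors are the entries of \<open>dif Y X D j c\<close>, which
   vanish.\<close>
 have "B0.push ?z \<in> B0.M'.rel"
 proof -
  let ?E = "\<lambda>x y. B0.M'.ge (?Az y) (c x)"
  have E: "?E x y \<in> carrier B0.M'.F" if "x \<in> ?X" "y \<in> X j" for x y using B0.M'.ge_F A0 cP that by (auto simp: Pi_def)
  have "B0.push ?z = (\<Oplus>\<^bsub>B0.M'.F\<^esub>x\<in>?X. B0.push (B0.ge (?A x) (c x)))"
   by (rule lin_finsum[OF rmod_free rmod_free B0.push_lin zF])
  also have "\<dots> = (\<Oplus>\<^bsub>B0.M'.F\<^esub>x\<in>?X. B0.M'.ge (lc (P j) (X j) (\<lambda>y. D j y x) ?Az) (c x))"
  proof (rule B0.M'.F.M.finsum_cong')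
   show "(\<lambda>x. B0.M'.ge (lc (P j) (X j) (\<lambda>y. D j y x) ?Az) (c x)) \<in> ?X \<rightarrow> carrier B0.M'.F"
    using cP A0 matD[of j] by (auto intro!: B0.M'.ge_F P.lc_closed simp: mat_def)
   show "B0.push (B0.ge (?A x) (c x)) = B0.M'.ge (lc (P j) (X j) (\<lambda>y. D j y x) ?Az) (c x)" if "x \<in> ?X" for x
    using B0.push_ge[of "?A x" "c x"] A cP that dA[OF that] by auto
  qed simp
  finally have 1: "B0.push ?z = (\<Oplus>\<^bsub>B0.M'.F\<^esub>x\<in>?X. B0.M'.ge (lc (P j) (X j) (\<lambda>y. D j y x) ?Az) (c x))" .
  have 2: "B0.M'.cg (\<Oplus>\<^bsub>B0.M'.F\<^esub>x\<in>?X. B0.M'.ge (lc (P j) (X j) (\<lambda>y. D j y x) ?Az) (c x))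
    (\<Oplus>\<^bsub>B0.M'.F\<^esub>x\<in>?X. \<Oplus>\<^bsub>B0.M'.F\<^esub>y\<in>X j. D j y x *[B0.M'.F] ?E x y)"
   by (rule B0.M'.cgs(6), rule B0.M'.cg_lc_l[unfolded lc_def[of B0.M'.F]]) (use cP A0 matD[of j] finX in \<open>auto simp: mat_def\<close>)
  have 3: "(\<Oplus>\<^bsub>B0.M'.F\<^esub>x\<in>?X. \<Oplus>\<^bsub>B0.M'.F\<^esub>y\<in>X j. D j y x *[B0.M'.F] ?E x y) = (\<Oplus>\<^bsub>B0.M'.F\<^esub>y\<in>X j. \<Oplus>\<^bsub>B0.M'.F\<^esub>x\<in>?X. D j y x *[B0.M'.F] ?E x y)"
   by (rule B0.M'.F.finsum_swap[OF finX finX], rule B0.M'.F.smult_closed, rule Submission.matD[OF matD]) (use E in auto)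
  have 4: "B0.M'.cg (\<Oplus>\<^bsub>B0.M'.F\<^esub>y\<in>X j. B0.M'.ge (?Az y) (lc Y ?X (D j y) c)) (\<Oplus>\<^bsub>B0.M'.F\<^esub>y\<in>X j. \<Oplus>\<^bsub>B0.M'.F\<^esub>x\<in>?X. D j y x *[B0.M'.F] ?E x y)"
   by (rule B0.M'.cgs(6), rule B0.M'.cg_lc_r[unfolded lc_def[of B0.M'.F]]) (use cP A0 matD[of j] finX in \<open>auto simp: mat_def\<close>)
  have 5: "lc Y ?X (D j y) c = \<zero>[Y]" if "y \<in> X j" for y using fun_cong[OF c0, of y] that by (simp add: mm_def)
  have "B0.M'.cg (\<Oplus>\<^bsub>B0.M'.F\<^esub>y\<in>X j. B0.M'.ge (?Az y) (lc Y ?X (D j y) c)) (\<Oplus>\<^bsub>B0.M'.F\<^esub>y\<in>X j. \<zero>[B0.M'.F])"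
   by (rule B0.M'.cgs(6)) (use 5 B0.M'.cg_zero_r A0 in auto)
  then have 6: "B0.M'.cg (\<Oplus>\<^bsub>B0.M'.F\<^esub>y\<in>X j. B0.M'.ge (?Az y) (lc Y ?X (D j y) c)) \<zero>[B0.M'.F]"
   by (simp only: B0.M'.F.M.finsum_zero)
  have "B0.M'.cg (B0.push ?z) \<zero>[B0.M'.F]"
   unfolding 1 by (rule B0.M'.cgs(2)[OF 2]) (unfold 3, rule B0.M'.cgs(2)[OF B0.M'.cgs(3)[OF 4] 6])
  then show ?thesis by (simp only: B0.M'.F.cm_zero[OF B0.M'.rel_sub])
 qed
 from hyp[OF z this] obtain w where w: "w \<in> carrier B1.F" "?z -[B0.F] B1.push w \<in> B0.rel" by blast
 \<comment> \<open>Defined so that \<open>?B i\<close> below is \<beta> tensored with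
   \<open>Y\<close>: the generator \<open>(p, y)\<close> goes to the vector of multiples of
   \<open>y\<close> by the entries of \<beta>(p).\<close>
 let ?G = "\<lambda>i (p, y). (\<lambda>x. \<beta> i p x *[Y] y)"
 have bR: "\<beta> i p x \<in> carrier R" if "p \<in> carrier (P i)" for i p x using pwR[OF lin_closed[OF b that]] .
 have G: "?G i \<in> carrier (P i) \<times> carrier Y \<rightarrow> vec Y (X i)" for i
  using bR pw0[OF lin_closed[OF b]] by (auto intro!: pwI)
 interpret PY: rmod R "pw Y (X i)" for i by (rule Y.rmod_pw)
 let ?B = "\<lambda>i. lext R (pw Y (X i)) (?G i)"
 have lB: "lin R (free_module_on R (carrier (P i) \<times> carrier Y)) (pw Y (X i)) (?B i)" for i
  by (rule lext_lin[OF Y.rmod_pw G])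
 have Bge: "?B i (free_gen R (p, y)) = (\<lambda>x. \<beta> i p x *[Y] y)" if "p \<in> carrier (P i)" "y \<in> carrier Y" for i p y
  using lext_gen[OF Y.rmod_pw, of "?G i" "(p, y)" "X i"] G[of i] that by (auto simp: Pi_def)
 let ?dY = "mm Y (X (Suc (Suc j))) (D (Suc j)) ?X"
 have ldY: "lin R (pw Y (X (Suc (Suc j)))) (pw Y ?X) ?dY" by (rule Y.mm_lin[OF finX matD])
 have Bz: "?B (Suc j) u = \<zero>[pw Y ?X]" if u: "u \<in> B0.rel" for u
 proof -
  have V: "submodule {\<zero>[pw Y ?X]} R (pw Y ?X)" by (rule PY.subI_comb) (auto simp del: pw_sel)
  have e: "rmod.cong_mod (pw Y ?X) {\<zero>[pw Y ?X]} s t" if "s \<in> vec Y ?X" "s = t" for s t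
   using PY.cm_refl[OF V] that by simp
  have "?B (Suc j) u \<in> {\<zero>[pw Y ?X]}"
  proof (rule B0.rel_kill[OF Y.rmod_pw V lB _ _ _ _ u])
   fix x x' y y' r assume x: "x \<in> carrier (P (Suc j))" and y: "y \<in> carrier Y"
   note ex = e[OF lin_closed[OF lB B0.ge_F]]
   show "PY.cong_mod (Suc j) {\<zero>[pw Y ?X]} (?B (Suc j) (B0.ge (x +[P (Suc j)] x') y)) (?B (Suc j) (B0.ge x y) +[pw Y ?X] ?B (Suc j) (B0.ge x' y))"
    if x': "x' \<in> carrier (P (Suc j))"
    by (rule ex) (simp_all add: x y x' Bge lin_add[OF b] bR Y.smult_l_distr)
   show "PY.cong_mod (Suc j) {\<zero>[pw Y ?X]} (?B (Suc j) (B0.ge x (y +[Y] y'))) (?B (Suc j) (B0.ge x y) +[pw Y ?X] ?B (Suc j) (B0.ge x y'))"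
    if y': "y' \<in> carrier Y"
    by (rule ex) (simp_all add: x y y' Bge bR Y.smult_r_distr)
   show "PY.cong_mod (Suc j) {\<zero>[pw Y ?X]} (?B (Suc j) (B0.ge (r *[P (Suc j)] x) y)) (r *[pw Y ?X] ?B (Suc j) (B0.ge x y))"
    if r: "r \<in> carrier R"
    by (rule ex) (simp_all add: x y r Bge lin_smult[OF b] bR Y.smult_assoc1)
   show "PY.cong_mod (Suc j) {\<zero>[pw Y ?X]} (?B (Suc j) (B0.ge x (r *[Y] y))) (r *[pw Y ?X] ?B (Suc j) (B0.ge x y))"
    if r: "r \<in> carrier R"
   proof (rule ex)
    have "\<beta> (Suc j) x i *[Y] (r *[Y] y) = r *[Y] (\<beta> (Suc j) x i *[Y] y)" for i
     using bR[OF x] r y by (simp add: Y.smult_assoc1[symmetric] m_comm)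
    then show "?B (Suc j) (B0.ge x (r *[Y] y)) = r *[pw Y ?X] ?B (Suc j) (B0.ge x y)" by (simp add: x y r Bge)
   qed (simp_all add: x y r)
  qed
  then show ?thesis by simp
 qed
 have lcomm: "?B (Suc j) (B1.push u) = ?dY (?B (Suc (Suc j)) u)" if u: "u \<in> carrier B1.F" for u
 proof -
  have hF: "(\<lambda>(x, y). free_gen R (d (Suc j) x, y)) \<in> carrier (P (Suc (Suc j))) \<times> carrier Y \<rightarrow> carrier B0.F"
   using B0.ge_F lin_closed[OF ld] by auto
  have "?B (Suc j) (B1.push u) = lext R (pw Y ?X) (\<lambda>q. ?B (Suc j) (case q of (x, y) => free_gen R (d (Suc j) x, y))) u"
   unfolding B1.push_def by (rule lin_lext[OF rmod_free Y.rmod_pw lB hF u])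
  also have "\<dots> = lext R (pw Y ?X) (\<lambda>q. ?dY (?G (Suc (Suc j)) q)) u"
  proof (rule lext_cong[OF Y.rmod_pw _ _ u])
   show "(\<lambda>q. ?dY (?G (Suc (Suc j)) q)) \<in> carrier (P (Suc (Suc j))) \<times> carrier Y \<rightarrow> vec Y ?X"
    using lin_closed[OF ldY] G by blast
   fix q assume "q \<in> carrier (P (Suc (Suc j))) \<times> carrier Y"
   then obtain p y where q: "q = (p, y)" "p \<in> carrier (P (Suc (Suc j)))" "y \<in> carrier Y" by auto
   have "\<beta> (Suc j) (d (Suc j) p) x *[Y] y = ?dY (\<lambda>x. \<beta> (Suc (Suc j)) p x *[Y] y) x" for x
   proof -
    have ly: "lin R rm Y (\<lambda>a. a *[Y] y)" by (rule linI) (auto simp: q Y.smult_l_distr Y.smult_assoc1)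
    have "(\<lambda>x. dT (Suc j) (\<beta> (Suc (Suc j)) p) x *[Y] y) = ?dY (\<lambda>x. \<beta> (Suc (Suc j)) p x *[Y] y)"
     by (rule lin_mm[OF rmod_rm Y ly matD]) (use bR q in auto)
    then show ?thesis using bc[OF q(2)] by metis
   qed
   then show "?B (Suc j) (case q of (x, y) => free_gen R (d (Suc j) x, y)) = ?dY (?G (Suc (Suc j)) q)"
    using Bge[OF lin_closed[OF ld q(2)] q(3)] q by auto
  qed
  also have "\<dots> = ?dY (?B (Suc (Suc j)) u)" by (rule lin_lext[OF Y.rmod_pw Y.rmod_pw ldY G u, symmetric])
  finally show ?thesis .
 qed
 let ?u = "?B (Suc (Suc j)) w"
 have u: "?u \<in> vec Y (X (Suc (Suc j)))" by (rule lin_closed[OF lB w(1)])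
 have "?B (Suc j) (?z -[B0.F] B1.push w) = ?B (Suc j) ?z -[pw Y ?X] ?dY ?u"
  using lin_minus[OF rmod_free Y.rmod_pw lB z lin_closed[OF B1.push_lin w(1)]] lcomm[OF w(1)] by simp
 then have "?B (Suc j) ?z -[pw Y ?X] ?dY ?u = \<zero>[pw Y ?X]" using Bz[OF w(2)] by simp
 then have Bzu: "?B (Suc j) ?z = ?dY ?u" by (rule PY.minus_eq_zeroD[OF lin_closed[OF lB z] lin_closed[OF ldY u]])
 let ?K = "\<lambda>k y x. k (free_gen R x) y"
 let ?BA = "?K (\<lambda>v. \<beta> (Suc j) (\<alpha> (Suc j) v))"
 have K: "mat R (X i') (X i) (?K k)" if "lin R (T i) (T i') k" for k i i'
  using lin_closed[OF that gen_pw] by (auto simp: mat_def intro: pwR)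
 have Bz2: "?B (Suc j) ?z x = lc Y ?X (?BA x) c" if x: "x \<in> ?X" for x
 proof -
  have "?B (Suc j) ?z = (\<Oplus>\<^bsub>pw Y ?X\<^esub>x'\<in>?X. ?B (Suc j) (B0.ge (?A x') (c x')))"
   by (rule lin_finsum[OF rmod_free Y.rmod_pw lB zF])
  moreover have ev: "lin R (pw Y ?X) Y (\<lambda>v. v x)" by (rule linI) (auto simp: x pwD)
  ultimately have "?B (Suc j) ?z x = (\<Oplus>\<^bsub>Y\<^esub>x'\<in>?X. ?B (Suc j) (B0.ge (?A x') (c x')) x)"
   using lin_finsum[OF Y.rmod_pw Y ev, of "\<lambda>x'. ?B (Suc j) (B0.ge (?A x') (c x'))" ?X] lin_closed[OF lB] zF by auto
  also have "\<dots> = lc Y ?X (?BA x) c" unfolding lc_def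
   by (rule Y.M.finsum_cong') (use A cP bR Bge in \<open>auto simp: Pi_def\<close>)
  finally show ?thesis .
 qed
 let ?h1 = "?K (h (Suc j))" and ?h0 = "?K (h j)"
 let ?u' = "mm Y ?X ?h1 (X (Suc (Suc j))) c"
 have u': "?u' \<in> vec Y (X (Suc (Suc j)))" by (rule Y.mm_closed[OF K[OF h] cP])
 have "c = ?dY (?u -[pw Y (X (Suc (Suc j)))] ?u')"
 proof (rule pw_ext[OF c])
  show "?dY (?u -[pw Y (X (Suc (Suc j)))] ?u') \<in> vec Y ?X"
   by (rule lin_closed[OF ldY PY.M.minus_closed[OF u u']])
  fix x assume x: "x \<in> ?X"
  let ?p = "\<lambda>x'. \<beta> (Suc j) (?A x') x" and ?q = "\<lambda>x'. mmul R (X (Suc (Suc j))) (D (Suc j)) ?h1 x x'" and ?r = "\<lambda>x'. mmul R (X j) ?h0 (D j) x x'"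
  have cl: "?p x' \<in> carrier R" "?q x' \<in> carrier R" "?r x' \<in> carrier R" if "x' \<in> ?X" for x'
   using bR A that mmul_closed[OF matD K[OF h] x that] mmul_closed[OF K[OF h] matD x that] by (auto simp: Pi_def)
  \<comment> \<open>The homotopy identity at the basis vector \<open>x'\<close>, in entry
    \<open>x\<close>: the unit matrix is the matrix of \<beta>\<alpha> minus those of dh and hd.
    Applied to \<open>c\<close>, the last one contributes nothing since \<open>c\<close> is a
    cycle.\<close>
  have ent: "free_gen R x' x = ?p x' \<oplus> \<ominus> (?q x' \<oplus> ?r x')" if x': "x' \<in> ?X" for x'
  proof -
   note g = gen_pw[OF x']
   have c1: "\<beta> (Suc j) (?A x') \<in> carrier (T (Suc j))" using lin_closed[OF b lin_closed[OF a g]] .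
   have c2: "dT (Suc j) (h (Suc j) (free_gen R x')) \<in> carrier (T (Suc j))" using lin_closed[OF lp lin_closed[OF h g]] .
   have c3: "h j (dT j (free_gen R x')) \<in> carrier (T (Suc j))" using lin_closed[OF h lin_closed[OF lp g]] .
   have q: "dT (Suc j) (h (Suc j) (free_gen R x')) x = ?q x'" using x by (simp add: mm_def mmul_def lc_rm)
   have "h j (dT j (free_gen R x')) = lc (T (Suc j)) (X j) (dT j (free_gen R x')) (\<lambda>y. h j (free_gen R y))"
    by (rule lin_free_lc[OF mT finX h lin_closed[OF lp g]])
   then have "h j (dT j (free_gen R x')) x = lc rm (X j) (dT j (free_gen R x')) (\<lambda>y. h j (free_gen R y) x)"
    using rm.pw_lc[of "dT j (free_gen R x')" "X j" "\<lambda>y. h j (free_gen R y)" ?X x] x lin_closed[OF h gen_pw] lin_closed[OF lp g] by auto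
   also have "\<dots> = (\<Oplus>y\<in>X j. h j (free_gen R y) x \<otimes> D j y x')" unfolding lc_rm
    by (rule finsum_cong') (use matD[of j] x' K[OF h, of j] x in \<open>auto simp: mm_gen[OF finX matD x'] mat_def m_comm\<close>)
   finally have r: "h j (dT j (free_gen R x')) x = ?r x'" by (simp add: mmul_def)
   have "free_gen R x' x = (\<beta> (Suc j) (?A x') -[T (Suc j)] (dT (Suc j) (h (Suc j) (free_gen R x')) +[T (Suc j)] h j (dT j (free_gen R x')))) x"
    using hc[OF g] by metis
   also have "\<dots> = \<beta> (Suc j) (?A x') x \<ominus> (dT (Suc j) (h (Suc j) (free_gen R x')) x \<oplus> h j (dT j (free_gen R x')) x)"
    using rm.pw_minus[OF c1 T.M.add.m_closed[OF c2 c3]] by (simp add: rm_minus)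
   finally show ?thesis unfolding q r by (simp add: a_minus_def)
  qed
  have "c x = lc Y ?X (free_gen R x) c" by (rule Y.lc_gen[OF finX x cP, symmetric])
  also have "\<dots> = lc Y ?X (\<lambda>x'. ?p x' \<oplus> \<ominus> (?q x' \<oplus> ?r x')) c"
  proof (rule Y.lc_cong)
   show "free_gen R x x' = ?p x' \<oplus> \<ominus> (?q x' \<oplus> ?r x')" if "x' \<in> ?X" for x'
   proof -
    have "free_gen R x x' = free_gen R x' x" by (auto simp: free_gen_def)
    then show ?thesis using ent[OF that] by (rule trans)
   qed
  qed (use cl cP in auto)
  also have "\<dots> = lc Y ?X ?p c +[Y] lc Y ?X (\<lambda>x'. (\<ominus> \<one>) \<otimes> (?q x' \<oplus> ?r x')) c"
  proof -
   have "lc Y ?X (\<lambda>x'. ?p x' \<oplus> \<ominus> (?q x' \<oplus> ?r x')) c = lc Y ?X ?p c +[Y] lc Y ?X (\<lambda>x'. \<ominus> (?q x' \<oplus> ?r x')) c"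
    by (rule Y.lc_add_l) (use cl cP in auto)
   also have "lc Y ?X (\<lambda>x'. \<ominus> (?q x' \<oplus> ?r x')) c = lc Y ?X (\<lambda>x'. (\<ominus> \<one>) \<otimes> (?q x' \<oplus> ?r x')) c"
    by (rule Y.lc_cong) (use cl cP in \<open>auto simp: l_minus\<close>)
   finally show ?thesis .
  qed
  also have "lc Y ?X (\<lambda>x'. (\<ominus> \<one>) \<otimes> (?q x' \<oplus> ?r x')) c = (\<ominus> \<one>) *[Y] lc Y ?X (\<lambda>x'. ?q x' \<oplus> ?r x') c"
   by (rule Y.lc_smult_l[OF finX]) (use cl cP in auto)
  also have "lc Y ?X (\<lambda>x'. ?q x' \<oplus> ?r x') c = lc Y ?X ?q c +[Y] lc Y ?X ?r c" by (rule Y.lc_add_l) (use cl cP in auto)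
  also have "lc Y ?X ?q c = ?dY ?u' x"
  proof -
   have "?dY ?u' = mm Y ?X (mmul R (X (Suc (Suc j))) (D (Suc j)) ?h1) ?X c" by (rule Y.mm_mm[OF finX finX K[OF h] matD cP])
   then have "?dY ?u' x = mm Y ?X (mmul R (X (Suc (Suc j))) (D (Suc j)) ?h1) ?X c x" by (rule fun_cong)
   then show ?thesis using x by (simp add: mm_def)
  qed
  also have "lc Y ?X ?r c = \<zero>[Y]"
  proof -
   have "lc Y ?X ?r c = mm Y (X j) ?h0 ?X (mm Y ?X (D j) (X j) c) x"
   proof -
    have "mm Y (X j) ?h0 ?X (mm Y ?X (D j) (X j) c) = mm Y ?X (mmul R (X j) ?h0 (D j)) ?X c" by (rule Y.mm_mm[OF finX finX matD K[OF h] cP])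
    then have "mm Y (X j) ?h0 ?X (mm Y ?X (D j) (X j) c) x = mm Y ?X (mmul R (X j) ?h0 (D j)) ?X c x" by (rule fun_cong)
    then show ?thesis using x by (simp add: mm_def)
   qed
   then show ?thesis unfolding c0 Y.mm_zero[OF K[OF h]] .
  qed
  also have "lc Y ?X ?p c = ?dY ?u x" using Bz2[OF x, unfolded Bzu] by (rule sym)
  also have "?dY ?u x +[Y] (\<ominus> \<one>) *[Y] (?dY ?u' x +[Y] \<zero>[Y]) = ?dY ?u x -[Y] ?dY ?u' x"
   using Y.pw_all[OF lin_closed[OF ldY u']] by (simp add: Y.smult_l_minus a_minus_def)
  also have "\<dots> = ?dY (?u -[pw Y (X (Suc (Suc j)))] ?u') x"
   unfolding lin_minus[OF Y.rmod_pw Y.rmod_pw ldY u u'] Y.pw_minus[OF lin_closed[OF ldY u] lin_closed[OF ldY u']] ..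
  finally show "c x = ?dY (?u -[pw Y (X (Suc (Suc j)))] ?u') x" .
 qed
 then show "\<exists>w\<in>vec Y (X (Suc (Suc j))). c = ?dY w" using PY.M.minus_closed[OF u u'] by blast
qed

end

context lnr begin

lemma tor_zero_exact:
 assumes H: "rmod R H" and fin: "finite_module R H" and r: "res_of R H X g D" and Y: "rmod R Y"
  and 0: "zero_module (tor_module R (Suc j) H Y)"
 shows "exa Y X D j"
proof -
 obtain P d where ch: "chosen_resolution R H = (P, d)" by (cases "chosen_resolution R H")
 obtain \<epsilon> where pr: "proj_resolution R H P d \<epsilon>" by (rule chosen_resolution_proj[OF H fin ch])
 interpret comparison R H P d \<epsilon> X g D by (intro comparison.intro comparison_axioms.intro crng_axioms H pr r)
 interpret B0: bimod_map R "P (Suc j)" Y "P j" "d j"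
  by (intro bimod_map.intro bimod.intro bimod_axioms.intro bimod_map_axioms.intro crng_axioms mP Y ld)
 interpret B1: bimod_map R "P (Suc (Suc j))" Y "P (Suc j)" "d (Suc j)"
  by (intro bimod_map.intro bimod.intro bimod_axioms.intro bimod_map_axioms.intro crng_axioms mP Y ld)
 let ?C = "\<lambda>n. tensor_module R (P n) Y"
 let ?\<delta> = "\<lambda>n. tensor_map R (P (Suc n)) Y (d n) (P n)"
 let ?Q = "(?C (Suc j))\<lparr>carrier := lin_kernel (?C (Suc j)) (?C j) (?\<delta> j)\<rparr>"
 have 1: "zero_module (quot_module ?Q (?\<delta> (Suc j) ` carrier (?C (Suc (Suc j)))))"
  using 0 unfolding tor_module_def ch by simp
 show ?thesis
 proof (rule tor_exact[OF Y])
  fix z assume z: "z \<in> carrier B0.F" and pz: "B0.push z \<in> B0.M'.rel"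
  let ?t = "B0.rel +>\<^bsub>B0.F\<^esub> z"
  have "?t \<in> ?\<delta> (Suc j) ` carrier (?C (Suc (Suc j)))"
  proof (rule zero_quotD[OF 1])
   have "?\<delta> j ?t = B0.M'.rel +>\<^bsub>B0.M'.F\<^esub> B0.push z" by (rule B0.tensor_map_coset[OF z])
   also have "\<dots> = B0.M'.rel"
    using B0.M'.F.coset_eq_iff[OF B0.M'.rel_sub lin_closed[OF B0.push_lin z]] pz by simp
   finally show "?t \<in> carrier ?Q" using z by (auto simp: lin_kernel_def B0.tensor_sel B0.M'.tensor_sel)
   have z1: "\<zero>[B1.F] \<in> carrier B1.F" by (rule B1.F.M.zero_closed)
   have "?\<delta> (Suc j) (B1.rel +>\<^bsub>B1.F\<^esub> \<zero>[B1.F]) = B0.rel +>\<^bsub>B0.F\<^esub> B1.push \<zero>[B1.F]" by (rule B1.tensor_map_coset[OF z1])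
   also have "B1.push \<zero>[B1.F] = \<zero>[B0.F]" by (rule lin_zero[OF rmod_free rmod_free B1.push_lin])
   also have "B0.rel +>\<^bsub>B0.F\<^esub> \<zero>[B0.F] = B0.rel"
    using B0.F.coset_eq_iff[OF B0.rel_sub B0.F.M.zero_closed] B0.F.sub_zero[OF B0.rel_sub] by simp
   finally have "B0.rel = ?\<delta> (Suc j) (B1.rel +>\<^bsub>B1.F\<^esub> \<zero>[B1.F])" ..
   moreover have "B1.rel +>\<^bsub>B1.F\<^esub> \<zero>[B1.F] \<in> carrier (?C (Suc (Suc j)))" using z1 by (auto simp: B1.tensor_sel)
   ultimately have "B0.rel \<in> ?\<delta> (Suc j) ` carrier (?C (Suc (Suc j)))" by (rule image_eqI)
   then show "\<zero>[?Q] \<in> ?\<delta> (Suc j) ` carrier (?C (Suc (Suc j)))" by (simp add: B0.tensor_sel)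
   show "\<zero>[?Q] +[?Q] ?t = ?t" using B0.tensor_zero_add[OF z] by (simp add: B0.tensor_sel)
  qed
  then obtain s where s: "s \<in> carrier (?C (Suc (Suc j)))" "?t = ?\<delta> (Suc j) s" by blast
  then obtain w where w: "w \<in> carrier B1.F" "s = B1.rel +>\<^bsub>B1.F\<^esub> w" by (auto simp: B1.tensor_sel)
  have "z \<in> ?t" by (rule B0.F.coset_self[OF B0.rel_sub z])
  then have "z \<in> B0.rel +>\<^bsub>B0.F\<^esub> B1.push w" using s(2) B1.tensor_map_coset[OF w(1)] w(2) by simp
  then have "B0.cg z (B1.push w)" by (rule B0.F.coset_cm[OF B0.rel_sub z lin_closed[OF B1.push_lin w(1)]])
  then show "\<exists>w\<in>carrier B1.F. z -[B0.F] B1.push w \<in> B0.rel" using w(1) by (auto simp: B0.F.cong_mod_def)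
 qed
qed

end

section \<open>The binomial formula, for the additivity of Frobenius\<close>

context crng begin

abbreviation np :: "nat => 'a => 'a" where "np n x \<equiv> add_pow R n x"

lemma binomial:
 assumes x: "x \<in> carrier R" and y: "y \<in> carrier R"
 shows "(x \<oplus> y) [^] (n::nat) = (\<Oplus>k\<in>{..n}. np (n choose k) ((x [^] k \<otimes> y [^] (n - k))))"
proof (induct n)
 case 0 show ?case using x y by simp
next
 case (Suc n)
 let ?t = "\<lambda>n k. x [^] (k::nat) \<otimes> y [^] (n - k)"
 have tc: "?t m k \<in> carrier R" for m k using x y by simp
 have pc: "np (c) (?t m k) \<in> carrier R" for c :: nat and m k using tc by simp
 have a: "(\<Oplus>k\<in>{..n}. np (n choose k) (?t n k)) \<otimes> y = (\<Oplus>k\<in>{..n}. np (n choose k) (?t (Suc n) k))"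
 proof -
  have "(\<Oplus>k\<in>{..n}. np (n choose k) (?t n k)) \<otimes> y = (\<Oplus>k\<in>{..n}. (np (n choose k) (?t n k)) \<otimes> y)"
   using x y y by (intro finsum_ldistr) auto
  also have "\<dots> = (\<Oplus>k\<in>{..n}. np (n choose k) (?t (Suc n) k))"
   using x y pc by (intro finsum_cong') (auto simp: add_pow_ldistr m_assoc Suc_diff_le)
  finally show ?thesis .
 qed
 have b: "(\<Oplus>k\<in>{..n}. np (n choose k) (?t n k)) \<otimes> x = (\<Oplus>k\<in>{..n}. np (n choose k) (?t (Suc n) (Suc k)))"
 proof -
  have "(\<Oplus>k\<in>{..n}. np (n choose k) (?t n k)) \<otimes> x = (\<Oplus>k\<in>{..n}. (np (n choose k) (?t n k)) \<otimes> x)"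
   using x y x by (intro finsum_ldistr) auto
  also have "\<dots> = (\<Oplus>k\<in>{..n}. np (n choose k) (?t (Suc n) (Suc k)))"
  proof (rule finsum_cong')
   show "(np (n choose k) (?t n k)) \<otimes> x = np (n choose k) (?t (Suc n) (Suc k))" for k
    using x y by (simp add: add_pow_ldistr add_pow_rdistr m_ac)
  qed (use x y in auto)
  finally show ?thesis .
 qed
 have "(x \<oplus> y) [^] Suc n = (\<Oplus>k\<in>{..n}. np (n choose k) (?t (Suc n) (Suc k))) \<oplus> (\<Oplus>k\<in>{..n}. np (n choose k) (?t (Suc n) k))"
  using Suc x y a b pc by (simp add: r_distr finsum_closed Pi_def)
 also have "(\<Oplus>k\<in>{..n}. np (n choose k) (?t (Suc n) k)) = (\<Oplus>k\<in>{..n}. np (n choose Suc k) (?t (Suc n) (Suc k))) \<oplus> np ((1::nat)) (?t (Suc n) 0)"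
 proof -
  have "(\<Oplus>k\<in>{..n}. np (n choose k) (?t (Suc n) k)) = (\<Oplus>k\<in>{..Suc n}. np (n choose k) (?t (Suc n) k))"
   using x y by (subst finsum_Suc) (auto simp: binomial_eq_0 intro!: finsum_closed)
  also have "\<dots> = (\<Oplus>k\<in>{..n}. np (n choose Suc k) (?t (Suc n) (Suc k))) \<oplus> np (n choose 0) (?t (Suc n) 0)"
   using x y by (intro finsum_Suc2) auto
  finally show ?thesis by simp
 qed
 also have "(\<Oplus>k\<in>{..n}. np (n choose k) (?t (Suc n) (Suc k))) \<oplus> ((\<Oplus>k\<in>{..n}. np (n choose Suc k) (?t (Suc n) (Suc k))) \<oplus> np ((1::nat)) (?t (Suc n) 0))
   = (\<Oplus>k\<in>{..n}. np (Suc n choose Suc k) (?t (Suc n) (Suc k))) \<oplus> np (Suc n choose 0) (?t (Suc n) 0)"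
 proof -
  have "(\<Oplus>k\<in>{..n}. np (Suc n choose Suc k) (?t (Suc n) (Suc k))) = (\<Oplus>k\<in>{..n}. np (n choose k) (?t (Suc n) (Suc k)) \<oplus> np (n choose Suc k) (?t (Suc n) (Suc k)))"
   using x y by (intro finsum_cong') (auto simp: add.nat_pow_mult)
  also have "\<dots> = (\<Oplus>k\<in>{..n}. np (n choose k) (?t (Suc n) (Suc k))) \<oplus> (\<Oplus>k\<in>{..n}. np (n choose Suc k) (?t (Suc n) (Suc k)))"
   using x y by (intro finsum_addf) auto
  finally show ?thesis using x y tc by (simp add: a_assoc finsum_closed Pi_def)
 qed
 also have "\<dots> = (\<Oplus>k\<in>{..Suc n}. np (Suc n choose k) (?t (Suc n) k))"
  using x y by (intro finsum_Suc2[symmetric]) auto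
 finally show ?case .
qed

end

lemma prime_dvd_choose:
 assumes "0 < k" "k < p" "Factorial_Ring.prime p" shows "p dvd (p choose k)"
proof -
 have "p dvd k * (p choose k)" using times_binomial_minus1_eq[OF assms(1), of p] by simp
 then show ?thesis using assms by (auto dest: dvd_imp_le simp: prime_dvd_mult_iff)
qed

section \<open>Frobenius powers\<close>

locale char_ring = crng R for R :: "'a ring" (structure) + fixes p :: nat
 assumes prime: "Factorial_Ring.prime p" and char: "has_char R p"
begin

lemma p_mult: "x \<in> carrier R ==> p dvd n ==> np (n) (x) = \<zero>"
proof -
 assume x: "x \<in> carrier R" and n: "p dvd n"
 have "np (n) (x) = np (n) ((\<one> \<otimes> x))" using x by simp
 also have "\<dots> = (np (n) (\<one>)) \<otimes> x" using x by (simp add: add_pow_ldistr)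
 also have "np n \<one> = \<zero>" using char n by (simp add: has_char_def)
 finally show ?thesis using x by simp
qed

lemma frob_add: "x \<in> carrier R ==> y \<in> carrier R ==> (x \<oplus> y) [^] p = x [^] p \<oplus> y [^] p"
proof -
 assume x: "x \<in> carrier R" and y: "y \<in> carrier R"
 have p0: "p > 0" using prime by (rule prime_gt_0_nat)
 then obtain q where q: "p = Suc q" by (cases p) auto
 let ?f = "\<lambda>k. np (p choose k) ((x [^] k \<otimes> y [^] (p - k)))"
 have fc: "?f k \<in> carrier R" for k using x y by simp
 have z: "?f k = \<zero>" if "0 < k" "k < p" for k
  using p_mult[of "x [^] k \<otimes> y [^] (p - k)" "p choose k"] prime_dvd_choose[OF that prime] x y by simp
 have "(x \<oplus> y) [^] p = (\<Oplus>k\<in>{..p}. ?f k)" by (rule binomial[OF x y])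
 also have "\<dots> = (\<Oplus>k\<in>{0,p}. ?f k)"
  by (rule add.finprod_mono_neutral_cong_right) (use fc z in auto)
 also have "\<dots> = ?f 0 \<oplus> ?f p" using p0 x y by (subst finsum_insert) (auto simp: Pi_def)
 also have "\<dots> = x [^] p \<oplus> y [^] p" using x y by (simp add: a_comm)
 finally show ?thesis .
qed

lemma frob_add_pow: "x \<in> carrier R ==> y \<in> carrier R ==> (x \<oplus> y) [^] (p ^ e) = x [^] (p ^ e) \<oplus> y [^] (p ^ e)"
proof (induct e)
 case (Suc e)
 have "(x \<oplus> y) [^] (p ^ e * p) = ((x \<oplus> y) [^] (p ^ e)) [^] p" using Suc(2,3) by (simp add: nat_pow_pow)
 also have "\<dots> = (x [^] (p ^ e)) [^] p \<oplus> (y [^] (p ^ e)) [^] p" using Suc by (simp add: frob_add)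
 finally show ?case using Suc by (simp add: nat_pow_pow mult.commute)
qed simp

lemma frob_sel: "carrier (frobenius_module R p e) = carrier R" "\<zero>[frobenius_module R p e] = \<zero>"
 "x +[frobenius_module R p e] y = x \<oplus> y" "a *[frobenius_module R p e] x = a [^] (p ^ e) \<otimes> x"
 by (simp_all add: frobenius_module_def ring_module_def)

lemma frob_finsum: "finsum (frobenius_module R p e) f X = finsum R f X"
 by (simp add: finsum_def finprod_def frobenius_module_def ring_module_def)

lemma rmod_frob: "rmod R (frobenius_module R p e)"
proof (rule rmodI)
 show "cring R" ..
 show "abelian_group (frobenius_module R p e)"
 proof (rule abelian_groupI)
  fix x assume "x \<in> carrier (frobenius_module R p e)"
  then show "\<exists>y\<in>carrier (frobenius_module R p e). y +[frobenius_module R p e] x = \<zero>[frobenius_module R p e]"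
   by (intro bexI[of _ "\<ominus> x"]) (simp_all add: l_neg frob_sel)
 qed (simp_all add: frob_sel a_ac)
qed (simp_all add: frob_sel frob_add_pow l_distr r_distr nat_pow_distrib m_assoc)

lemma mm_frob:
 assumes "finite X" "mat R Y X D" "v \<in> X \<rightarrow> carrier R"
 shows "mm (frobenius_module R p e) X D Y v = mm rm X (\<lambda>y x. D y x [^] (p ^ e)) Y v"
 by (auto simp: mm_def lc_def frob_finsum frob_sel rm_finsum)

lemma pw_frob: "vec (frobenius_module R p e) X = vec rm X"
 by (simp add: pw_def frob_sel)

text \<open>Vectors over R^(e) are vectors over R, and scalars act through their powers, so
  coefficients in R^(e) amount to raising all matrix entries to the power \<open>p ^ e\<close>.
  Through this, vanishing of Ext or Tor becomes a statement on matrices over R.\<close>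

lemma exat_frob:
 assumes "finite X" "finite Y" "mat R Y X D" "mat R Z Y E"
 shows "exat (frobenius_module R p e) X D Y E Z \<longleftrightarrow> exat rm X (\<lambda>y x. D y x [^] (p ^ e)) Y (\<lambda>y x. E y x [^] (p ^ e)) Z"
 unfolding exat_def pw_frob using assms by (simp add: mm_frob frob_sel)

end

context crng begin

abbreviation dot :: "'x set => ('x => 'a) => ('x => 'a) => 'a" where "dot X v w \<equiv> lc rm X v w"

lemma dot_closed[simp]: "v \<in> X \<rightarrow> carrier R ==> w \<in> X \<rightarrow> carrier R ==> dot X v w \<in> carrier R"
 using rmod.lc_closed[OF rmod_rm, of v X w] by simp

text \<open>Gaussian elimination, pivoting on entries outside the prime \<open>p\<close>.\<close>

lemma pivot:
 assumes p: "primeideal p R"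
 shows "finite X ==> submodule U R (pw rm X) ==>
  (\<exists>s\<in>carrier R - p. \<forall>v\<in>vec rm X. s *[pw rm X] v \<in> U) \<or>
  (\<exists>v\<in>vec rm X. (\<exists>x\<in>X. v x \<notin> p) \<and> (\<forall>u\<in>U. dot X v u \<in> p))"
proof (induct X arbitrary: U rule: finite_induct)
 interpret p: primeideal p R by (rule p)
 interpret rm: rmod R rm by (rule rmod_rm)
 have "\<one> \<in> carrier R - p" using p.I_notcarr p.one_imp_carrier by auto
 { case empty
  interpret P: rmod R "pw rm {}" by (rule rm.rmod_pw)
  have "v \<in> U" if "v \<in> vec rm {}" for v
   using P.sub_zero[OF empty] pw_ext[OF that P.M.zero_closed] by simp
  then show ?case using \<open>\<one> \<in> carrier R - p\<close> by (intro disjI1 bexI[of _ \<one>]) (auto simp del: pw_sel intro: P.smult_closed) }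
 case (insert k X)
 interpret P: rmod R "pw rm (insert k X)" by (rule rm.rmod_pw)
 interpret P': rmod R "pw rm X" by (rule rm.rmod_pw)
 note U = \<open>submodule U R (pw rm (insert k X))\<close>
 have Uc: "u \<in> vec rm (insert k X)" if "u \<in> U" for u by (rule P.sub_car[OF U that])
 have UR: "u x \<in> carrier R" if "u \<in> U" for u x by (rule pwR[OF Uc[OF that]])
 have dotins: "dot (insert k X) v u = v k \<otimes> u k \<oplus> dot X v u" if "\<And>x. v x \<in> carrier R" "\<And>x. u x \<in> carrier R" for v u
  using rm.lc_insert[OF insert(1,2), of v u] that by simp
 show ?case
 proof (cases "\<forall>u\<in>U. u k \<in> p")
  case True
  have g: "free_gen R k \<in> vec rm (insert k X)" by (rule gen_pw) simp
  have "dot (insert k X) (free_gen R k) u \<in> p" if "u \<in> U" for u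
   using rm.lc_gen[of "insert k X" k u] insert(1) UR[OF that] True that by simp
  moreover have "free_gen R k k \<notin> p" using \<open>\<one> \<in> carrier R - p\<close> by (simp add: free_gen_def)
  ultimately show ?thesis using g by blast
 next
  case False
  then obtain u where u: "u \<in> U" "u k \<notin> p" by blast
  let ?c = "u k"
  have c: "?c \<in> carrier R" by (rule UR[OF u(1)])
  let ?U = "{w \<in> vec rm X. w \<in> U}"
  have U': "submodule ?U R (pw rm X)"
   by (rule P'.subI_comb) (use P.sub_zero[OF U] P.sub_add[OF U] P.sub_smult[OF U] P'.M.zero_closed P'.M.add.m_closed P'.smult_closed in auto)
  \<comment> \<open>Clears the entry at \<open>k\<close> with the pivot \<open>?c\<close>, by
    cross-multiplication instead of division.\<close>
  have red: "(\<lambda>x. ?c \<otimes> w x \<ominus> w k \<otimes> u x) \<in> vec rm X" "(\<lambda>x. ?c \<otimes> w x \<ominus> w k \<otimes> u x) = ?c *[pw rm (insert k X)] w -[pw rm (insert k X)] w k *[pw rm (insert k X)] u"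
   if w: "w \<in> vec rm (insert k X)" for w
  proof -
   have wR: "w x \<in> carrier R" for x by (rule pwR[OF w])
   show "(\<lambda>x. ?c \<otimes> w x \<ominus> w k \<otimes> u x) = ?c *[pw rm (insert k X)] w -[pw rm (insert k X)] w k *[pw rm (insert k X)] u"
    unfolding rm.pw_minus[OF P.smult_closed[OF c w] P.smult_closed[OF wR Uc[OF u(1)]]] by (simp add: rm_minus)
   show "(\<lambda>x. ?c \<otimes> w x \<ominus> w k \<otimes> u x) \<in> vec rm X"
   proof (rule pwI)
    fix x assume "x \<notin> X"
    then have "x = k \<or> x \<notin> insert k X" by blast
    then show "?c \<otimes> w x \<ominus> w k \<otimes> u x = \<zero>[rm]"
     using c wR UR[OF u(1)] pw0[OF w, of x] pw0[OF Uc[OF u(1)], of x] by (auto simp: a_minus_def m_comm r_neg)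
   qed (use c wR UR[OF u(1)] in simp)
  qed
  from insert(3)[OF U'] show ?thesis
  proof
   assume "\<exists>s\<in>carrier R - p. \<forall>v\<in>vec rm X. s *[pw rm X] v \<in> ?U"
   then obtain s where s: "s \<in> carrier R" "s \<notin> p" "\<And>v. v \<in> vec rm X ==> (\<lambda>x. s \<otimes> v x) \<in> U" by auto
   have "(s \<otimes> ?c) *[pw rm (insert k X)] w \<in> U" if w: "w \<in> vec rm (insert k X)" for w
   proof -
    have wR: "w x \<in> carrier R" for x by (rule pwR[OF w])
    have 1: "(\<lambda>x. s \<otimes> (?c \<otimes> w x \<ominus> w k \<otimes> u x)) \<in> U" by (rule s(3)[OF red(1)[OF w]])
    have 2: "(s \<otimes> w k) *[pw rm (insert k X)] u \<in> U" by (rule P.sub_smult[OF U _ u(1)]) (use s wR in simp)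
    have "(\<lambda>x. s \<otimes> (?c \<otimes> w x \<ominus> w k \<otimes> u x)) +[pw rm (insert k X)] (s \<otimes> w k) *[pw rm (insert k X)] u = (s \<otimes> ?c) *[pw rm (insert k X)] w"
     using s(1) c wR UR[OF u(1)] by (auto simp: a_minus_def r_distr r_minus m_assoc a_assoc l_neg)
    then show ?thesis using P.sub_add[OF U 1 2] by simp
   qed
   moreover have "s \<otimes> ?c \<in> carrier R - p" using s c u(2) p.I_prime by auto
   ultimately show ?thesis by blast
  next
   assume "\<exists>v\<in>vec rm X. (\<exists>x\<in>X. v x \<notin> p) \<and> (\<forall>u\<in>?U. dot X v u \<in> p)"
   then obtain v x0 where v: "v \<in> vec rm X" "x0 \<in> X" "v x0 \<notin> p" "\<And>u. u \<in> ?U ==> dot X v u \<in> p" by blast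
   have vR: "v x \<in> carrier R" for x by (rule pwR[OF v(1)])
   let ?d = "dot X v u"
   have d: "?d \<in> carrier R" using vR UR[OF u(1)] by simp
   \<comment> \<open>The entry at \<open>k\<close> is chosen so that this form vanishes on
     \<open>u\<close>; the factor \<open>?c\<close>, being outside the prime, keeps the entry at
     \<open>x0\<close> outside it.\<close>
   let ?v = "\<lambda>x. if x = k then \<ominus> ?d else ?c \<otimes> v x"
   have v'R: "?v x \<in> carrier R" for x using vR c d by simp
   have v': "?v \<in> vec rm (insert k X)" by (rule pwI) (use v'R pw0[OF v(1)] c in auto)
   have dv: "dot (insert k X) ?v w = \<ominus> ?d \<otimes> w k \<oplus> ?c \<otimes> dot X v w" if wR: "\<And>x. w x \<in> carrier R" for w
   proof -
    have "dot X ?v w = dot X (\<lambda>x. ?c \<otimes> v x) w" by (rule rm.lc_cong) (use insert(2) c vR wR in auto)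
    also have "\<dots> = ?c \<otimes> dot X v w" using rm.lc_smult_l[OF insert(1) c, of v w] vR wR by simp
    finally show ?thesis using dotins[of ?v w] v'R wR by simp
   qed
   have "dot (insert k X) ?v w \<in> p" if w: "w \<in> U" for w
   proof -
    note wR = UR[OF w]
    have "(\<lambda>x. ?c \<otimes> w x \<ominus> w k \<otimes> u x) \<in> ?U"
     using red[OF Uc[OF w]] P.sub_minus[OF U P.sub_smult[OF U c w] P.sub_smult[OF U wR[of k] u(1)]] by simp
    then have "dot X v (\<lambda>x. ?c \<otimes> w x \<ominus> w k \<otimes> u x) \<in> p" by (rule v(4))
    moreover have "dot X v (\<lambda>x. ?c \<otimes> w x \<ominus> w k \<otimes> u x) = ?c \<otimes> dot X v w \<oplus> (\<ominus> w k) \<otimes> ?d"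
    proof -
     have "dot X v (\<lambda>x. ?c \<otimes> w x \<ominus> w k \<otimes> u x) = dot X v (\<lambda>x. ?c \<otimes> w x \<oplus> (\<ominus> w k) \<otimes> u x)"
      by (rule rm.lc_cong) (use vR wR c UR[OF u(1)] in \<open>auto simp: a_minus_def l_minus\<close>)
     also have "\<dots> = dot X v (\<lambda>x. ?c \<otimes> w x) \<oplus> dot X v (\<lambda>x. (\<ominus> w k) \<otimes> u x)"
      using rm.lc_add_r[of v X "\<lambda>x. (\<ominus> w k) \<otimes> u x" "\<lambda>x. ?c \<otimes> w x"] vR wR c UR[OF u(1)] by simp
     finally show ?thesis
      using rm.lc_smult_r[OF insert(1) c, of v w] rm.lc_smult_r[OF insert(1), of "\<ominus> w k" v u] vR wR UR[OF u(1)] by simp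
    qed
    moreover have "?c \<otimes> dot X v w \<oplus> (\<ominus> w k) \<otimes> ?d = dot (insert k X) ?v w"
     using dv[OF wR] c d wR vR by (simp add: l_minus r_minus m_comm a_comm)
    ultimately show ?thesis by simp
   qed
   moreover have "?v x0 \<notin> p" using v(2,3) insert(2) p.I_prime[OF c vR[of x0]] u(2) by auto
   ultimately show ?thesis using v' v(2) by (intro disjI2 bexI[OF _ v'] conjI bexI[of _ x0] ballI) auto
  qed
 qed
qed

end

context lnr begin

text \<open>The entries of \<open>D\<close> lie in \<open>mx\<close>, which multiplies
  \<open>u\<close> into (xs), so u e_x is a cycle modulo \<open>xs\<close>. Of the
  \<open>t + 1\<close> exact places one is left modulo \<open>xs\<close>, and there u e_x is
  congruent to a boundary; the entry of that boundary at \<open>x\<close> is a combination of high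
  powers of nonunits and lies in \<open>Q\<close>, which would put \<open>u\<close> into
  \<open>Q\<close>.\<close>

lemma koh_lee:
 fixes X :: "nat => 'x set"
 assumes d: "depth R rm = enat t"
  and X: "\<And>j. finite (X j)" and D: "\<And>j. mat R (X j) (X (Suc j)) (D j)"
  and min: "\<And>j y x. y \<in> X j ==> x \<in> X (Suc j) ==> D j y x \<in> mx"
  and inf: "infinite S" and ex: "\<And>q j. q \<in> S ==> j \<le> t ==>
   exat rm (X (Suc (Suc j))) (\<lambda>y x. D (Suc j) y x [^] (q::nat)) (X (Suc j)) (\<lambda>y x. D j y x [^] q) (X j)"
 shows "X (Suc t) = {}"
proof (rule ccontr)
 interpret rm: rmod R rm by (rule rmod_rm)
 assume "X (Suc t) \<noteq> {}"
 then obtain x where x: "x \<in> X (Suc t)" by blast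
 obtain xs u where xs: "length xs = t" "wreg R rm xs" and u: "u \<in> carrier R" "u \<notin> seq_submodule R rm xs"
  and soc: "\<And>c. c \<in> mx ==> c \<otimes> u \<in> seq_submodule R rm xs" by (rule depth_socle[OF d]) (rule that)
 let ?I = "seq_submodule R rm xs"
 have I: "ideal ?I R" by (rule seq_rm_ideal[OF rm.wreg_set[OF xs(2)]])
 obtain Q where Q: "ideal Q R" "?I \<subseteq> Q" "u \<notin> Q" and Qp: "\<And>a. a \<in> mx ==> \<exists>n::nat. \<forall>k\<ge>n. a [^] k \<in> Q"
  by (rule socle_power[OF I u soc]) (assumption, rule that)
 interpret Q: ideal Q R by (rule Q)
 have "\<forall>z\<in>X (Suc (Suc t)). \<exists>n::nat. \<forall>k\<ge>n. D (Suc t) x z [^] k \<in> Q" using min[OF x] Qp by blast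
 then obtain n where n: "\<And>z k. z \<in> X (Suc (Suc t)) ==> k \<ge> n z ==> D (Suc t) x z [^] (k::nat) \<in> Q" by metis
 \<comment> \<open>The sum dominates every \<open>n z\<close>; the \<open>Suc\<close> makes the
   exponent positive, which keeps the entries of \<open>?D t\<close> in \<open>mx\<close>.\<close>
 let ?m = "Suc (\<Sum>z\<in>X (Suc (Suc t)). n z)"
 obtain q where q: "q \<in> S" "q \<ge> ?m" using inf by (metis finite_nat_set_iff_bounded_le nat_le_linear)
 have nq: "n z \<le> q" if "z \<in> X (Suc (Suc t))" for z
  using member_le_sum[OF that, of n] X[of "Suc (Suc t)"] q(2) by simp
 let ?D = "\<lambda>j y x. D j y x [^] q"
 have D': "mat R (X j) (X (Suc j)) (?D j)" for j using D[of j] by (auto simp: mat_def)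
 let ?v = "\<lambda>i. u \<otimes> free_gen R x i"
 have v: "?v \<in> vec rm (X (Suc t))" using u(1) x by (intro pwI) (auto simp: free_gen_def)
 have Dv: "dif rm X ?D t ?v y \<in> ?I" if y: "y \<in> X t" for y
 proof -
  have "dif rm X ?D t (u *[pw rm (X (Suc t))] free_gen R x) = u *[pw rm (X t)] dif rm X ?D t (free_gen R x)"
   by (rule lin_smult[OF rm.mm_lin[OF X D'] u(1) gen_pw[OF x]])
  then have "dif rm X ?D t ?v y = u \<otimes> dif rm X ?D t (free_gen R x) y" by (simp add: fun_eq_iff)
  also have "\<dots> = ?D t y x \<otimes> u" using mm_gen[OF X D' x y] u(1) D'[of t] x y by (simp add: mat_def m_comm)
  finally have e: "dif rm X ?D t ?v y = ?D t y x \<otimes> u" .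
  obtain q' where q': "q = Suc q'" using q(2) by (cases q) auto
  have "?D t y x \<in> mx" unfolding q' using min[OF y x] mx_mult_l mx_sub by simp
  then show ?thesis unfolding e by (rule soc)
 qed
 have "\<exists>w\<in>vec rm (X (Suc (Suc t))). \<forall>y\<in>X (Suc t). ?v y -[rm] dif rm X ?D (Suc t) w y \<in> ?I"
  by (rule rm.reduce_mat[where lo = 0 and hi = "Suc t" and j = t, OF X D' _ xs(2) _ _ v Dv]) (use ex q xs(1) in auto)
 then obtain w where w: "w \<in> vec rm (X (Suc (Suc t)))" "?v x \<ominus> dif rm X ?D (Suc t) w x \<in> ?I"
  using x by (auto simp: rm_minus)
 let ?b = "dif rm X ?D (Suc t) w x"
 have "?b = (\<Oplus>z\<in>X (Suc (Suc t)). ?D (Suc t) x z \<otimes> w z)" using x by (simp add: mm_def lc_rm)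
 also have "\<dots> \<in> Q"
 proof -
  have "submodule Q R rm" using Q(1) rm_sub_ideal by simp
  then have "finsum rm (\<lambda>z. ?D (Suc t) x z \<otimes> w z) (X (Suc (Suc t))) \<in> Q"
   by (rule rm.sub_finsum) (use n nq Q.I_r_closed pwR[OF w(1)] in auto)
  then show ?thesis by (simp add: rm_finsum)
 qed
 finally have b: "?b \<in> Q" .
 have "u \<ominus> ?b \<in> Q" using w(2) Q(2) u(1) by (auto simp: free_gen_def)
 then have "(u \<ominus> ?b) \<oplus> ?b \<in> Q" using b by (rule Q.a_closed)
 moreover have "(u \<ominus> ?b) \<oplus> ?b = u" using u(1) Q.Icarr[OF b] by (simp add: a_minus_def a_assoc l_neg)
 ultimately show False using Q(3) by simp
qed

end

section \<open>Total complexes\<close>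

text \<open>The tensor product of G_a and F_b consists of vectors indexed by \<open>gX a\<close>
  with entries in \<open>Fm b\<close>: the differential of G acts as a matrix, that of F entry by
  entry, and the two commute by \<open>lin_mm\<close>.\<close>

locale two_res = crng R for R :: "'a ring" (structure) +
 fixes N :: "('a, 'c) module" and gX :: "nat => nat set" and G and fX :: "nat => nat set" and \<eta> and F
 assumes N: "rmod R N" and G: "res R gX G" and F: "res_of R N fX \<eta> F"
begin

sublocale N: rmod R N by (rule N)
sublocale rm: rmod R rm by (rule rmod_rm)

abbreviation "Fm b \<equiv> pw rm (fX b)"
abbreviation "\<phi> b \<equiv> dif rm fX F b"
abbreviation "Ga A a \<equiv> dif A gX G a"
abbreviation "et u \<equiv> lc N (fX 0) u \<eta>"

sublocale Fm: rmod R "Fm b" for b by (rule rm.rmod_pw)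
sublocale PF: rmod R "pw (Fm b) (gX a)" for a b by (rule Fm.rmod_pw)

lemma fg: "finite (gX i)" "mat R (gX i) (gX (Suc i)) (G i)" "finite (fX i)" "mat R (fX i) (fX (Suc i)) (F i)" "\<eta> \<in> fX 0 \<rightarrow> carrier N"
 using G F by (auto simp: res_def res_of_def gens_def)

lemma resF: "res R fX F" using F by (simp add: res_of_def)

lemma phi_lin: "lin R (Fm (Suc b)) (Fm b) (\<phi> b)" by (rule rm.mm_lin[OF fg(3,4)])
lemma et_lin: "lin R (Fm 0) N et" by (rule lc_lin[OF N fg(3,5)])
lemma Ga_lin: "rmod R A ==> lin R (pw A (gX (Suc a))) (pw A (gX a)) (Ga A a)"
 by (rule rmod.mm_lin[OF _ fg(1,2)])

lemma phi_ex: "u \<in> carrier (Fm (Suc b)) ==> \<phi> b u = \<zero>[Fm b] \<longleftrightarrow> (\<exists>w\<in>carrier (Fm (Suc (Suc b))). u = \<phi> (Suc b) w)"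
 using resF unfolding res_def exat_def by simp

lemma et_ex: "u \<in> carrier (Fm 0) ==> et u = \<zero>[N] \<longleftrightarrow> (\<exists>w\<in>carrier (Fm (Suc 0)). u = \<phi> 0 w)"
 using F unfolding res_of_def by simp

lemma et_surj: "n \<in> carrier N ==> \<exists>u\<in>carrier (Fm 0). et u = n"
 using F unfolding res_of_def gens_def by metis

lemma Ga_phi: "V \<in> vec (Fm (Suc b)) (gX (Suc a)) ==> (\<lambda>i. \<phi> b (Ga (Fm (Suc b)) a V i)) = Ga (Fm b) a (\<lambda>i. \<phi> b (V i))"
 by (rule lin_mm[OF rm.rmod_pw rm.rmod_pw phi_lin fg(2)]) (rule Fm.pw_Pi)

lemma Ga_et: "V \<in> vec (Fm 0) (gX (Suc a)) ==> (\<lambda>i. et (Ga (Fm 0) a V i)) = Ga N a (\<lambda>i. et (V i))"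
 by (rule lin_mm[OF rm.rmod_pw N et_lin fg(2)]) (rule Fm.pw_Pi)

lemma comp_lin:
 assumes "rmod R A" "rmod R B" "lin R A B f" and V: "V \<in> vec A Z"
 shows "(\<lambda>i. f (V i)) \<in> vec B Z"
proof (rule pwI)
 show "f (V x) = \<zero>[B]" if "x \<notin> Z" for x using lin_zero[OF assms(1-3)] pw0[OF V that] by simp
qed (rule lin_closed[OF assms(3) pwD[OF V]])

lemma comp_phi: "V \<in> vec (Fm (Suc b)) Z ==> (\<lambda>i. \<phi> b (V i)) \<in> vec (Fm b) Z"
 by (rule comp_lin[OF rm.rmod_pw rm.rmod_pw phi_lin])

lemma comp_et: "V \<in> vec (Fm 0) Z ==> (\<lambda>i. et (V i)) \<in> vec N Z"
 by (rule comp_lin[OF rm.rmod_pw N et_lin])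

lemma pw_choose:
 assumes "\<And>i. i \<in> Z ==> \<exists>w\<in>carrier A. P i w"
 obtains W where "W \<in> vec A Z" "\<And>i. i \<in> Z ==> P i (W i)"
proof -
 have "\<forall>i\<in>Z. \<exists>w. w \<in> carrier A \<and> P i w" using assms by blast
 then obtain w where w: "\<forall>i\<in>Z. w i \<in> carrier A \<and> P i (w i)" by (rule bchoice[THEN exE])
 have "(\<lambda>i. if i \<in> Z then w i else \<zero>[A]) \<in> vec A Z" using w by (intro pwI) auto
 then show ?thesis using w that[of "\<lambda>i. if i \<in> Z then w i else \<zero>[A]"] by simp
qed

end

text \<open>The total complex of the tensor product of the complexes \<open>G\<close> and \<open>F\<close>, where \<open>F\<close> resolves \<open>N\<close> and
 \<open>G \<otimes> N\<close> resolves \<open>H\<close>. The basis of its degree \<open>k\<close> part consists of triples \<open>(a, i, j)\<close> with \<open>i\<close> a basis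
 index of \<open>G\<^sub>a\<close> and \<open>j\<close> one of \<open>F\<^sub>k\<^sub>-\<^sub>a\<close>.\<close>

locale total = two_res R N gX G fX \<eta> F for R :: "'a ring" (structure) and N :: "('a, 'c) module" and gX G fX \<eta> F +
 fixes H :: "('a, 'd) module" and \<kappa>
 assumes H: "rmod R H"
  and GN: "\<And>i. exa N gX G i"
  and k: "lin R (pw N (gX 0)) H \<kappa>" and ksurj: "\<And>h. h \<in> carrier H ==> \<exists>n\<in>vec N (gX 0). \<kappa> n = h"
  and kker: "\<And>n. n \<in> vec N (gX 0) ==> \<kappa> n = \<zero>[H] \<longleftrightarrow> (\<exists>w\<in>vec N (gX 1). n = mm N (gX 1) (G 0) (gX 0) w)"
begin

definition "T k = {(a, i, j). a \<le> k \<and> i \<in> gX a \<and> j \<in> fX (k - a)}"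
definition sg :: "nat => 'a" where "sg a = (if even a then \<one> else \<ominus> \<one>)"
definition Dt :: "nat => nat \<times> nat \<times> nat => nat \<times> nat \<times> nat => 'a" where
 "Dt k = (\<lambda>(a', i', j') (a, i, j). if a = Suc a' \<and> j = j' then G a' i' i
   else if a = a' \<and> i = i' then sg a' \<otimes> F (k - a') j' j else \<zero>)"

sublocale H: rmod R H by (rule H)

lemma sg_R[simp]: "sg a \<in> carrier R" by (simp add: sg_def)
lemma sg_sg: "sg a \<otimes> sg a = \<one>" by (simp add: sg_def l_minus r_minus)
lemma sg_Suc: "sg (Suc a) = \<ominus> sg a" by (simp add: sg_def)

text \<open>The last column, where F has degree 0. Lift \<open>n\<close> through \<open>et\<close>
  to \<open>W'\<close>; then \<open>V\<close> minus the image of \<open>W'\<close> lies in the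
  kernel of \<open>et\<close>, hence comes from degree 1 of F.\<close>

lemma sweep_top:
 assumes V: "V \<in> vec (Fm 0) (gX K)" and n: "n \<in> vec N (gX (Suc K))" "(\<lambda>i. et (V i)) = Ga N K n"
 obtains W' W where "W' \<in> vec (Fm 0) (gX (Suc K))" "W \<in> vec (Fm (Suc 0)) (gX K)"
  "\<And>i. i \<in> gX K ==> V i = Ga (Fm 0) K W' i +[Fm 0] sg K *[Fm 0] \<phi> 0 (W i)"
proof -
 obtain W' where W': "W' \<in> vec (Fm 0) (gX (Suc K))" "\<And>i. i \<in> gX (Suc K) ==> et (W' i) = n i"
  by (rule pw_choose[of "gX (Suc K)" "Fm 0" "\<lambda>i w. et w = n i"]) (use et_surj pwD[OF n(1)] in blast)+
 have en: "(\<lambda>i. et (W' i)) = n" by (rule pw_ext[OF comp_et[OF W'(1)] n(1) W'(2)])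
 have GW: "Ga (Fm 0) K W' \<in> vec (Fm 0) (gX K)" by (rule lin_closed[OF Ga_lin[OF rm.rmod_pw] W'(1)])
 have "\<exists>w\<in>carrier (Fm (Suc 0)). V i -[Fm 0] Ga (Fm 0) K W' i = \<phi> 0 w" if i: "i \<in> gX K" for i
 proof -
  have c: "V i \<in> carrier (Fm 0)" "Ga (Fm 0) K W' i \<in> carrier (Fm 0)" using pwD[OF V i] pwD[OF GW i] by auto
  have "et (V i -[Fm 0] Ga (Fm 0) K W' i) = et (V i) -[N] et (Ga (Fm 0) K W' i)" by (rule lin_minus[OF rm.rmod_pw N et_lin c])
  also have "et (V i) = et (Ga (Fm 0) K W' i)" using fun_cong[OF n(2), of i] fun_cong[OF Ga_et[OF W'(1)], of i] en by simp
  finally have "et (V i -[Fm 0] Ga (Fm 0) K W' i) = \<zero>[N]" using lin_closed[OF et_lin c(2)] by (simp add: a_minus_def N.M.r_neg)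
  then show ?thesis using et_ex[OF Fm.M.minus_closed[OF c]] by blast
 qed
 then obtain W0 where W0: "W0 \<in> vec (Fm (Suc 0)) (gX K)" "\<And>i. i \<in> gX K ==> V i -[Fm 0] Ga (Fm 0) K W' i = \<phi> 0 (W0 i)"
  by (rule pw_choose[of "gX K" "Fm (Suc 0)" "\<lambda>i w. V i -[Fm 0] Ga (Fm 0) K W' i = \<phi> 0 w"]) blast+
 let ?W = "sg K *[pw (Fm (Suc 0)) (gX K)] W0"
 show ?thesis
 proof (rule that[of W' ?W, OF W'(1) PF.smult_closed[OF sg_R W0(1)]])
  fix i assume i: "i \<in> gX K"
  have c: "V i \<in> carrier (Fm 0)" "Ga (Fm 0) K W' i \<in> carrier (Fm 0)" "W0 i \<in> carrier (Fm (Suc 0))" "\<phi> 0 (W0 i) \<in> carrier (Fm 0)"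
   using pwD[OF V i] pwD[OF GW i] pwD[OF W0(1) i] lin_closed[OF phi_lin pwD[OF W0(1) i]] by auto
  have "\<phi> 0 (?W i) = sg K *[Fm 0] \<phi> 0 (W0 i)" using lin_smult[OF phi_lin sg_R c(3), of K] by simp
  then have "sg K *[Fm 0] \<phi> 0 (?W i) = \<phi> 0 (W0 i)" using c(4) sg_sg[of K] Fm.smult_assoc1[OF sg_R sg_R c(4), of K K] by (metis Fm.smult_one)
  also have "Ga (Fm 0) K W' i +[Fm 0] \<phi> 0 (W0 i) = V i"
   unfolding W0(2)[OF i, symmetric] using c by (simp add: a_minus_def Fm.M.r_neg3 del: pw_sel)
  ultimately show "V i = Ga (Fm 0) K W' i +[Fm 0] sg K *[Fm 0] \<phi> 0 (?W i)" by simp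
 qed
qed

text \<open>The cycle condition at \<open>a\<close> and the formula for \<open>V1\<close> show that
  \<phi> kills \<open>V\<close> minus the image of \<open>W1\<close>; exactness of F supplies
  \<open>W\<close>.\<close>

lemma sweep_step:
 assumes V: "V \<in> vec (Fm (Suc b)) (gX a)" and V1: "V1 \<in> vec (Fm b) (gX (Suc a))"
  and W1: "W1 \<in> vec (Fm (Suc b)) (gX (Suc a))" and W2: "W2 \<in> vec (Fm b) (gX (Suc (Suc a)))"
  and eq1: "\<And>i. i \<in> gX (Suc a) ==> V1 i = Ga (Fm b) (Suc a) W2 i +[Fm b] sg (Suc a) *[Fm b] \<phi> b (W1 i)"
  and cyc: "\<And>i. i \<in> gX a ==> Ga (Fm b) a V1 i +[Fm b] sg a *[Fm b] \<phi> b (V i) = \<zero>[Fm b]"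
 obtains W where "W \<in> vec (Fm (Suc (Suc b))) (gX a)"
  "\<And>i. i \<in> gX a ==> V i = Ga (Fm (Suc b)) a W1 i +[Fm (Suc b)] sg a *[Fm (Suc b)] \<phi> (Suc b) (W i)"
proof -
 note l = Ga_lin[OF rm.rmod_pw]
 have pW1: "(\<lambda>i. \<phi> b (W1 i)) \<in> vec (Fm b) (gX (Suc a))" by (rule comp_phi[OF W1])
 have GW2: "Ga (Fm b) (Suc a) W2 \<in> vec (Fm b) (gX (Suc a))" by (rule lin_closed[OF l W2])
 have sW: "sg (Suc a) *[pw (Fm b) (gX (Suc a))] (\<lambda>i. \<phi> b (W1 i)) \<in> vec (Fm b) (gX (Suc a))" by (rule PF.smult_closed[OF sg_R pW1])
 have "V1 = Ga (Fm b) (Suc a) W2 +[pw (Fm b) (gX (Suc a))] sg (Suc a) *[pw (Fm b) (gX (Suc a))] (\<lambda>i. \<phi> b (W1 i))"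
  by (rule pw_ext[OF V1 PF.M.add.m_closed[OF GW2 sW]]) (use eq1 in \<open>simp only: pw_sel\<close>)
 then have "Ga (Fm b) a V1 = Ga (Fm b) a (Ga (Fm b) (Suc a) W2) +[pw (Fm b) (gX a)] sg (Suc a) *[pw (Fm b) (gX a)] Ga (Fm b) a (\<lambda>i. \<phi> b (W1 i))"
  using lin_add[OF l GW2 sW] lin_smult[OF l sg_R pW1] by simp
 also have "Ga (Fm b) a (Ga (Fm b) (Suc a) W2) = \<zero>[pw (Fm b) (gX a)]" using res_zero_mm[OF rm.rmod_pw G W2] by simp
 also have "Ga (Fm b) a (\<lambda>i. \<phi> b (W1 i)) = (\<lambda>i. \<phi> b (Ga (Fm (Suc b)) a W1 i))" by (rule Ga_phi[OF W1, symmetric])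
 finally have GV1: "Ga (Fm b) a V1 = \<zero>[pw (Fm b) (gX a)] +[pw (Fm b) (gX a)] sg (Suc a) *[pw (Fm b) (gX a)] (\<lambda>i. \<phi> b (Ga (Fm (Suc b)) a W1 i))" .
 have GW1: "Ga (Fm (Suc b)) a W1 \<in> vec (Fm (Suc b)) (gX a)" by (rule lin_closed[OF l W1])
 have "\<exists>w\<in>carrier (Fm (Suc (Suc b))). V i -[Fm (Suc b)] Ga (Fm (Suc b)) a W1 i = \<phi> (Suc b) w" if i: "i \<in> gX a" for i
 proof -
  have c: "V i \<in> carrier (Fm (Suc b))" "Ga (Fm (Suc b)) a W1 i \<in> carrier (Fm (Suc b))" using pwD[OF V i] pwD[OF GW1 i] by auto
  let ?x = "\<phi> b (Ga (Fm (Suc b)) a W1 i)" and ?y = "\<phi> b (V i)"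
  have xy: "?x \<in> carrier (Fm b)" "?y \<in> carrier (Fm b)" using lin_closed[OF phi_lin] c by auto
  have "Ga (Fm b) a V1 i = sg (Suc a) *[Fm b] ?x"
   unfolding GV1 using Fm.smult_closed[OF sg_R xy(1)] by (simp only: pw_sel(1-3)[of "Fm b"] Fm.M.l_zero)
  then have "sg (Suc a) *[Fm b] ?x +[Fm b] sg a *[Fm b] ?y = \<zero>[Fm b]" using cyc[OF i] by simp
  then have "sg a *[Fm b] (?y -[Fm b] ?x) = \<zero>[Fm b]"
   using xy by (simp add: sg_Suc Fm.smult_l_minus Fm.smult_r_distr Fm.smult_r_minus a_minus_def Fm.M.a_comm del: pw_sel)
  then have "sg a *[Fm b] (sg a *[Fm b] (?y -[Fm b] ?x)) = \<zero>[Fm b]" by (simp only: Fm.smult_r_null[OF sg_R])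
  then have "?y -[Fm b] ?x = \<zero>[Fm b]"
   using Fm.smult_assoc1[OF sg_R sg_R Fm.M.minus_closed[OF xy(2,1)], of a a] sg_sg[of a] Fm.smult_one[OF Fm.M.minus_closed[OF xy(2,1)]] by simp
  then have "\<phi> b (V i -[Fm (Suc b)] Ga (Fm (Suc b)) a W1 i) = \<zero>[Fm b]" using lin_minus[OF rm.rmod_pw rm.rmod_pw phi_lin c] by simp
  then show ?thesis using phi_ex[OF Fm.M.minus_closed[OF c]] by blast
 qed
 then obtain W0 where W0: "W0 \<in> vec (Fm (Suc (Suc b))) (gX a)" "\<And>i. i \<in> gX a ==> V i -[Fm (Suc b)] Ga (Fm (Suc b)) a W1 i = \<phi> (Suc b) (W0 i)"
  by (rule pw_choose[of "gX a" "Fm (Suc (Suc b))" "\<lambda>i w. V i -[Fm (Suc b)] Ga (Fm (Suc b)) a W1 i = \<phi> (Suc b) w"]) blast+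
 let ?W = "sg a *[pw (Fm (Suc (Suc b))) (gX a)] W0"
 show ?thesis
 proof (rule that[of ?W, OF PF.smult_closed[OF sg_R W0(1)]])
  fix i assume i: "i \<in> gX a"
  have c: "V i \<in> carrier (Fm (Suc b))" "Ga (Fm (Suc b)) a W1 i \<in> carrier (Fm (Suc b))" "W0 i \<in> carrier (Fm (Suc (Suc b)))" "\<phi> (Suc b) (W0 i) \<in> carrier (Fm (Suc b))"
   using pwD[OF V i] pwD[OF GW1 i] pwD[OF W0(1) i] lin_closed[OF phi_lin pwD[OF W0(1) i]] by auto
  have "\<phi> (Suc b) (?W i) = sg a *[Fm (Suc b)] \<phi> (Suc b) (W0 i)" using lin_smult[OF phi_lin sg_R c(3), of a] by simp
  then have "sg a *[Fm (Suc b)] \<phi> (Suc b) (?W i) = \<phi> (Suc b) (W0 i)" using c(4) sg_sg[of a] Fm.smult_assoc1[OF sg_R sg_R c(4), of a a] by (metis Fm.smult_one)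
  also have "Ga (Fm (Suc b)) a W1 i +[Fm (Suc b)] \<phi> (Suc b) (W0 i) = V i"
   unfolding W0(2)[OF i, symmetric] using c by (simp add: a_minus_def Fm.M.r_neg3 del: pw_sel)
  ultimately show "V i = Ga (Fm (Suc b)) a W1 i +[Fm (Suc b)] sg a *[Fm (Suc b)] \<phi> (Suc b) (?W i)" by simp
 qed
qed

text \<open>The components of a preimage are found from \<open>a = K\<close> downward, each from the
  previous one by exactness of F. To start, the image of the component \<open>V K\<close> in G_K
  tensor N has to be a boundary, and \<open>n\<close> is its preimage.\<close>

lemma sweep:
 assumes V: "\<And>a. a \<le> K ==> V a \<in> vec (Fm (K - a)) (gX a)"
  and n: "n \<in> vec N (gX (Suc K))" "(\<lambda>i. et (V K i)) = Ga N K n"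
  and cyc: "\<And>a i. a < K ==> i \<in> gX a ==> Ga (Fm (K - Suc a)) a (V (Suc a)) i +[Fm (K - Suc a)] sg a *[Fm (K - Suc a)] \<phi> (K - Suc a) (V a i) = \<zero>[Fm (K - Suc a)]"
 shows "\<exists>W. (\<forall>a\<le>Suc K. W a \<in> vec (Fm (Suc K - a)) (gX a)) \<and>
  (\<forall>a\<le>K. \<forall>i\<in>gX a. V a i = Ga (Fm (K - a)) a (W (Suc a)) i +[Fm (K - a)] sg a *[Fm (K - a)] \<phi> (K - a) (W a i))"
proof -
 let ?P = "\<lambda>W c. (\<forall>a. c \<le> a \<and> a \<le> Suc K --> W a \<in> vec (Fm (Suc K - a)) (gX a)) \<and>
  (\<forall>a. c \<le> a \<and> a \<le> K --> (\<forall>i\<in>gX a. V a i = Ga (Fm (K - a)) a (W (Suc a)) i +[Fm (K - a)] sg a *[Fm (K - a)] \<phi> (K - a) (W a i)))"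
 have "\<exists>W. ?P W c" if "c \<le> K" for c
  using that
 proof (induct rule: inc_induct)
  case base
  have VK: "V K \<in> vec (Fm 0) (gX K)" using V[of K] by simp
  obtain W' W where W: "W' \<in> vec (Fm 0) (gX (Suc K))" "W \<in> vec (Fm (Suc 0)) (gX K)"
   "\<And>i. i \<in> gX K ==> V K i = Ga (Fm 0) K W' i +[Fm 0] sg K *[Fm 0] \<phi> 0 (W i)"
   by (rule sweep_top[OF VK n]) (rule that)
  show ?case
  proof (rule exI[of _ "\<lambda>a. if a = K then W else W'"], intro conjI allI impI ballI)
   fix a assume "K \<le> a \<and> a \<le> Suc K"
   then have "a = K \<or> a = Suc K" by auto
   then show "(if a = K then W else W') \<in> vec (Fm (Suc K - a)) (gX a)" using W(1,2) by auto
  next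
   fix a i assume "K \<le> a \<and> a \<le> K" "i \<in> gX a"
   then have "a = K" "i \<in> gX K" by auto
   then show "V a i = Ga (Fm (K - a)) a (if Suc a = K then W else W') i +[Fm (K - a)] sg a *[Fm (K - a)] \<phi> (K - a) ((if a = K then W else W') i)"
    using W(3)[of i] by (simp del: pw_sel)
  qed
 next
  case (step c)
  then obtain W where W: "?P W (Suc c)" by blast
  obtain b where b: "K - c = Suc b" "K - Suc c = b" "Suc K - Suc c = Suc b" "Suc K - Suc (Suc c) = b" "Suc K - c = Suc (Suc b)" using step(2) by (cases "K - c") auto
  have V': "V c \<in> vec (Fm (Suc b)) (gX c)" "V (Suc c) \<in> vec (Fm b) (gX (Suc c))"
   using V[of c] V[of "Suc c"] step(2) b by auto
  have W': "W (Suc c) \<in> vec (Fm (Suc b)) (gX (Suc c))" "W (Suc (Suc c)) \<in> vec (Fm b) (gX (Suc (Suc c)))"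
   using W[THEN conjunct1, rule_format, of "Suc c"] W[THEN conjunct1, rule_format, of "Suc (Suc c)"] step(2) b by auto
  have e1: "V (Suc c) i = Ga (Fm b) (Suc c) (W (Suc (Suc c))) i +[Fm b] sg (Suc c) *[Fm b] \<phi> b (W (Suc c) i)" if "i \<in> gX (Suc c)" for i
   using W[THEN conjunct2, rule_format, of "Suc c" i] that step(2) b(2) by (simp del: pw_sel)
  have cy: "Ga (Fm b) c (V (Suc c)) i +[Fm b] sg c *[Fm b] \<phi> b (V c i) = \<zero>[Fm b]" if "i \<in> gX c" for i
   using cyc[of c i] that step(2) b(2) by (simp del: pw_sel)
  obtain Y where Y: "Y \<in> vec (Fm (Suc (Suc b))) (gX c)"
   "\<And>i. i \<in> gX c ==> V c i = Ga (Fm (Suc b)) c (W (Suc c)) i +[Fm (Suc b)] sg c *[Fm (Suc b)] \<phi> (Suc b) (Y i)"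
   by (rule sweep_step[OF V' W' e1 cy]) (assumption | rule that)+
  show ?case
  proof (rule exI[of _ "W(c := Y)"], intro conjI allI impI ballI)
   fix a assume a: "c \<le> a \<and> a \<le> Suc K"
   show "(W(c := Y)) a \<in> vec (Fm (Suc K - a)) (gX a)"
    using W[THEN conjunct1, rule_format, of a] Y(1) a b by (cases "a = c") auto
  next
   fix a i assume a: "c \<le> a \<and> a \<le> K" "i \<in> gX a"
   show "V a i = Ga (Fm (K - a)) a ((W(c := Y)) (Suc a)) i +[Fm (K - a)] sg a *[Fm (K - a)] \<phi> (K - a) ((W(c := Y)) a i)"
    using W[THEN conjunct2, rule_format, of a i] Y(2)[of i] a b by (cases "a = c") (auto simp del: pw_sel)
  qed
 qed
 from this[of 0] obtain W where "?P W 0" by blast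
 then show ?thesis by (intro exI[of _ W]) simp
qed

end

context total begin

definition sl :: "(nat \<times> nat \<times> nat => 'a) => nat => nat => nat => 'a" where "sl w a i = (\<lambda>j. w (a, i, j))"
definition e :: "nat \<times> nat \<times> nat => 'd" where "e = (\<lambda>(a, i, j). \<kappa> (\<lambda>i'. if i' = i then \<eta> j else \<zero>[N]))"

lemma T_fin: "finite (T k)"
proof (rule finite_subset)
 show "T k \<subseteq> {..k} \<times> (\<Union>a\<in>{..k}. gX a) \<times> (\<Union>a\<in>{..k}. fX (k - a))" unfolding T_def by auto
qed (use fg in auto)

lemma Dt_mat: "mat R (T k) (T (Suc k)) (Dt k)"
 using fg(2,4) by (auto simp: mat_def T_def Dt_def Suc_diff_le)

lemma sl_pw: "w \<in> vec rm (T k) ==> a \<le> k ==> sl w a \<in> vec (Fm (k - a)) (gX a)"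
proof (rule pwI)
 assume w: "w \<in> vec rm (T k)" and a: "a \<le> k"
 show "sl w a i \<in> carrier (Fm (k - a))" if "i \<in> gX a" for i
  unfolding sl_def by (rule pwI) (use pwR[OF w] pw0[OF w] in \<open>auto simp: T_def\<close>)
 show "sl w a i = \<zero>[Fm (k - a)]" if "i \<notin> gX a" for i
  using that pw0[OF w] by (auto simp: sl_def T_def)
qed

lemma Ga_eval:
 assumes V: "V \<in> vec (Fm b) (gX (Suc a))" and i: "i \<in> gX a" and j: "j \<in> fX b"
 shows "Ga (Fm b) a V i j = (\<Oplus>i'\<in>gX (Suc a). G a i i' \<otimes> V i' j)"
proof -
 have "Ga (Fm b) a V i j = lc (Fm b) (gX (Suc a)) (G a i) V j" using i by (simp add: mm_def)
 also have "\<dots> = lc rm (gX (Suc a)) (G a i) (\<lambda>i'. V i' j)"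
  by (rule rm.pw_lc) (use i j V fg(2)[of a] in \<open>auto simp: mat_def pwD\<close>)
 finally show ?thesis by (simp add: lc_rm)
qed

lemma phi_eval: "j \<in> fX b ==> \<phi> b u j = (\<Oplus>j'\<in>fX (Suc b). F b j j' \<otimes> u j')"
 by (simp add: mm_def lc_rm)

lemma mm_Dt:
 assumes w: "w \<in> vec rm (T (Suc k))" and x: "(a, i, j) \<in> T k"
 shows "dif rm T Dt k w (a, i, j) = Ga (Fm (k - a)) a (sl w (Suc a)) i j \<oplus> sg a \<otimes> \<phi> (k - a) (sl w a i) j"
proof -
 have x': "a \<le> k" "i \<in> gX a" "j \<in> fX (k - a)" using x by (auto simp: T_def)
 then have sk: "Suc k - a = Suc (k - a)" by simp
 let ?A = "(\<lambda>i'. (Suc a, i', j)) ` gX (Suc a)" and ?B = "(\<lambda>j'. (a, i, j')) ` fX (Suc (k - a))"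
 let ?h = "\<lambda>y. Dt k (a, i, j) y \<otimes> w y"
 have sub: "?A \<union> ?B \<subseteq> T (Suc k)" using x' by (auto simp: T_def sk)
 have hR: "?h y \<in> carrier R" if "y \<in> T (Suc k)" for y using matD[OF Dt_mat x that] pwR[OF w] by simp
 have "dif rm T Dt k w (a, i, j) = (\<Oplus>y\<in>T (Suc k). ?h y)" using x by (simp add: mm_def lc_rm)
 also have "\<dots> = (\<Oplus>y\<in>?A \<union> ?B. ?h y)"
 proof (rule add.finprod_mono_neutral_cong_right[OF T_fin sub])
  fix y assume y: "y \<in> T (Suc k) - (?A \<union> ?B)"
  obtain a' i' j' where y': "y = (a', i', j')" by (cases y)
  have "\<not> (a' = Suc a \<and> j' = j)" using y unfolding y' by (auto simp: T_def)
  moreover have "\<not> (a' = a \<and> i' = i)" using y sk unfolding y' by (auto simp: T_def)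
  ultimately have "Dt k (a, i, j) y = \<zero>" unfolding y' Dt_def by auto
  then show "?h y = \<zero>" using pwR[OF w] by simp
 qed (rule Pi_I hR refl | assumption)+
 also have "\<dots> = (\<Oplus>y\<in>?A. ?h y) \<oplus> (\<Oplus>y\<in>?B. ?h y)"
  proof (rule add.finprod_Un_disjoint)
  show "?A \<inter> ?B = {}" by auto
  show "?h \<in> ?A \<rightarrow> carrier R" "?h \<in> ?B \<rightarrow> carrier R" by (rule Pi_I, rule hR, rule subsetD[OF sub], simp)+
 qed (use fg(1,3) in simp_all)
 also have "(\<Oplus>y\<in>?A. ?h y) = (\<Oplus>i'\<in>gX (Suc a). ?h (Suc a, i', j))"
  by (rule add.finprod_reindex) (use sub hR in \<open>auto simp: inj_on_def\<close>)
 also have "\<dots> = Ga (Fm (k - a)) a (sl w (Suc a)) i j"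
  using sl_pw[OF w, of "Suc a"] x' by (subst Ga_eval) (auto simp: Dt_def sl_def)
 also have "(\<Oplus>y\<in>?B. ?h y) = (\<Oplus>j'\<in>fX (Suc (k - a)). ?h (a, i, j'))"
  by (rule add.finprod_reindex) (use sub hR in \<open>auto simp: inj_on_def\<close>)
 also have "\<dots> = (\<Oplus>j'\<in>fX (Suc (k - a)). sg a \<otimes> (F (k - a) j j' \<otimes> w (a, i, j')))"
  by (rule finsum_cong') (use fg(4)[of "k - a"] x' pwR[OF w] in \<open>auto simp: Dt_def mat_def m_assoc\<close>)
 also have "\<dots> = sg a \<otimes> \<phi> (k - a) (sl w a i) j"
  unfolding phi_eval[OF x'(3)] sl_def
  by (rule finsum_rdistr[symmetric]) (use fg x' pwR[OF w] in \<open>auto simp: mat_def\<close>)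
 finally show ?thesis .
qed

lemma sl_Dt:
 assumes w: "w \<in> vec rm (T (Suc k))" and a: "a \<le> k" "i \<in> gX a"
 shows "sl (dif rm T Dt k w) a i = Ga (Fm (k - a)) a (sl w (Suc a)) i +[Fm (k - a)] sg a *[Fm (k - a)] \<phi> (k - a) (sl w a i)"
proof (rule pw_ext[where X = "fX (k - a)"])
 have 1: "sl w (Suc a) \<in> vec (Fm (k - a)) (gX (Suc a))" using sl_pw[OF w, of "Suc a"] a by simp
 have 2: "sl w a i \<in> carrier (Fm (Suc (k - a)))" using pwD[OF sl_pw[OF w, of a] a(2)] a by (simp add: Suc_diff_le)
 show "sl (dif rm T Dt k w) a i \<in> carrier (Fm (k - a))"
  using pwD[OF sl_pw[OF rm.mm_closed[OF Dt_mat] a(1)] a(2)] w by simp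
 show "Ga (Fm (k - a)) a (sl w (Suc a)) i +[Fm (k - a)] sg a *[Fm (k - a)] \<phi> (k - a) (sl w a i) \<in> carrier (Fm (k - a))"
  by (intro Fm.M.add.m_closed Fm.smult_closed sg_R lin_closed[OF phi_lin 2] pwD[OF lin_closed[OF Ga_lin[OF rm.rmod_pw] 1] a(2)])
 fix j assume "j \<in> fX (k - a)"
 then have "(a, i, j) \<in> T k" using a by (simp add: T_def)
 from mm_Dt[OF w this] show "sl (dif rm T Dt k w) a i j = (Ga (Fm (k - a)) a (sl w (Suc a)) i +[Fm (k - a)] sg a *[Fm (k - a)] \<phi> (k - a) (sl w a i)) j"
  by (simp add: sl_def[of "dif rm T Dt k w"])
qed

definition flat :: "nat => (nat => nat => nat => 'a) => nat \<times> nat \<times> nat => 'a" where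
 "flat k W = (\<lambda>(a, i, j). if (a, i, j) \<in> T k then W a i j else \<zero>)"

lemma flat_pw: "(\<And>a. a \<le> k ==> W a \<in> vec (Fm (k - a)) (gX a)) ==> flat k W \<in> vec rm (T k)"
proof (rule pwI)
 fix x assume W: "\<And>a. a \<le> k ==> W a \<in> vec (Fm (k - a)) (gX a)" and x: "x \<in> T k"
 obtain a i j where x': "x = (a, i, j)" by (cases x)
 have "a \<le> k" "i \<in> gX a" using x by (auto simp: T_def x')
 then show "flat k W x \<in> carrier rm" using pwR[OF pwD[OF W]] x by (simp add: flat_def x')
qed (auto simp: flat_def)

lemma sl_flat: "(\<And>a. a \<le> k ==> W a \<in> vec (Fm (k - a)) (gX a)) ==> a \<le> k ==> sl (flat k W) a = W a"
proof (rule ext)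
 fix i assume W: "\<And>a. a \<le> k ==> W a \<in> vec (Fm (k - a)) (gX a)" and a: "a \<le> k"
 show "sl (flat k W) a i = W a i"
 proof (cases "i \<in> gX a")
  case True
  have "W a i \<in> carrier (Fm (k - a))" by (rule pwD[OF W[OF a] True])
  then show ?thesis using True a pw0[of "W a i" rm "fX (k - a)"] by (auto simp: sl_def flat_def T_def fun_eq_iff)
 next
  case False
  then show ?thesis using pw0[OF W[OF a] False] by (auto simp: sl_def flat_def T_def)
 qed
qed

lemma sl_ext:
 assumes v: "v \<in> vec rm (T k)" and w: "w \<in> vec rm (T k)" and eq: "\<And>a i. a \<le> k ==> i \<in> gX a ==> sl v a i = sl w a i"
 shows "v = w"
proof (rule pw_ext[OF v w])
 fix x assume "x \<in> T k"
 then obtain a i j where "x = (a, i, j)" "a \<le> k" "i \<in> gX a" by (auto simp: T_def)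
 then show "v x = w x" using fun_cong[OF eq[of a i], of j] by (simp add: sl_def)
qed

lemma from_sweep:
 assumes v: "v \<in> vec rm (T k)"
  and n: "n \<in> vec N (gX (Suc k))" "(\<lambda>i. et (sl v k i)) = Ga N k n"
  and cyc: "\<And>a i. a < k ==> i \<in> gX a ==> Ga (Fm (k - Suc a)) a (sl v (Suc a)) i +[Fm (k - Suc a)] sg a *[Fm (k - Suc a)] \<phi> (k - Suc a) (sl v a i) = \<zero>[Fm (k - Suc a)]"
 shows "\<exists>w\<in>vec rm (T (Suc k)). v = dif rm T Dt k w"
proof -
 obtain W where W: "\<And>a. a \<le> Suc k ==> W a \<in> vec (Fm (Suc k - a)) (gX a)"
  "\<And>a i. a \<le> k ==> i \<in> gX a ==> sl v a i = Ga (Fm (k - a)) a (W (Suc a)) i +[Fm (k - a)] sg a *[Fm (k - a)] \<phi> (k - a) (W a i)"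
  using sweep[of k "sl v" n, OF sl_pw[OF v] n cyc] by blast
 let ?w = "flat (Suc k) W"
 have w: "?w \<in> vec rm (T (Suc k))" by (rule flat_pw[OF W(1)])
 have "v = dif rm T Dt k ?w"
 proof (rule sl_ext[OF v])
  show "dif rm T Dt k ?w \<in> vec rm (T k)" using w by (intro rm.mm_closed[OF Dt_mat]) simp
  fix a i assume a: "a \<le> k" "i \<in> gX a"
  have s: "sl ?w (Suc a) = W (Suc a)" "sl ?w a = W a" using sl_flat[of "Suc k" W, OF W(1)] a by simp_all
  show "sl v a i = sl (dif rm T Dt k ?w) a i" unfolding sl_Dt[OF w a] s by (rule W(2)[OF a])
 qed
 then show ?thesis using w by blast
qed

lemma Dt_Dt:
 assumes w: "w \<in> vec rm (T (Suc (Suc k)))"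
 shows "dif rm T Dt k (dif rm T Dt (Suc k) w) = (\<lambda>_. \<zero>)"
proof -
 let ?v = "dif rm T Dt (Suc k) w"
 have v: "?v \<in> vec rm (T (Suc k))" using w by (intro rm.mm_closed[OF Dt_mat]) simp
 note l = Ga_lin[OF rm.rmod_pw]
 show ?thesis
 proof (rule sl_ext[where k = k])
  show "dif rm T Dt k ?v \<in> vec rm (T k)" using v by (intro rm.mm_closed[OF Dt_mat]) simp
  show "(\<lambda>_. \<zero>) \<in> vec rm (T k)" by (rule pwI) auto
  fix a i assume a: "a \<le> k" "i \<in> gX a"
  define b where "b = k - a"
  have b: "Suc k - Suc a = b" "Suc k - a = Suc b" "Suc (Suc k) - Suc (Suc a) = b" "Suc (Suc k) - Suc a = Suc b" "Suc (Suc k) - a = Suc (Suc b)" using a by (auto simp: b_def)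
  have s0: "sl w a \<in> vec (Fm (Suc (Suc b))) (gX a)" and s1: "sl w (Suc a) \<in> vec (Fm (Suc b)) (gX (Suc a))"
   and s2: "sl w (Suc (Suc a)) \<in> vec (Fm b) (gX (Suc (Suc a)))"
   using sl_pw[OF w, of a] sl_pw[OF w, of "Suc a"] sl_pw[OF w, of "Suc (Suc a)"] a b by simp_all
  have p1: "(\<lambda>i. \<phi> b (sl w (Suc a) i)) \<in> vec (Fm b) (gX (Suc a))" by (rule comp_phi[OF s1])
  have g2: "Ga (Fm b) (Suc a) (sl w (Suc (Suc a))) \<in> vec (Fm b) (gX (Suc a))" by (rule lin_closed[OF l s2])
  have sp: "sg (Suc a) *[pw (Fm b) (gX (Suc a))] (\<lambda>i. \<phi> b (sl w (Suc a) i)) \<in> vec (Fm b) (gX (Suc a))" by (rule PF.smult_closed[OF sg_R p1])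
  have v1: "sl ?v (Suc a) \<in> vec (Fm b) (gX (Suc a))" using sl_pw[OF v, of "Suc a"] a b by simp
  have "sl ?v (Suc a) = Ga (Fm b) (Suc a) (sl w (Suc (Suc a))) +[pw (Fm b) (gX (Suc a))] sg (Suc a) *[pw (Fm b) (gX (Suc a))] (\<lambda>i. \<phi> b (sl w (Suc a) i))"
  proof (rule pw_ext[OF v1 PF.M.add.m_closed[OF g2 sp]])
   fix i' assume "i' \<in> gX (Suc a)"
   from sl_Dt[OF w _ this] a b show "sl ?v (Suc a) i' = (Ga (Fm b) (Suc a) (sl w (Suc (Suc a))) +[pw (Fm b) (gX (Suc a))] sg (Suc a) *[pw (Fm b) (gX (Suc a))] (\<lambda>i. \<phi> b (sl w (Suc a) i))) i'"
    by simp
  qed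
  then have "Ga (Fm b) a (sl ?v (Suc a)) = Ga (Fm b) a (Ga (Fm b) (Suc a) (sl w (Suc (Suc a)))) +[pw (Fm b) (gX a)] sg (Suc a) *[pw (Fm b) (gX a)] Ga (Fm b) a (\<lambda>i. \<phi> b (sl w (Suc a) i))"
   using lin_add[OF l g2 sp] lin_smult[OF l sg_R p1] by simp
  also have "Ga (Fm b) a (Ga (Fm b) (Suc a) (sl w (Suc (Suc a)))) = \<zero>[pw (Fm b) (gX a)]" using res_zero_mm[OF rm.rmod_pw G s2] by simp
  also have "Ga (Fm b) a (\<lambda>i. \<phi> b (sl w (Suc a) i)) = (\<lambda>i. \<phi> b (Ga (Fm (Suc b)) a (sl w (Suc a)) i))" by (rule Ga_phi[OF s1, symmetric])
  finally have GV1: "Ga (Fm b) a (sl ?v (Suc a)) = \<zero>[pw (Fm b) (gX a)] +[pw (Fm b) (gX a)] sg (Suc a) *[pw (Fm b) (gX a)] (\<lambda>i. \<phi> b (Ga (Fm (Suc b)) a (sl w (Suc a)) i))" .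
  let ?g = "Ga (Fm (Suc b)) a (sl w (Suc a)) i" and ?p = "\<phi> (Suc b) (sl w a i)"
  have g: "?g \<in> carrier (Fm (Suc b))" by (rule pwD[OF lin_closed[OF l s1] a(2)])
  have p: "?p \<in> carrier (Fm (Suc b))" by (rule lin_closed[OF phi_lin pwD[OF s0 a(2)]])
  have pg: "\<phi> b ?g \<in> carrier (Fm b)" by (rule lin_closed[OF phi_lin g])
  have "sl ?v a i = ?g +[Fm (Suc b)] sg a *[Fm (Suc b)] ?p" using sl_Dt[OF w _ a(2)] a b by simp
  then have "\<phi> b (sl ?v a i) = \<phi> b ?g +[Fm b] sg a *[Fm b] \<phi> b ?p"
   using lin_add[OF phi_lin g Fm.smult_closed[OF sg_R p]] lin_smult[OF phi_lin sg_R p] by simp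
  also have "\<phi> b ?p = \<zero>[Fm b]" using phi_ex[OF p] pwD[OF s0 a(2)] by blast
  finally have pv: "\<phi> b (sl ?v a i) = \<phi> b ?g" using pg by (simp only: Fm.smult_r_null[OF sg_R] Fm.M.r_zero)
  have "sl (dif rm T Dt k ?v) a i = Ga (Fm b) a (sl ?v (Suc a)) i +[Fm b] sg a *[Fm b] \<phi> b (sl ?v a i)"
   using sl_Dt[OF v a] by (simp add: b_def)
  also have "\<dots> = sg (Suc a) *[Fm b] \<phi> b ?g +[Fm b] sg a *[Fm b] \<phi> b ?g"
   unfolding GV1 pv using Fm.smult_closed[OF sg_R pg] by (simp only: pw_sel(1-3)[of "Fm b"] Fm.M.l_zero)
  also have "\<dots> = \<zero>[Fm b]" using pg Fm.smult_closed[OF sg_R pg, of a] by (simp add: sg_Suc Fm.smult_l_minus Fm.M.l_neg del: pw_sel)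
  finally show "sl (dif rm T Dt k ?v) a i = sl (\<lambda>_. \<zero>) a i" by (simp add: sl_def)
 qed
qed

text \<open>For a cycle \<open>v\<close>, apply \<open>et\<close> to its component in G_(k+1) tensor
  F_0: contributions from positive degree of F die, so the result is a cycle of G tensor N, a
  boundary by \<open>GN\<close>, and the sweep can start.\<close>

lemma total_res: "res R T Dt"
 unfolding res_def exat_def
proof (intro conjI allI ballI iffI)
 show "finite (T k)" for k by (rule T_fin)
 show "mat R (T k) (T (Suc k)) (Dt k)" for k by (rule Dt_mat)
 fix k v assume v: "v \<in> vec rm (T (Suc k))"
 { assume "\<exists>w\<in>vec rm (T (Suc (Suc k))). v = dif rm T Dt (Suc k) w"
  then show "dif rm T Dt k v = (\<lambda>_. \<zero>[rm])" using Dt_Dt by auto }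
 assume v0: "dif rm T Dt k v = (\<lambda>_. \<zero>[rm])"
 have cyc: "Ga (Fm (k - a)) a (sl v (Suc a)) i +[Fm (k - a)] sg a *[Fm (k - a)] \<phi> (k - a) (sl v a i) = \<zero>[Fm (k - a)]" if "a \<le> k" "i \<in> gX a" for a i
  using sl_Dt[OF v that] unfolding v0 by (simp add: sl_def[of "\<lambda>_. \<zero>"])
 have vk: "sl v (Suc k) \<in> vec (Fm 0) (gX (Suc k))" "sl v k \<in> vec (Fm (Suc 0)) (gX k)" using sl_pw[OF v, of "Suc k"] sl_pw[OF v, of k] by simp_all
 have ev: "(\<lambda>i. et (sl v (Suc k) i)) \<in> vec N (gX (Suc k))" by (rule comp_et[OF vk(1)])
 have "Ga N k (\<lambda>i. et (sl v (Suc k) i)) = (\<lambda>i. et (Ga (Fm 0) k (sl v (Suc k)) i))" by (rule Ga_et[OF vk(1), symmetric])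
 also have "\<dots> = (\<lambda>_. \<zero>[N])"
 proof (rule pw_ext[where X = "gX k"])
  have GV: "Ga (Fm 0) k (sl v (Suc k)) \<in> vec (Fm 0) (gX k)" by (rule lin_closed[OF Ga_lin[OF rm.rmod_pw] vk(1)])
  show "(\<lambda>i. et (Ga (Fm 0) k (sl v (Suc k)) i)) \<in> vec N (gX k)" by (rule comp_et[OF GV])
  show "(\<lambda>_. \<zero>[N]) \<in> vec N (gX k)" by (rule pwI) auto
  fix i assume i: "i \<in> gX k"
  let ?x = "Ga (Fm 0) k (sl v (Suc k)) i" and ?y = "\<phi> 0 (sl v k i)"
  have x: "?x \<in> carrier (Fm 0)" by (rule pwD[OF GV i])
  have y: "?y \<in> carrier (Fm 0)" by (rule lin_closed[OF phi_lin pwD[OF vk(2) i]])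
  have "et (?x +[Fm 0] sg k *[Fm 0] ?y) = et ?x +[N] sg k *[N] et ?y"
   using lin_add[OF et_lin x Fm.smult_closed[OF sg_R y]] lin_smult[OF et_lin sg_R y] by simp
  moreover have "et ?y = \<zero>[N]" using et_ex[OF y] pwD[OF vk(2) i] by blast
  moreover have "?x +[Fm 0] sg k *[Fm 0] ?y = \<zero>[Fm 0]" using cyc[of k i] i by (simp del: pw_sel)
  moreover have "et \<zero>[Fm 0] = \<zero>[N]" by (rule lin_zero[OF rm.rmod_pw N et_lin])
  ultimately show "et ?x = \<zero>[N]" using lin_closed[OF et_lin x] by (simp only: N.smult_r_null[OF sg_R] N.M.r_zero)
 qed
 finally obtain n where n: "n \<in> vec N (gX (Suc (Suc k)))" "(\<lambda>i. et (sl v (Suc k) i)) = Ga N (Suc k) n"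
  using GN[of k] ev unfolding exat_def by blast
 show "\<exists>w\<in>vec rm (T (Suc (Suc k))). v = dif rm T Dt (Suc k) w"
  by (rule from_sweep[OF v n]) (use cyc in simp)
qed

lemma e_H: "e \<in> T 0 \<rightarrow> carrier H"
proof
 fix x assume "x \<in> T 0"
 then obtain i j where x: "x = (0, i, j)" "i \<in> gX 0" "j \<in> fX 0" by (auto simp: T_def)
 have "(\<lambda>i'. if i' = i then \<eta> j else \<zero>[N]) \<in> vec N (gX 0)" using x fg(5) by (intro pwI) auto
 then show "e x \<in> carrier H" unfolding x e_def using lin_closed[OF k] by simp
qed

lemma lc_e:
 assumes v: "v \<in> vec rm (T 0)"
 shows "lc H (T 0) v e = \<kappa> (\<lambda>i. et (sl v 0 i))"
proof -
 interpret PN: rmod R "pw N (gX 0)" by (rule N.rmod_pw)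
 let ?u = "\<lambda>(a::nat, i, j) i'. if i' = i then \<eta> j else \<zero>[N]"
 have u: "?u \<in> T 0 \<rightarrow> vec N (gX 0)" using fg(5) by (auto simp: T_def intro!: pwI)
 have vR: "v \<in> T 0 \<rightarrow> carrier R" using v by simp
 have "\<kappa> (lc (pw N (gX 0)) (T 0) v ?u) = lc H (T 0) v (\<lambda>x. \<kappa> (?u x))" by (rule lin_lc[OF N.rmod_pw H k vR u])
 also have "(\<lambda>x. \<kappa> (?u x)) = e" by (auto simp: e_def fun_eq_iff)
 also have "lc (pw N (gX 0)) (T 0) v ?u = (\<lambda>i. et (sl v 0 i))"
 proof (rule pw_ext[OF PN.lc_closed[OF vR u]])
  have s: "sl v 0 \<in> vec (Fm 0) (gX 0)" using sl_pw[OF v, of 0] by simp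
  show "(\<lambda>i. et (sl v 0 i)) \<in> vec N (gX 0)" by (rule comp_et[OF s])
  fix i assume i: "i \<in> gX 0"
  have "lc (pw N (gX 0)) (T 0) v ?u i = lc N (T 0) v (\<lambda>x. ?u x i)" by (rule N.pw_lc[OF vR u i])
  also have "\<dots> = (\<Oplus>\<^bsub>N\<^esub>x\<in>(\<lambda>j. (0, i, j)) ` fX 0. v x *[N] ?u x i)"
   unfolding lc_def
   by (rule N.M.add.finprod_mono_neutral_cong_right[OF T_fin]) (use i vR fg(5) in \<open>auto simp: T_def Pi_def image_iff\<close>)
  also have "\<dots> = (\<Oplus>\<^bsub>N\<^esub>j\<in>fX 0. v (0, i, j) *[N] ?u (0, i, j) i)"
   by (rule N.M.add.finprod_reindex) (use i pwR[OF v] fg(5) in \<open>auto simp: inj_on_def Pi_def\<close>)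
  also have "\<dots> = et (sl v 0 i)" unfolding lc_def sl_def by simp
  finally show "lc (pw N (gX 0)) (T 0) v ?u i = et (sl v 0 i)" .
 qed
 finally show ?thesis by simp
qed

lemma total_res_of: "res_of R H T e Dt"
 unfolding res_of_def gens_def
proof (intro conjI ballI iffI)
 show "res R T Dt" by (rule total_res)
 show "e \<in> T 0 \<rightarrow> carrier H" by (rule e_H)
 show "\<exists>v\<in>vec rm (T 0). h = lc H (T 0) v e" if h: "h \<in> carrier H" for h
 proof -
  obtain n where n: "n \<in> vec N (gX 0)" "\<kappa> n = h" using ksurj[OF h] by blast
  obtain W where W: "W \<in> vec (Fm 0) (gX 0)" "\<And>i. i \<in> gX 0 ==> et (W i) = n i"
   by (rule pw_choose[of "gX 0" "Fm 0" "\<lambda>i w. et w = n i"]) (use et_surj pwD[OF n(1)] in blast)+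
  have en: "(\<lambda>i. et (W i)) = n" by (rule pw_ext[OF comp_et[OF W(1)] n(1) W(2)])
  have W': "\<And>a. a \<le> 0 ==> (\<lambda>_. W) a \<in> vec (Fm (0 - a)) (gX a)" using W(1) by simp
  have v: "flat 0 (\<lambda>_. W) \<in> vec rm (T 0)" by (rule flat_pw[OF W'])
  have "lc H (T 0) (flat 0 (\<lambda>_. W)) e = h" using lc_e[OF v] sl_flat[of 0 "\<lambda>_. W", OF W'] en n(2) by simp
  then show ?thesis using v by blast
 qed
 fix v assume v: "v \<in> vec rm (T 0)"
 have s: "sl v 0 \<in> vec (Fm 0) (gX 0)" using sl_pw[OF v, of 0] by simp
 { assume "\<exists>w\<in>vec rm (T 1). v = mm rm (T 1) (Dt 0) (T 0) w"
  then obtain w where w: "w \<in> vec rm (T (Suc 0))" "v = dif rm T Dt 0 w" by auto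
  have w1: "sl w (Suc 0) \<in> vec (Fm 0) (gX (Suc 0))" "sl w 0 \<in> vec (Fm (Suc 0)) (gX 0)" using sl_pw[OF w(1), of "Suc 0"] sl_pw[OF w(1), of 0] by simp_all
  have "(\<lambda>i. et (sl v 0 i)) = Ga N 0 (\<lambda>i. et (sl w (Suc 0) i))"
  proof (rule pw_ext[OF comp_et[OF s]])
   have ew: "(\<lambda>i. et (sl w (Suc 0) i)) \<in> vec N (gX (Suc 0))" by (rule comp_et[OF w1(1)])
   show "Ga N 0 (\<lambda>i. et (sl w (Suc 0) i)) \<in> vec N (gX 0)" by (rule lin_closed[OF Ga_lin[OF N] ew])
   fix i assume i: "i \<in> gX 0"
   let ?x = "Ga (Fm 0) 0 (sl w (Suc 0)) i" and ?y = "\<phi> 0 (sl w 0 i)"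
   have x: "?x \<in> carrier (Fm 0)" by (rule pwD[OF lin_closed[OF Ga_lin[OF rm.rmod_pw] w1(1)] i])
   have y: "?y \<in> carrier (Fm 0)" by (rule lin_closed[OF phi_lin pwD[OF w1(2) i]])
   have "sl v 0 i = ?x +[Fm 0] sg 0 *[Fm 0] ?y" using sl_Dt[OF w(1) _ i] w(2) by simp
   then have "et (sl v 0 i) = et ?x +[N] sg 0 *[N] et ?y"
    using lin_add[OF et_lin x Fm.smult_closed[OF sg_R y]] lin_smult[OF et_lin sg_R y] by simp
   moreover have "et ?y = \<zero>[N]" using et_ex[OF y] pwD[OF w1(2) i] by blast
   ultimately have "et (sl v 0 i) = et ?x" using lin_closed[OF et_lin x] by (simp only: N.smult_r_null[OF sg_R] N.M.r_zero)
   then show "et (sl v 0 i) = Ga N 0 (\<lambda>i. et (sl w (Suc 0) i)) i" using fun_cong[OF Ga_et[OF w1(1)], of i] by simp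
  qed
  then have "\<kappa> (\<lambda>i. et (sl v 0 i)) = \<zero>[H]" using kker[OF comp_et[OF s]] comp_et[OF w1(1)] by auto
  then show "lc H (T 0) v e = \<zero>[H]" using lc_e[OF v] by simp }
 assume "lc H (T 0) v e = \<zero>[H]"
 then have "\<kappa> (\<lambda>i. et (sl v 0 i)) = \<zero>[H]" using lc_e[OF v] by simp
 then obtain n where n: "n \<in> vec N (gX (Suc 0))" "(\<lambda>i. et (sl v 0 i)) = Ga N 0 n" using kker[OF comp_et[OF s]] by auto
 from from_sweep[OF v n] show "\<exists>w\<in>vec rm (T 1). v = mm rm (T 1) (Dt 0) (T 0) w" by simp
qed

end

section \<open>Tensoring with a module of finite projective dimension\<close>

context two_res begin

lemma Ga_entry:
 assumes v: "v \<in> vec (Fm b) (gX (Suc k))" and j: "j \<in> fX b"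
 shows "Ga (Fm b) k v i j = Ga rm k (\<lambda>i. v i j) i"
proof (cases "i \<in> gX k")
 case True
 then show ?thesis using rm.pw_lc[of "G k i" "gX (Suc k)" v "fX b" j] fg(2)[of k] Fm.pw_Pi[OF v] j by (simp add: mm_def mat_def)
qed (simp add: mm_def)

text \<open>G tensor F_b is a direct sum of copies of G, one for each \<open>j\<close> in
  \<open>fX b\<close>; exactness is checked for each fixed \<open>j\<close>.\<close>

lemma exF:
 assumes v: "v \<in> vec (Fm b) (gX (Suc k))" "Ga (Fm b) k v = (\<lambda>_. \<zero>[Fm b])"
 shows "\<exists>w\<in>vec (Fm b) (gX (Suc (Suc k))). v = Ga (Fm b) (Suc k) w"
proof -
 have "\<exists>w\<in>vec rm (gX (Suc (Suc k))). (\<lambda>i. v i j) = Ga rm (Suc k) w" if j: "j \<in> fX b" for j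
 proof -
  have "(\<lambda>i. v i j) \<in> vec rm (gX (Suc k))"
   by (rule pwI) (use pwR[OF Fm.pw_all[OF v(1)]] pw0[OF v(1)] in auto)
  moreover have "Ga rm k (\<lambda>i. v i j) = (\<lambda>_. \<zero>[rm])" using Ga_entry[OF v(1) j] v(2) by (auto simp: fun_eq_iff)
  ultimately show ?thesis using G unfolding res_def exat_def by blast
 qed
 then obtain W where W: "W \<in> vec (pw rm (gX (Suc (Suc k)))) (fX b)" "\<And>j. j \<in> fX b ==> (\<lambda>i. v i j) = Ga rm (Suc k) (W j)"
  using pw_choose[of "fX b" _ "\<lambda>j w. (\<lambda>i. v i j) = Ga rm (Suc k) w"] by metis
 let ?w = "\<lambda>i j. W j i"
 have Wp: "W j \<in> vec rm (gX (Suc (Suc k)))" for j by (rule rmod.pw_all[OF rm.rmod_pw W(1)])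
 have w: "?w \<in> vec (Fm b) (gX (Suc (Suc k)))"
  by (intro pwI) (use pwR[OF Wp] pw0[OF W(1)] pw0[OF Wp] in auto)
 have Gw: "Ga (Fm b) (Suc k) ?w \<in> vec (Fm b) (gX (Suc k))" by (rule lin_closed[OF Ga_lin[OF rm.rmod_pw] w])
 have "v = Ga (Fm b) (Suc k) ?w"
 proof (rule pw_ext[OF v(1) Gw], rule pw_ext[OF Fm.pw_all[OF v(1)] Fm.pw_all[OF Gw]])
  fix i j assume "j \<in> fX b"
  then show "v i j = Ga (Fm b) (Suc k) ?w i j" using Ga_entry[OF w] fun_cong[OF W(2), of j i] by simp
 qed
 then show ?thesis using w by blast
qed

text \<open>Tor vanishes above \<open>q\<close>, by a chase along a diagonal of the double
  complex.\<close>

lemma tor_vanish: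
 assumes q: "\<And>j. j > q ==> fX j = {}" and k: "q \<le> k"
 shows "exa N gX G k"
proof -
 have Gz: "Ga A k (Ga A (Suc k) v) = (\<lambda>_. \<zero>[A])" if "rmod R A" "v \<in> vec A (gX (Suc (Suc k)))" for A :: "('a, 'm) module" and k v
  by (rule res_zero_mm[OF that(1) G that(2)])
 have exF: "\<exists>w\<in>vec (Fm b) (gX (Suc (Suc k))). v = Ga (Fm b) (Suc k) w"
  if v: "v \<in> vec (Fm b) (gX (Suc k))" "Ga (Fm b) k v = (\<lambda>_. \<zero>[Fm b])" for b k v
  by (rule exF[OF that])
 \<comment> \<open>A cycle modulo the image of \<phi> is a boundary modulo the image of \<phi>. The
   obstruction \<open>v'\<close> has F-degree one higher and G-degree one lower; after at most
   \<open>q - b\<close> such moves it lies in a zero term of F, and \<open>q - b \<le> k\<close>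
   guarantees that G has enough degrees.\<close>
 have S: "\<exists>w\<in>vec (Fm b) (gX (Suc (Suc k))). \<exists>w'\<in>vec (Fm (Suc b)) (gX (Suc k)).
   v = Ga (Fm b) (Suc k) w +[pw (Fm b) (gX (Suc k))] (\<lambda>i. \<phi> b (w' i))"
  if "q - b \<le> k" "v \<in> vec (Fm b) (gX (Suc k))" "v' \<in> vec (Fm (Suc b)) (gX k)" "Ga (Fm b) k v = (\<lambda>i. \<phi> b (v' i))" for b k v v'
  using that
 proof (induct "q - b" arbitrary: b k v v')
  case 0
  have e: "fX (Suc b) = {}" by (rule q) (use 0(1) in simp)
  have "v' i = (\<lambda>_. \<zero>)" for i using Fm.pw_all[OF 0(4), of i] pw0[of "v' i" rm "fX (Suc b)"] unfolding e by auto
  then have "Ga (Fm b) k v = (\<lambda>_. \<zero>[Fm b])" unfolding 0(5) using lin_zero[OF rm.rmod_pw rm.rmod_pw phi_lin, of b] by simp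
  from exF[OF 0(3) this] obtain w where w: "w \<in> vec (Fm b) (gX (Suc (Suc k)))" "v = Ga (Fm b) (Suc k) w" by blast
  have z: "(\<lambda>_. \<zero>[Fm (Suc b)]) \<in> vec (Fm (Suc b)) (gX (Suc k))" by (rule pwI) (auto simp del: pw_sel intro: Fm.M.zero_closed)
  have "(\<lambda>i::nat. \<phi> b \<zero>[Fm (Suc b)]) = \<zero>[pw (Fm b) (gX (Suc k))]"
   using lin_zero[OF rm.rmod_pw rm.rmod_pw phi_lin, of b] by simp
  then have "v = Ga (Fm b) (Suc k) w +[pw (Fm b) (gX (Suc k))] (\<lambda>i. \<phi> b \<zero>[Fm (Suc b)])"
   using PF.M.r_zero[OF 0(3)] w(2) by metis
  then show ?case by (intro bexI[OF _ w(1)] bexI[OF _ z])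
 next
  case (Suc d)
  then obtain k' where k': "k = Suc k'" by (cases k) auto
  have Kv': "Ga (Fm (Suc b)) k' v' \<in> vec (Fm (Suc b)) (gX k')" using Suc(5) unfolding k' by (rule lin_closed[OF Ga_lin[OF rm.rmod_pw]])
  have "(\<lambda>i. \<phi> b (Ga (Fm (Suc b)) k' v' i)) = Ga (Fm b) k' (Ga (Fm b) (Suc k') v)"
   using Ga_phi[of v' b k'] Suc(5,6) unfolding k' by simp
  also have "\<dots> = (\<lambda>_. \<zero>[Fm b])" by (rule Gz[OF rm.rmod_pw Suc(4)[unfolded k']])
  finally have z: "\<phi> b (Ga (Fm (Suc b)) k' v' i) = \<zero>[Fm b]" for i by (rule fun_cong)
  have "\<exists>y\<in>carrier (Fm (Suc (Suc b))). Ga (Fm (Suc b)) k' v' i = \<phi> (Suc b) y" if "i \<in> gX k'" for i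
   using phi_ex[OF pwD[OF Kv' that]] z by blast
  then obtain v'' where v'': "v'' \<in> vec (Fm (Suc (Suc b))) (gX k')" "\<And>i. i \<in> gX k' ==> Ga (Fm (Suc b)) k' v' i = \<phi> (Suc b) (v'' i)"
   using pw_choose[of "gX k'" _ "\<lambda>i y. Ga (Fm (Suc b)) k' v' i = \<phi> (Suc b) y"] by metis
  have "Ga (Fm (Suc b)) k' v' = (\<lambda>i. \<phi> (Suc b) (v'' i))" by (rule pw_ext[OF Kv' comp_phi[OF v''(1)] v''(2)])
  have d: "d = q - Suc b" "q - Suc b \<le> k'" using Suc(2,3) k' by simp_all
  from Suc(1)[OF d Suc(5)[unfolded k'] v''(1) \<open>Ga (Fm (Suc b)) k' v' = (\<lambda>i. \<phi> (Suc b) (v'' i))\<close>] obtain w0 w0' where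
   w0: "w0 \<in> vec (Fm (Suc b)) (gX (Suc k))" "w0' \<in> vec (Fm (Suc (Suc b))) (gX k)"
   "v' = Ga (Fm (Suc b)) k w0 +[pw (Fm (Suc b)) (gX k)] (\<lambda>i. \<phi> (Suc b) (w0' i))" unfolding k' by blast
  have pw0: "(\<lambda>i. \<phi> b (w0 i)) \<in> vec (Fm b) (gX (Suc k))" by (rule comp_phi[OF w0(1)])
  have "(\<lambda>i. \<phi> b (v' i)) = (\<lambda>i. \<phi> b (Ga (Fm (Suc b)) k w0 i))"
  proof
   fix i
   have a: "Ga (Fm (Suc b)) k w0 i \<in> carrier (Fm (Suc b))" by (rule Fm.pw_all[OF lin_closed[OF Ga_lin[OF rm.rmod_pw] w0(1)]])
   have b: "\<phi> (Suc b) (w0' i) \<in> carrier (Fm (Suc b))" by (rule Fm.pw_all[OF comp_phi[OF w0(2)]])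
   have "\<phi> b (\<phi> (Suc b) (w0' i)) = \<zero>[Fm b]" using phi_ex[OF b] Fm.pw_all[OF w0(2), of i] by blast
   then show "\<phi> b (v' i) = \<phi> b (Ga (Fm (Suc b)) k w0 i)"
    unfolding w0(3) using lin_add[OF phi_lin a b] Fm.M.r_zero[OF lin_closed[OF phi_lin a]] by (simp only: pw_sel(2)[where X = "gX k"])
  qed
  also have "\<dots> = Ga (Fm b) k (\<lambda>i. \<phi> b (w0 i))" by (rule Ga_phi[OF w0(1)])
  finally have "Ga (Fm b) k v = Ga (Fm b) k (\<lambda>i. \<phi> b (w0 i))" using Suc(6) by simp
  then have "Ga (Fm b) k (v -[pw (Fm b) (gX (Suc k))] (\<lambda>i. \<phi> b (w0 i))) = \<zero>[pw (Fm b) (gX k)]"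
   using lin_minus[OF Fm.rmod_pw Fm.rmod_pw Ga_lin[OF rm.rmod_pw] Suc(4) pw0] PF.M.r_neg[OF lin_closed[OF Ga_lin[OF rm.rmod_pw] pw0]]
   by (simp only: a_minus_def)
  then obtain w where w: "w \<in> vec (Fm b) (gX (Suc (Suc k)))" "v -[pw (Fm b) (gX (Suc k))] (\<lambda>i. \<phi> b (w0 i)) = Ga (Fm b) (Suc k) w"
   using exF[OF PF.M.minus_closed[OF Suc(4) pw0]] by auto
  have "v = Ga (Fm b) (Suc k) w +[pw (Fm b) (gX (Suc k))] (\<lambda>i. \<phi> b (w0 i))"
   unfolding w(2)[symmetric] a_minus_def using Suc(4) pw0 PF.M.a_inv_closed[OF pw0] PF.M.l_neg[OF pw0] PF.M.r_zero[OF Suc(4)]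
   by (simp only: PF.M.a_assoc)
  then show ?case using w(1) w0(1) by blast
 qed
 show ?thesis unfolding exat_def
 proof (intro ballI iffI)
  fix v assume v: "v \<in> vec N (gX (Suc k))"
  { assume "\<exists>w\<in>vec N (gX (Suc (Suc k))). v = Ga N (Suc k) w"
   then show "Ga N k v = (\<lambda>_. \<zero>[N])" using Gz[OF N] by auto }
  assume v0: "Ga N k v = (\<lambda>_. \<zero>[N])"
  obtain u where u: "u \<in> vec (Fm 0) (gX (Suc k))" "\<And>i. i \<in> gX (Suc k) ==> et (u i) = v i"
   by (rule pw_choose[of "gX (Suc k)" "Fm 0" "\<lambda>i w. et w = v i"]) (use et_surj pwD[OF v] in blast)+
  have en: "(\<lambda>i. et (u i)) = v" by (rule pw_ext[OF comp_et[OF u(1)] v u(2)])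
  have Gu: "Ga (Fm 0) k u \<in> vec (Fm 0) (gX k)" by (rule lin_closed[OF Ga_lin[OF rm.rmod_pw] u(1)])
  have "\<exists>y\<in>carrier (Fm (Suc 0)). Ga (Fm 0) k u i = \<phi> 0 y" if "i \<in> gX k" for i
   using et_ex[OF pwD[OF Gu that]] fun_cong[OF Ga_et[OF u(1)], of i] v0 en by simp
  then obtain v' where v': "v' \<in> vec (Fm (Suc 0)) (gX k)" "\<And>i. i \<in> gX k ==> Ga (Fm 0) k u i = \<phi> 0 (v' i)"
   using pw_choose[of "gX k" _ "\<lambda>i y. Ga (Fm 0) k u i = \<phi> 0 y"] by metis
  have "Ga (Fm 0) k u = (\<lambda>i. \<phi> 0 (v' i))" by (rule pw_ext[OF Gu comp_phi[OF v'(1)] v'(2)])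
  from S[OF _ u(1) v'(1) this] k obtain w w' where w: "w \<in> vec (Fm 0) (gX (Suc (Suc k)))" "w' \<in> vec (Fm (Suc 0)) (gX (Suc k))"
   "u = Ga (Fm 0) (Suc k) w +[pw (Fm 0) (gX (Suc k))] (\<lambda>i. \<phi> 0 (w' i))" by auto
  have "et (u i) = et (Ga (Fm 0) (Suc k) w i)" for i
  proof -
   have a: "Ga (Fm 0) (Suc k) w i \<in> carrier (Fm 0)" by (rule Fm.pw_all[OF lin_closed[OF Ga_lin[OF rm.rmod_pw] w(1)]])
   have b: "\<phi> 0 (w' i) \<in> carrier (Fm 0)" by (rule Fm.pw_all[OF comp_phi[OF w(2)]])
   have "et (\<phi> 0 (w' i)) = \<zero>[N]" using et_ex[OF b] Fm.pw_all[OF w(2), of i] by blast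
   then show ?thesis
    unfolding w(3) using lin_add[OF et_lin a b] N.M.r_zero[OF lin_closed[OF et_lin a]] by (simp only: pw_sel(2)[where X = "gX (Suc k)"])
  qed
  then have "v = (\<lambda>i. et (Ga (Fm 0) (Suc k) w i))" using en by auto
  also have "\<dots> = Ga N (Suc k) (\<lambda>i. et (w i))" by (rule Ga_et[OF w(1)])
  finally show "\<exists>w\<in>vec N (gX (Suc (Suc k))). v = Ga N (Suc k) w" using comp_et[OF w(1)] by blast
 qed
qed

end

section \<open>Hom of two modules as a cokernel\<close>

context crng begin

lemma hom_sel: "carrier (hom_module R A B) = lin_maps R A B" "\<zero>[hom_module R A B] = (\<lambda>x\<in>carrier A. \<zero>[B])"
 "f +[hom_module R A B] g = (\<lambda>x\<in>carrier A. f x +[B] g x)" "a *[hom_module R A B] f = (\<lambda>x\<in>carrier A. a *[B] f x)"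
 by (simp_all add: hom_module_def)

lemma lin_maps_ext: "f \<in> lin_maps R A B ==> g \<in> lin_maps R A B ==> (\<And>x. x \<in> carrier A ==> f x = g x) ==> f = g"
 by (rule extensionalityI[of _ "carrier A"]) (auto simp: lin_maps_def PiE_def)

lemma rmod_hom:
 assumes A: "rmod R A" and B: "rmod R B"
 shows "rmod R (hom_module R A B)" (is "rmod R ?H")
proof -
 interpret A: rmod R A by (rule A)
 interpret B: rmod R B by (rule B)
 note L = lin_maps_lin and c = lin_closed[OF lin_maps_lin]
 have add: "f +[?H] g \<in> carrier ?H" if "f \<in> carrier ?H" "g \<in> carrier ?H" for f g
  unfolding hom_sel
  by (rule lin_lin_maps[OF A linI])
   (use that[unfolded hom_sel] in \<open>auto simp: c lin_add[OF L] lin_smult[OF L] B.M.add.m_ac B.smult_r_distr\<close>)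
 have smult: "a *[?H] f \<in> carrier ?H" if "a \<in> carrier R" "f \<in> carrier ?H" for a f
  unfolding hom_sel
  by (rule lin_lin_maps[OF A linI])
   (use that[unfolded hom_sel] in \<open>auto simp: c lin_add[OF L] lin_smult[OF L] B.smult_r_distr B.smult_assoc1[symmetric] m_comm\<close>)
 have zero: "\<zero>[?H] \<in> carrier ?H" unfolding hom_sel by (rule lin_lin_maps[OF A linI]) auto
 have ext: "f = g" if "f \<in> carrier ?H" "g \<in> carrier ?H" "\<And>x. x \<in> carrier A ==> f x = g x" for f g
  using that unfolding hom_sel(1) by (rule lin_maps_ext)
 have cl: "f x \<in> carrier B" if "f \<in> carrier ?H" "x \<in> carrier A" for f x using that unfolding hom_sel(1) by (rule c)
 have v: "\<zero>[?H] x = \<zero>[B]" "(f +[?H] g) x = f x +[B] g x" "(a *[?H] f) x = a *[B] f x" if "x \<in> carrier A" for f g a x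
  using that by (simp_all add: hom_sel)
 show ?thesis
 proof (rule rmodI[OF is_cring abelian_groupI])
  show "\<exists>g\<in>carrier ?H. g +[?H] f = \<zero>[?H]" if f: "f \<in> carrier ?H" for f
  proof
   show n: "(\<ominus> \<one>) *[?H] f \<in> carrier ?H" using f by (intro smult) auto
   show "((\<ominus> \<one>) *[?H] f) +[?H] f = \<zero>[?H]"
    by (rule ext[OF add[OF n f] zero]) (simp add: v cl f B.smult_l_minus B.M.l_neg)
  qed
 qed (auto intro!: add zero smult ext simp: v cl B.M.add.m_ac B.smult_l_distr B.smult_r_distr B.smult_assoc1)
qed

text \<open>A homomorphism is known by its values on the generators \<open>\<mu>\<close>, so Hom(M,
  N) is the kernel of the transpose of \<open>\<Lambda> 0\<close> with coefficients in
  \<open>N\<close>. By \<open>e1\<close> this kernel is the image of \<open>A\<close>, and by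
  \<open>e0\<close> that image is the cokernel of \<open>G0\<close>; \<kappa> is the induced
  map.\<close>

lemma hom_presentation:
 assumes M: "rmod R M" and N: "rmod R N" and r: "res_of R M lX \<mu> \<Lambda>"
  and g0: "finite g0" and A: "mat R (lX 0) g0 A"
  and e1: "exat N g0 A (lX 0) (tp (\<Lambda> 0)) (lX 1)" and e0: "exat N g1 G0 g0 A (lX 0)"
 obtains \<kappa> where "lin R (pw N g0) (hom_module R M N) \<kappa>"
  "\<And>h. h \<in> carrier (hom_module R M N) ==> \<exists>n\<in>vec N g0. \<kappa> n = h"
  "\<And>n. n \<in> vec N g0 ==> \<kappa> n = \<zero>[hom_module R M N] \<longleftrightarrow> (\<exists>w\<in>vec N g1. n = mm N g1 G0 g0 w)"
proof -
 interpret M: rmod R M by (rule M)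
 interpret N: rmod R N by (rule N)
 interpret rm: rmod R rm by (rule rmod_rm)
 interpret L: rmod R "pw rm (lX 0)" by (rule rm.rmod_pw)
 let ?L = "lX 0" and ?H = "hom_module R M N" and ?Z = "\<lambda>v. mm N (lX 0) (tp (\<Lambda> 0)) (lX 1) v = (\<lambda>_. \<zero>[N])"
 have f: "finite ?L" "finite (lX 1)" "mat R ?L (lX 1) (\<Lambda> 0)" "\<mu> \<in> ?L \<rightarrow> carrier M"
  using r by (auto simp: res_of_def res_def gens_def)
 have mu: "\<exists>c\<in>vec rm ?L. m = lc M ?L c \<mu>" if "m \<in> carrier M" for m using r that by (simp add: res_of_def gens_def)
 have lM: "lin R (pw rm ?L) M (\<lambda>c. lc M ?L c \<mu>)" by (rule lc_lin[OF M f(1,4)])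
 have lN: "lin R (pw rm ?L) N (\<lambda>c. lc N ?L c v)" if "v \<in> vec N ?L" for v by (rule lc_lin[OF N f(1) N.pw_Pi[OF that]])
 have lA: "lin R (pw N g0) (pw N ?L) (mm N g0 A ?L)" by (rule N.mm_lin[OF g0 A])
 \<comment> \<open>A vector killed by the transpose of \<open>\<Lambda> 0\<close> respects the
   relations among the generators of \<open>M\<close>, so the value depends on the element of
   \<open>M\<close> only.\<close>
 have wd: "lc N ?L c v = lc N ?L c' v" if v: "v \<in> vec N ?L" "?Z v"
  and c: "c \<in> vec rm ?L" "c' \<in> vec rm ?L" "lc M ?L c \<mu> = lc M ?L c' \<mu>" for v c c'
 proof -
  have d: "c -[pw rm ?L] c' \<in> vec rm ?L" by (rule L.M.minus_closed[OF c(1,2)])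
  have "lc M ?L (c -[pw rm ?L] c') \<mu> = \<zero>[M]"
   using lin_minus[OF rm.rmod_pw M lM c(1,2)] c(3) lin_closed[OF lM c(2)] by (simp only: M.M.r_neg a_minus_def)
  then obtain w where w: "w \<in> vec rm (lX 1)" "c -[pw rm ?L] c' = mm rm (lX 1) (\<Lambda> 0) ?L w" using r d unfolding res_of_def by auto
  have "lc N ?L (c -[pw rm ?L] c') v = lc N (lX 1) w (\<lambda>_. \<zero>[N])"
   using lc_mm[OF N f(2,1,3) pwR_Pi[OF w(1)] N.pw_Pi[OF v(1)]] v(2) w(2) by simp
  also have "\<dots> = \<zero>[N]" by (rule N.lc_zero_r[OF pwR_Pi[OF w(1)]])
  finally have "lc N ?L c v -[N] lc N ?L c' v = \<zero>[N]" using lin_minus[OF rm.rmod_pw N lN[OF v(1)] c(1,2)] by simp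
  then show ?thesis by (rule N.minus_eq_zeroD[OF lin_closed[OF lN[OF v(1)] c(1)] lin_closed[OF lN[OF v(1)] c(2)]])
 qed
 obtain ch where ch: "\<And>m. m \<in> carrier M ==> ch m \<in> vec rm ?L" "\<And>m. m \<in> carrier M ==> lc M ?L (ch m) \<mu> = m"
  using mu by metis
 define \<kappa> where "\<kappa> n = (\<lambda>m\<in>carrier M. lc N ?L (ch m) (mm N g0 A ?L n))" for n
 have AZ: "mm N g0 A ?L n \<in> vec N ?L" "?Z (mm N g0 A ?L n)" if "n \<in> vec N g0" for n
 proof -
  show c: "mm N g0 A ?L n \<in> vec N ?L" by (rule lin_closed[OF lA that])
  show "?Z (mm N g0 A ?L n)" using e1 c that unfolding exat_def by blast
 qed
 have kv: "\<kappa> n (lc M ?L c \<mu>) = lc N ?L c (mm N g0 A ?L n)" if n: "n \<in> vec N g0" and c: "c \<in> vec rm ?L" for n c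
 proof -
  have m: "lc M ?L c \<mu> \<in> carrier M" by (rule lin_closed[OF lM c])
  show ?thesis using wd[OF AZ[OF n] ch(1)[OF m] c ch(2)[OF m]] m by (simp add: \<kappa>_def)
 qed
 have kl: "\<kappa> n \<in> lin_maps R M N" if n: "n \<in> vec N g0" for n
 proof -
  have "lin R M N (\<kappa> n)"
  proof (rule linI)
   fix m assume "m \<in> carrier M"
   then obtain c where c: "c \<in> vec rm ?L" "m = lc M ?L c \<mu>" using mu by blast
   show "\<kappa> n m \<in> carrier N" using lin_closed[OF lN[OF AZ(1)[OF n]] c(1)] kv[OF n c(1)] c(2) by simp
   { fix m' assume "m' \<in> carrier M"
    then obtain c' where c': "c' \<in> vec rm ?L" "m' = lc M ?L c' \<mu>" using mu by blast
    have cc: "c +[pw rm ?L] c' \<in> vec rm ?L" by (rule L.M.a_closed[OF c(1) c'(1)])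
    have "\<kappa> n (lc M ?L (c +[pw rm ?L] c') \<mu>) = \<kappa> n m +[N] \<kappa> n m'"
     unfolding c(2) c'(2) kv[OF n cc] kv[OF n c(1)] kv[OF n c'(1)] by (rule lin_add[OF lN[OF AZ(1)[OF n]] c(1) c'(1)])
    then show "\<kappa> n (m +[M] m') = \<kappa> n m +[N] \<kappa> n m'" unfolding lin_add[OF lM c(1) c'(1)] c(2)[symmetric] c'(2)[symmetric] . }
   fix a assume a: "a \<in> carrier R"
   have ac: "a *[pw rm ?L] c \<in> vec rm ?L" by (rule L.smult_closed[OF a c(1)])
   have "\<kappa> n (lc M ?L (a *[pw rm ?L] c) \<mu>) = a *[N] \<kappa> n m"
    unfolding c(2) kv[OF n ac] kv[OF n c(1)] by (rule lin_smult[OF lN[OF AZ(1)[OF n]] a c(1)])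
   then show "\<kappa> n (a *[M] m) = a *[N] \<kappa> n m" unfolding lin_smult[OF lM a c(1)] c(2)[symmetric] .
  qed
  then have "restrict (\<kappa> n) (carrier M) \<in> lin_maps R M N" by (rule lin_lin_maps[OF M])
  then show ?thesis by (simp add: \<kappa>_def)
 qed
 have kext: "\<kappa> n = f" if "n \<in> vec N g0" "f \<in> lin_maps R M N"
  "\<And>c. c \<in> vec rm ?L ==> lc N ?L c (mm N g0 A ?L n) = f (lc M ?L c \<mu>)" for n f
  by (rule lin_maps_ext[OF kl[OF that(1)] that(2)]) (use mu kv[OF that(1)] that(3) in metis)
 interpret H: rmod R ?H by (rule rmod_hom[OF M N])
 interpret P: rmod R "pw N g0" by (rule N.rmod_pw)
 show ?thesis
 proof
  show "lin R (pw N g0) ?H \<kappa>"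
  proof (rule linI)
   fix n assume n: "n \<in> vec N g0"
   show kn: "\<kappa> n \<in> carrier ?H" using kl[OF n] by (simp add: hom_sel)
   { fix n' assume n': "n' \<in> vec N g0"
    have "\<kappa> n +[?H] \<kappa> n' \<in> lin_maps R M N" using H.M.a_closed[of "\<kappa> n" "\<kappa> n'"] kl[OF n] kl[OF n'] by (simp add: hom_sel(1))
    then show "\<kappa> (n +[pw N g0] n') = \<kappa> n +[?H] \<kappa> n'"
    proof (rule kext[OF P.M.a_closed[OF n n']])
     fix c assume c: "c \<in> vec rm ?L"
     have "lc N ?L c (mm N g0 A ?L (n +[pw N g0] n')) = lc N ?L c (mm N g0 A ?L n) +[N] lc N ?L c (mm N g0 A ?L n')"
      unfolding lin_add[OF lA n n'] unfolding pw_sel by (rule N.lc_add_r[OF pwR_Pi[OF c] N.pw_Pi[OF AZ(1)[OF n']] N.pw_Pi[OF AZ(1)[OF n]]])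
     then show "lc N ?L c (mm N g0 A ?L (n +[pw N g0] n')) = (\<kappa> n +[?H] \<kappa> n') (lc M ?L c \<mu>)"
      using kv[OF n c] kv[OF n' c] lin_closed[OF lM c] by (simp add: hom_sel)
    qed }
   fix a assume a: "a \<in> carrier R"
   have "a *[?H] \<kappa> n \<in> lin_maps R M N" using H.smult_closed[OF a kn] by (simp add: hom_sel(1))
   then show "\<kappa> (a *[pw N g0] n) = a *[?H] \<kappa> n"
   proof (rule kext[OF P.smult_closed[OF a n]])
    fix c assume c: "c \<in> vec rm ?L"
    have "lc N ?L c (mm N g0 A ?L (a *[pw N g0] n)) = a *[N] lc N ?L c (mm N g0 A ?L n)"
     unfolding lin_smult[OF lA a n] unfolding pw_sel by (rule N.lc_smult_r[OF f(1) a pwR_Pi[OF c] N.pw_Pi[OF AZ(1)[OF n]]])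
    then show "lc N ?L c (mm N g0 A ?L (a *[pw N g0] n)) = (a *[?H] \<kappa> n) (lc M ?L c \<mu>)"
     using kv[OF n c] lin_closed[OF lM c] by (simp add: hom_sel)
   qed
  qed
  show "\<exists>n\<in>vec N g0. \<kappa> n = h" if "h \<in> carrier ?H" for h
  proof -
   have h: "h \<in> lin_maps R M N" using that by (simp add: hom_sel)
   note hl = lin_maps_lin[OF h]
   let ?v = "\<lambda>x. if x \<in> ?L then h (\<mu> x) else \<zero>[N]"
   have v: "?v \<in> vec N ?L" by (rule pwI) (use f(4) lin_closed[OF hl] in auto)
   have hv: "lc N ?L c ?v = h (lc M ?L c \<mu>)" if "c \<in> ?L \<rightarrow> carrier R" for c
    using lin_lc[OF M N hl that f(4)] N.lc_cong[of ?L c c "\<lambda>x. h (\<mu> x)" ?v, OF _ _ that N.pw_Pi[OF v]] by simp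
   have "?Z ?v"
   proof (rule pw_ext[where X = "lX 1"])
    show "mm N ?L (tp (\<Lambda> 0)) (lX 1) ?v \<in> vec N (lX 1)" by (rule N.mm_closed[OF _ N.pw_Pi[OF v]]) (use f(3) in simp)
    show "(\<lambda>_. \<zero>[N]) \<in> vec N (lX 1)" by (rule pwI) auto
    fix y assume y: "y \<in> lX 1"
    have g: "free_gen R y \<in> vec rm (lX 1)" by (rule gen_pw[OF y])
    let ?c = "mm rm (lX 1) (\<Lambda> 0) ?L (free_gen R y)"
    have c: "?c \<in> vec rm ?L" by (rule rm.mm_closed[OF f(3)]) (use g in simp)
    have "lc M ?L ?c \<mu> = \<zero>[M]" using r c g unfolding res_of_def by blast
    moreover have "tp (\<Lambda> 0) y \<in> ?L \<rightarrow> carrier R" using f(3) y by (auto simp: mat_def tp_def)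
    moreover have "lc M ?L (tp (\<Lambda> 0) y) \<mu> = lc M ?L ?c \<mu>"
     by (rule M.lc_cong) (use y f mm_gen[OF f(2,3) y] c in \<open>auto simp: tp_def mat_def\<close>)
    ultimately show "mm N ?L (tp (\<Lambda> 0)) (lX 1) ?v y = \<zero>[N]" using hv[of "tp (\<Lambda> 0) y"] y lin_zero[OF M N hl] by (simp add: mm_def)
   qed
   then obtain n where n: "n \<in> vec N g0" "?v = mm N g0 A ?L n" using e1 v unfolding exat_def by blast
   have "\<kappa> n = h" by (rule kext[OF n(1) h]) (use hv n(2) in simp)
   then show ?thesis using n(1) by blast
  qed
  fix n assume n: "n \<in> vec N g0"
  have "\<kappa> n = \<zero>[?H] \<longleftrightarrow> mm N g0 A ?L n = (\<lambda>_. \<zero>[N])"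
  proof
   assume k0: "\<kappa> n = \<zero>[?H]"
   show "mm N g0 A ?L n = (\<lambda>_. \<zero>[N])"
   proof (rule pw_ext[OF AZ(1)[OF n]])
    show "(\<lambda>_. \<zero>[N]) \<in> vec N ?L" by (rule pwI) auto
    fix x assume x: "x \<in> ?L"
    have "mm N g0 A ?L n x = \<kappa> n (\<mu> x)"
     using kv[OF n gen_pw[OF x]] M.lc_gen[OF f(1) x f(4)] N.lc_gen[OF f(1) x N.pw_Pi[OF AZ(1)[OF n]]] by simp
    then show "mm N g0 A ?L n x = \<zero>[N]" using k0 f(4) x by (auto simp: hom_sel)
   qed
  next
   assume "mm N g0 A ?L n = (\<lambda>_. \<zero>[N])"
   then show "\<kappa> n = \<zero>[?H]"
    by (intro kext[OF n]) (use H.M.zero_closed lin_closed[OF lM] N.lc_zero_r[OF pwR_Pi] in \<open>auto simp: hom_sel\<close>)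
  qed
  then show "\<kappa> n = \<zero>[?H] \<longleftrightarrow> (\<exists>w\<in>vec N g1. n = mm N g1 G0 g0 w)" using e0 n unfolding exat_def by blast
 qed
qed

end

section \<open>Frobenius vanishing bounds a minimal resolution\<close>

lemma (in total) Dt_mx:
 assumes "lnr R" and G: "\<And>i y x. y \<in> gX i ==> x \<in> gX (Suc i) ==> G i y x \<in> max_ideal R"
  and F: "\<And>i y x. y \<in> fX i ==> x \<in> fX (Suc i) ==> F i y x \<in> max_ideal R"
  and y: "y \<in> T k" "x \<in> T (Suc k)"
 shows "Dt k y x \<in> max_ideal R"
proof -
 interpret lnr R by fact
 obtain a i j a' i' j' where e: "y = (a, i, j)" "x = (a', i', j')" by (cases y, cases x)
 have "sg a \<otimes> F (k - a) j j' \<in> mx" if "a' = a"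
  by (rule mx_mult_l[OF F sg_R]) (use y that in \<open>auto simp: T_def e Suc_diff_le\<close>)
 moreover have "G a i i' \<in> mx" if "a' = Suc a" using G[of i a i'] y that by (auto simp: T_def e)
 ultimately show ?thesis using mx_zero by (simp add: Dt_def e)
qed

text \<open>Both cases feed \<open>koh_lee\<close>: for Tor with a tail of the resolution, for Ext
  with the dual complex read backwards, since transposition keeps the entries in the maximal
  ideal.\<close>

lemma (in lnr) frob_vanish:
 fixes H :: "('a, 'b) module" and T :: "nat => 'x set"
 assumes pr: "Factorial_Ring.prime p" and ch: "has_char R p" and d: "depth R rm = enat t"
  and H: "rmod R H" and r: "res_of R H T e D" and min: "\<And>i y x. y \<in> T i ==> x \<in> T (Suc i) ==> D i y x \<in> mx"
  and hyp: "(\<exists>l\<ge>1. infinite {e. e \<ge> 1 \<and> (\<forall>i\<in>{l..l + t}. zero_module (ext_module R i H (frobenius_module R p e)))})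
     \<or> (\<exists>J Q :: nat. \<forall>j\<ge>J. \<forall>e\<ge>1. p ^ e \<ge> Q --> zero_module (tor_module R j H (frobenius_module R p e)))"
 shows "\<exists>k. T k = {}"
proof -
 interpret c: char_ring R p by (rule char_ring.intro[OF crng_axioms char_ring_axioms.intro[OF pr ch]])
 interpret H: rmod R H by (rule H)
 have T: "finite (T i)" "mat R (T i) (T (Suc i)) (D i)" for i using r by (auto simp: res_of_def res_def)
 have fin: "finite_module R H" by (rule H.finite_moduleI[OF T(1)]) (use r in \<open>auto simp: res_of_def\<close>)
 have p2: "p \<ge> 2" by (rule prime_ge_2_nat[OF pr])
 have inj: "inj (\<lambda>e. p ^ e)" using p2 by (auto simp: inj_on_def)
 show ?thesis using hyp
 proof (elim disjE exE conjE)
  fix l :: nat assume l: "1 \<le> l"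
   and inf: "infinite {e. e \<ge> 1 \<and> (\<forall>i\<in>{l..l + t}. zero_module (ext_module R i H (frobenius_module R p e)))}" (is "infinite ?E")
  \<comment> \<open>Place \<open>Suc j\<close> holds degree \<open>l + t - j\<close> of the
    resolution, so the places 1 to \<open>t + 1\<close> are the degrees from \<open>l + t\<close>
    down to \<open>l\<close>, and \<open>X (Suc t)\<close> is \<open>T l\<close>. These degrees are
    positive as \<open>l\<close> is.\<close>
  define X where "X j = (if j \<le> l + t + 1 then T (l + t + 1 - j) else {})" for j
  have Xs: "X (Suc j) = T (l + t - j)" "X j = T (Suc (l + t - j))" if "j \<le> l + t" for j using that by (auto simp: X_def Suc_diff_le)
  have e: "X (Suc j) = {}" if "\<not> j \<le> l + t" for j using that by (simp add: X_def)
  have "X (Suc t) = {}"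
  proof (rule koh_lee[OF d, where D = "\<lambda>j. tp (D (l + t - j))"])
   show "finite (X j)" for j using T by (simp add: X_def)
   show "mat R (X j) (X (Suc j)) (tp (D (l + t - j)))" for j
    using T(2)[of "l + t - j"] Xs e by (cases "j \<le> l + t") (auto simp: mat_def tp_def)
   show "tp (D (l + t - j)) y x \<in> mx" if "y \<in> X j" "x \<in> X (Suc j)" for j y x
    using min[of x "l + t - j" y] that Xs e by (cases "j \<le> l + t") (auto simp: tp_def)
   show "infinite ((\<lambda>e. p ^ e) ` ?E)" using inf finite_imageD[OF _ inj_on_subset[OF inj subset_UNIV]] by blast
   fix Q j assume "Q \<in> (\<lambda>e. p ^ e) ` ?E" and j: "j \<le> t"
   then obtain e where e: "Q = p ^ e" "e \<in> ?E" by blast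
   define k where "k = l + t - Suc j"
   have k: "Suc k = l + t - j" "k = l + t - Suc j" using j l by (auto simp: k_def)
   have "Suc k \<in> {l..l + t}" using j l by (auto simp: k_def)
   then have "zero_module (ext_module R (Suc k) H (frobenius_module R p e))" using e(2) by blast
   from ext_zero_exact[OF H fin r c.rmod_frob this]
   have "exat rm (T k) (\<lambda>y x. tp (D k) y x [^] Q) (T (Suc k)) (\<lambda>y x. tp (D (Suc k)) y x [^] Q) (T (Suc (Suc k)))"
    using c.exat_frob[of "T k" "T (Suc k)" "tp (D k)" "T (Suc (Suc k))" "tp (D (Suc k))" e] T e(1) by simp
   moreover have "X (Suc (Suc j)) = T k" "X (Suc j) = T (Suc k)" "X j = T (Suc (Suc k))" using Xs(1)[of "Suc j"] Xs[of j] k j l by simp_all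
   ultimately show "exat rm (X (Suc (Suc j))) (\<lambda>y x. tp (D (l + t - Suc j)) y x [^] Q) (X (Suc j)) (\<lambda>y x. tp (D (l + t - j)) y x [^] Q) (X j)"
    unfolding k(1)[symmetric] k(2)[symmetric] by simp
  qed
  then show ?thesis using Xs(1)[of t] by auto
 next
  fix J Q :: nat assume tor: "\<forall>j\<ge>J. \<forall>e\<ge>1. p ^ e \<ge> Q --> zero_module (tor_module R j H (frobenius_module R p e))"
  have "T (J + Suc t) = {}"
  proof (rule koh_lee[OF d, where X = "\<lambda>j. T (J + j)" and D = "\<lambda>j. D (J + j)"])
   show "infinite ((\<lambda>e. p ^ e) ` {Suc Q..})"
    using infinite_Ici[of "Suc Q"] finite_imageD[OF _ inj_on_subset[OF inj subset_UNIV]] by blast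
   fix q j assume "q \<in> (\<lambda>e. p ^ e) ` {Suc Q..}"
   then obtain e where e: "q = p ^ e" "Suc Q \<le> e" by auto
   have "Q \<le> p ^ e" using e(2) less_exp[of e] power_mono[OF p2, of e] by linarith
   then have "zero_module (tor_module R (Suc (J + j)) H (frobenius_module R p e))" using tor e(2) by simp
   from tor_zero_exact[OF H fin r c.rmod_frob this]
   show "exat rm (T (J + Suc (Suc j))) (\<lambda>y x. D (J + Suc j) y x [^] q) (T (J + Suc j)) (\<lambda>y x. D (J + j) y x [^] q) (T (J + j))"
    using c.exat_frob[of "T (Suc (Suc (J + j)))" "T (Suc (J + j))" "D (Suc (J + j))" "T (J + j)" "D (J + j)" e] T e(1) by simp
  qed (use T min in auto)
  then show ?thesis by blast
 qed
qed

section \<open>The dual complex\<close>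

text \<open>The minimal resolution \<open>L\<close> of a module, and the complex \<open>K\<close>: the dual of \<open>L\<close>, truncated after degree
 \<open>q + 1\<close>, followed by a resolution \<open>X\<close> of the kernel \<open>L\<^sub>0\<^sup>* \<rightarrow> L\<^sub>1\<^sup>*\<close>; here \<open>X\<^sub>0 = L\<^sub>0\<^sup>*\<close>.\<close>

locale dual = lnr R for R :: "'a ring" (structure) +
 fixes q :: nat and lX :: "nat => nat set" and \<Lambda> and X :: "nat => nat set" and D
 assumes L: "res R lX \<Lambda>" and Lmx: "\<And>i y x. y \<in> lX i ==> x \<in> lX (Suc i) ==> \<Lambda> i y x \<in> mx"
  and Lex: "\<And>i. i < q ==> exat rm (lX i) (tp (\<Lambda> i)) (lX (Suc i)) (tp (\<Lambda> (Suc i))) (lX (Suc (Suc i)))"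
  and X: "res R X D" and X0: "X 0 = lX 0"
  and D0: "\<And>u. u \<in> vec rm (lX 0) \<and> mm rm (lX 0) (tp (\<Lambda> 0)) (lX 1) u = (\<lambda>_. \<zero>) \<longleftrightarrow>
   (\<exists>v\<in>vec rm (X 1). u = mm rm (X 1) (D 0) (X 0) v)"
  and Dmx: "\<And>i y x. y \<in> X (Suc i) ==> x \<in> X (Suc (Suc i)) ==> D (Suc i) y x \<in> mx"
begin

text \<open>Degree 0 holds the dual of L_(q+1) and degree \<open>q + 1\<close> the dual of L_0,
  which is also \<open>X 0\<close>; there the descriptions \<open>kX_l\<close> and
  \<open>kX_r\<close> overlap.\<close>

definition "kX j = (if j \<le> q then lX (Suc (q - j)) else X (j - Suc q))"
definition "kD j = (if j \<le> q then tp (\<Lambda> (q - j)) else D (j - Suc q))"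

lemma kX_l: "j \<le> Suc q ==> kX j = lX (Suc q - j)"
 by (cases "j \<le> q") (simp_all add: kX_def Suc_diff_le X0 le_Suc_eq)
lemma kX_r: "kX (Suc q + a) = X a" by (simp add: kX_def)
lemma kD_r: "kD (Suc q + a) = D a" by (simp add: kD_def)
lemma kX_q: "kX (Suc q) = X 0" "kX (Suc (Suc q)) = X 1" "kX q = lX 1" using kX_r[of 0] kX_r[of 1] by (simp_all add: kX_def)
lemma kD_q: "kD (Suc q) = D 0" "kD q = tp (\<Lambda> 0)" by (simp_all add: kD_def)

lemma LX: "finite (lX i)" "mat R (lX i) (lX (Suc i)) (\<Lambda> i)" "finite (X i)" "mat R (X i) (X (Suc i)) (D i)"
 using L X by (auto simp: res_def)

lemma K_ex_mid: "exat rm (X 1) (D 0) (X 0) (tp (\<Lambda> 0)) (lX 1)"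
 unfolding exat_def using D0 by (auto simp: X0)

lemma K_fin: "finite (kX j)" using LX by (simp add: kX_def)
lemma K_mat: "mat R (kX j) (kX (Suc j)) (kD j)"
proof (cases "j \<le> q")
 case True
 then show ?thesis using LX(2)[of "q - j"] kX_l[of j] kX_l[of "Suc j"] by (simp add: kD_def Suc_diff_le)
next
 case False
 then obtain a where "j = Suc q + a" using less_imp_Suc_add[of q j] by auto
 then show ?thesis using LX(4)[of a] kX_r[of a] kX_r[of "Suc a"] kD_r[of a] by simp
qed

lemma K_res: "res R kX kD"
 unfolding res_def
proof (intro conjI allI K_fin K_mat)
 fix j
 \<comment> \<open>The exact place is degree \<open>Suc j\<close>: inside the dual of L by vanishing
   of Ext, at the dual of L_0 by the choice of \<open>D 0\<close>, and beyond it because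
   \<open>X\<close> is a resolution.\<close>
 consider "j < q" | "j = q" | a where "j = Suc q + a" using less_imp_Suc_add[of q j] by (cases j q rule: linorder_cases) auto
 then show "exa rm kX kD j"
 proof cases
  case 1
  define i where "i = q - Suc j"
  have "kX (Suc (Suc j)) = lX i" "kX (Suc j) = lX (Suc i)" "kX j = lX (Suc (Suc i))" "kD (Suc j) = tp (\<Lambda> i)" "kD j = tp (\<Lambda> (Suc i))"
   using 1 kX_l[of "Suc (Suc j)"] kX_l[of "Suc j"] kX_l[of j] Suc_diff_Suc[OF 1] Suc_diff_le[of j q] unfolding i_def kD_def by simp_all
  then show ?thesis using Lex[of i] 1 by (simp add: i_def)
 next
  case 2
  then show ?thesis using K_ex_mid kX_q kD_q by simp
 next
  case 3
  then show ?thesis using X kX_r[of "Suc (Suc a)"] kX_r[of "Suc a"] kX_r[of a] kD_r[of "Suc a"] kD_r[of a] by (simp add: res_def)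
 qed
qed

end

text \<open>One empty degree \<open>k\<close> of the total complex suffices: it contains all triples
  \<open>(k, i, j)\<close> with \<open>i\<close> a basis index of G_k and \<open>j\<close> in
  \<open>fX 0\<close>, and the latter is nonempty, so G_k is zero.\<close>

lemma (in dual) dual_bounded:
 fixes M :: "('a, 'b) module" and N :: "('a, 'c) module" and fX :: "nat => nat set"
 assumes pr: "Factorial_Ring.prime p" and ch: "has_char R p" and d: "depth R rm = enat t"
  and M: "rmod R M" and N: "rmod R N" and r: "res_of R M lX \<mu> \<Lambda>"
  and F: "res_of R N fX \<eta> F" and Fmx: "\<And>i y x. y \<in> fX i ==> x \<in> fX (Suc i) ==> F i y x \<in> mx"
  and Fq: "\<And>j. j > q ==> fX j = {}" and F0: "fX 0 \<noteq> {}"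
  and hyp: "(\<exists>l\<ge>1. infinite {e. e \<ge> 1 \<and> (\<forall>i\<in>{l..l + t}. zero_module (ext_module R i (hom_module R M N) (frobenius_module R p e)))})
     \<or> (\<exists>J Q :: nat. \<forall>j\<ge>J. \<forall>e\<ge>1. p ^ e \<ge> Q --> zero_module (tor_module R j (hom_module R M N) (frobenius_module R p e)))"
 shows "\<exists>a. X (Suc a) = {}"
proof -
 interpret K: two_res R N kX kD fX \<eta> F by (intro two_res.intro two_res_axioms.intro crng_axioms N K_res F)
 \<comment> \<open>The place is degree \<open>Suc k\<close> of \<open>kX\<close>, so the first one
   covered is degree \<open>Suc q\<close>, the dual of L_0.\<close>
 have ex: "exa N kX kD k" if "q \<le> k" for k by (rule K.tor_vanish[OF Fq that])
 have exN: "exa N X D a" for a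
  using ex[of "Suc q + a"] kX_r[of "Suc (Suc a)"] kX_r[of "Suc a"] kX_r[of a] kD_r[of "Suc a"] kD_r[of a] by simp
 have e1: "exat N (X 1) (D 0) (lX 0) (tp (\<Lambda> 0)) (lX 1)" using ex[of q] kX_q kD_q X0 by simp
 have e0: "exat N (X (Suc 1)) (D 1) (X 1) (D 0) (lX 0)" using exN[of 0] X0 by simp
 obtain \<kappa> where \<kappa>: "lin R (pw N (X 1)) (hom_module R M N) \<kappa>"
  "\<And>h. h \<in> carrier (hom_module R M N) ==> \<exists>n\<in>vec N (X 1). \<kappa> n = h"
  "\<And>n. n \<in> vec N (X 1) ==> \<kappa> n = \<zero>[hom_module R M N] \<longleftrightarrow> (\<exists>w\<in>vec N (X (Suc 1)). n = dif N X D 1 w)"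
  by (rule hom_presentation[OF M N r LX(3) _ e1 e0]) (use LX(4)[of 0] X0 in simp, rule that)
 \<comment> \<open>G is \<open>X\<close> without its term \<open>X 0\<close>.\<close>
 interpret T: total R N "\<lambda>a. X (Suc a)" "\<lambda>a. D (Suc a)" fX \<eta> F "hom_module R M N" \<kappa>
 proof (intro total.intro total_axioms.intro two_res.intro two_res_axioms.intro crng_axioms N F rmod_hom M)
  show "res R (\<lambda>a. X (Suc a)) (\<lambda>a. D (Suc a))" using X by (simp add: res_def)
  show "exa N X D (Suc i)" for i by (rule exN)
 qed (use \<kappa> in simp_all)
 obtain k where k: "T.T k = {}"
  using frob_vanish[OF pr ch d rmod_hom[OF M N] T.total_res_of _ hyp] T.Dt_mx[OF lnr_axioms Dmx Fmx] by blast
 have "X (Suc k) = {}"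
 proof (rule ccontr)
  assume "X (Suc k) \<noteq> {}"
  then obtain i j where "i \<in> X (Suc k)" "j \<in> fX 0" using F0 by auto
  then have "(k, i, j) \<in> T.T k" by (simp add: T.T_def)
  then show False using k by simp
 qed
 then show ?thesis ..
qed

lemma lin_image_sub:
 assumes A: "rmod R A" and B: "rmod R B" and f: "lin R A B f" shows "submodule (f ` carrier A) R B"
proof -
 interpret A: rmod R A by (rule A)
 interpret B: rmod R B by (rule B)
 show ?thesis
 proof (rule B.subI_comb)
  show "\<zero>[B] \<in> f ` carrier A" using lin_zero[OF A B f] by (metis A.M.zero_closed imageI)
  fix x assume "x \<in> f ` carrier A"
  then obtain a where a: "a \<in> carrier A" "x = f a" by blast
  show "c *[B] x \<in> f ` carrier A" if "c \<in> carrier R" for c unfolding a(2) lin_smult[OF f that a(1), symmetric] using that a by simp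
  fix y assume "y \<in> f ` carrier A"
  then obtain b where b: "b \<in> carrier A" "y = f b" by blast
  show "x +[B] y \<in> f ` carrier A" unfolding a(2) b(2) lin_add[OF f a(1) b(1), symmetric] using a b by simp
 qed (use lin_closed[OF f] in blast)
qed

lemma (in crng) ann_set_ideal:
 assumes A: "rmod R A" and V: "submodule V R A" and Z: "Z \<subseteq> carrier A"
 shows "ideal {c \<in> carrier R. \<forall>a\<in>Z. c *[A] a \<in> V} R"
proof -
 interpret A: rmod R A by (rule A)
 show ?thesis
  by (rule ideal_comb) (use Z A.sub_zero[OF V] A.sub_add[OF V] A.sub_smult[OF V] in \<open>auto simp: A.smult_l_distr A.smult_assoc1 subset_iff\<close>)
qed

lemma (in abelian_group) add_minus: "x \<in> carrier G ==> y \<in> carrier G ==> (x \<oplus> y) \<ominus> x = y"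
 unfolding a_minus_def by (metis a_assoc a_comm a_inv_closed r_neg3)

lemma (in abelian_group) minus_split:
 assumes "a \<in> carrier G" "u \<in> carrier G" "x \<in> carrier G" shows "a \<ominus> x = (a \<ominus> (u \<oplus> x)) \<oplus> u"
proof -
 have "(a \<ominus> (u \<oplus> x)) \<oplus> u = a \<oplus> (\<ominus> x \<oplus> (\<ominus> u \<oplus> u))" using assms by (simp only: a_minus_def minus_add a_inv_closed a_closed a_assoc a_comm[of "\<ominus> u" "\<ominus> x"])
 then show ?thesis using assms by (simp add: l_neg a_minus_def)
qed

lemma (in abelian_group) minus_minus_cancel:
 assumes "a \<in> carrier G" "u \<in> carrier G" "x \<in> carrier G" shows "(a \<ominus> u) \<ominus> (a \<ominus> x) = x \<ominus> u"
proof -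
 have "(a \<ominus> u) \<ominus> (a \<ominus> x) = a \<oplus> (\<ominus> a \<oplus> (x \<oplus> \<ominus> u))"
  using assms by (simp add: a_minus_def minus_add a_assoc a_comm[of "\<ominus> u"])
 then show ?thesis using assms by (simp add: r_neg2 a_minus_def)
qed

section \<open>The acyclicity lemma\<close>

text \<open>Cycles and boundaries are taken modulo the submodules \<open>U\<^sub>i\<close>. Sequences are written in reverse order.\<close>

locale cochain = crng R for R :: "'a ring" (structure) +
 fixes C :: "nat => ('a, 'b) module" and d and U
 assumes C: "\<And>i. rmod R (C i)" and d: "\<And>i. lin R (C i) (C (Suc i)) (d i)"
  and U: "\<And>i. submodule (U i) R (C i)" and dU: "\<And>i c. c \<in> U i ==> d i c \<in> U (Suc i)"
  and dd: "\<And>i c. c \<in> carrier (C i) ==> d (Suc i) (d i c) = \<zero>[C (Suc (Suc i))]"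
begin

sublocale C: rmod R "C i" for i by (rule C)

primrec V :: "'a list => nat => 'b set" where
 "V [] i = U i"
| "V (x # xs) i = {v +[C i] x *[C i] b | v b. v \<in> V xs i \<and> b \<in> carrier (C i)}"

primrec reg :: "'a list => bool" where
 "reg [] = True"
| "reg (x # xs) = (reg xs \<and> x \<in> carrier R \<and> (\<forall>i. \<forall>c\<in>carrier (C i). x *[C i] c \<in> V xs i --> c \<in> V xs i))"

text \<open>No term precedes degree 0, so exactness there means that \<open>d 0\<close> is injective
  modulo \<open>U\<close>.\<close>

definition im :: "nat => 'b set" where "im p = (case p of 0 => {\<zero>[C 0]} | Suc k => d k ` carrier (C k))"
definition bd :: "'a list => nat => 'b => bool" where "bd xs p v \<longleftrightarrow> (\<exists>b\<in>im p. v -[C p] b \<in> V xs p)"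
definition ex :: "'a list => nat => bool" where "ex xs p \<longleftrightarrow> (\<forall>v\<in>carrier (C p). d p v \<in> V xs (Suc p) --> bd xs p v)"

lemma reg_set: "reg xs ==> set xs \<subseteq> carrier R" by (induct xs) auto
lemma reg_append: "reg (ys @ xs) ==> reg xs" by (induct ys) auto

lemma V_sub: "set xs \<subseteq> carrier R ==> submodule (V xs i) R (C i)"
 by (induct xs) (auto intro!: U C.sum_sub)

lemma d_V: "set xs \<subseteq> carrier R ==> v \<in> V xs i ==> d i v \<in> V xs (Suc i)"
proof (induct xs arbitrary: v)
 case (Cons x xs)
 then obtain v' b where b: "v' \<in> V xs i" "b \<in> carrier (C i)" "v = v' +[C i] x *[C i] b" and x: "x \<in> carrier R" by auto
 have "v' \<in> carrier (C i)" using C.sub_car[OF V_sub b(1)] Cons(2) by simp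
 then have "d i v = d i v' +[C (Suc i)] x *[C (Suc i)] d i b" using b x by (simp add: lin_add[OF d] lin_smult[OF d])
 then show ?case using Cons(1)[OF _ b(1)] Cons(2) lin_closed[OF d b(2)] by auto
qed (simp add: dU)

lemma V_mono: "set (x # xs) \<subseteq> carrier R ==> v \<in> V xs i ==> v \<in> V (x # xs) i"
proof -
 assume x: "set (x # xs) \<subseteq> carrier R" and v: "v \<in> V xs i"
 have "v \<in> carrier (C i)" using C.sub_car[OF V_sub v] x by simp
 then have "v = v +[C i] x *[C i] \<zero>[C i]" using x by simp
 then show ?thesis using v C.M.zero_closed[of i] by auto
qed

lemma im_sub: "submodule (im p) R (C p)"
proof (cases p)
 case 0
 show ?thesis unfolding im_def 0 by (rule C.subI_comb) auto
next
 case (Suc k)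
 show ?thesis unfolding im_def Suc nat.case by (rule lin_image_sub[OF C C d])
qed

lemma V_im_d: "b \<in> im p ==> set xs \<subseteq> carrier R ==> d p b \<in> V xs (Suc p)"
proof -
 assume b: "b \<in> im p" and xs: "set xs \<subseteq> carrier R"
 have "U i \<subseteq> V xs i" for i using xs
 proof (induct xs)
  case (Cons x xs)
  then show ?case using V_mono[of x xs] by auto
 qed simp
 moreover have "d p b \<in> U (Suc p)"
  using b dd lin_zero[OF C C d] C.sub_zero[OF U] by (cases p) (auto simp: im_def)
 ultimately show ?thesis by blast
qed

lemma bdI: "set xs \<subseteq> carrier R ==> b \<in> im p ==> v' \<in> V xs p ==> v = b +[C p] v' ==> bd xs p v"
proof -
 assume *: "set xs \<subseteq> carrier R" "b \<in> im p" "v' \<in> V xs p" "v = b +[C p] v'"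
 have c: "b \<in> carrier (C p)" "v' \<in> carrier (C p)" using C.sub_car[OF im_sub *(2)] C.sub_car[OF V_sub[OF *(1)] *(3)] .
 have "v -[C p] b = v'" unfolding *(4) using c by (rule C.M.add_minus)
 then show ?thesis using *(2,3) unfolding bd_def by (intro bexI[of _ b]) auto
qed

lemma bdE:
 assumes "set xs \<subseteq> carrier R" "v \<in> carrier (C p)" "bd xs p v"
 obtains b v' where "b \<in> im p" "v' \<in> V xs p" "v = b +[C p] v'"
proof -
 obtain b where b: "b \<in> im p" "v -[C p] b \<in> V xs p" using assms(3) unfolding bd_def by blast
 have "b +[C p] (v -[C p] b) = v" unfolding a_minus_def by (rule C.M.r_neg3[OF C.sub_car[OF im_sub b(1)] assms(2)])
 then show ?thesis using that b by metis
qed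

lemma ex_bd: "ex xs p ==> v \<in> carrier (C p) ==> d p v \<in> V xs (Suc p) ==> bd xs p v" by (simp add: ex_def)

text \<open>If \<open>x\<close> is regular modulo \<open>V xs\<close>, and \<open>x v\<close> is a boundary modulo \<open>V xs\<close>, say of \<open>w\<close>, then exactness one
 step lower modulo \<open>V (x # xs)\<close> allows to divide by \<open>x\<close>.\<close>

lemma divide:
 assumes r: "reg (x # xs)" and v: "v \<in> carrier (C p)" and xv: "bd xs p (x *[C p] v)"
  and lower: "\<And>k w. p = Suc k ==> w \<in> carrier (C k) ==> x *[C p] v -[C p] d k w \<in> V xs p ==> bd (x # xs) k w"
 shows "bd xs p v"
proof -
 have xs: "set xs \<subseteq> carrier R" "x \<in> carrier R" "set (x # xs) \<subseteq> carrier R" using reg_set[OF r] by auto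
 have rx: "c \<in> V xs p" if "c \<in> carrier (C p)" "x *[C p] c \<in> V xs p" for c using r that by simp
 obtain b where b: "b \<in> im p" "x *[C p] v -[C p] b \<in> V xs p" using xv unfolding bd_def by blast
 have xvc: "x *[C p] v \<in> carrier (C p)" by (rule C.smult_closed[OF xs(2) v])
 show ?thesis
 proof (cases p)
  case 0
  then have "b = \<zero>[C p]" using b(1) by (simp add: im_def)
  then have "x *[C p] v \<in> V xs p" using b(2) C.M.add_minus[OF C.M.zero_closed xvc] xvc by simp
  from rx[OF v this] show ?thesis using C.sub_zero[OF im_sub] v by (intro bdI[OF xs(1)]) auto
 next
  case (Suc k)
  then obtain w where w: "w \<in> carrier (C k)" "b = d k w" using b(1) by (auto simp: im_def)
  from lower[OF Suc w(1)] b(2) w(2) have "bd (x # xs) k w" by simp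
  from bdE[OF xs(3) w(1) this] obtain b' y where "b' \<in> im k" "y \<in> V (x # xs) k" "w = b' +[C k] y" .
  then obtain v' c where w': "b' \<in> im k" "v' \<in> V xs k" "c \<in> carrier (C k)" "w = b' +[C k] (v' +[C k] x *[C k] c)" by auto
  have cc: "b' \<in> carrier (C k)" "v' \<in> carrier (C k)" "x *[C k] c \<in> carrier (C k)"
   using C.sub_car[OF im_sub w'(1)] C.sub_car[OF V_sub[OF xs(1)] w'(2)] C.smult_closed[OF xs(2) w'(3)] .
  have dc: "d k b' \<in> carrier (C p)" "d k v' \<in> carrier (C p)" "d k c \<in> carrier (C p)" using lin_closed[OF d, of _ k] cc(1,2) w'(3) Suc by auto
  have dV: "d k b' \<in> V xs p" "d k v' \<in> V xs p" using V_im_d[OF w'(1) xs(1)] d_V[OF xs(1) w'(2)] Suc by auto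
  have bdec: "b = d k b' +[C p] (d k v' +[C p] x *[C p] d k c)"
   unfolding w(2) w'(4) using lin_add[OF d cc(1) C.M.a_closed[OF cc(2,3)]] lin_add[OF d cc(2,3)] lin_smult[OF d xs(2) w'(3)] Suc by simp
  have xdc: "x *[C p] d k c \<in> carrier (C p)" by (rule C.smult_closed[OF xs(2) dc(3)])
  note sub = V_sub[OF xs(1), of p]
  have "x *[C p] (v -[C p] d k c) = x *[C p] v -[C p] x *[C p] d k c"
   unfolding a_minus_def using xs(2) v dc(3) by (simp add: C.smult_r_distr C.smult_r_minus)
  also have "\<dots> = (x *[C p] v -[C p] b) +[C p] (d k b' +[C p] d k v')"
  proof -
   have "b = (d k b' +[C p] d k v') +[C p] x *[C p] d k c" unfolding bdec using dc xdc by (simp add: C.M.a_assoc)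
   then show ?thesis using C.M.minus_split[OF xvc C.M.a_closed[OF dc(1,2)] xdc] by simp
  qed
  also have "\<dots> \<in> V xs p" by (intro C.sub_add[OF sub] b(2) dV)
  finally have "v -[C p] d k c \<in> V xs p" by (rule rx[OF C.M.minus_closed[OF v dc(3)]])
  moreover have "d k c \<in> im p" using w'(3) Suc by (simp add: im_def)
  ultimately show ?thesis unfolding bd_def by blast
 qed
qed

text \<open>\<open>reduce_step\<close> once more; indices now increase along the differential, so
  the place consumed is the one above.\<close>

lemma reduce_ex:
 assumes r: "reg (x # xs)" and e: "ex xs p" "ex xs (Suc p)" shows "ex (x # xs) p"
proof -
 have xs: "set xs \<subseteq> carrier R" "x \<in> carrier R" using reg_set[OF r] by auto
 let ?I = "(C p)\<lparr>carrier := im p\<rparr>"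
 have "exm ?I (\<lambda>b. b) (C p) (V (x # xs) p) (d p) (V (x # xs) (Suc p))"
  unfolding V.simps
 proof (rule reduce_step[OF C C C _ d d V_sub[OF xs(1)] V_sub[OF xs(1)] V_sub[OF xs(1)] dd d_V[OF xs(1)] xs(2)])
  show "exm ?I (\<lambda>b. b) (C p) (V xs p) (d p) (V xs (Suc p))" using e(1) by (simp add: exm_def ex_def bd_def)
  show "exm (C p) (d p) (C (Suc p)) (V xs (Suc p)) (d (Suc p)) (V xs (Suc (Suc p)))" using e(2) by (simp add: exm_def ex_def bd_def im_def)
 qed (use r C.sub_car[OF im_sub] in auto)
 then show ?thesis by (simp add: exm_def ex_def bd_def)
qed

text \<open>Induction on \<open>p\<close>. With \<open>y\<close> the first element of
  \<open>zs\<close>, y v is d w modulo \<open>xs\<close>, and by \<open>divide\<close> it is enough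
  that \<open>w\<close> be a boundary modulo \<open>y\<close> and \<open>xs\<close>. For this the
  remaining elements \<open>z\<close> are used one place lower: if z v is d w_z, then z w - y w_z is
  a cycle modulo \<open>xs\<close>, hence a boundary, so z w is a boundary modulo \<open>y\<close>
  and \<open>xs\<close>.\<close>

lemma acyclic:
 assumes "length zs = Suc p" "reg (rev zs @ xs)" "\<And>j. j < p ==> ex xs j"
  and "v \<in> carrier (C p)" "\<And>z. z \<in> set zs ==> bd xs p (z *[C p] v)"
 shows "bd xs p v"
 using assms
proof (induct p arbitrary: zs xs v)
 case 0
 then obtain y where "zs = [y]" by (cases zs) auto
 moreover have "reg (y # xs)" using 0(2) unfolding \<open>zs = [y]\<close> by simp
 ultimately show ?case using 0(4) 0(5)[of y] by (intro divide[of y xs v 0]) simp_all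
next
 case (Suc p)
 then obtain y zs' where zs: "zs = y # zs'" "length zs' = Suc p" by (cases zs) auto
 have r: "reg (rev zs' @ y # xs)" using Suc(3) zs(1) by simp
 have ry: "reg (y # xs)" by (rule reg_append[OF r])
 have xs: "set xs \<subseteq> carrier R" "y \<in> carrier R" "set (y # xs) \<subseteq> carrier R" using reg_set[OF ry] by auto
 have zR: "z \<in> carrier R" if "z \<in> set zs'" for z using reg_set[OF r] that by auto
 show ?case
 proof (rule divide[OF ry Suc(5)])
  show "bd xs (Suc p) (y *[C (Suc p)] v)" using Suc(6) zs by simp
  fix k w assume "Suc p = Suc k" and w: "w \<in> carrier (C k)" and vw: "y *[C (Suc p)] v -[C (Suc p)] d k w \<in> V xs (Suc p)"
  then have k: "k = p" by simp
  show "bd (y # xs) k w" unfolding k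
  proof (rule Suc(1)[OF zs(2) r])
   show "ex (y # xs) j" if "j < p" for j using Suc(4)[of j] Suc(4)[of "Suc j"] that by (intro reduce_ex[OF ry]) auto
   show "w \<in> carrier (C p)" using w k by simp
   fix z assume z: "z \<in> set zs'"
   have "bd xs (Suc p) (z *[C (Suc p)] v)" using Suc(6) zs(1) z by simp
   then obtain wz where wz: "wz \<in> carrier (C p)" "z *[C (Suc p)] v -[C (Suc p)] d p wz \<in> V xs (Suc p)" unfolding bd_def im_def by auto
   have c: "z *[C p] w \<in> carrier (C p)" "y *[C p] wz \<in> carrier (C p)" using C.smult_closed zR[OF z] xs(2) w wz(1) k by auto
   note vc = Suc(5) and dw = lin_closed[OF d w[unfolded k]] and dwz = lin_closed[OF d wz(1)]
   note cl = C.smult_closed[OF zR[OF z]] C.smult_closed[OF xs(2)] C.smult_closed[OF zR[OF z] C.smult_closed[OF xs(2) vc]]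
   have zy: "z *[C (Suc p)] (y *[C (Suc p)] v) = y *[C (Suc p)] (z *[C (Suc p)] v)"
    using C.smult_assoc1[OF zR[OF z] xs(2) vc] C.smult_assoc1[OF xs(2) zR[OF z] vc] m_comm[OF zR[OF z] xs(2)] by simp
   \<comment> \<open>Both y (z v - d w_z) and z (y v - d w) lie in \<open>V xs\<close>, and the
     element here is their difference.\<close>
   have "d p (z *[C p] w -[C p] y *[C p] wz) = z *[C (Suc p)] d p w -[C (Suc p)] y *[C (Suc p)] d p wz"
    using lin_minus[OF C C d c] lin_smult[OF d zR[OF z]] lin_smult[OF d xs(2) wz(1)] w k by simp
   also have "\<dots> = y *[C (Suc p)] (z *[C (Suc p)] v -[C (Suc p)] d p wz) -[C (Suc p)] z *[C (Suc p)] (y *[C (Suc p)] v -[C (Suc p)] d p w)"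
   proof -
    have "y *[C (Suc p)] (z *[C (Suc p)] v -[C (Suc p)] d p wz) = z *[C (Suc p)] (y *[C (Suc p)] v) -[C (Suc p)] y *[C (Suc p)] d p wz"
     "z *[C (Suc p)] (y *[C (Suc p)] v -[C (Suc p)] d p w) = z *[C (Suc p)] (y *[C (Suc p)] v) -[C (Suc p)] z *[C (Suc p)] d p w"
     unfolding zy unfolding a_minus_def using cl vc dw dwz zR[OF z] xs(2) by (simp_all add: C.smult_r_distr C.smult_r_minus zy)
    then show ?thesis using C.M.minus_minus_cancel[OF cl(3) cl(2)[OF dwz] cl(1)[OF dw]] by simp
   qed
   also have "\<dots> \<in> V xs (Suc p)"

    by (rule C.sub_minus[OF V_sub[OF xs(1)]]; rule C.sub_smult[OF V_sub[OF xs(1)]]) (use vw k wz(2) zR[OF z] xs(2) in simp_all)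
   finally have "bd xs p (z *[C p] w -[C p] y *[C p] wz)" by (rule ex_bd[OF Suc(4)[of p, simplified] C.M.minus_closed[OF c]])
   from bdE[OF xs(1) C.M.minus_closed[OF c] this] obtain b' v' where bv: "b' \<in> im p" "v' \<in> V xs p" "z *[C p] w -[C p] y *[C p] wz = b' +[C p] v'" by blast
   have wc: "b' \<in> carrier (C p)" "v' \<in> carrier (C p)" using C.sub_car[OF im_sub bv(1)] C.sub_car[OF V_sub[OF xs(1)] bv(2)] .
   have "z *[C p] w = (z *[C p] w -[C p] y *[C p] wz) +[C p] y *[C p] wz" unfolding a_minus_def using c by (simp add: C.M.a_assoc C.M.l_neg)
   also have "\<dots> = b' +[C p] (v' +[C p] y *[C p] wz)" unfolding bv(3) by (rule C.M.a_assoc[OF wc c(2)])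
   finally show "bd (y # xs) p (z *[C p] w)" by (rule bdI[OF xs(3) bv(1), rotated]) (use bv(2) wz(1) in auto)
  qed
 qed
qed

end

lemma (in rmod) lin_scale: "y \<in> carrier R ==> lin R M M (\<lambda>w. y *[M] w)"
 by (rule linI) (simp_all add: smult_r_distr smult_assoc1[symmetric] R.m_comm)

context cochain begin

text \<open>\<open>B\<close> plays the role of \<open>C i\<close> modulo \<open>U i\<close>;
  regularity known for \<open>B\<close>, which later is the module M in degree 0, can thus be used
  for the submodules \<open>V\<close>.\<close>

lemma V_quot:
 assumes B: "rmod R B" and f: "lin R (C i) B f" and surj: "\<And>b. b \<in> carrier B ==> \<exists>c\<in>carrier (C i). f c = b"
  and ker: "\<And>c. c \<in> carrier (C i) ==> f c = \<zero>[B] \<longleftrightarrow> c \<in> U i"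
 shows "set xs \<subseteq> carrier R ==> c \<in> carrier (C i) ==> c \<in> V (rev xs) i \<longleftrightarrow> f c \<in> seq_submodule R B xs"
proof (induct xs arbitrary: c rule: rev_induct)
 case Nil
 interpret B: rmod R B by (rule B)
 show ?case using Nil ker by (simp add: B.seq_Nil)
next
 case (snoc x xs)
 interpret B: rmod R B by (rule B)
 have xs: "set xs \<subseteq> carrier R" "x \<in> carrier R" using snoc(2) by auto
 note S = B.seq_snoc[OF xs]
 show ?case
 proof
  assume "c \<in> V (rev (xs @ [x])) i"
  then obtain v b where v: "v \<in> V (rev xs) i" "b \<in> carrier (C i)" "c = v +[C i] x *[C i] b" by auto
  have vc: "v \<in> carrier (C i)" by (rule C.sub_car[OF V_sub v(1)]) (use xs in simp)
  have "f c = f v +[B] x *[B] f b" unfolding v(3) lin_smult[OF f xs(2) v(2), symmetric] by (rule lin_add[OF f vc C.smult_closed[OF xs(2) v(2)]])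
  then show "f c \<in> seq_submodule R B (xs @ [x])" unfolding S using snoc(1)[OF xs(1) vc] v(1) lin_closed[OF f v(2)] by blast
 next
  assume "f c \<in> seq_submodule R B (xs @ [x])"
  then obtain v b where v: "v \<in> seq_submodule R B xs" "b \<in> carrier B" "f c = v +[B] x *[B] b" unfolding S by blast
  obtain b' where b': "b' \<in> carrier (C i)" "f b' = b" using surj[OF v(2)] by blast
  have xb: "x *[C i] b' \<in> carrier (C i)" by (rule C.smult_closed[OF xs(2) b'(1)])
  have vc: "v \<in> carrier B" by (rule B.sub_car[OF B.seq_sub[OF xs(1)] v(1)])
  have "f (c -[C i] x *[C i] b') = v"
   unfolding lin_minus[OF C B f snoc(3) xb] lin_smult[OF f xs(2) b'(1)] v(3) b'(2)
   using B.M.add_minus[OF B.smult_closed[OF xs(2) v(2)] vc] B.M.a_comm[OF vc B.smult_closed[OF xs(2) v(2)]] by simp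
  then have "c -[C i] x *[C i] b' \<in> V (rev xs) i" using snoc(1)[OF xs(1) C.M.minus_closed[OF snoc(3) xb]] v(1) by simp
  moreover have "c = (c -[C i] x *[C i] b') +[C i] x *[C i] b'" unfolding a_minus_def using snoc(3) xb by (simp add: C.M.a_assoc C.M.l_neg)
  ultimately show "c \<in> V (rev (xs @ [x])) i" using b'(1) by auto
 qed
qed

lemma V_wreg:
 assumes B: "rmod R B" and f: "lin R (C i) B f" and surj: "\<And>b. b \<in> carrier B ==> \<exists>c\<in>carrier (C i). f c = b"
  and ker: "\<And>c. c \<in> carrier (C i) ==> f c = \<zero>[B] \<longleftrightarrow> c \<in> U i"
  and w: "wreg R B (xs @ [x])" and c: "c \<in> carrier (C i)" "x *[C i] c \<in> V (rev xs) i"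
 shows "c \<in> V (rev xs) i"
proof -
 interpret B: rmod R B by (rule B)
 have xs: "set xs \<subseteq> carrier R" "x \<in> carrier R" using B.wreg_set[OF w] by auto
 have q: "c \<in> V (rev xs) i \<longleftrightarrow> f c \<in> seq_submodule R B xs" if "c \<in> carrier (C i)" for c
  by (rule V_quot[OF B f _ _ xs(1) that]) (rule surj ker, assumption)+
 have "x *[B] f c \<in> seq_submodule R B xs" using q[OF C.smult_closed[OF xs(2) c(1)]] c(2) lin_smult[OF f xs(2) c(1)] by simp
 then have "f c \<in> seq_submodule R B xs" using w lin_closed[OF f c(1)] unfolding B.wreg_snoc by blast
 then show ?thesis using q[OF c(1)] by simp
qed

lemma regI:
 assumes "set xs \<subseteq> carrier R" "\<And>ys x zs i c. xs = ys @ x # zs ==> c \<in> carrier (C i) ==> x *[C i] c \<in> V (rev ys) i ==> c \<in> V (rev ys) i"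
 shows "reg (rev xs)"
 using assms
proof (induct xs rule: rev_induct)
 case (snoc x xs)
 have "reg (rev xs)"
 proof (rule snoc(1))
  show "c \<in> V (rev ys) i" if "xs = ys @ y # zs" "c \<in> carrier (C i)" "y *[C i] c \<in> V (rev ys) i" for ys y zs i c
   by (rule snoc(3)[of ys y "zs @ [x]"]) (use that in simp_all)
 qed (use snoc(2) in simp)
 then show ?case using snoc(2) snoc(3)[of xs x "[]"] by simp
qed simp

text \<open>Counterpart of \<open>reduce_seq\<close> for cochains: here the low places survive and
  the high ones are used up.\<close>

lemma reduce_all: "reg (ys @ xs) ==> (\<And>j. j \<le> length ys + p ==> ex xs j) ==> ex (ys @ xs) p"
proof (induct ys arbitrary: p)
 case (Cons y ys)
 have "reg (ys @ xs)" using Cons(2) by simp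
 then show ?case using Cons(1)[of p] Cons(1)[of "Suc p"] Cons(2,3) by (simp add: reduce_ex)
qed simp

end

section \<open>Homotopies that express annihilation of cohomology\<close>

context crng begin

text \<open>Pair the homotopy with a cocycle \<open>v\<close>: the term through \<open>E\<close>
  drops out and the other one is a coboundary. The multiplier \<open>s\<close> thus annihilates
  cohomology with any coefficients \<open>A\<close>.\<close>

lemma homotopy_dual:
 assumes A: "rmod R A" and fin: "finite X0" "finite X1" "finite X2" and D: "mat R X0 X1 D" and E: "mat R X1 X2 E"
  and h: "lin R (pw rm X1) (pw rm X2) h" and h': "lin R (pw rm X0) (pw rm X1) h'" and s: "s \<in> carrier R"
  and eq: "\<And>w. w \<in> vec rm X1 ==> s *[pw rm X1] w = mm rm X2 E X1 (h w) +[pw rm X1] h' (mm rm X1 D X0 w)"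
  and v: "v \<in> vec A X1" "mm A X1 (tp E) X2 v = (\<lambda>_. \<zero>[A])"
 shows "\<exists>v'\<in>vec A X0. s *[pw A X1] v = mm A X0 (tp D) X1 v'"
proof -
 interpret A: rmod R A by (rule A)
 interpret rm: rmod R rm by (rule rmod_rm)
 interpret P: rmod R "pw A X1" by (rule A.rmod_pw)
 note vP = A.pw_Pi[OF v(1)]
 have lv: "lin R (pw rm X1) A (\<lambda>w. lc A X1 w v)" by (rule lc_lin[OF A fin(2) vP])
 note lh = lin_comp[OF h' lv]
 let ?v' = "\<lambda>x. if x \<in> X0 then lc A X1 (h' (free_gen R x)) v else \<zero>[A]"
 have v': "?v' \<in> vec A X0" by (rule pwI) (use lin_closed[OF lh gen_pw] in auto)
 have "s *[pw A X1] v = mm A X0 (tp D) X1 ?v'"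
 proof (rule pw_ext[OF P.smult_closed[OF s v(1)]])
  show "mm A X0 (tp D) X1 ?v' \<in> vec A X1" by (rule A.mm_closed) (use D A.pw_Pi[OF v'] in simp_all)
  fix x assume x: "x \<in> X1"
  let ?e = "free_gen R x"
  have e: "?e \<in> vec rm X1" by (rule gen_pw[OF x])
  have De: "mm rm X1 D X0 ?e \<in> vec rm X0" by (rule rm.mm_closed[OF D]) (use e in simp)
  have he: "h ?e \<in> vec rm X2" by (rule lin_closed[OF h e])
  have "s *[A] v x = s *[A] lc A X1 ?e v" using A.lc_gen[OF fin(2) x vP] by simp
  also have "\<dots> = lc A X1 (s *[pw rm X1] ?e) v" by (rule lin_smult[OF lv s e, symmetric])
  also have "\<dots> = lc A X1 (mm rm X2 E X1 (h ?e)) v +[A] lc A X1 (h' (mm rm X1 D X0 ?e)) v"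
   unfolding eq[OF e] by (rule lin_add[OF lv rm.mm_closed[OF E] lin_closed[OF h' De]]) (use he in simp)
  also have "lc A X1 (mm rm X2 E X1 (h ?e)) v = lc A X2 (h ?e) (\<lambda>_. \<zero>[A])" unfolding v(2)[symmetric] by (rule lc_mm[OF A fin(3,2) E _ vP]) (use he in simp)
  also have "\<dots> = \<zero>[A]" by (rule A.lc_zero_r) (use he in simp)
  also have "lc A X1 (h' (mm rm X1 D X0 ?e)) v = lc A X0 (mm rm X1 D X0 ?e) (\<lambda>z. lc A X1 (h' (free_gen R z)) v)"
   by (rule lin_free_lc[OF A fin(1) lh De])
  also have "\<dots> = lc A X0 (tp D x) ?v'"
   by (rule A.lc_cong) (use mm_gen[OF fin(2) D x] D x A.pw_Pi[OF v'] in \<open>auto simp: tp_def mat_def\<close>)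
  also have "\<dots> = mm A X0 (tp D) X1 ?v' x" using x by (simp add: mm_def)
  also have "\<zero>[A] +[A] mm A X0 (tp D) X1 ?v' x = mm A X0 (tp D) X1 ?v' x"
   using pwD[OF A.mm_closed[of X1 X0 "tp D" ?v'] x] D A.pw_Pi[OF v'] by simp
  finally show "(s *[pw A X1] v) x = mm A X0 (tp D) X1 ?v' x" by simp
 qed
 then show ?thesis using v' by blast
qed

text \<open>An element annihilating the cokernel of \<open>D 0\<close> acts null-homotopically. The
  recursion carries the homotopy identity composed with the differential, y d = d h d; this alone
  makes y - h d take values in cycles, from which the next homotopy is lifted.\<close>

lemma null_homotopy:
 assumes r: "res R W D" and y: "y \<in> carrier R"
  and y0: "\<And>w. w \<in> vec rm (W 0) ==> \<exists>z\<in>vec rm (W 1). mm rm (W 1) (D 0) (W 0) z = y *[pw rm (W 0)] w"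
 shows "\<exists>h h'. lin R (pw rm (W (Suc i))) (pw rm (W (Suc (Suc i)))) h \<and> lin R (pw rm (W i)) (pw rm (W (Suc i))) h' \<and>
  (\<forall>w\<in>vec rm (W (Suc i)). y *[pw rm (W (Suc i))] w =
   dif rm W D (Suc i) (h w) +[pw rm (W (Suc i))] h' (dif rm W D i w))"
proof -
 interpret rm: rmod R rm by (rule rmod_rm)
 interpret P: rmod R "pw rm (W n)" for n by (rule rm.rmod_pw)
 let ?d = "\<lambda>i. dif rm W D i"
 have W: "finite (W i)" "mat R (W i) (W (Suc i)) (D i)" for i using r by (auto simp: res_def)
 have l: "lin R (pw rm (W (Suc i))) (pw rm (W i)) (?d i)" for i by (rule rm.mm_lin[OF W])
 have step: "\<exists>h. lin R (pw rm (W (Suc i))) (pw rm (W (Suc (Suc i)))) h \<and> (\<forall>w\<in>vec rm (W (Suc i)).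
   y *[pw rm (W (Suc i))] w = ?d (Suc i) (h w) +[pw rm (W (Suc i))] h' (?d i w))"
  if h': "lin R (pw rm (W i)) (pw rm (W (Suc i))) h'"
   and Q: "\<And>z. z \<in> vec rm (W (Suc i)) ==> y *[pw rm (W i)] ?d i z = ?d i (h' (?d i z))" for i h'
 proof -
  let ?k = "\<lambda>w. y *[pw rm (W (Suc i))] w -[pw rm (W (Suc i))] h' (?d i w)"
  have hd: "h' (?d i w) \<in> vec rm (W (Suc i))" if "w \<in> vec rm (W (Suc i))" for w by (rule lin_closed[OF h' lin_closed[OF l that]])
  have ly: "lin R (pw rm (W (Suc i))) (pw rm (W (Suc i))) (\<lambda>w. y *[pw rm (W (Suc i))] w)"
   by (rule P.lin_scale[OF y])
  have k: "lin R (pw rm (W (Suc i))) (pw rm (W (Suc i))) ?k" by (rule lin_diff[OF rm.rmod_pw rm.rmod_pw ly lin_comp[OF l h']])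
  have im: "\<exists>z\<in>vec rm (W (Suc (Suc i))). ?d (Suc i) z = ?k w" if w: "w \<in> vec rm (W (Suc i))" for w
  proof -
   have "?d i (?k w) = y *[pw rm (W i)] ?d i w -[pw rm (W i)] ?d i (h' (?d i w))"
    using lin_minus[OF rm.rmod_pw rm.rmod_pw l P.smult_closed[OF y w] hd[OF w]] lin_smult[OF l y w] by simp
   also have "\<dots> = \<zero>[pw rm (W i)]" unfolding Q[OF w] a_minus_def by (rule P.M.r_neg[OF lin_closed[OF l hd[OF w]]])
   finally show ?thesis using r lin_closed[OF k w] unfolding res_def exat_def by auto
  qed
  obtain h where h: "lin R (pw rm (W (Suc i))) (pw rm (W (Suc (Suc i)))) h" "\<forall>w\<in>vec rm (W (Suc i)). ?d (Suc i) (h w) = ?k w"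
   using free_lift[OF rm.rmod_pw rm.rmod_pw W(1) l k im] by blast
  have "y *[pw rm (W (Suc i))] w = ?d (Suc i) (h w) +[pw rm (W (Suc i))] h' (?d i w)" if w: "w \<in> vec rm (W (Suc i))" for w
   using h(2) w P.smult_closed[OF y w] hd[OF w] by (simp add: a_minus_def P.M.a_assoc P.M.l_neg del: pw_sel)
  then show ?thesis using h(1) by blast
 qed
 have Q: "\<exists>h. lin R (pw rm (W i)) (pw rm (W (Suc i))) h \<and> (\<forall>z\<in>vec rm (W (Suc i)). y *[pw rm (W i)] ?d i z = ?d i (h (?d i z)))" for i
 proof (induct i)
  case 0
  have ly: "lin R (pw rm (W 0)) (pw rm (W 0)) (\<lambda>w. y *[pw rm (W 0)] w)"
   by (rule P.lin_scale[OF y])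
  obtain h where "lin R (pw rm (W 0)) (pw rm (W (Suc 0))) h" "\<forall>w\<in>vec rm (W 0). ?d 0 (h w) = y *[pw rm (W 0)] w"
   using free_lift[OF rm.rmod_pw rm.rmod_pw W(1) l ly] y0 by auto
  then show ?case using lin_closed[OF l, of _ 0] by (metis)
 next
  case (Suc i)
  then obtain h' where h': "lin R (pw rm (W i)) (pw rm (W (Suc i))) h'" "\<forall>z\<in>vec rm (W (Suc i)). y *[pw rm (W i)] ?d i z = ?d i (h' (?d i z))" by blast
  obtain h where h: "lin R (pw rm (W (Suc i))) (pw rm (W (Suc (Suc i)))) h"
   "\<forall>w\<in>vec rm (W (Suc i)). y *[pw rm (W (Suc i))] w = ?d (Suc i) (h w) +[pw rm (W (Suc i))] h' (?d i w)"
   using step[OF h'(1)] h'(2) by blast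
  have "y *[pw rm (W (Suc i))] ?d (Suc i) z = ?d (Suc i) (h (?d (Suc i) z))" if z: "z \<in> vec rm (W (Suc (Suc i)))" for z
  proof -
   have "?d i (?d (Suc i) z) = \<zero>[pw rm (W i)]" using res_zero_mm[OF rmod_rm r z] by simp
   then have "h' (?d i (?d (Suc i) z)) = \<zero>[pw rm (W (Suc i))]" using lin_zero[OF rm.rmod_pw rm.rmod_pw h'(1)] by simp
   then show ?thesis using h(2) lin_closed[OF l z] P.M.r_zero[OF lin_closed[OF l lin_closed[OF h(1) lin_closed[OF l z]]]] by simp
  qed
  then show ?case using h(1) by blast
 qed
 from Q[of i] obtain h' where h': "lin R (pw rm (W i)) (pw rm (W (Suc i))) h'" "\<forall>z\<in>vec rm (W (Suc i)). y *[pw rm (W i)] ?d i z = ?d i (h' (?d i z))" by blast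
 obtain h where h: "lin R (pw rm (W (Suc i))) (pw rm (W (Suc (Suc i)))) h"
  "\<forall>w\<in>vec rm (W (Suc i)). y *[pw rm (W (Suc i))] w = ?d (Suc i) (h w) +[pw rm (W (Suc i))] h' (?d i w)"
  using step[OF h'(1)] h'(2) by blast
 show ?thesis using h h'(1) by blast
qed

end

text \<open>The longer sequence forces Ext^p(R/(ys), A) to vanish for
  \<open>p \<le> length xs\<close>, because \<open>ys\<close> annihilates these modules and the
  acyclicity lemma applies. Dividing \<open>A\<close> by \<open>xs\<close> uses up all these places
  except degree 0, where Hom(R/(ys), A/(xs)) is therefore zero; \<open>b\<close> defines such a
  homomorphism.\<close>

lemma (in lnr) wreg_comp:
 assumes A: "rmod R A" and x: "wreg R A xs" and y: "wreg R A ys" and len: "length ys = Suc (length xs)"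
  and b: "b \<in> carrier A" "\<And>y. y \<in> set ys ==> y *[A] b \<in> seq_submodule R A xs"
 shows "b \<in> seq_submodule R A xs"
proof -
 interpret A: rmod R A by (rule A)
 interpret rm: rmod R rm by (rule rmod_rm)
 have xs: "set xs \<subseteq> carrier R" and ys: "set ys \<subseteq> carrier R" using A.wreg_set x y by auto
 interpret P: rmod R "pw rm {0::nat}" by (rule rm.rmod_pw)
 \<comment> \<open>\<open>W\<close> resolves R/(ys), with a single basis element in degree
   0.\<close>
 obtain W D where r: "res R W D" and W0: "W 0 = {0::nat}"
  and im: "\<And>u. u \<in> seq_submodule R (pw rm {0}) ys \<longleftrightarrow> (\<exists>v\<in>vec rm (W 1). u = mm rm (W 1) (D 0) (W 0) v)"
  by (rule res_tail[OF _ P.seq_sub[OF ys]]) (simp, rule that)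
 have W: "finite (W i)" "mat R (W i) (W (Suc i)) (D i)" for i using r by (auto simp: res_def)
 interpret AW: rmod R "pw A (W n)" for n by (rule A.rmod_pw)
 let ?d = "\<lambda>i. cod A W D i"
 interpret K: cochain R "\<lambda>i. pw A (W i)" ?d "\<lambda>i. {\<zero>[pw A (W i)]}"
 proof (intro cochain.intro cochain_axioms.intro crng_axioms A.rmod_pw)
  show d: "lin R (pw A (W i)) (pw A (W (Suc i))) (?d i)" for i by (rule A.mm_lin) (use W in simp_all)
  show "submodule {\<zero>[pw A (W i)]} R (pw A (W i))" for i
   by (rule AW.subI_comb) (use AW.M.zero_closed[of i] AW.M.l_zero[OF AW.M.zero_closed, of i] AW.smult_r_null[of _ i] in \<open>auto simp del: pw_sel\<close>)
  show "?d i c \<in> {\<zero>[pw A (W (Suc i))]}" if "c \<in> {\<zero>[pw A (W i)]}" for i c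
   using lin_zero[OF A.rmod_pw A.rmod_pw d] that by simp
  show "?d (Suc i) (?d i c) = \<zero>[pw A (W (Suc (Suc i)))]" if "c \<in> vec A (W i)" for i c using res_zero_tp[OF A r that] by simp
 qed
 have lid: "lin R (pw A (W i)) (pw A (W i)) (\<lambda>c. c)" for i by (rule linI) auto
 have V: "c \<in> K.V (rev zs) i \<longleftrightarrow> c \<in> seq_submodule R (pw A (W i)) zs" if "set zs \<subseteq> carrier R" "c \<in> vec A (W i)" for zs i c
  by (rule K.V_quot[OF A.rmod_pw lid _ _ that]) auto
 have reg: "K.reg (rev zs)" if zs: "wreg R A zs" for zs
 proof (rule K.regI[OF A.wreg_set[OF zs]])
  fix us u vs i c assume z: "zs = us @ u # vs" "c \<in> vec A (W i)" "u *[pw A (W i)] c \<in> K.V (rev us) i"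
  have "wreg R (pw A (W i)) (us @ [u])" using A.wreg_take[OF zs, of "Suc (length us)"] unfolding z(1) by (intro A.wreg_pw) simp
  then show "c \<in> K.V (rev us) i" by (rule K.V_wreg[OF A.rmod_pw lid _ _ _ z(2,3), rotated 2]) auto
 qed
 \<comment> \<open>Multiplication by \<open>z\<close> is null-homotopic on \<open>W\<close>, since
   \<open>z\<close> annihilates R/(ys). Dualizing settles positive degrees; in degree 0 the
   presentation is used directly.\<close>
 have bd: "K.bd [] p (z *[pw A (W p)] v)" if z: "z \<in> set ys" and v: "v \<in> vec A (W p)" "?d p v = (\<lambda>_. \<zero>[A])" for z p v
 proof -
  have zR: "z \<in> carrier R" using z ys by blast
  have z0: "\<exists>u\<in>vec rm (W 1). mm rm (W 1) (D 0) (W 0) u = z *[pw rm (W 0)] w" if w: "w \<in> vec rm (W 0)" for w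
  proof -
   have "z *[pw rm {0}] w \<in> seq_submodule R (pw rm {0}) ys"
    unfolding seq_submodule_def by (rule subsetD[OF P.span_superset], rule CollectI, rule exI[of _ z], rule exI[of _ w]) (use z w W0 in \<open>simp del: pw_sel\<close>)
   then show ?thesis using im W0 by metis
  qed
  have zv: "z *[pw A (W p)] v \<in> vec A (W p)" by (rule AW.smult_closed[OF zR v(1)])
  have "\<exists>b\<in>K.im p. z *[pw A (W p)] v = b"
  proof (cases p)
   case 0
   have "(z *[pw A (W p)] v) = (\<lambda>_. \<zero>[A])"
   proof (rule pw_ext[OF zv])
    show "(\<lambda>_. \<zero>[A]) \<in> vec A (W p)" by (rule pwI) auto
    fix x assume x: "x \<in> W p"
    have e: "free_gen R x \<in> vec rm (W 0)" using gen_pw x 0 by metis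
    obtain u where u: "u \<in> vec rm (W 1)" "mm rm (W 1) (D 0) (W 0) u = z *[pw rm (W 0)] free_gen R x" using z0[OF e] by blast
    have "z *[A] v x = z *[A] lc A (W 0) (free_gen R x) v" using A.lc_gen[OF W(1) x A.pw_Pi[OF v(1)]] 0 by simp
    also have "\<dots> = lc A (W 0) (mm rm (W 1) (D 0) (W 0) u) v" unfolding u(2)
     by (rule lin_smult[OF lc_lin[OF A W(1) A.pw_Pi[OF v(1)]] zR e, symmetric])
    also have "\<dots> = lc A (W 1) u (?d 0 v)" using lc_mm[OF A W(1,1) W(2), of u 0 v] u(1) A.pw_Pi[OF v(1)] by simp
    also have "\<dots> = \<zero>[A]" using v(2) A.lc_zero_r[OF pwR_Pi[OF u(1)]] 0 by simp
    finally show "(z *[pw A (W p)] v) x = \<zero>[A]" by simp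
   qed
   then show ?thesis using 0 by (simp add: K.im_def)
  next
   case (Suc i)
   obtain h h' where h: "lin R (pw rm (W (Suc i))) (pw rm (W (Suc (Suc i)))) h" "lin R (pw rm (W i)) (pw rm (W (Suc i))) h'"
    "\<And>w. w \<in> vec rm (W (Suc i)) ==> z *[pw rm (W (Suc i))] w =
     dif rm W D (Suc i) (h w) +[pw rm (W (Suc i))] h' (dif rm W D i w)"
    using null_homotopy[OF r zR z0, of i] by metis
   show ?thesis
    using homotopy_dual[OF A W(1) W(1) W(1) W(2) W(2) h(1,2) zR h(3), of v] v by (auto simp: Suc K.im_def)
  qed
  then show ?thesis unfolding K.bd_def using AW.M.r_neg[OF zv] by (auto simp: a_minus_def simp del: pw_sel)
 qed
 \<comment> \<open>The first \<open>Suc p\<close> elements of \<open>ys\<close> annihilate the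
   cohomology at \<open>p\<close>, and the places below are exact by induction; the acyclicity lemma
   applies as long as \<open>Suc p \<le> length ys\<close>.\<close>
 have ex: "K.ex [] p" if "p \<le> length xs" for p using that
 proof (induct p rule: less_induct)
  case (less p)
  show ?case unfolding K.ex_def
  proof (intro ballI impI)
   fix v assume v: "v \<in> vec A (W p)" "?d p v \<in> K.V [] (Suc p)"
   show "K.bd [] p v"
   proof (rule K.acyclic[where zs = "take (Suc p) ys"])
    show "length (take (Suc p) ys) = Suc p" using less(2) len by simp
    show "K.reg (rev (take (Suc p) ys) @ [])" using reg[OF A.wreg_take[OF y]] by simp
    show "K.ex [] j" if "j < p" for j using less that by simp
    show "K.bd [] p (z *[pw A (W p)] v)" if "z \<in> set (take (Suc p) ys)" for z
     by (rule bd[OF in_set_takeD[OF that] v(1)]) (use v(2)[unfolded K.V.simps] in simp)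
   qed (rule v(1))
  qed
 qed
 have "K.ex (rev xs @ []) 0" by (rule K.reduce_all) (use reg[OF x] ex in simp_all)
 then have ex0: "K.ex (rev xs) 0" by simp
 \<comment> \<open>The element \<open>b\<close> as a cochain of degree 0; it is a cocycle modulo
   \<open>xs\<close> because the entries of \<open>D 0\<close> lie in (ys).\<close>
 let ?b = "\<lambda>i. if i = (0::nat) then b else \<zero>[A]"
 have b': "?b \<in> vec A (W 0)" by (rule pwI) (use b W0 in auto)
 have "?d 0 ?b x \<in> seq_submodule R A xs" if x: "x \<in> W (Suc 0)" for x
 proof -
  have e: "free_gen R x \<in> vec rm (W 1)" using gen_pw x by simp
  have D0: "D 0 0 x \<in> carrier R" using W(2)[of 0] x W0 by (simp add: mat_def)
  have "mm rm (W 1) (D 0) (W 0) (free_gen R x) \<in> seq_submodule R (pw rm {0}) ys" using im e by blast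
  then have "mm rm (W 1) (D 0) (W 0) (free_gen R x) 0 \<in> seq_submodule R rm ys"
   using rm.seq_pw[OF ys, of "mm rm (W 1) (D 0) (W 0) (free_gen R x)" "{0::nat}"] rm.mm_closed[OF W(2)[of 0], of "free_gen R x"] e W0 by simp
  then have D0y: "D 0 0 x \<in> seq_submodule R rm ys" using mm_gen[OF W(1) W(2)[of 0] x, of 0] W0 by simp
  have "seq_submodule R rm ys \<subseteq> {c \<in> carrier R. c *[A] b \<in> seq_submodule R A xs}"
   by (rule seq_rm_sub[OF _ ann_ideal[OF A A.seq_sub[OF xs] b(1)]]) (use ys b(2) in blast)
  then have "D 0 0 x *[A] b \<in> seq_submodule R A xs" using D0y by blast
  moreover have "?d 0 ?b x = D 0 0 x *[A] b"
   using x W0 A.lc_insert[of "{}" 0 "tp (D 0) x" ?b] D0 b(1) by (simp add: mm_def tp_def)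
  ultimately show ?thesis by simp
 qed
 then have "?d 0 ?b \<in> K.V (rev xs) (Suc 0)" using V[OF xs lin_closed[OF K.d b']] A.seq_pw[OF xs lin_closed[OF K.d b']] by blast
 then have "K.bd (rev xs) 0 ?b" by (rule K.ex_bd[OF ex0 b'])
 then have "?b -[pw A (W 0)] \<zero>[pw A (W 0)] \<in> K.V (rev xs) 0" unfolding K.bd_def K.im_def nat.case by blast
 then have "?b \<in> K.V (rev xs) 0" using AW.M.add_minus[OF AW.M.zero_closed b'] AW.M.l_zero[OF b'] by metis
 then have "?b \<in> seq_submodule R (pw A (W 0)) xs" using V[OF xs b'] by simp
 then show ?thesis using A.seq_pw[OF xs b'] W0 by simp
qed

section \<open>Splitting of bounded exact complexes at an associated prime\<close>

context lnr begin

text \<open>By \<open>Q\<close>, the map \<pi> = s - a h vanishes on boundaries, so over the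
  localized ring it should factor through the differential \<open>?b\<close>; that it does, up to an
  element outside \<open>p\<close>, is decided by \<open>pivot\<close>.\<close>

lemma contract_step:
 assumes r: "res R X D" and w: "wreg R rm xs" and len: "length xs \<le> j" and u: "u \<in> carrier R"
  and p: "primeideal p R" and p_def: "p = {c \<in> carrier R. c \<otimes> u \<in> seq_submodule R rm xs}"
  and s: "s \<in> carrier R - p" and h: "lin R (pw rm (X (Suc j))) (pw rm (X (Suc (Suc j)))) h"
  and Q: "\<And>z. z \<in> vec rm (X (Suc (Suc j))) ==> s *[pw rm (X (Suc j))] dif rm X D (Suc j) z
   = dif rm X D (Suc j) (h (dif rm X D (Suc j) z))"
 shows "\<exists>s'\<in>carrier R - p. \<exists>h h'. lin R (pw rm (X (Suc j))) (pw rm (X (Suc (Suc j)))) h \<and> lin R (pw rm (X j)) (pw rm (X (Suc j))) h' \<and>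
  (\<forall>w\<in>vec rm (X (Suc j)). s' *[pw rm (X (Suc j))] w =
   dif rm X D (Suc j) (h w) +[pw rm (X (Suc j))] h' (dif rm X D j w))"
proof -
 interpret rm: rmod R rm by (rule rmod_rm)
 interpret P: primeideal p R by (rule p)
 define X0 X1 X2 where X: "X0 = X j" "X1 = X (Suc j)" "X2 = X (Suc (Suc j))"
 interpret K0: rmod R "pw rm X0" by (rule rm.rmod_pw)
 interpret K1: rmod R "pw rm X1" by (rule rm.rmod_pw)
 let ?K0 = "vec rm X0" and ?K1 = "vec rm X1" and ?K2 = "vec rm X2"
 let ?a = "mm rm X2 (D (Suc j)) X1" and ?b = "mm rm X1 (D j) X0"
 have f: "finite X0" "finite X1" "finite X2" "mat R X0 X1 (D j)" "mat R X1 X2 (D (Suc j))" using r by (auto simp: X res_def)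
 have sR: "s \<in> carrier R" "s \<notin> p" using s by auto
 have pR: "c \<in> p ==> c \<in> carrier R" for c using P.Icarr .
 have xs: "set xs \<subseteq> carrier R" by (rule rm.wreg_set[OF w])
 note K = rm.rmod_pw and h = h[folded X] and Q = Q[folded X]
 have a: "lin R (pw rm X2) (pw rm X1) ?a" and b: "lin R (pw rm X1) (pw rm X0) ?b" by (rule rm.mm_lin[OF f(3,5)], rule rm.mm_lin[OF f(2,4)])
 note ah = lin_comp[OF h a]
 define \<pi> where "\<pi> w = s *[pw rm X1] w -[pw rm X1] ?a (h w)" for w
 have \<pi>: "lin R (pw rm X1) (pw rm X1) \<pi>" unfolding \<pi>_def by (rule lin_diff[OF K K K1.lin_scale[OF sR(1)] ah])
 note \<pi>c = lin_closed[OF \<pi>]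
 have dec: "s *[pw rm X1] w = \<pi> w +[pw rm X1] ?a (h w)" if "w \<in> ?K1" for w
  using K1.smult_closed[OF sR(1) that] lin_closed[OF ah that] by (simp add: \<pi>_def a_minus_def K1.M.a_assoc K1.M.l_neg del: pw_sel)
 have \<pi>a: "\<pi> (?a z) = \<zero>[pw rm X1]" if "z \<in> ?K2" for z
  unfolding \<pi>_def Q[OF that] a_minus_def by (rule K1.M.r_neg[OF lin_closed[OF ah lin_closed[OF a that]]])
 have ba: "?b (?a z) = \<zero>[pw rm X0]" if "z \<in> ?K2" for z using res_zero_mm[OF rmod_rm r, of z j] that by (simp add: X)
 have b\<pi>: "?b (\<pi> w) = s *[pw rm X0] ?b w" if w: "w \<in> ?K1" for w
 proof -
  have "s *[pw rm X0] ?b w = ?b (\<pi> w) +[pw rm X0] ?b (?a (h w))"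
   unfolding lin_smult[OF b sR(1) w, symmetric] dec[OF w] by (rule lin_add[OF b \<pi>c[OF w] lin_closed[OF ah w]])
  then show ?thesis unfolding ba[OF lin_closed[OF h w]] using K0.M.r_zero[OF lin_closed[OF b \<pi>c[OF w]]] by metis
 qed
 \<comment> \<open>Applying \<pi> to s w = \<pi> w + a h w and using that \<pi> kills boundaries
   gives s \<pi> w = \<pi> \<pi> w; comparison with the same decomposition of s \<pi> w leaves a h
   \<pi> w = 0.\<close>
 have ah\<pi>: "?a (h (\<pi> w)) = \<zero>[pw rm X1]" if w: "w \<in> ?K1" for w
 proof -
  have "\<pi> (s *[pw rm X1] w) = \<pi> (\<pi> w) +[pw rm X1] \<pi> (?a (h w))" unfolding dec[OF w] by (rule lin_add[OF \<pi> \<pi>c[OF w] lin_closed[OF ah w]])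
  then have "s *[pw rm X1] \<pi> w = \<pi> (\<pi> w)"
   unfolding \<pi>a[OF lin_closed[OF h w]] lin_smult[OF \<pi> sR(1) w] using K1.M.r_zero[OF \<pi>c[OF \<pi>c[OF w]]] by metis
  then have "\<pi> (\<pi> w) +[pw rm X1] ?a (h (\<pi> w)) = \<pi> (\<pi> w) +[pw rm X1] \<zero>[pw rm X1]"
   using dec[OF \<pi>c[OF w]] K1.M.r_zero[OF \<pi>c[OF \<pi>c[OF w]]] by metis
  then show ?thesis by (rule K1.M.add.l_cancel[OF _ lin_closed[OF ah \<pi>c[OF w]] K1.M.zero_closed \<pi>c[OF \<pi>c[OF w]]])
 qed
 have dl: "lin R (pw rm X1) rm (\<lambda>\<psi>. dot X1 \<psi> g)" if "g \<in> ?K1" for g by (rule lc_lin[OF rmod_rm f(2)]) (use that in simp)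
 have dl0: "lin R (pw rm X0) rm (\<lambda>\<psi>. dot X0 \<psi> g)" if "g \<in> ?K0" for g by (rule lc_lin[OF rmod_rm f(1)]) (use that in simp)
 \<comment> \<open>If a multiple by an element outside \<open>p\<close> brings all coordinate forms
   into \<open>U\<close>, the factorizations through \<open>?b\<close> are the rows of the new
   \<open>h'\<close>.\<close>
 define U where "U = {\<psi> \<in> ?K1. \<exists>w\<in>?K0. \<forall>v\<in>?K1. dot X1 \<psi> (\<pi> v) = dot X0 w (?b v)}"
 have UI: "\<psi> \<in> U" if "\<psi> \<in> ?K1" "w \<in> ?K0" "\<And>v. v \<in> ?K1 ==> dot X1 \<psi> (\<pi> v) = dot X0 w (?b v)" for \<psi> w using that unfolding U_def by blast
 have UE: "\<exists>w\<in>?K0. \<forall>v\<in>?K1. dot X1 \<psi> (\<pi> v) = dot X0 w (?b v)" "\<psi> \<in> ?K1" if "\<psi> \<in> U" for \<psi> using that unfolding U_def by blast+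
 have U: "submodule U R (pw rm X1)"
 proof (rule K1.subI_comb)
  have z: "dot X1 \<zero>[pw rm X1] (\<pi> v) = dot X0 \<zero>[pw rm X0] (?b v)" if "v \<in> ?K1" for v
   using lin_zero[OF K rmod_rm dl[OF \<pi>c[OF that]]] lin_zero[OF K rmod_rm dl0[OF lin_closed[OF b that]]] by simp
  show "\<zero>[pw rm X1] \<in> U" by (rule UI[OF K1.M.zero_closed K0.M.zero_closed z])
  fix \<psi> assume "\<psi> \<in> U"
  then obtain w where \<psi>: "\<psi> \<in> ?K1" "w \<in> ?K0" "\<And>v. v \<in> ?K1 ==> dot X1 \<psi> (\<pi> v) = dot X0 w (?b v)" using UE by blast
  { fix \<psi>' assume "\<psi>' \<in> U"
   then obtain w' where \<psi>': "\<psi>' \<in> ?K1" "w' \<in> ?K0" "\<And>v. v \<in> ?K1 ==> dot X1 \<psi>' (\<pi> v) = dot X0 w' (?b v)" using UE by blast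
   have "dot X1 (\<psi> +[pw rm X1] \<psi>') (\<pi> v) = dot X0 (w +[pw rm X0] w') (?b v)" if "v \<in> ?K1" for v
    using lin_add[OF dl[OF \<pi>c[OF that]] \<psi>(1) \<psi>'(1)] lin_add[OF dl0[OF lin_closed[OF b that]] \<psi>(2) \<psi>'(2)] \<psi>(3)[OF that] \<psi>'(3)[OF that] by simp
   then show "\<psi> +[pw rm X1] \<psi>' \<in> U" by (rule UI[OF K1.M.a_closed[OF \<psi>(1) \<psi>'(1)] K0.M.a_closed[OF \<psi>(2) \<psi>'(2)]]) }
  fix c assume c: "c \<in> carrier R"
  have "dot X1 (c *[pw rm X1] \<psi>) (\<pi> v) = dot X0 (c *[pw rm X0] w) (?b v)" if "v \<in> ?K1" for v
   using lin_smult[OF dl[OF \<pi>c[OF that]] c \<psi>(1)] lin_smult[OF dl0[OF lin_closed[OF b that]] c \<psi>(2)] \<psi>(3)[OF that] by simp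
  then show "c *[pw rm X1] \<psi> \<in> U" by (rule UI[OF K1.smult_closed[OF c \<psi>(1)] K0.smult_closed[OF c \<psi>(2)]])
 qed (use UE(2) in auto)
 have dotc: "dot X1 v \<psi> = dot X1 \<psi> v" if "v \<in> ?K1" "\<psi> \<in> ?K1" for v \<psi> by (rule lc_rm_comm) (use that in simp_all)
 consider s' where "s' \<in> carrier R - p" "\<And>v. v \<in> ?K1 ==> s' *[pw rm X1] v \<in> U"
  | v x where "v \<in> ?K1" "x \<in> X1" "v x \<notin> p" "\<And>\<psi>. \<psi> \<in> U ==> dot X1 v \<psi> \<in> p"
  using pivot[OF p f(2) U] by blast
 then show ?thesis
 proof cases
  case 1
  have "\<exists>w\<in>?K0. \<forall>v\<in>?K1. s' \<otimes> \<pi> v y = dot X0 w (?b v)" if y: "y \<in> X1" for y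
  proof -
   obtain w where w: "w \<in> ?K0" "\<forall>v\<in>?K1. dot X1 (s' *[pw rm X1] free_gen R y) (\<pi> v) = dot X0 w (?b v)" using UE(1)[OF 1(2)[OF gen_pw[OF y]]] by blast
   have "dot X1 (s' *[pw rm X1] free_gen R y) (\<pi> v) = s' \<otimes> \<pi> v y" if v: "v \<in> ?K1" for v
    using lin_smult[OF dl[OF \<pi>c[OF v]] _ gen_pw[OF y], of s'] 1(1) rm.lc_gen[OF f(2) y, of "\<pi> v"] \<pi>c[OF v] by simp
   then show ?thesis using w by metis
  qed
  then obtain W where W: "\<And>y. y \<in> X1 ==> W y \<in> ?K0" "\<And>y v. y \<in> X1 ==> v \<in> ?K1 ==> s' \<otimes> \<pi> v y = dot X0 (W y) (?b v)" by metis
  have s': "s' \<in> carrier R" "s' \<notin> p" using 1(1) by auto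
  let ?h' = "mm rm X0 W X1" and ?h = "\<lambda>w. s' *[pw rm X2] h w"
  have mW: "mat R X1 X0 W" using pwR[OF W(1)] by (simp add: mat_def)
  have h': "lin R (pw rm X0) (pw rm X1) ?h'" by (rule rm.mm_lin[OF f(1) mW])
  have h2: "lin R (pw rm X1) (pw rm X2) ?h" by (rule lin_comp[OF h rmod.lin_scale[OF K s'(1)]])
  have eq: "(s' \<otimes> s) *[pw rm X1] w = ?a (?h w) +[pw rm X1] ?h' (?b w)" if w: "w \<in> ?K1" for w
  proof -
   have "s' *[pw rm X1] \<pi> w = ?h' (?b w)"
    by (rule pw_ext[OF K1.smult_closed[OF s'(1) \<pi>c[OF w]] lin_closed[OF h' lin_closed[OF b w]]]) (use W(2)[OF _ w] in \<open>simp add: mm_def\<close>)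
   moreover have "s' *[pw rm X1] ?a (h w) = ?a (?h w)" by (rule lin_smult[OF a s'(1) lin_closed[OF h w], symmetric])
   ultimately show ?thesis
    unfolding K1.smult_assoc1[OF s'(1) sR(1) w] dec[OF w] K1.smult_r_distr[OF s'(1) \<pi>c[OF w] lin_closed[OF ah w]]
    using K1.M.a_comm[OF lin_closed[OF h' lin_closed[OF b w]] lin_closed[OF a lin_closed[OF h2 w]]] by simp
  qed
  have "s' \<otimes> s \<in> carrier R - p" using P.I_prime[OF s'(1) sR(1)] s' sR by auto
  then show ?thesis unfolding X[symmetric] using h2 h' eq by blast
 next
  case 2
  \<comment> \<open>The other alternative is contradictory, in two halves. The rows of
    \<open>?b\<close> lie in \<open>U\<close> because b \<pi> = s b; so b v has entries in
    \<open>p\<close>, u v is a cycle and hence a boundary modulo \<open>xs\<close>, and applying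
    \<pi> puts u \<pi>(v) into (xs), so that \<pi>(v) has entry \<open>x\<close> in
    \<open>p\<close>.\<close>
  have bv: "?b v i \<in> p" if i: "i \<in> X0" for i
  proof -
   let ?\<psi> = "\<lambda>x. if x \<in> X1 then D j i x else \<zero>"
   have \<psi>: "?\<psi> \<in> ?K1" by (rule pwI) (use f(4) i in \<open>auto simp: mat_def\<close>)
   have d: "dot X1 ?\<psi> w = ?b w i" if "w \<in> ?K1" for w
    using i rm.lc_cong[of X1 "D j i" ?\<psi> w w] \<psi> that by (simp add: mm_def)
   have "dot X1 ?\<psi> (\<pi> w) = dot X0 (s *[pw rm X0] free_gen R i) (?b w)" if w: "w \<in> ?K1" for w
    using d[OF \<pi>c[OF w]] b\<pi>[OF w] lin_smult[OF dl0[OF lin_closed[OF b w]] sR(1) gen_pw[OF i]] rm.lc_gen[OF f(1) i, of "?b w"] lin_closed[OF b w] by simp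
   then have "?\<psi> \<in> U" by (rule UI[OF \<psi> K0.smult_closed[OF sR(1) gen_pw[OF i]]])
   from 2(4)[OF this] show ?thesis using d[OF 2(1)] dotc[OF 2(1) \<psi>] by simp
  qed
  have uv: "u *[pw rm X1] v \<in> ?K1" by (rule K1.smult_closed[OF u 2(1)])
  have "?b (u *[pw rm X1] v) i \<in> seq_submodule R rm xs" if i: "i \<in> X0" for i
   using bv[OF i] lin_smult[OF b u 2(1)] m_comm[OF u pR[OF bv[OF i]]] unfolding p_def by simp
  then obtain z where z: "z \<in> ?K2" "\<And>y. y \<in> X1 ==> (u *[pw rm X1] v) y -[rm] ?a z y \<in> seq_submodule R rm xs"
   using rm.reduce_mat[of X D 0 "Suc j" xs j "u *[pw rm X1] v"] r w len uv unfolding X res_def by auto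
  let ?y = "u *[pw rm X1] v -[pw rm X1] ?a z"
  have yc: "?y \<in> ?K1" by (rule K1.M.minus_closed[OF uv lin_closed[OF a z(1)]])
  have "?y \<in> seq_submodule R (pw rm X1) xs"
   using rm.seq_pw[OF xs yc] z(2) fun_cong[OF rm.pw_minus[OF uv lin_closed[OF a z(1)]]] by simp
  from lin_seq[OF K K \<pi> xs this] have "\<pi> ?y \<in> seq_submodule R (pw rm X1) xs" .
  moreover have "\<pi> ?y = u *[pw rm X1] \<pi> v"
   unfolding lin_minus[OF K K \<pi> uv lin_closed[OF a z(1)]] \<pi>a[OF z(1)] lin_smult[OF \<pi> u 2(1)]
   using K1.M.add_minus[OF K1.M.zero_closed K1.smult_closed[OF u \<pi>c[OF 2(1)]]] K1.M.l_zero[OF K1.smult_closed[OF u \<pi>c[OF 2(1)]]] by metis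
  ultimately have "u \<otimes> \<pi> v x \<in> seq_submodule R rm xs" using rm.seq_pw[OF xs K1.smult_closed[OF u \<pi>c[OF 2(1)]]] 2(2) by simp
  then have \<pi>v: "\<pi> v x \<in> p" unfolding p_def using pwR[OF \<pi>c[OF 2(1)]] m_comm[OF u pwR[OF \<pi>c[OF 2(1)]]] by simp
  \<comment> \<open>Second half: row \<open>x\<close> of a h lies in \<open>U\<close> with factor
    zero, as a h \<pi> = 0, so its value at \<open>v\<close> is in \<open>p\<close>. The halves add
    up to \<open>s \<otimes> v x\<close> in \<open>p\<close>, although neither factor is.\<close>
  let ?k = "\<lambda>w. ?a (h w) x" and ?\<psi> = "\<lambda>i. if i \<in> X1 then ?a (h (free_gen R i)) x else \<zero>"
  have k: "lin R (pw rm X1) rm ?k"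
   by (rule linI) (use lin_add[OF ah] lin_smult[OF ah] pwR[OF lin_closed[OF ah]] in simp_all)
  have \<psi>: "?\<psi> \<in> ?K1" by (rule pwI) (use pwR[OF lin_closed[OF ah gen_pw]] in auto)
  have d: "dot X1 w ?\<psi> = ?k w" if w: "w \<in> ?K1" for w
  proof -
   have "dot X1 w ?\<psi> = dot X1 w (\<lambda>i. ?k (free_gen R i))"
    by (rule rm.lc_cong) (use pwR[OF w] pwR[OF lin_closed[OF ah gen_pw]] in \<open>auto simp: Pi_def\<close>)
   then show ?thesis using lin_free_lc[OF rmod_rm f(2) k w] by simp
  qed
  have "dot X1 ?\<psi> (\<pi> w) = dot X0 \<zero>[pw rm X0] (?b w)" if w: "w \<in> ?K1" for w
   using d[OF \<pi>c[OF w]] dotc[OF \<pi>c[OF w] \<psi>] ah\<pi>[OF w] lin_zero[OF K rmod_rm dl0[OF lin_closed[OF b w]]] by simp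
  then have "?\<psi> \<in> U" by (rule UI[OF \<psi> K0.M.zero_closed])
  from 2(4)[OF this] have "?k v \<in> p" using d[OF 2(1)] by simp
  then have "\<pi> v x \<oplus> ?k v \<in> p" using \<pi>v by (simp add: P.a_closed)
  then have "s \<otimes> v x \<in> p" using fun_cong[OF dec[OF 2(1)], of x] by simp
  then show ?thesis using P.I_prime[OF sR(1) pwR[OF 2(1)]] sR(2) 2(3) by blast
 qed
qed

text \<open>The contraction of the localization at \<open>p\<close>, with denominators cleared by \<open>s\<close>; the assumptions on \<open>p\<close>
 say that the localized ring has depth \<open>length xs\<close>.\<close>

lemma contract:
 assumes r: "res R X D" and e: "X (Suc n) = {}" and w: "wreg R rm xs" and u: "u \<in> carrier R"
  and p: "primeideal p R" and p_def: "p = {c \<in> carrier R. c \<otimes> u \<in> seq_submodule R rm xs}"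
 shows "Suc (j + d) = n ==> length xs \<le> j ==> \<exists>s\<in>carrier R - p. \<exists>h h'. lin R (pw rm (X (Suc j))) (pw rm (X (Suc (Suc j)))) h \<and> lin R (pw rm (X j)) (pw rm (X (Suc j))) h' \<and>
  (\<forall>w\<in>vec rm (X (Suc j)). s *[pw rm (X (Suc j))] w =
   dif rm X D (Suc j) (h w) +[pw rm (X (Suc j))] h' (dif rm X D j w))"
proof (induct d arbitrary: j)
 interpret rm: rmod R rm by (rule rmod_rm)
 interpret P: primeideal p R by (rule p)
 have f: "finite (X i)" "mat R (X i) (X (Suc i)) (D i)" for i using r by (auto simp: res_def)
 note l = rm.mm_lin[OF f]
 {
  case 0
  interpret K: rmod R "pw rm (X (Suc (Suc j)))" by (rule rm.rmod_pw)
  interpret K1: rmod R "pw rm (X (Suc j))" by (rule rm.rmod_pw)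
  have e': "X (Suc (Suc j)) = {}" using e 0 by simp
  have z: "z = \<zero>[pw rm (X (Suc (Suc j)))]" if "z \<in> vec rm (X (Suc (Suc j)))" for z by (rule pw_ext[OF that K.M.zero_closed]) (simp add: e')
  have "\<one> \<in> carrier R - p" using P.I_notcarr P.one_imp_carrier by auto
  then show ?case
  proof (rule contract_step[OF r w 0(2) u p p_def, where h = "\<lambda>_. \<zero>[pw rm (X (Suc (Suc j)))]"])
   show "lin R (pw rm (X (Suc j))) (pw rm (X (Suc (Suc j)))) (\<lambda>_. \<zero>[pw rm (X (Suc (Suc j)))])"
    by (rule linI) (use K.M.zero_closed K.M.r_zero K.smult_r_null in simp_all)
   fix z assume "z \<in> vec rm (X (Suc (Suc j)))"
   from lin_zero[OF rm.rmod_pw rm.rmod_pw l, folded z[OF this]]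
   show "\<one> *[pw rm (X (Suc j))] dif rm X D (Suc j) z
    = dif rm X D (Suc j) \<zero>[pw rm (X (Suc (Suc j)))]"
    using lin_zero[OF rm.rmod_pw rm.rmod_pw l, of "Suc j"] z[OF \<open>z \<in> vec rm (X (Suc (Suc j)))\<close>] K1.smult_one[OF K1.M.zero_closed] by metis
  qed
 next
  case (Suc d)
  interpret K1: rmod R "pw rm (X (Suc j))" by (rule rm.rmod_pw)
  let ?d1 = "dif rm X D (Suc j)" and ?d2 = "dif rm X D (Suc (Suc j))"
  have j: "Suc (Suc j + d) = n" "length xs \<le> Suc j" using Suc(2,3) by simp_all
  obtain s h h' where *: "s \<in> carrier R - p" "lin R (pw rm (X (Suc (Suc j)))) (pw rm (X (Suc (Suc (Suc j))))) h"
   "lin R (pw rm (X (Suc j))) (pw rm (X (Suc (Suc j)))) h'"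
   "\<And>w. w \<in> vec rm (X (Suc (Suc j))) ==> s *[pw rm (X (Suc (Suc j)))] w = ?d2 (h w) +[pw rm (X (Suc (Suc j)))] h' (?d1 w)"
   using Suc(1)[OF j] by blast
  show ?case
  proof (rule contract_step[OF r w Suc(3) u p p_def *(1,3)])
   fix z assume z: "z \<in> vec rm (X (Suc (Suc j)))"
   have hz: "h z \<in> vec rm (X (Suc (Suc (Suc j))))" by (rule lin_closed[OF *(2) z])
   have hd: "h' (?d1 z) \<in> vec rm (X (Suc (Suc j)))" by (rule lin_closed[OF *(3) lin_closed[OF l z]])
   have "?d1 (s *[pw rm (X (Suc (Suc j)))] z) = ?d1 (?d2 (h z)) +[pw rm (X (Suc j))] ?d1 (h' (?d1 z))"
    unfolding *(4)[OF z] by (rule lin_add[OF l lin_closed[OF l hz] hd])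
   also have "?d1 (?d2 (h z)) = \<zero>[pw rm (X (Suc j))]" using res_zero_mm[OF rmod_rm r hz] by simp
   finally show "s *[pw rm (X (Suc j))] ?d1 z = ?d1 (h' (?d1 z))"
    unfolding lin_smult[OF l DiffD1[OF *(1)] z] using K1.M.l_zero[OF lin_closed[OF l hd]] by simp
  qed
 }
qed

text \<open>Suppose a regular sequence \<open>xs\<close> in \<open>I\<close> with at most
  \<open>j\<close> elements cannot be prolonged inside \<open>I\<close>. Then \<open>I\<close> lies
  in a prime \<open>?p\<close> of zero divisors modulo \<open>xs\<close>, whose localization has
  depth \<open>length xs\<close>; there the complex splits in degree \<open>Suc j\<close>, and
  clearing denominators yields an \<open>s\<close> in \<open>I\<close> outside
  \<open>?p\<close>.\<close>

lemma ann_regular: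
 fixes X :: "nat => 'x set"
 assumes r: "res R X D" and e: "X (Suc n) = {}" and j: "Suc j \<le> n"
 defines "I \<equiv> {c \<in> carrier R. \<forall>v\<in>vec rm (X (Suc j)). cod rm X D (Suc j) v = (\<lambda>_. \<zero>) -->
   (\<exists>w\<in>vec rm (X j). c *[pw rm (X (Suc j))] v = cod rm X D j w)}"
 shows "ideal I R" "\<exists>xs. length xs = Suc j \<and> set xs \<subseteq> I \<and> wreg R rm xs"
proof -
 interpret rm: rmod R rm by (rule rmod_rm)
 let ?t = "cod rm X D j"
 have f: "finite (X i)" "mat R (X i) (X (Suc i)) (D i)" for i using r by (auto simp: res_def)
 have l: "lin R (pw rm (X j)) (pw rm (X (Suc j))) ?t" by (rule rm.mm_lin) (use f in simp_all)
 have I_alt: "I = {c \<in> carrier R. \<forall>v\<in>{v \<in> vec rm (X (Suc j)). cod rm X D (Suc j) v = (\<lambda>_. \<zero>)}.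
   c *[pw rm (X (Suc j))] v \<in> ?t ` vec rm (X j)}"
  unfolding I_def image_iff by auto
 show I: "ideal I R" unfolding I_alt by (rule ann_set_ideal[OF rm.rmod_pw lin_image_sub[OF rm.rmod_pw rm.rmod_pw l]]) auto
 have "\<exists>xs. length xs = k \<and> set xs \<subseteq> I \<and> wreg R rm xs" if "k \<le> Suc j" for k
  using that
 proof (induct k)
  case 0
  then show ?case using rm.wreg_Nil by (intro exI[of _ "[]"]) simp
 next
  case (Suc k)
  then obtain xs where xs: "length xs = k" "set xs \<subseteq> I" "wreg R rm xs" by auto
  have "\<exists>x\<in>I. wreg R rm (xs @ [x])"
  proof (rule ccontr)
   assume "\<not> ?thesis"
   then have mx: "\<And>x. x \<in> I ==> \<not> wreg R rm (xs @ [x])" by blast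
   obtain u where u: "u \<in> carrier R" "primeideal {c \<in> carrier R. c \<otimes> u \<in> seq_submodule R rm xs} R" "I \<subseteq> {c \<in> carrier R. c \<otimes> u \<in> seq_submodule R rm xs}"
    by (rule reg_extend[OF xs(3) I mx]) (assumption, rule that)
   let ?p = "{c \<in> carrier R. c \<otimes> u \<in> seq_submodule R rm xs}"
   have jn: "Suc (j + (n - Suc j)) = n" "length xs \<le> j" using j Suc(2) xs(1) by simp_all
   obtain s h h' where *: "s \<in> carrier R - ?p" "lin R (pw rm (X (Suc j))) (pw rm (X (Suc (Suc j)))) h" "lin R (pw rm (X j)) (pw rm (X (Suc j))) h'"
    "\<And>w. w \<in> vec rm (X (Suc j)) ==> s *[pw rm (X (Suc j))] w =
     dif rm X D (Suc j) (h w) +[pw rm (X (Suc j))] h' (dif rm X D j w)"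
    using contract[OF r e xs(3) u(1,2) refl jn] by blast
   have sR: "s \<in> carrier R" using *(1) by blast
   have "s \<in> I" unfolding I_def
    using homotopy_dual[OF rmod_rm f(1) f(1) f(1) f(2) f(2) *(2,3) sR *(4)] sR by simp
   then show False using u(3) *(1) by blast
  qed
  then obtain x where "x \<in> I" "wreg R rm (xs @ [x])" by blast
  then show ?case using xs by (intro exI[of _ "xs @ [x]"]) simp
 qed
 then show "\<exists>xs. length xs = Suc j \<and> set xs \<subseteq> I \<and> wreg R rm xs" by blast
qed

end

text \<open>Operations on fractions are unions over all representatives; once the value does not
  depend on them, the union is that value.\<close>

lemma UN_const:
 assumes "\<And>x y x' y'. (x, y) \<in> A ==> (x', y') \<in> B ==> f x y x' y' = c" "(a, b) \<in> A" "(a', b') \<in> B"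
 shows "(\<Union>(x, y)\<in>A. \<Union>(x', y')\<in>B. f x y x' y') = c"
proof -
 have "(\<Union>(x, y)\<in>A. \<Union>(x', y')\<in>B. f x y x' y') = (\<Union>z\<in>A. \<Union>z'\<in>B. c)" using assms(1) by (intro SUP_cong refl) auto
 then show ?thesis using assms(2,3) by auto
qed

section \<open>Localization and the Serre condition\<close>

locale localization = crng R for R :: "'a ring" (structure) +
 fixes M :: "('a, 'b) module" and p
 assumes M: "rmod R M" and p: "primeideal p R"
begin

sublocale M: rmod R M by (rule M)
sublocale P: primeideal p R by (rule p)

definition "S = carrier R - p"
abbreviation "L \<equiv> loc_module R S M"
abbreviation "Rp \<equiv> loc_ring R S"
abbreviation "fr \<equiv> loc_frac R S M"
abbreviation "fR \<equiv> loc_frac R S rm"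

lemma S_car[simp]: "s \<in> S ==> s \<in> carrier R" by (simp add: S_def)
lemma S_one[simp]: "\<one> \<in> S" using P.I_notcarr P.one_imp_carrier by (auto simp: S_def)
lemma S_mult[simp]: "s \<in> S ==> t \<in> S ==> s \<otimes> t \<in> S" using P.I_prime by (auto simp: S_def)

lemma fr_mem: "(m', s') \<in> fr m s \<longleftrightarrow> m' \<in> carrier M \<and> s' \<in> S \<and> (\<exists>u\<in>S. u *[M] (s' *[M] m) = u *[M] (s *[M] m'))"
 unfolding loc_frac_def by simp

lemma smult_swap: "a \<in> carrier R ==> b \<in> carrier R ==> m \<in> carrier M ==> a *[M] (b *[M] m) = b *[M] (a *[M] m)"
 by (simp add: M.smult_assoc1[symmetric] m_comm)

lemma fr_eq:
 assumes m: "m \<in> carrier M" "s \<in> S" and n: "n \<in> carrier M" "t \<in> S"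
 shows "fr m s = fr n t \<longleftrightarrow> (\<exists>u\<in>S. u *[M] (t *[M] m) = u *[M] (s *[M] n))"
proof
 assume "fr m s = fr n t"
 moreover have "(n, t) \<in> fr n t" unfolding fr_mem using n S_one by blast
 ultimately have "(n, t) \<in> fr m s" by simp
 then show "\<exists>u\<in>S. u *[M] (t *[M] m) = u *[M] (s *[M] n)" unfolding fr_mem by blast
next
 have *: "fr m s \<subseteq> fr n t" if m: "m \<in> carrier M" "s \<in> S" and n: "n \<in> carrier M" "t \<in> S"
  and u: "u \<in> S" "u *[M] (t *[M] m) = u *[M] (s *[M] n)" for m n s t u
 proof (rule subrelI)
  fix k w assume "(k, w) \<in> fr m s"
  then obtain v where k: "k \<in> carrier M" "w \<in> S" "v \<in> S" "v *[M] (w *[M] m) = v *[M] (s *[M] k)" unfolding fr_mem by blast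
  note c = S_car[OF m(2)] S_car[OF n(2)] S_car[OF u(1)] S_car[OF k(2)] S_car[OF k(3)]
  have "((u \<otimes> v) \<otimes> s) *[M] (w *[M] n) = (v \<otimes> w) *[M] (u *[M] (s *[M] n))"
   using c n by (simp add: M.smult_assoc1[symmetric] m_ac)
  also have "\<dots> = (u \<otimes> t) *[M] (v *[M] (w *[M] m))" unfolding u(2)[symmetric] using c m by (simp add: M.smult_assoc1[symmetric] m_ac)
  also have "\<dots> = ((u \<otimes> v) \<otimes> s) *[M] (t *[M] k)" unfolding k(4) using c k(1) by (simp add: M.smult_assoc1[symmetric] m_ac)
  finally show "(k, w) \<in> fr n t" unfolding fr_mem using k(1,2) S_mult[OF S_mult[OF u(1) k(3)] m(2)] by blast
 qed
 assume "\<exists>u\<in>S. u *[M] (t *[M] m) = u *[M] (s *[M] n)"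
 then obtain u where u: "u \<in> S" "u *[M] (t *[M] m) = u *[M] (s *[M] n)" by blast
 show "fr m s = fr n t" using *[OF m n u] *[OF n m u(1) u(2)[symmetric]] by blast
qed

lemma fr_eqI: "m \<in> carrier M ==> s \<in> S ==> n \<in> carrier M ==> t \<in> S ==> t *[M] m = s *[M] n ==> fr m s = fr n t"
 using S_one by (subst fr_eq) auto

lemma fr_cancel: "m \<in> carrier M ==> s \<in> S ==> t \<in> S ==> fr (t *[M] m) (t \<otimes> s) = fr m s"
 by (rule fr_eqI) (auto simp: S_mult M.smult_assoc1[symmetric] m_comm)

lemma fr_self: "m \<in> carrier M ==> s \<in> S ==> (m, s) \<in> fr m s"
 unfolding fr_mem using S_one by blast

lemma L_sel: "carrier L = {fr m s | m s. m \<in> carrier M \<and> s \<in> S}" "\<zero>[L] = fr \<zero>[M] \<one>" "carrier Rp = carrier (loc_module R S rm)"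
 "\<zero>[Rp] = \<zero>[loc_module R S rm]" "\<one>\<^bsub>Rp\<^esub> = fR \<one> \<one>" "x +[Rp] y = x +[loc_module R S rm] y" "x \<otimes>\<^bsub>Rp\<^esub> y = x *[loc_module R S rm] y"
 by (auto simp: loc_module_def loc_ring_def Let_def)

lemma L_E: "z \<in> carrier L ==> (\<And>m s. m \<in> carrier M ==> s \<in> S ==> z = fr m s ==> P) ==> P"
 unfolding L_sel by blast

lemma fr_L: "m \<in> carrier M ==> s \<in> S ==> fr m s \<in> carrier L" unfolding L_sel by blast

lemma fr_add:
 assumes m: "m \<in> carrier M" "s \<in> S" and n: "n \<in> carrier M" "t \<in> S"
 shows "fr m s +[L] fr n t = fr (t *[M] m +[M] s *[M] n) (s \<otimes> t)"
proof -
 have eq: "fr (t' *[M] m' +[M] s' *[M] n') (s' \<otimes> t') = fr (t *[M] m +[M] s *[M] n) (s \<otimes> t)"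
  if e: "(m', s') \<in> fr m s" "(n', t') \<in> fr n t" for m' s' n' t'
 proof -
  obtain u v where u: "m' \<in> carrier M" "s' \<in> S" "u \<in> S" "u *[M] (s' *[M] m) = u *[M] (s *[M] m')"
   and v: "n' \<in> carrier M" "t' \<in> S" "v \<in> S" "v *[M] (t' *[M] n) = v *[M] (t *[M] n')" using e unfolding fr_mem by blast
  note c = S_car[OF m(2)] S_car[OF n(2)] S_car[OF u(2)] S_car[OF u(3)] S_car[OF v(2)] S_car[OF v(3)]
  have "(u \<otimes> v) *[M] ((s \<otimes> t) *[M] (t' *[M] m' +[M] s' *[M] n')) =
   (v \<otimes> (t \<otimes> t')) *[M] (u *[M] (s *[M] m')) +[M] (u \<otimes> (s \<otimes> s')) *[M] (v *[M] (t *[M] n'))"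
   using c m n u v by (simp add: M.smult_r_distr M.smult_assoc1[symmetric] m_ac)
  also have "\<dots> = (v \<otimes> (t \<otimes> t')) *[M] (u *[M] (s' *[M] m)) +[M] (u \<otimes> (s \<otimes> s')) *[M] (v *[M] (t' *[M] n))" unfolding u(4) v(4) ..
  also have "\<dots> = (u \<otimes> v) *[M] ((s' \<otimes> t') *[M] (t *[M] m +[M] s *[M] n))"
   using c m n by (simp add: M.smult_r_distr M.smult_assoc1[symmetric] m_ac)
  finally show ?thesis
   by (intro fr_eq[THEN iffD2] bexI[of _ "u \<otimes> v"]) (use c m n u v in simp_all)
 qed
 have "fr m s +[L] fr n t = (\<Union>(m', s')\<in>fr m s. \<Union>(n', t')\<in>fr n t. fr (t' *[M] m' +[M] s' *[M] n') (s' \<otimes> t'))"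
  by (simp add: loc_module_def)
 also have "\<dots> = fr (t *[M] m +[M] s *[M] n) (s \<otimes> t)" by (rule UN_const[OF eq fr_self[OF m] fr_self[OF n]])
 finally show ?thesis .
qed

lemma fr_add_same: "m \<in> carrier M ==> n \<in> carrier M ==> s \<in> S ==> fr m s +[L] fr n s = fr (m +[M] n) s"
 using fr_cancel[of "m +[M] n" s s] by (simp add: fr_add M.smult_r_distr)

lemma fR_mem: "(a', s') \<in> fR a s \<longleftrightarrow> a' \<in> carrier R \<and> s' \<in> S \<and> (\<exists>u\<in>S. u \<otimes> (s' \<otimes> a) = u \<otimes> (s \<otimes> a'))"
 unfolding loc_frac_def by simp

lemma fr_smult:
 assumes a: "a \<in> carrier R" "s \<in> S" and m: "m \<in> carrier M" "t \<in> S"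
 shows "fR a s *[L] fr m t = fr (a *[M] m) (s \<otimes> t)"
proof -
 have eq: "fr (a' *[M] m') (s' \<otimes> t') = fr (a *[M] m) (s \<otimes> t)" if e: "(a', s') \<in> fR a s" "(m', t') \<in> fr m t" for a' s' m' t'
 proof -
  obtain u v where u: "a' \<in> carrier R" "s' \<in> S" "u \<in> S" "u \<otimes> (s' \<otimes> a) = u \<otimes> (s \<otimes> a')"
   and v: "m' \<in> carrier M" "t' \<in> S" "v \<in> S" "v *[M] (t' *[M] m) = v *[M] (t *[M] m')" using e unfolding fr_mem fR_mem by blast
  note c = a(1) S_car[OF a(2)] S_car[OF m(2)] S_car[OF u(2)] S_car[OF u(3)] S_car[OF v(2)] S_car[OF v(3)]
  have "(u \<otimes> v) *[M] ((s \<otimes> t) *[M] (a' *[M] m')) = (u \<otimes> (s \<otimes> a')) *[M] (v *[M] (t *[M] m'))"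
   using c u v by (simp add: M.smult_assoc1[symmetric] m_ac)
  also have "\<dots> = (u \<otimes> (s' \<otimes> a)) *[M] (v *[M] (t' *[M] m))" unfolding u(4) v(4) ..
  also have "\<dots> = (u \<otimes> v) *[M] ((s' \<otimes> t') *[M] (a *[M] m))" using c m by (simp add: M.smult_assoc1[symmetric] m_ac)
  finally show ?thesis
   by (intro fr_eq[THEN iffD2] bexI[of _ "u \<otimes> v"]) (use a c m u v in simp_all)
 qed
 have "fR a s *[L] fr m t = (\<Union>(a', s')\<in>fR a s. \<Union>(m', t')\<in>fr m t. fr (a' *[M] m') (s' \<otimes> t'))" by (simp add: loc_module_def)
 also have "\<dots> = fr (a *[M] m) (s \<otimes> t)"
 proof -
  have f: "(a, s) \<in> fR a s" unfolding fR_mem using a S_one by blast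
  show ?thesis by (rule UN_const[OF eq f fr_self[OF m]])
 qed
 finally show ?thesis .
qed

lemma L_common:
 assumes "x \<in> carrier L" "y \<in> carrier L"
 obtains m n s where "m \<in> carrier M" "n \<in> carrier M" "s \<in> S" "x = fr m s" "y = fr n s"
proof -
 obtain m s n t where *: "m \<in> carrier M" "s \<in> S" "x = fr m s" "n \<in> carrier M" "t \<in> S" "y = fr n t" using assms by (metis L_E)
 have "x = fr (t *[M] m) (t \<otimes> s)" "y = fr (s *[M] n) (t \<otimes> s)"
  using * fr_cancel[of m s t] fr_cancel[of n t s] m_comm[of s t] by auto
 then show ?thesis using * S_mult by (intro that[of "t *[M] m" "s *[M] n" "t \<otimes> s"]) auto
qed

lemma L_abelian: "abelian_group L"
proof (rule abelian_groupI)
 show "x +[L] y \<in> carrier L" if "x \<in> carrier L" "y \<in> carrier L" for x y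
  by (rule L_common[OF that]) (simp add: fr_add_same fr_L)
 show "\<zero>[L] \<in> carrier L" using S_one unfolding L_sel(2) by (intro fr_L) auto
 show "x +[L] y = y +[L] x" if "x \<in> carrier L" "y \<in> carrier L" for x y
  by (rule L_common[OF that]) (simp add: fr_add_same M.M.a_comm)
 show "x +[L] y +[L] z = x +[L] (y +[L] z)" if c: "x \<in> carrier L" "y \<in> carrier L" "z \<in> carrier L" for x y z
 proof -
  obtain m n s where 1: "m \<in> carrier M" "n \<in> carrier M" "s \<in> S" "x = fr m s" "y = fr n s" by (rule L_common[OF c(1,2)])
  obtain k w where 2: "k \<in> carrier M" "w \<in> S" "z = fr k w" by (rule L_E[OF c(3)])
  have "x = fr (w *[M] m) (w \<otimes> s)" "y = fr (w *[M] n) (w \<otimes> s)" "z = fr (s *[M] k) (w \<otimes> s)"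
   using 1 2 fr_cancel[of m s w] fr_cancel[of n s w] fr_cancel[of k w s] m_comm[of s w] by simp_all
  then show ?thesis using 1(1-3) 2(1,2) by (simp add: fr_add_same M.M.a_assoc)
 qed
 show "\<zero>[L] +[L] x = x" if x: "x \<in> carrier L" for x
  by (rule L_E[OF x]) (use S_one in \<open>simp add: L_sel(2) fr_add\<close>)
 show "\<exists>y\<in>carrier L. y +[L] x = \<zero>[L]" if x: "x \<in> carrier L" for x
 proof (rule L_E[OF x])
  fix m s assume m: "m \<in> carrier M" "s \<in> S" "x = fr m s"
  have "fr (\<ominus>[M] m) s +[L] x = \<zero>[L]" using m fr_eqI[of "\<zero>[M]" s "\<zero>[M]" \<one>] S_one by (simp add: fr_add_same M.M.l_neg L_sel(2))
  then show ?thesis using m fr_L[of "\<ominus>[M] m" s] by auto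
 qed
qed

lemma loc_rm: "localization R rm p" by (rule localization.intro[OF crng_axioms localization_axioms.intro[OF rmod_rm p]])

lemma Rp_cring: "cring Rp"
proof -
 interpret Q: localization R rm p by (rule loc_rm)
 interpret A: abelian_group "loc_module R S rm" by (rule Q.L_abelian)
 have m: "comm_monoid Rp"
 proof (rule comm_monoidI)
  fix x y assume "x \<in> carrier Rp" "y \<in> carrier Rp"
  then obtain a s b t where *: "a \<in> carrier R" "s \<in> S" "x = fR a s" "b \<in> carrier R" "t \<in> S" "y = fR b t" unfolding L_sel(3) by (metis Q.L_E rm_sel(1))
  show "x \<otimes>\<^bsub>Rp\<^esub> y \<in> carrier Rp" "x \<otimes>\<^bsub>Rp\<^esub> y = y \<otimes>\<^bsub>Rp\<^esub> x" using * Q.fr_smult[of a s b t] Q.fr_smult[of b t a s] Q.fr_L[of "a \<otimes> b" "s \<otimes> t"] S_mult[of s t]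
   by (simp_all add: L_sel(3,7) m_comm)
  fix z assume "z \<in> carrier Rp"
  then obtain c w where "c \<in> carrier R" "w \<in> S" "z = fR c w" unfolding L_sel(3) by (metis Q.L_E rm_sel(1))
  then show "(x \<otimes>\<^bsub>Rp\<^esub> y) \<otimes>\<^bsub>Rp\<^esub> z = x \<otimes>\<^bsub>Rp\<^esub> (y \<otimes>\<^bsub>Rp\<^esub> z)" using * S_mult[of s t] S_mult[of t w] by (simp add: L_sel(7) Q.fr_smult m_ac)
 next
  show "\<one>\<^bsub>Rp\<^esub> \<in> carrier Rp" using Q.fr_L[of \<one> \<one>] S_one by (simp add: L_sel(3,5))
  show "\<one>\<^bsub>Rp\<^esub> \<otimes>\<^bsub>Rp\<^esub> x = x" if x: "x \<in> carrier Rp" for x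
   by (rule Q.L_E[OF x[unfolded L_sel(3)]]) (use S_one in \<open>simp add: L_sel(5,7) Q.fr_smult\<close>)
 qed
 have "abelian_group Rp" by (rule abelian_groupI) (use A.a_closed A.a_assoc A.a_comm A.l_neg A.a_inv_closed in \<open>auto simp: L_sel(3,4,6)\<close>)
 then show ?thesis
 proof (rule cringI[OF _ m])
  fix x y z assume "x \<in> carrier Rp" "y \<in> carrier Rp" and z: "z \<in> carrier Rp"
  then obtain a b s where *: "a \<in> carrier R" "b \<in> carrier R" "s \<in> S" "x = fR a s" "y = fR b s" unfolding L_sel(3) using Q.L_common[of x y] by auto
  obtain c w where "c \<in> carrier R" "w \<in> S" "z = fR c w" using z unfolding L_sel(3) by (metis Q.L_E rm_sel(1))
  then show "(x +[Rp] y) \<otimes>\<^bsub>Rp\<^esub> z = x \<otimes>\<^bsub>Rp\<^esub> z +[Rp] y \<otimes>\<^bsub>Rp\<^esub> z"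
   using * S_mult[of s w] Q.fr_add_same[of a b s] Q.fr_add_same[of "a \<otimes> c" "b \<otimes> c" "s \<otimes> w"] by (simp add: L_sel(6,7) Q.fr_smult l_distr)
 qed
qed

lemma L_rmod: "rmod Rp L"
proof -
 interpret Q: localization R rm p by (rule loc_rm)
 show ?thesis
 proof (rule rmodI[OF Rp_cring L_abelian])
  fix x y assume x: "x \<in> carrier Rp" and y: "y \<in> carrier L"
  obtain a s m t where *: "a \<in> carrier R" "s \<in> S" "x = fR a s" "m \<in> carrier M" "t \<in> S" "y = fr m t" using x y unfolding L_sel(3) by (metis Q.L_E L_E rm_sel(1))
  show "x *[L] y \<in> carrier L" using * fr_L[of "a *[M] m" "s \<otimes> t"] S_mult[of s t] by (simp add: fr_smult)
  { fix z assume "z \<in> carrier Rp"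
   then obtain a b s where 1: "a \<in> carrier R" "b \<in> carrier R" "s \<in> S" "x = fR a s" "z = fR b s" using x unfolding L_sel(3) using Q.L_common[of x z] by auto
   then show "(x +[Rp] z) *[L] y = x *[L] y +[L] z *[L] y"
    using * S_mult[of s t] Q.fr_add_same[of a b s] fr_add_same[of "a *[M] m" "b *[M] m" "s \<otimes> t"] by (simp add: L_sel(6) fr_smult M.smult_l_distr)
   show "(x \<otimes>\<^bsub>Rp\<^esub> z) *[L] y = x *[L] (z *[L] y)"
    using 1 * S_mult[of s s] S_mult[of s t] Q.fr_smult[of a s b s] by (simp add: L_sel(7) fr_smult M.smult_assoc1 m_assoc) }
  fix z assume "z \<in> carrier L"
  then obtain m n t where 1: "m \<in> carrier M" "n \<in> carrier M" "t \<in> S" "y = fr m t" "z = fr n t" using y L_common by metis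
  then show "x *[L] (y +[L] z) = x *[L] y +[L] x *[L] z"
   using * S_mult[of s t] fr_add_same[of "a *[M] m" "a *[M] n" "s \<otimes> t"] by (simp add: fr_add_same fr_smult M.smult_r_distr)
 next
  show "\<one>\<^bsub>Rp\<^esub> *[L] x = x" if x: "x \<in> carrier L" for x
   by (rule L_E[OF x]) (use S_one in \<open>simp add: L_sel(5) fr_smult\<close>)
 qed
qed

end

lemma depth_ge: "set xs \<subseteq> max_ideal R ==> regular_sequence R M xs ==> enat (length xs) \<le> depth R M"
 unfolding depth_def by (auto intro!: Sup_upper)

lemma depth_less:
 assumes "\<not> zero_module M" "enat (Suc k) \<le> depth R M"
 shows "\<exists>xs. set xs \<subseteq> max_ideal R \<and> regular_sequence R M xs \<and> k < length xs"
proof (rule ccontr)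
 assume "\<not> ?thesis"
 then have "depth R M \<le> enat k" unfolding depth_def using assms(1) by (auto intro!: Sup_least simp: not_less)
 then show False using assms(2) order_trans[of "enat (Suc k)" "depth R M" "enat k"] by simp
qed

lemma seq_cong:
 assumes "carrier A = carrier B" "\<zero>[A] = \<zero>[B]" "ring.add A = ring.add B" "smult A = smult B"
 shows "seq_submodule R A xs = seq_submodule R B xs" "wreg R A xs = wreg R B xs"
proof -
 have "add_monoid A = add_monoid B" using assms by simp
 then have "submodule H R A = submodule H R B" for H
  unfolding submodule_def submodule_axioms_def using assms by simp
 then show s: "seq_submodule R A xs = seq_submodule R B xs" for xs unfolding seq_submodule_def module_span_def using assms by simp
 show "wreg R A xs = wreg R B xs" unfolding wreg_def s using assms by simp
qed

section \<open>The localized module over R, and passage from fractions to numerators\<close>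

context localization begin

definition "mp = {fR a s | a s. a \<in> p \<and> s \<in> S}"

lemma Rp_E: "z \<in> carrier Rp ==> (\<And>a s. a \<in> carrier R ==> s \<in> S ==> z = fR a s ==> P) ==> P"
 unfolding L_sel(3) by (erule localization.L_E[OF loc_rm]) simp

lemma fR_Rp: "a \<in> carrier R ==> s \<in> S ==> fR a s \<in> carrier Rp"
 unfolding L_sel(3) using localization.fr_L[OF loc_rm, of a s] by simp

lemma fR_mult: "a \<in> carrier R ==> s \<in> S ==> b \<in> carrier R ==> t \<in> S ==> fR a s \<otimes>\<^bsub>Rp\<^esub> fR b t = fR (a \<otimes> b) (s \<otimes> t)"
 unfolding L_sel(7) using localization.fr_smult[OF loc_rm, of a s b t] by simp

lemma fR_eqI: "a \<in> carrier R ==> s \<in> S ==> b \<in> carrier R ==> t \<in> S ==> t \<otimes> a = s \<otimes> b ==> fR a s = fR b t"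
 using localization.fr_eqI[OF loc_rm, of a s b t] by simp

text \<open>\<open>max_ideal\<close> is a definite description, so uniqueness is part of the claim;
  it holds because a fraction outside \<open>mp\<close> is a unit.\<close>

lemma max_ideal_Rp: "max_ideal Rp = mp"
proof -
 interpret Q: cring Rp by (rule Rp_cring)
 have unit: "I = carrier Rp" if I: "ideal I Rp" and x: "x \<in> I" "x \<notin> mp" for I x
 proof -
  interpret I: ideal I Rp by (rule I)
  obtain a s where a: "a \<in> carrier R" "s \<in> S" "x = fR a s" by (rule Rp_E[OF I.Icarr[OF x(1)]])
  have aS: "a \<in> S" using a x(2) unfolding mp_def S_def by blast
  have "fR s a \<otimes>\<^bsub>Rp\<^esub> x = \<one>\<^bsub>Rp\<^esub>" unfolding a(3) L_sel(5) fR_mult[OF a(2)[THEN S_car] aS a(1,2)]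
   by (rule fR_eqI) (use a aS in \<open>simp_all add: m_comm\<close>)
  then have "\<one>\<^bsub>Rp\<^esub> \<in> I" using I.I_l_closed[OF x(1) fR_Rp[of s a]] a aS by simp
  then show ?thesis by (rule I.one_imp_carrier)
 qed
 have one: "\<one>\<^bsub>Rp\<^esub> \<notin> mp"
 proof
  assume "\<one>\<^bsub>Rp\<^esub> \<in> mp"
  then obtain a s where a: "a \<in> p" "s \<in> S" "fR \<one> \<one> = fR a s" unfolding mp_def L_sel(5) by blast
  have "(a, s) \<in> fR \<one> \<one>" unfolding a(3) fR_mem using a P.Icarr by (auto intro!: bexI[of _ \<one>])
  then obtain u where u: "u \<in> S" "u \<otimes> (s \<otimes> \<one>) = u \<otimes> (\<one> \<otimes> a)" unfolding fR_mem by blast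
  have "u \<otimes> s \<in> p" using u a P.I_l_closed[OF a(1), of u] P.Icarr[OF a(1)] by simp
  then show False using S_mult[OF u(1) a(2)] by (simp add: S_def)
 qed
 have id: "ideal mp Rp"
 proof (rule Q.ideal_comb)
  show "mp \<subseteq> carrier Rp" unfolding mp_def using fR_Rp P.Icarr by auto
  show "\<zero>[Rp] \<in> mp" unfolding mp_def L_sel(4) localization.L_sel(2)[OF loc_rm]
   by (rule CollectI, rule exI[of _ \<zero>], rule exI[of _ \<one>]) (simp add: P.zero_closed)
  fix x assume "x \<in> mp"
  then obtain a s where a: "a \<in> p" "a \<in> carrier R" "s \<in> S" "x = fR a s" unfolding mp_def using P.Icarr by blast
  { fix y assume "y \<in> mp"
   then obtain b t where b: "b \<in> p" "b \<in> carrier R" "t \<in> S" "y = fR b t" unfolding mp_def using P.Icarr by blast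
   have "x +[Rp] y = fR (t \<otimes> a \<oplus> s \<otimes> b) (s \<otimes> t)" unfolding a(4) b(4) L_sel(6) using localization.fr_add[OF loc_rm, of a s b t] a b by simp
   moreover have "t \<otimes> a \<oplus> s \<otimes> b \<in> p" using a b by (intro P.a_closed P.I_l_closed) auto
   ultimately show "x +[Rp] y \<in> mp" unfolding mp_def using S_mult[OF a(3) b(3)] by (intro CollectI exI conjI) }
  fix y assume "y \<in> carrier Rp"
  then obtain b t where b: "b \<in> carrier R" "t \<in> S" "y = fR b t" by (rule Rp_E)
  show "y \<otimes>\<^bsub>Rp\<^esub> x \<in> mp" unfolding a(4) b(3) fR_mult[OF b(1,2) a(2,3)] mp_def
   by (rule CollectI, rule exI, rule exI, intro conjI, rule refl) (use P.I_l_closed[OF a(1) b(1)] a b in simp_all)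
 qed
 have max: "maximalideal mp Rp"
 proof (rule maximalidealI[OF id])
  show "carrier Rp \<noteq> mp" using one Q.one_closed by blast
  show "J = mp \<or> J = carrier Rp" if "ideal J Rp" "mp \<subseteq> J" "J \<subseteq> carrier Rp" for J
   using unit[OF that(1)] that(2) by blast
 qed
 have "I = mp" if I: "maximalideal I Rp" for I
 proof -
  interpret I: maximalideal I Rp by (rule I)
  have "I \<subseteq> mp" using unit[OF I.is_ideal] I.I_notcarr by blast
  then show ?thesis using I.I_maximal[OF id \<open>I \<subseteq> mp\<close>] one Q.one_closed ideal.Icarr[OF id] by (metis subsetI)
 qed
 then show ?thesis unfolding max_ideal_def by (rule the_equality[where P = "\<lambda>m. maximalideal m Rp", OF max])
qed

text \<open>The localized module as a module over R: the homological lemmas above are stated over a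
  Noetherian local ring, and they are applied to this module instead of transferring that property
  to the localized ring.\<close>

definition A :: "('a, ('b \<times> 'a) set) module" where
 "A = \<lparr>carrier = carrier L, monoid.mult = undefined, monoid.one = undefined, ring.zero = \<zero>[L], ring.add = ring.add L,
  smult = (\<lambda>a z. fR a \<one> *[L] z)\<rparr>"

lemma A_sel: "carrier A = carrier L" "\<zero>[A] = \<zero>[L]" "x +[A] y = x +[L] y" "a *[A] z = fR a \<one> *[L] z"
 by (simp_all add: A_def)

lemma fr_smult_A: "a \<in> carrier R ==> m \<in> carrier M ==> s \<in> S ==> a *[A] fr m s = fr (a *[M] m) s"
 by (simp add: A_sel fr_smult)

lemma rmod_A: "rmod R A"
proof -
 interpret LA: abelian_group L by (rule L_abelian)
 have "abelian_group A" by (rule abelian_groupI) (use LA.a_assoc LA.a_comm LA.l_neg LA.a_inv_closed in \<open>auto simp: A_sel(1-3)\<close>)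
 then show ?thesis
 proof (rule rmodI[OF is_cring])
  fix a x assume a: "a \<in> carrier R" and "x \<in> carrier A"
  then have xL: "x \<in> carrier L" by (simp add: A_sel)
  then obtain m s where x: "m \<in> carrier M" "s \<in> S" "x = fr m s" by (rule L_E)
  show "a *[A] x \<in> carrier A" using a x by (simp add: fr_smult_A A_sel(1) fr_L)
  show "(a \<oplus> b) *[A] x = a *[A] x +[A] b *[A] x" "(a \<otimes> b) *[A] x = a *[A] (b *[A] x)" if "b \<in> carrier R" for b
   using a x that by (simp_all add: fr_smult_A A_sel(3) fr_add_same M.smult_l_distr M.smult_assoc1)
  fix y assume "y \<in> carrier A"
  then have yL: "y \<in> carrier L" by (simp add: A_sel)
  obtain m n s where "m \<in> carrier M" "n \<in> carrier M" "s \<in> S" "x = fr m s" "y = fr n s" by (rule L_common[OF xL yL])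
  then show "a *[A] (x +[A] y) = a *[A] x +[A] a *[A] y" using a by (simp add: fr_smult_A A_sel(3) fr_add_same M.smult_r_distr)
 next
  show "\<one> *[A] x = x" if "x \<in> carrier A" for x
   by (rule L_E[of x]) (use that in \<open>simp_all add: A_sel(1) fr_smult_A\<close>)
 qed
qed

sublocale A: rmod R A by (rule rmod_A)

lemma seq_A:
 "set xs \<subseteq> carrier R ==> m \<in> carrier M ==> s \<in> S ==> fr m s \<in> seq_submodule R A xs \<longleftrightarrow> (\<exists>u\<in>S. u *[M] m \<in> seq_submodule R M xs)"
proof (induct xs arbitrary: m s rule: rev_induct)
 case Nil
 have "fr m s = fr \<zero>[M] \<one> \<longleftrightarrow> (\<exists>u\<in>S. u *[M] m = \<zero>[M])" using Nil by (subst fr_eq) (auto simp: M.smult_r_null)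
 then show ?case by (simp add: A.seq_Nil M.seq_Nil A_sel(2) L_sel(2))
next
 case (snoc x xs)
 have xs: "set xs \<subseteq> carrier R" "x \<in> carrier R" using snoc(2) by auto
 note m = snoc(3,4)
 show ?case
 proof
  assume "fr m s \<in> seq_submodule R A (xs @ [x])"
  then obtain v b where v: "v \<in> seq_submodule R A xs" "b \<in> carrier A" "fr m s = v +[A] x *[A] b" unfolding A.seq_snoc[OF xs] by blast
  have vL: "v \<in> carrier L" using A.sub_car[OF A.seq_sub[OF xs(1)] v(1)] by (simp add: A_sel)
  obtain k n t where k: "k \<in> carrier M" "n \<in> carrier M" "t \<in> S" "v = fr k t" "b = fr n t" by (rule L_common[OF vL, of b]) (use v(2) in \<open>simp_all add: A_sel\<close>)
  obtain u where u: "u \<in> S" "u *[M] k \<in> seq_submodule R M xs" using snoc(1)[OF xs(1) k(1,3)] v(1) k(4) by blast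
  have "fr m s = fr (k +[M] x *[M] n) t" unfolding v(3) k(4,5) using k xs(2) by (simp add: fr_smult_A A_sel(3) fr_add_same)
  then obtain w where w: "w \<in> S" "w *[M] (t *[M] m) = w *[M] (s *[M] (k +[M] x *[M] n))" using fr_eq[OF m, of "k +[M] x *[M] n" t] k xs(2) by auto
  have "(u \<otimes> (w \<otimes> t)) *[M] m = u *[M] (w *[M] (t *[M] m))" using u w k m by (simp add: M.smult_assoc1)
  also have "\<dots> = (w \<otimes> s) *[M] (u *[M] k) +[M] x *[M] ((w \<otimes> (s \<otimes> u)) *[M] n)"
   unfolding w(2) using u w k m xs(2) by (simp add: M.smult_r_distr M.smult_assoc1[symmetric] m_ac)
  also have "\<dots> \<in> seq_submodule R M (xs @ [x])" unfolding M.seq_snoc[OF xs]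
   by (rule CollectI, rule exI, rule exI, intro conjI, rule refl, rule M.sub_smult[OF M.seq_sub[OF xs(1)] _ u(2)]) (use u w k m in simp_all)
  finally show "\<exists>u\<in>S. u *[M] m \<in> seq_submodule R M (xs @ [x])" using u w k by (intro bexI[of _ "u \<otimes> (w \<otimes> t)"]) auto
 next
  assume "\<exists>u\<in>S. u *[M] m \<in> seq_submodule R M (xs @ [x])"
  then obtain u v b where u: "u \<in> S" "v \<in> seq_submodule R M xs" "b \<in> carrier M" "u *[M] m = v +[M] x *[M] b" unfolding M.seq_snoc[OF xs] by blast
  have v: "v \<in> carrier M" by (rule M.sub_car[OF M.seq_sub[OF xs(1)] u(2)])
  have us: "u \<otimes> s \<in> S" using u m by simp
  have "fr m s = fr v (u \<otimes> s) +[A] x *[A] fr b (u \<otimes> s)"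
   unfolding fr_cancel[OF m u(1), symmetric] u(4) using us v u xs(2) by (simp add: fr_smult_A A_sel(3) fr_add_same)
  moreover have "fr v (u \<otimes> s) \<in> seq_submodule R A xs" using snoc(1)[OF xs(1) v us] v u(2) by (auto intro!: bexI[of _ \<one>])
  ultimately show "fr m s \<in> seq_submodule R A (xs @ [x])" unfolding A.seq_snoc[OF xs] using fr_L[OF u(3) us] by (auto simp: A_sel(1))
 qed
qed

lemma wreg_A: "wreg R M xs ==> wreg R A xs"
proof (induct xs rule: rev_induct)
 case (snoc x xs)
 then have xs: "wreg R M xs" "x \<in> carrier R" "\<And>a. a \<in> carrier M ==> x *[M] a \<in> seq_submodule R M xs ==> a \<in> seq_submodule R M xs"
  unfolding M.wreg_snoc by auto
 note x = M.wreg_set[OF xs(1)]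
 have "a \<in> seq_submodule R A xs" if a: "a \<in> carrier A" "x *[A] a \<in> seq_submodule R A xs" for a
 proof -
  obtain m s where m: "m \<in> carrier M" "s \<in> S" "a = fr m s" using a(1) unfolding A_sel(1) by (rule L_E)
  obtain u where u: "u \<in> S" "u *[M] (x *[M] m) \<in> seq_submodule R M xs"
   using a(2) seq_A[OF x, of "x *[M] m" s] m xs(2) by (auto simp: fr_smult_A)
  then have "u *[M] m \<in> seq_submodule R M xs" using xs(3)[of "u *[M] m"] m xs(2) by (simp add: smult_swap)
  then show ?thesis using seq_A[OF x m(1,2)] u(1) m(3) by blast
 qed
 then show ?case using snoc(1)[OF xs(1)] xs(2) by (simp add: A.wreg_snoc)
qed (rule A.wreg_Nil)

lemma Rp_smult:
 assumes "c \<in> carrier R" "s \<in> S" "z \<in> carrier L"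
 shows "fR c s *[L] z = c *[A] (fR \<one> s *[L] z)" "c *[A] z = s *[A] (fR c s *[L] z)" "fR \<one> s *[L] z \<in> carrier L"
proof -
 obtain m t where m: "m \<in> carrier M" "t \<in> S" "z = fr m t" using assms(3) by (rule L_E)
 show "fR c s *[L] z = c *[A] (fR \<one> s *[L] z)" "fR \<one> s *[L] z \<in> carrier L" using m assms by (simp_all add: fr_smult fr_smult_A fr_L)
 show "c *[A] z = s *[A] (fR c s *[L] z)" using m assms by (simp add: fr_smult fr_smult_A fr_cancel)
qed

lemma inv_lin: "s \<in> S ==> lin R A A (\<lambda>z. fR \<one> s *[L] z)"
proof (rule linI)
 interpret Lm: rmod Rp L by (rule L_rmod)
 assume s: "s \<in> S"
 note f = fR_Rp[OF one_closed s]
 show "fR \<one> s *[L] z \<in> carrier A" if "z \<in> carrier A" for z using Lm.smult_closed[OF f] that by (simp add: A_sel)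
 show "fR \<one> s *[L] (z +[A] y) = fR \<one> s *[L] z +[A] fR \<one> s *[L] y" if "z \<in> carrier A" "y \<in> carrier A" for z y
  using Lm.smult_r_distr[OF f] that by (simp add: A_sel)
 show "fR \<one> s *[L] (a *[A] z) = a *[A] (fR \<one> s *[L] z)" if "a \<in> carrier R" "z \<in> carrier A" for a z
  using that s by (elim L_E[of z, folded A_sel(1)]) (simp add: fr_smult fr_smult_A)
qed

definition "num ys cs \<longleftrightarrow> list_all2 (\<lambda>y c. c \<in> carrier R \<and> (\<exists>s\<in>S. y = fR c s)) ys cs"

lemma num_set: "num ys cs ==> set cs \<subseteq> carrier R \<and> set ys \<subseteq> carrier Rp"
 unfolding num_def by (induct rule: list_all2_induct) (auto intro: fR_Rp)

lemma num_in: "num ys cs ==> (\<forall>y\<in>set ys. \<exists>c\<in>set cs. \<exists>s\<in>S. y = fR c s) \<and> (\<forall>c\<in>set cs. \<exists>y\<in>set ys. \<exists>s\<in>S. y = fR c s)"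
 unfolding num_def by (induct rule: list_all2_induct) auto

text \<open>Denominators act invertibly on the localization, by \<open>inv_lin\<close>, so fractions
  and their numerators generate the same submodules.\<close>

lemma seq_Rp:
 assumes n: "num ys cs" shows "seq_submodule Rp L ys = seq_submodule R A cs"
proof
 interpret Lm: rmod Rp L by (rule L_rmod)
 have cs: "set cs \<subseteq> carrier R" and ys: "set ys \<subseteq> carrier Rp" using num_set[OF n] by auto
 note sub = A.seq_sub[OF cs] and subL = Lm.seq_sub[OF ys]
 have sA: "submodule (seq_submodule R A cs) Rp L"
 proof (rule Lm.subI_comb)
  show "seq_submodule R A cs \<subseteq> carrier L" using A.sub_car[OF sub] by (auto simp: A_sel)
  show "\<zero>[L] \<in> seq_submodule R A cs" using A.sub_zero[OF sub] by (simp add: A_sel)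
  fix x assume x: "x \<in> seq_submodule R A cs"
  then have xL: "x \<in> carrier L" using A.sub_car[OF sub] by (simp add: A_sel)
  show "x +[L] y \<in> seq_submodule R A cs" if "y \<in> seq_submodule R A cs" for y using A.sub_add[OF sub x that] by (simp add: A_sel)
  fix a assume "a \<in> carrier Rp"
  then obtain c s where c: "c \<in> carrier R" "s \<in> S" "a = fR c s" by (rule Rp_E)
  show "a *[L] x \<in> seq_submodule R A cs"
   unfolding c(3) Rp_smult(1)[OF c(1,2) xL] by (rule A.sub_smult[OF sub c(1) lin_seq[OF rmod_A rmod_A inv_lin[OF c(2)] cs x]])
 qed
 show "seq_submodule Rp L ys \<subseteq> seq_submodule R A cs"
  unfolding seq_submodule_def[of Rp L]
 proof (rule Lm.span_least[OF sA], rule subsetI)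
  fix z assume "z \<in> {x *[L] m |x m. x \<in> set ys \<and> m \<in> carrier L}"
  then obtain y m where y: "y \<in> set ys" "m \<in> carrier L" "z = y *[L] m" by blast
  obtain c s where c: "c \<in> set cs" "s \<in> S" "y = fR c s" using num_in[OF n] y(1) by blast
  have cR: "c \<in> carrier R" using c cs by blast
  show "z \<in> seq_submodule R A cs" unfolding y(3) c(3) Rp_smult(1)[OF cR c(2) y(2)] seq_submodule_def
   by (rule subsetD[OF A.span_superset]) (use c(1) Rp_smult(3)[OF cR c(2) y(2)] in \<open>auto simp: A_sel(1)\<close>)
 qed
 have sL: "submodule (seq_submodule Rp L ys) R A"
 proof (rule A.subI_comb)
  show "seq_submodule Rp L ys \<subseteq> carrier A" using Lm.sub_car[OF subL] by (auto simp: A_sel)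
 qed (use Lm.sub_zero[OF subL] Lm.sub_add[OF subL] Lm.sub_smult[OF subL] fR_Rp in \<open>simp_all add: A_sel\<close>)
 show "seq_submodule R A cs \<subseteq> seq_submodule Rp L ys"
  unfolding seq_submodule_def[of R A]
 proof (rule A.span_least[OF sL], rule subsetI)
  fix z assume "z \<in> {x *[A] m |x m. x \<in> set cs \<and> m \<in> carrier A}"
  then obtain c m where c: "c \<in> set cs" "m \<in> carrier L" "z = c *[A] m" by (auto simp: A_sel(1))
  obtain y s where y: "y \<in> set ys" "s \<in> S" "y = fR c s" using num_in[OF n] c(1) by blast
  have cR: "c \<in> carrier R" using c cs by blast
  have "y *[L] m \<in> seq_submodule Rp L ys" unfolding seq_submodule_def by (rule subsetD[OF Lm.span_superset]) (use y(1) c(2) in blast)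
  then show "z \<in> seq_submodule Rp L ys" unfolding c(3) Rp_smult(2)[OF cR y(2) c(2)] y(3)[symmetric] by (rule A.sub_smult[OF sL S_car[OF y(2)]])
 qed
qed

lemma wreg_Rp:
 assumes n: "num ys cs" shows "wreg Rp L ys \<longleftrightarrow> wreg R A cs"
proof -
 have len: "length ys = length cs" using n unfolding num_def by (rule list_all2_lengthD)
 have "ys ! i *[L] a \<in> seq_submodule Rp L (take i ys) \<longleftrightarrow> cs ! i *[A] a \<in> seq_submodule R A (take i cs)"
  if i: "i < length ys" and a: "a \<in> carrier L" for i a
 proof -
  have nt: "num (take i ys) (take i cs)" using n unfolding num_def by (rule list_all2_takeI)
  have ct: "set (take i cs) \<subseteq> carrier R" using num_set[OF nt] by blast
  obtain s where s: "cs ! i \<in> carrier R" "s \<in> S" "ys ! i = fR (cs ! i) s" using n i unfolding num_def list_all2_conv_all_nth by blast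
  have "ys ! i *[L] a = fR \<one> s *[L] (cs ! i *[A] a)"
   using Rp_smult(1)[OF s(1,2) a] lin_smult[OF inv_lin[OF s(2)] s(1), of a] a s(3) by (simp add: A_sel(1))
  then show ?thesis
   unfolding seq_Rp[OF nt] using lin_seq[OF rmod_A rmod_A inv_lin[OF s(2)] ct, of "cs ! i *[A] a"]
    A.sub_smult[OF A.seq_sub[OF ct] S_car[OF s(2)], of "ys ! i *[L] a"] Rp_smult(2)[OF s(1,2) a] s(3) by metis
 qed
 moreover have "a \<in> seq_submodule Rp L (take i ys) \<longleftrightarrow> a \<in> seq_submodule R A (take i cs)" for i a
  using seq_Rp[of "take i ys" "take i cs"] n by (simp add: num_def list_all2_takeI)
 ultimately show ?thesis unfolding wreg_def using num_set[OF n] len by (simp add: A_sel(1))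
qed

lemma numI:
 assumes "set ys \<subseteq> mp" obtains cs where "num ys cs" "set cs \<subseteq> p"
proof -
 have "\<exists>cs. num ys cs \<and> set cs \<subseteq> p" using assms
 proof (induct ys)
  case (Cons y ys)
  then obtain cs where cs: "num ys cs" "set cs \<subseteq> p" by auto
  obtain a s where "a \<in> p" "s \<in> S" "y = fR a s" using Cons(2) by (auto simp: mp_def)
  then show ?case using cs P.Icarr by (intro exI[of _ "a # cs"]) (auto simp: num_def)
 qed (simp add: num_def)
 then show ?thesis using that by blast
qed

end

text \<open>Suppose \<open>x\<close> is a zero divisor on M modulo \<open>xs\<close>, and let
  \<open>p\<close> be an associated prime containing it, the annihilator of \<open>b\<close>. Over
  the ring localized at \<open>p\<close> the sequence stays regular with \<open>x\<close> appended,
  so the Serre condition supplies an equally long regular sequence on the localized M. Its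
  numerators lie in \<open>p\<close> and multiply \<open>b\<close> into (xs), which
  \<open>wreg_comp\<close> excludes.\<close>

lemma (in lnr) S_tilde_wreg:
 assumes M: "rmod R M" and St: "S_tilde R r M"
 shows "wreg R rm xs ==> set xs \<subseteq> mx ==> length xs \<le> r ==> wreg R M xs"
proof (induct xs rule: rev_induct)
 interpret M: rmod R M by (rule M)
 interpret rm: rmod R rm by (rule rmod_rm)
 {
  case Nil
  show ?case by (rule M.wreg_Nil)
 next
  case (snoc x xs)
  have xs: "wreg R rm xs" "x \<in> carrier R" using snoc(2) unfolding rm.wreg_snoc by auto
  have IH: "wreg R M xs" using snoc(1)[OF xs(1)] snoc(3,4) by simp
  have xsR: "set xs \<subseteq> carrier R" by (rule rm.wreg_set[OF xs(1)])
  let ?V = "seq_submodule R M xs"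
  have V: "submodule ?V R M" by (rule M.seq_sub[OF xsR])
  have "a \<in> ?V" if a: "a \<in> carrier M" "x *[M] a \<in> ?V" for a
  proof (rule ccontr)
   assume na: "a \<notin> ?V"
   \<comment> \<open>The annihilator of \<open>a\<close> modulo \<open>?V\<close>, which contains
     \<open>x\<close>, is enlarged to a prime annihilator.\<close>
   obtain b where b: "b \<in> carrier M" "{c \<in> carrier R. c *[M] a \<in> ?V} \<subseteq> {c \<in> carrier R. c *[M] b \<in> ?V}"
    "primeideal {c \<in> carrier R. c *[M] b \<in> ?V} R"
    by (rule max_ann[OF M V a(1) na]) (rule that)
   define p where "p = {c \<in> carrier R. c *[M] b \<in> ?V}"
   have p: "primeideal p R" using b(3) by (simp add: p_def)
   interpret K: localization R M p by (rule localization.intro[OF crng_axioms localization_axioms.intro[OF M p]])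
   interpret Q: localization R rm p by (rule K.loc_rm)
   interpret Rp: crng "loc_ring R K.S" by (rule crng.intro[OF K.Rp_cring])
   interpret Rpm: rmod K.Rp "ring_module K.Rp" by (rule Rp.rmod_rm)
   interpret Lm: rmod K.Rp K.L by (rule K.L_rmod)
   have xp: "x \<in> p" using a(2) b(2) xs(2) unfolding p_def by blast
   have xsp: "set xs \<subseteq> p"
    unfolding p_def seq_submodule_def using xsR b(1) M.span_superset[of "{x *[M] m |x m. x \<in> set xs \<and> m \<in> carrier M}"] by blast
   let ?ys = "map (\<lambda>x. K.fR x \<one>) (xs @ [x])"
   have n: "K.num ?ys (xs @ [x])" unfolding K.num_def list_all2_conv_all_nth using xsR xs(2) by (auto simp: nth_append intro!: bexI[of _ \<one>])
   have sel: "carrier (ring_module K.Rp) = carrier Q.L" "\<zero>[ring_module K.Rp] = \<zero>[Q.L]" "ring.add (ring_module K.Rp) = ring.add Q.L" "smult (ring_module K.Rp) = smult Q.L"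
    by (simp_all add: ring_module_def loc_ring_def Let_def)
   have "wreg K.Rp (ring_module K.Rp) ?ys" unfolding seq_cong(2)[OF sel] Q.wreg_Rp[OF n] by (rule Q.wreg_A[OF snoc(2)])
   \<comment> \<open>The sequence lies in \<open>p\<close>, so it generates no element outside
     \<open>p\<close>, and the quotient is nonzero.\<close>
   moreover have "seq_submodule K.Rp (ring_module K.Rp) ?ys \<noteq> carrier (ring_module K.Rp)"
   proof
    have c: "set (xs @ [x]) \<subseteq> carrier R" using xsR xs(2) by simp
    assume "seq_submodule K.Rp (ring_module K.Rp) ?ys = carrier (ring_module K.Rp)"
    then have "K.fR \<one> \<one> \<in> seq_submodule R Q.A (xs @ [x])" unfolding seq_cong(1)[OF sel] Q.seq_Rp[OF n] sel(1) using Q.fr_L[of \<one> \<one>] by simp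
    then obtain u where u: "u \<in> K.S" "u \<in> seq_submodule R rm (xs @ [x])" using Q.seq_A[OF c, of \<one> \<one>] by auto
    have "seq_submodule R rm (xs @ [x]) \<subseteq> p" using seq_rm_sub[of "xs @ [x]" p] xp xsp K.P.is_ideal by simp
    then show False using u by (auto simp: K.S_def)
   qed
   ultimately have reg: "regular_sequence K.Rp (ring_module K.Rp) ?ys" unfolding Rpm.regular_sequence_iff by blast
   have "K.fR z \<one> \<in> K.mp" if "z \<in> p" for z unfolding K.mp_def using that K.S_one by blast
   then have "set ?ys \<subseteq> max_ideal K.Rp" unfolding K.max_ideal_Rp using xp xsp by auto
   then have "enat (length ?ys) \<le> depth K.Rp (ring_module K.Rp)" using reg by (rule depth_ge)
   moreover have "depth K.Rp K.L \<ge> min (enat r) (depth K.Rp (ring_module K.Rp))" using St p unfolding S_tilde_def Let_def K.S_def by blast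
   ultimately have dL: "enat (Suc (length xs)) \<le> depth K.Rp K.L"
    using snoc(4) order_trans[of "enat (Suc (length xs))" "min (enat r) (depth K.Rp (ring_module K.Rp))"] by simp
   \<comment> \<open>Elements outside \<open>p\<close> do not multiply \<open>b\<close> into
     \<open>?V\<close>, so \<open>b\<close> survives localization modulo \<open>xs\<close>; in
     particular the localized module is nonzero and its depth is a genuine supremum.\<close>
   have b0: "K.fr b \<one> \<notin> seq_submodule R K.A xs"
    unfolding K.seq_A[OF xsR b(1) K.S_one] unfolding K.S_def unfolding p_def by blast
   have bL: "K.fr b \<one> \<in> carrier K.A" using K.fr_L[OF b(1)] by (simp add: K.A_sel(1))
   then have "K.fr b \<one> \<noteq> \<zero>[K.L]" using b0 K.A.sub_zero[OF K.A.seq_sub[OF xsR]] by (auto simp: K.A_sel)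
   then have "\<not> zero_module K.L" using bL unfolding zero_module_def K.A_sel(1) by auto
   then obtain ys where ys: "set ys \<subseteq> K.mp" "wreg K.Rp K.L ys" "length xs < length ys"
    using depth_less[OF _ dL] unfolding K.max_ideal_Rp Lm.regular_sequence_iff by blast
   \<comment> \<open>Exactly one element more than \<open>xs\<close>, as \<open>wreg_comp\<close>
     asks.\<close>
   let ?zs = "take (Suc (length xs)) ys"
   have "set ?zs \<subseteq> K.mp" by (rule subset_trans[OF set_take_subset ys(1)])
   then obtain cs where cs: "K.num ?zs cs" "set cs \<subseteq> p" by (rule K.numI)
   have "wreg R K.A cs" using Lm.wreg_take[OF ys(2)] K.wreg_Rp[OF cs(1)] by blast
   moreover have "length cs = Suc (length xs)" using list_all2_lengthD[OF cs(1)[unfolded K.num_def]] ys(3) by simp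
   moreover have "c *[K.A] K.fr b \<one> \<in> seq_submodule R K.A xs" if c: "c \<in> set cs" for c
   proof -
    have c': "c \<in> carrier R" "c *[M] b \<in> ?V" using c cs(2) unfolding p_def by blast+
    show ?thesis unfolding K.fr_smult_A[OF c'(1) b(1) K.S_one] K.seq_A[OF xsR M.smult_closed[OF c'(1) b(1)] K.S_one]
     by (rule bexI[OF _ K.S_one]) (use c' M.smult_one[OF M.smult_closed[OF c'(1) b(1)]] in simp)
   qed
   ultimately have "K.fr b \<one> \<in> seq_submodule R K.A xs" using wreg_comp[OF K.rmod_A K.wreg_A[OF IH] _ _ bL] by blast
   then show False using b0 by blast
  qed
  then show ?case unfolding M.wreg_snoc using IH xs(2) by blast
 }
qed

lemma tp_tp[simp]: "tp (tp D) = D" by (intro ext) (simp add: tp_def)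

section \<open>Complexes longer than the depth, and a criterion for freeness\<close>

context lnr begin

text \<open>Multiplied by the socle element \<open>u\<close>, the vector \<open>v\<close> becomes a
  cycle modulo \<open>xs\<close>; exactness survives at this place, and no boundaries exist since
  the next term is zero. So \<open>u \<otimes> v x\<close> lies in (xs), which is impossible for a
  unit \<open>v x\<close>.\<close>

lemma inj_mod_mx:
 assumes r: "res R X D" and d: "depth R rm = enat t" and j: "t \<le> j" and e: "X (Suc (Suc j)) = {}"
  and v: "v \<in> vec rm (X (Suc j))" and Dv: "\<And>y. y \<in> X j ==> dif rm X D j v y \<in> mx" and x: "x \<in> X (Suc j)"
 shows "v x \<in> mx"
proof (rule ccontr)
 interpret rm: rmod R rm by (rule rmod_rm)
 interpret K: rmod R "pw rm (X (Suc j))" by (rule rm.rmod_pw)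
 assume "v x \<notin> mx"
 then obtain b where b: "b \<in> carrier R" "b \<otimes> v x = \<one>" using unit_if_notin_mx[OF pwR[OF v]] by blast
 obtain xs u where xs: "length xs = t" "wreg R rm xs" "u \<in> carrier R" "u \<notin> seq_submodule R rm xs" "\<And>c. c \<in> mx ==> c \<otimes> u \<in> seq_submodule R rm xs"
  by (rule depth_socle[OF d]) (rule that)
 have f: "finite (X i)" "mat R (X i) (X (Suc i)) (D i)" for i using r by (auto simp: res_def)
 have uv: "u *[pw rm (X (Suc j))] v \<in> vec rm (X (Suc j))" by (rule K.smult_closed[OF xs(3) v])
 have "dif rm X D j (u *[pw rm (X (Suc j))] v) y \<in> seq_submodule R rm xs" if "y \<in> X j" for y
  using xs(5)[OF Dv[OF that]] m_comm[OF xs(3) mx_sub[OF Dv[OF that]]] lin_smult[OF rm.mm_lin[OF f] xs(3) v] by simp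
 then obtain w where w: "u \<otimes> v x -[rm] dif rm X D (Suc j) w x \<in> seq_submodule R rm xs"
  using rm.reduce_mat[of X D 0 "Suc j" xs j "u *[pw rm (X (Suc j))] v"] r xs(1,2) j uv x unfolding res_def by auto
 have z: "dif rm X D (Suc j) w x = \<zero>" using x by (simp add: mm_def e lc_def rm_finsum)
 then have "u \<otimes> v x \<in> seq_submodule R rm xs" using w xs(3) pwR[OF v] unfolding rm_minus z by (simp add: a_minus_def)
 then have "b \<otimes> (u \<otimes> v x) \<in> seq_submodule R rm xs" using rm.sub_smult[OF rm.seq_sub[OF rm.wreg_set[OF xs(2)]] b(1)] by simp
 moreover have "b \<otimes> (u \<otimes> v x) = u \<otimes> (b \<otimes> v x)" using b(1) xs(3) pwR[OF v] by (simp add: m_lcomm)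
 ultimately show False using xs(3,4) b(2) by simp
qed

text \<open>One inequality of the Auslander-Buchsbaum formula: by minimality a basis vector of the
  last term is a cycle modulo \<open>mx\<close>, against \<open>inj_mod_mx\<close>.\<close>

lemma length_le_depth:
 assumes r: "res R X D" and d: "depth R rm = enat t" and e: "X (Suc (Suc j)) = {}" "X (Suc j) \<noteq> {}"
  and D: "\<And>y x. y \<in> X j ==> x \<in> X (Suc j) ==> D j y x \<in> mx"
 shows "Suc j \<le> t"
proof (rule ccontr)
 assume "\<not> Suc j \<le> t"
 then have j: "t \<le> j" by simp
 obtain x where x: "x \<in> X (Suc j)" using e(2) by blast
 have "free_gen R x x \<in> mx"
  by (rule inj_mod_mx[OF r d j e(1) gen_pw[OF x] _ x]) (use mm_gen[of "X (Suc j)" "X j" "D j"] r D x in \<open>simp add: res_def\<close>)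
 then show False using one_notin_mx by (simp add: free_gen_def)
qed

lemma mx_vec: "v \<in> X \<rightarrow> mx ==> w \<in> X \<rightarrow> carrier R ==> dot X v w \<in> mx"
 unfolding lc_rm by (rule mx_finsum) (auto intro!: mx_mult_r)

text \<open>\<open>pivot\<close> at the maximal ideal, where elements outside are units: a form of
  Nakayama's lemma, tested on linear forms modulo \<open>mx\<close>.\<close>

lemma pivot_mx:
 assumes X: "finite X" and f: "lin R A (pw rm X) f" and A: "rmod R A"
  and v: "\<And>v x. v \<in> vec rm X ==> x \<in> X ==> v x \<notin> mx ==> (\<And>a. a \<in> carrier A ==> dot X v (f a) \<in> mx) ==> False"
  and w: "w \<in> vec rm X"
 shows "\<exists>a\<in>carrier A. w = f a"
proof -
 interpret rm: rmod R rm by (rule rmod_rm)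
 interpret A: rmod R A by (rule A)
 interpret K: rmod R "pw rm X" by (rule rm.rmod_pw)
 have U: "submodule (f ` carrier A) R (pw rm X)" by (rule lin_image_sub[OF A rm.rmod_pw f])
 from pivot[OF mx_prime X U] consider s where "s \<in> carrier R - mx" "\<And>v. v \<in> vec rm X ==> s *[pw rm X] v \<in> f ` carrier A" using v by blast
 then show ?thesis
 proof cases
  case 1
  then obtain b where b: "b \<in> carrier R" "b \<otimes> s = \<one>" using unit_if_notin_mx by blast
  have s: "s \<in> carrier R" using 1(1) by blast
  have "s *[pw rm X] (b *[pw rm X] w) = w" using K.smult_assoc1[OF s b(1) w] b m_comm[OF s b(1)] K.smult_one[OF w] by metis
  then show ?thesis using 1(2)[OF K.smult_closed[OF b(1) w]] by auto
 qed
qed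

text \<open>Freeness is defined through a set of elements; independence makes \<open>\<mu>\<close>
  injective on \<open>X\<close>, so that the family can be traded for its image.\<close>

lemma free_moduleI:
 assumes M: "rmod R M" and X: "finite X" and g: "gens R M X \<mu>" and inj: "\<And>c. c \<in> vec rm X ==> lc M X c \<mu> = \<zero>[M] ==> c = \<zero>[pw rm X]"
 shows "free_module R M"
proof -
 interpret M: rmod R M by (rule M)
 interpret rm: rmod R rm by (rule rmod_rm)
 interpret K: rmod R "pw rm X" by (rule rm.rmod_pw)
 have \<mu>: "\<mu> \<in> X \<rightarrow> carrier M" using g by (simp add: gens_def)
 note l = lc_lin[OF M X \<mu>]
 have inj': "c = c'" if "c \<in> vec rm X" "c' \<in> vec rm X" "lc M X c \<mu> = lc M X c' \<mu>" for c c'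
 proof (rule K.minus_eq_zeroD[OF that(1,2)], rule inj[OF K.M.minus_closed[OF that(1,2)]])
  show "lc M X (c -[pw rm X] c') \<mu> = \<zero>[M]" using lin_minus[OF rm.rmod_pw M l that(1,2)] that(3) M.M.r_neg[OF lin_closed[OF l that(2)]] by (simp add: a_minus_def)
 qed
 have "inj_on \<mu> X"
 proof (rule inj_onI, rule ccontr)
  fix x y assume x: "x \<in> X" "y \<in> X" "\<mu> x = \<mu> y" "x \<noteq> y"
  have "free_gen R x = free_gen R y" by (rule inj'[OF gen_pw[OF x(1)] gen_pw[OF x(2)]]) (use M.lc_gen[OF X _ \<mu>] x in simp)
  from fun_cong[OF this, of x] show False using x(4) one_notin_mx mx_zero by (simp add: free_gen_def)
 qed
 let ?B = "\<mu> ` X"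
 have F: "carrier (free_module_on R ?B) = vec rm ?B" using pw_free[of ?B] X by simp
 have ev: "(\<Oplus>\<^bsub>M\<^esub>b\<in>{b. c b \<noteq> \<zero>}. c b *[M] b) = lc M X (\<lambda>x. if x \<in> X then c (\<mu> x) else \<zero>) \<mu>" (is "_ = lc M X ?c \<mu>") if c: "c \<in> vec rm ?B" for c
 proof -
  have "(\<Oplus>\<^bsub>M\<^esub>b\<in>{b. c b \<noteq> \<zero>}. c b *[M] b) = lext R M (\<lambda>b. b) c" by (simp add: lext_def lc_def)
  also have "\<dots> = lc M ?B c (\<lambda>b. b)" by (rule lext_fin[OF M]) (use X pwR[OF c] pw0[OF c] \<mu> in auto)
  also have "\<dots> = lc M X (\<lambda>x. c (\<mu> x)) \<mu>" unfolding lc_def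
   by (rule M.M.add.finprod_reindex) (use pwR[OF c] \<mu> \<open>inj_on \<mu> X\<close> in auto)
  also have "\<dots> = lc M X ?c \<mu>" by (rule M.lc_cong) (use pwR[OF c] \<mu> in auto)
  finally show ?thesis .
 qed
 have cX: "(\<lambda>x. if x \<in> X then c (\<mu> x) else \<zero>) \<in> vec rm X" if "c \<in> vec rm ?B" for c by (rule pwI) (use pwR[OF that] in auto)
 have "bij_betw (\<lambda>c. \<Oplus>\<^bsub>M\<^esub>b\<in>{b. c b \<noteq> \<zero>}. c b *[M] b) (carrier (free_module_on R ?B)) (carrier M)"
  unfolding F
 proof (rule bij_betw_imageI)
  show "inj_on (\<lambda>c. \<Oplus>\<^bsub>M\<^esub>b\<in>{b. c b \<noteq> \<zero>}. c b *[M] b) (vec rm ?B)"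
  proof (rule inj_onI)
   fix c c' assume c: "c \<in> vec rm ?B" "c' \<in> vec rm ?B" "(\<Oplus>\<^bsub>M\<^esub>b\<in>{b. c b \<noteq> \<zero>}. c b *[M] b) = (\<Oplus>\<^bsub>M\<^esub>b\<in>{b. c' b \<noteq> \<zero>}. c' b *[M] b)"
   have e: "(\<lambda>x. if x \<in> X then c (\<mu> x) else \<zero>) = (\<lambda>x. if x \<in> X then c' (\<mu> x) else \<zero>)"
    by (rule inj'[OF cX[OF c(1)] cX[OF c(2)]]) (use c(3) ev[OF c(1)] ev[OF c(2)] in simp)
   show "c = c'"
   proof (rule pw_ext[OF c(1,2)])
    fix b assume "b \<in> ?B"
    then obtain x where "x \<in> X" "b = \<mu> x" by blast
    then show "c b = c' b" using fun_cong[OF e, of x] by simp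
   qed
  qed
  show "(\<lambda>c. \<Oplus>\<^bsub>M\<^esub>b\<in>{b. c b \<noteq> \<zero>}. c b *[M] b) ` vec rm ?B = carrier M"
  proof (intro subset_antisym subsetI)
   fix m assume "m \<in> (\<lambda>c. \<Oplus>\<^bsub>M\<^esub>b\<in>{b. c b \<noteq> \<zero>}. c b *[M] b) ` vec rm ?B"
   then show "m \<in> carrier M" using ev lin_closed[OF l cX] by auto
  next
   fix m assume "m \<in> carrier M"
   then obtain c where c: "c \<in> vec rm X" "m = lc M X c \<mu>" using g by (auto simp: gens_def)
   let ?c = "\<lambda>b. if b \<in> ?B then c (inv_into X \<mu> b) else \<zero>"
   have c': "?c \<in> vec rm ?B" by (rule pwI) (use pwR[OF c(1)] in auto)
   have "(\<lambda>x. if x \<in> X then ?c (\<mu> x) else \<zero>) = c" using \<open>inj_on \<mu> X\<close> pw0[OF c(1)] by (auto simp: fun_eq_iff)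
   then have "(\<Oplus>\<^bsub>M\<^esub>b\<in>{b. ?c b \<noteq> \<zero>}. ?c b *[M] b) = m" using ev[OF c'] c(2) by simp
   then show "m \<in> (\<lambda>c. \<Oplus>\<^bsub>M\<^esub>b\<in>{b. c b \<noteq> \<zero>}. c b *[M] b) ` vec rm ?B" by (rule image_eqI[OF _ c', OF sym])
  qed
 qed
 moreover have "?B \<subseteq> carrier M" using \<mu> by blast
 ultimately show ?thesis unfolding free_module_def by blast
qed

end

section \<open>Freeness\<close>

locale dual_module = dual R q lX \<Lambda> X D for R :: "'a ring" (structure) and q lX \<Lambda> X D +
 fixes M :: "('a, 'b) module" and \<mu> and t r :: nat
 assumes M: "rmod R M" and res: "res_of R M lX \<mu> \<Lambda>" and depth: "depth R rm = enat t" and t: "t = q + r"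
  and regM: "\<And>xs. wreg R rm xs ==> set xs \<subseteq> mx ==> length xs \<le> r ==> wreg R M xs"
  and bounded: "\<exists>a. X (Suc a) = {}"
begin

sublocale M: rmod R M by (rule M)
sublocale rm: rmod R rm by (rule rmod_rm)
sublocale C: rmod R "pw rm (X i)" for i by (rule rm.rmod_pw)

abbreviation "dC p \<equiv> cod rm X D p"
abbreviation "aug c \<equiv> lc M (X 0) c \<mu>"
text \<open>In degree 0 this is the kernel of L_0 to M, so the complex modulo \<open>U\<close> is M
  followed by the duals of G_0, G_1 and so on.\<close>

definition "U p = (if p = 0 then {c \<in> vec rm (X 0). aug c = \<zero>[M]} else {\<zero>[pw rm (X p)]})"

lemma aug: "lin R (pw rm (X 0)) M aug" "\<And>m. m \<in> carrier M ==> \<exists>c\<in>vec rm (X 0). aug c = m"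
proof -
 have "\<mu> \<in> X 0 \<rightarrow> carrier M" using res by (simp add: res_of_def gens_def X0)
 then show "lin R (pw rm (X 0)) M aug" by (rule lc_lin[OF M LX(3)])
 show "\<And>m. m \<in> carrier M ==> \<exists>c\<in>vec rm (X 0). aug c = m" using res unfolding res_of_def gens_def X0 by metis
qed

lemma dC: "lin R (pw rm (X p)) (pw rm (X (Suc p))) (dC p)" by (rule rm.mm_lin[OF LX(3)]) (simp add: LX(4))

lemma U0: "c \<in> U 0 ==> \<exists>w\<in>vec rm (lX 1). c = mm rm (lX 1) (\<Lambda> 0) (lX 0) w"
 using res unfolding U_def res_of_def X0 by auto

lemma U0_mx: "c \<in> U 0 ==> c x \<in> mx"
proof -
 assume "c \<in> U 0"
 then obtain w where w: "w \<in> vec rm (lX 1)" "c = mm rm (lX 1) (\<Lambda> 0) (lX 0) w" using U0 by blast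
 have "dot (lX 1) (\<Lambda> 0 x) w \<in> mx" if "x \<in> lX 0" by (rule mx_vec) (use Lmx that w(1) in auto)
 then show ?thesis using mx_zero by (simp add: w(2) mm_def)
qed

lemma dC_U0: "c \<in> U 0 ==> dC 0 c = \<zero>[pw rm (X 1)]"
proof -
 assume "c \<in> U 0"
 then obtain w where w: "w \<in> vec rm (lX 1)" "c = mm rm (lX 1) (\<Lambda> 0) (lX 0) w" using U0 by blast
 from res_zero_tp[OF rmod_rm K_res, of w q] w show ?thesis by (simp add: kX_q kD_q X0)
qed

sublocale K: cochain R "\<lambda>p. pw rm (X p)" dC U
proof (intro cochain.intro cochain_axioms.intro crng_axioms rm.rmod_pw dC)
 show "submodule (U i) R (pw rm (X i))" for i
 proof (rule C.subI_comb)
  show "\<zero>[pw rm (X i)] \<in> U i" using lin_zero[OF rm.rmod_pw M aug(1)] C.M.zero_closed[of 0] by (auto simp: U_def simp del: pw_sel)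
  show "U i \<subseteq> vec rm (X i)" using C.M.zero_closed[of i] by (auto simp: U_def simp del: pw_sel)
  fix x assume x: "x \<in> U i"
  show "x +[pw rm (X i)] y \<in> U i" if "y \<in> U i" for y
   using x that lin_add[OF aug(1)] C.M.a_closed[of _ 0] C.M.l_zero[OF C.M.zero_closed, of i] by (cases "i = 0") (auto simp: U_def simp del: pw_sel)
  show "a *[pw rm (X i)] x \<in> U i" if "a \<in> carrier R" for a
   using x that lin_smult[OF aug(1)] C.smult_closed[of a _ 0] C.smult_r_null[of a i] by (cases "i = 0") (auto simp: U_def simp del: pw_sel)
 qed
 show "dC i c \<in> U (Suc i)" if "c \<in> U i" for i c
  using that dC_U0 lin_zero[OF rm.rmod_pw rm.rmod_pw dC, of i] by (cases "i = 0") (auto simp: U_def simp del: pw_sel)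
 show "dC (Suc i) (dC i c) = \<zero>[pw rm (X (Suc (Suc i)))]" if "c \<in> vec rm (X i)" for i c
  using res_zero_tp[OF rmod_rm X that] by simp
qed

text \<open>Degree 0 is M by way of \<open>aug\<close>, and there the Serre condition enters through
  \<open>regM\<close>; the terms of positive degree are free.\<close>

lemma regK:
 assumes xs: "wreg R rm xs" "set xs \<subseteq> mx" "length xs \<le> r" shows "K.reg (rev xs)"
proof (rule K.regI[OF rm.wreg_set[OF xs(1)]])
 have lid: "lin R (pw rm (X i)) (pw rm (X i)) (\<lambda>c. c)" for i by (rule linI) auto
 fix us u vs i c assume z: "xs = us @ u # vs" "c \<in> vec rm (X i)" "u *[pw rm (X i)] c \<in> K.V (rev us) i"
 have *: "wreg R A (us @ [u])" if "wreg R A xs" "rmod R A" for A :: "('a, 'x) module" using rmod.wreg_take[OF that(2,1), of "Suc (length us)"] unfolding z(1) by simp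
 show "c \<in> K.V (rev us) i"
 proof (cases i)
  case 0
  show ?thesis unfolding 0
  proof (rule K.V_wreg[OF M aug(1) aug(2) _ *[OF regM[OF xs] M.rmod_axioms]])
   show "aug c = \<zero>[M] \<longleftrightarrow> c \<in> U 0" if "c \<in> vec rm (X 0)" for c using that by (simp add: U_def)
  qed (use z 0 in simp_all)
 next
  case (Suc p)
  have w: "wreg R (pw rm (X i)) (us @ [u])" by (rule rm.wreg_pw[OF *[OF xs(1) rm.rmod_axioms]])
  show ?thesis by (rule K.V_wreg[OF rm.rmod_pw lid _ _ w z(2,3)]) (auto simp: U_def Suc)
 qed
qed

text \<open>G_a is \<open>X (Suc a)\<close>, so this is the number of terms of G before the first
  zero one.\<close>

definition "a0 = (LEAST a. X (Suc a) = {})"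

lemma a0: "X (Suc a0) = {}" "b < a0 ==> X (Suc b) \<noteq> {}"
 unfolding a0_def using LeastI_ex[OF bounded] not_less_Least[of b "\<lambda>a. X (Suc a) = {}"] by auto

lemma kX_n: "kX (Suc (Suc q + a0)) = {}" using kX_r[of "Suc a0"] a0(1) by simp

text \<open>The place \<open>X p\<close> is degree \<open>q + p + 1\<close> of K, so
  \<open>ann_regular\<close> gives a regular sequence of that length, of which \<open>Suc p\<close>
  elements go into the acyclicity lemma. The second alternative is that of the unit ideal, where the
  sequence might leave \<open>mx\<close> but the cohomology vanishes outright.\<close>

lemma coboundary_killed:
 assumes p: "p \<le> a0"
 shows "\<exists>zs. length zs = Suc p \<and> wreg R rm zs \<and> set zs \<subseteq> mx \<and> (\<forall>z\<in>set zs. \<forall>v\<in>vec rm (X p). dC p v \<in> U (Suc p) --> K.bd [] p (z *[pw rm (X p)] v))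
  \<or> (\<forall>v\<in>vec rm (X p). dC p v \<in> U (Suc p) --> K.bd [] p v)"
proof -
 let ?k = "q + p"
 let ?I = "{c \<in> carrier R. \<forall>v\<in>vec rm (kX (Suc ?k)). cod rm kX kD (Suc ?k) v = (\<lambda>_. \<zero>) -->
   (\<exists>w\<in>vec rm (kX ?k). c *[pw rm (kX (Suc ?k))] v = cod rm kX kD ?k w)}"
 have pn: "Suc ?k \<le> Suc q + a0" using p by simp
 note I = ann_regular[OF K_res kX_n pn]
 have kp: "kX (Suc ?k) = X p" "kD (Suc ?k) = D p" "kX (Suc (Suc ?k)) = X (Suc p)" using kX_r[of p] kD_r[of p] kX_r[of "Suc p"] by simp_all
 have bd: "K.bd [] p (c *[pw rm (X p)] v)" if c: "c \<in> ?I" and v: "v \<in> vec rm (X p)" "dC p v \<in> U (Suc p)" for c v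
 proof -
  have cR: "c \<in> carrier R" using c by blast
  obtain w where w: "w \<in> vec rm (kX ?k)" "c *[pw rm (X p)] v = mm rm (kX ?k) (tp (kD ?k)) (X p) w"
   using c v unfolding kp by (auto simp: U_def)
  have cv: "c *[pw rm (X p)] v \<in> vec rm (X p)" by (rule C.smult_closed[OF cR v(1)])
  show ?thesis
  proof (cases p)
   case 0
   \<comment> \<open>The coboundaries of the dual of K at this place come from L_1; they are the
     relations of M, which make up \<open>U 0\<close>.\<close>
   have "c *[pw rm (X p)] v \<in> U 0" using res w cv unfolding 0 by (auto simp: kX_q kD_q U_def res_of_def X0 simp del: pw_sel)
   then show ?thesis unfolding 0
    by (intro K.bdI[of "[]" "\<zero>[pw rm (X 0)]" 0 "c *[pw rm (X 0)] v"])
     (use C.M.l_zero[OF cv[unfolded 0], symmetric] in \<open>simp_all add: K.im_def del: pw_sel\<close>)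
  next
   case (Suc p')
   then have "kX ?k = X p'" "kD ?k = D p'" using kX_r[of p'] kD_r[of p'] by simp_all
   then have "c *[pw rm (X p)] v \<in> K.im p" using w Suc by (auto simp: K.im_def)
   then show ?thesis
    by (intro K.bdI[of "[]" _ _ "\<zero>[pw rm (X p)]"]) (use C.M.r_zero[OF cv, symmetric] Suc in \<open>simp_all add: U_def del: pw_sel\<close>)
  qed
 qed
 show ?thesis
 proof (cases "\<one> \<in> ?I")
  case True
  show ?thesis using bd[OF True] C.smult_one by (simp del: pw_sel)
 next
  case False
  have Imx: "?I \<subseteq> mx" by (rule ideal_le_mx[OF I(1) False])
  obtain zs where zs: "length zs = Suc ?k" "set zs \<subseteq> ?I" "wreg R rm zs" using I(2) by blast
  have s: "set (take (Suc p) zs) \<subseteq> ?I" by (rule subset_trans[OF set_take_subset zs(2)])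
  show ?thesis
  proof (intro exI[of _ "take (Suc p) zs"] disjI1 conjI ballI impI rm.wreg_take zs(3) subset_trans[OF s Imx])
   show "length (take (Suc p) zs) = Suc p" using zs(1) by simp
   show "K.bd [] p (z *[pw rm (X p)] v)" if "z \<in> set (take (Suc p) zs)" "v \<in> vec rm (X p)" "dC p v \<in> U (Suc p)" for z v
    by (rule bd[OF subsetD[OF s that(1)] that(2,3)])
  qed
 qed
qed

text \<open>Regular sequences of R are known to be regular on M up to length \<open>r\<close>; this
  accounts for the bound on \<open>p\<close>.\<close>

lemma exact: "p \<le> a0 ==> Suc p \<le> r ==> v \<in> vec rm (X p) ==> dC p v \<in> U (Suc p) ==> K.bd [] p v"
proof (induct p arbitrary: v rule: less_induct)
 case (less p)
 have ex: "K.ex [] j" if "j < p" for j unfolding K.ex_def using less(1)[OF that] less(2,3) that by simp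
 from coboundary_killed[OF less(2)] consider zs where "length zs = Suc p" "wreg R rm zs" "set zs \<subseteq> mx" "\<And>z. z \<in> set zs ==> K.bd [] p (z *[pw rm (X p)] v)"
  | "K.bd [] p v" using less(4,5) by blast
 then show ?case
 proof cases
  case 1
  show ?thesis
  proof (rule K.acyclic[OF 1(1) _ ex less(4) 1(4)])
   show "K.reg (rev zs @ [])" using regK[OF 1(2,3)] 1(1) less(3) by simp
  qed
 qed
qed

lemma gen_one: "free_gen R x x \<notin> mx" using one_notin_mx by (simp add: free_gen_def)

text \<open>Otherwise the leftmost map of K is minimal, the length of K is bounded by the depth, and
  \<open>exact\<close> reaches the last place: there every basis vector is a coboundary of a minimal
  matrix and has entries in \<open>mx\<close>.\<close>

lemma a0_le: "a0 \<le> 1"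
proof (rule ccontr)
 assume "\<not> a0 \<le> 1"
 then obtain b where b: "a0 = Suc (Suc b)" by (metis One_nat_def le_SucI le_zero_eq not0_implies_Suc not_less_eq_eq)
 have ne: "X (Suc (Suc b)) \<noteq> {}" using a0(2)[of "Suc b"] b by simp
 have k: "kX (Suc q + Suc b) = X (Suc b)" "kX (Suc (Suc q + Suc b)) = X a0" "kX (Suc (Suc (Suc q + Suc b))) = {}" "kD (Suc q + Suc b) = D (Suc b)"
  using kX_r[of "Suc b"] kX_r[of a0] kX_n kD_r[of "Suc b"] b by simp_all
 \<comment> \<open>The length of K is \<open>q + 1 + a0\<close>, and \<open>t = q + r\<close>;
   comparing them gives the inequality under which \<open>exact\<close> is available at
   \<open>a0\<close>.\<close>
 have "Suc (Suc q + Suc b) \<le> t"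
  by (rule length_le_depth[OF K_res depth k(3)]) (use k ne b Dmx in auto)
 then have ar: "Suc a0 \<le> r" using t b by simp
 obtain x where x: "x \<in> X a0" using ne b by auto
 note e = gen_pw[OF x]
 have "dC a0 (free_gen R x) = \<zero>[pw rm (X (Suc a0))]" by (simp add: mm_def a0(1))
 then have "K.bd [] a0 (free_gen R x)" by (intro exact[OF order_refl ar e]) (simp add: U_def)
 then obtain c where c: "c \<in> vec rm (X (Suc b))" "free_gen R x -[pw rm (X a0)] dC (Suc b) c = \<zero>[pw rm (X a0)]"
  by (auto simp: K.bd_def K.im_def b U_def)
 have "free_gen R x = dC (Suc b) c" using C.minus_eq_zeroD[OF e _ c(2)] lin_closed[OF dC c(1)] b by simp
 then have "free_gen R x x = dot (X (Suc b)) (tp (D (Suc b)) x) c" using x b by (simp add: mm_def)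
 also have "\<dots> \<in> mx" by (rule mx_vec) (use Dmx x b c(1) in \<open>auto simp: tp_def\<close>)
 finally show False using gen_one[of x] by blast
qed

lemma dot_tp: "finite Z ==> mat R Z (X i) E ==> v \<in> vec rm Z ==> z \<in> vec rm (X i) ==> dot Z v (mm rm (X i) E Z z) = dot (X i) (mm rm Z (tp E) (X i) v) z"
proof -
 assume *: "finite Z" "mat R Z (X i) E" "v \<in> vec rm Z" "z \<in> vec rm (X i)"
 have m: "mm rm (X i) E Z z \<in> vec rm Z" "mm rm Z (tp E) (X i) v \<in> vec rm (X i)" using * by (intro rm.mm_closed; simp)+
 have "dot Z v (mm rm (X i) E Z z) = dot Z (mm rm (X i) E Z z) v" by (rule lc_rm_comm[OF pwR_Pi[OF *(3)] pwR_Pi[OF m(1)]])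
 also have "\<dots> = dot (X i) z (mm rm Z (tp E) (X i) v)" by (rule lc_mm[OF rmod_rm LX(3) *(1,2)]) (use * in simp_all)
 also have "\<dots> = dot (X i) (mm rm Z (tp E) (X i) v) z" by (rule lc_rm_comm[OF pwR_Pi[OF *(4)] pwR_Pi[OF m(2)]])
 finally show ?thesis .
qed

text \<open>For \<open>r \<ge> 2\<close> this is \<open>exact\<close> at the last place. For smaller
  \<open>r\<close> the complex K, of length \<open>q + 2\<close>, is longer than the depth, so
  \<open>D 0\<close> is injective modulo \<open>mx\<close> by \<open>inj_mod_mx\<close>, and its
  transpose is onto.\<close>

lemma dC_surj:
 assumes a: "a0 = 1" and w: "w \<in> vec rm (X 1)"
 shows "\<exists>c\<in>vec rm (X 0). w = dC 0 c"
proof (cases "2 \<le> r")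
 case True
 have "dC 1 w = \<zero>[pw rm (X 2)]" using a0(1) a by (simp add: mm_def numeral_2_eq_2)
 then have "K.bd [] 1 w" using a True w by (intro exact) (simp_all add: U_def numeral_2_eq_2)
 then obtain c where c: "c \<in> vec rm (X 0)" "w -[pw rm (X 1)] dC 0 c = \<zero>[pw rm (X 1)]"
  by (auto simp: K.bd_def K.im_def U_def)
 then show ?thesis using C.minus_eq_zeroD[OF w _ c(2)] lin_closed[OF dC c(1)] by auto
next
 case False
 have dC0: "lin R (pw rm (X 0)) (pw rm (X 1)) (dC 0)" using dC[of 0] by simp
 show ?thesis
 proof (rule pivot_mx[OF LX(3) dC0 rm.rmod_pw _ w])
  fix v x assume v: "v \<in> vec rm (X 1)" "x \<in> X 1" "v x \<notin> mx" and U: "\<And>c. c \<in> vec rm (X 0) ==> dot (X 1) v (dC 0 c) \<in> mx"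
  have "mm rm (X 1) (D 0) (X 0) v y \<in> mx" if y: "y \<in> X 0" for y
  proof -
   have m: "mm rm (X 1) (D 0) (X 0) v \<in> vec rm (X 0)" by (rule rm.mm_closed) (use LX(4)[of 0] v in simp_all)
   have "dot (X 1) v (dC 0 (free_gen R y)) = dot (X 0) (mm rm (X 1) (D 0) (X 0) v) (free_gen R y)"
    using dot_tp[OF LX(3), of 1 0 "tp (D 0)" v "free_gen R y"] LX(4)[of 0] v(1) gen_pw[OF y] by simp
   also have "\<dots> = dot (X 0) (free_gen R y) (mm rm (X 1) (D 0) (X 0) v)" by (rule lc_rm_comm) (use m gen_pw[OF y] in simp_all)
   also have "\<dots> = mm rm (X 1) (D 0) (X 0) v y" by (rule rm.lc_gen[OF LX(3) y]) (use m in simp)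
   finally show ?thesis using U[OF gen_pw[OF y]] by simp
  qed
  then have "v x \<in> mx"
   by (intro inj_mod_mx[OF K_res depth, of "Suc q" v x]) (use v kX_q kD_q kX_n t False a in simp_all)
  then show False using v(3) by blast
 qed
qed

lemma splitting:
 assumes a: "a0 = 1" obtains B where "lin R (pw rm (X 1)) (pw rm (X 0)) B" "\<And>w. w \<in> vec rm (X 1) ==> dC 0 (B w) = w"
proof -
 have "lin R (pw rm (X 0)) (pw rm (X 1)) (dC 0)" using dC[of 0] by simp
 moreover have "lin R (pw rm (X 1)) (pw rm (X 1)) (\<lambda>w. w)" by (rule linI) auto
 ultimately show ?thesis
  using free_lift[of "pw rm (X 0)" "pw rm (X 1)" "X 1" "dC 0" "\<lambda>w. w", OF rm.rmod_pw rm.rmod_pw LX(3)] dC_surj[OF a] that by metis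
qed

lemma sec_ker:
 assumes B: "lin R (pw rm (X 1)) (pw rm (X 0)) B" "\<And>w. w \<in> vec rm (X 1) ==> dC 0 (B w) = w" and c: "c \<in> vec rm (X 0)"
 shows "c -[pw rm (X 0)] B (dC 0 c) \<in> vec rm (X 0)" "dC 0 (c -[pw rm (X 0)] B (dC 0 c)) = \<zero>[pw rm (X 1)]"
proof -
 have d: "dC 0 c \<in> vec rm (X 1)" using lin_closed[OF dC c] by simp
 show "c -[pw rm (X 0)] B (dC 0 c) \<in> vec rm (X 0)" by (rule C.M.minus_closed[OF c lin_closed[OF B(1) d]])
 show "dC 0 (c -[pw rm (X 0)] B (dC 0 c)) = \<zero>[pw rm (X 1)]"
  using lin_minus[OF rm.rmod_pw rm.rmod_pw dC c lin_closed[OF B(1) d]] B(2)[OF d] C.M.r_neg[OF d] by (simp add: a_minus_def del: pw_sel)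
qed

lemma exact0:
 assumes "r > 0" and c: "c \<in> vec rm (X 0)" "dC 0 c = \<zero>[pw rm (X 1)]" shows "c \<in> U 0"
proof -
 have "K.bd [] 0 c" by (rule exact[OF _ _ c(1)]) (use assms(1) c(2) in \<open>simp_all add: U_def\<close>)
 then have "c -[pw rm (X 0)] \<zero>[pw rm (X 0)] \<in> U 0" unfolding K.bd_def K.im_def nat.case by auto
 then show ?thesis using C.M.add_minus[OF C.M.zero_closed c(1)] C.M.l_zero[OF c(1)] by metis
qed

text \<open>As \<open>a0 \<le> 1\<close>, four cases remain. The relations of M have entries in
  \<open>mx\<close> and are killed by \<open>dC 0\<close>; exactness, on one side or the other, then
  leaves no room for them.\<close>

lemma U0_trivial: "c \<in> U 0 ==> c = \<zero>[pw rm (X 0)]"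
proof -
 assume c: "c \<in> U 0"
 have cc: "c \<in> vec rm (X 0)" using c by (simp add: U_def)
 consider "a0 = 0" "r = 0" | "a0 = 0" "r > 0" | "a0 = 1" "r > 0" | "a0 = 1" "r = 0" using a0_le by linarith
 then show ?thesis
 proof cases
  case 1
  \<comment> \<open>Otherwise K would end in the dual of L_0 with a minimal matrix and have length
    \<open>q + 1\<close>, exceeding the depth \<open>q\<close>.\<close>
  have "X 0 = {}"
  proof (rule ccontr)
   assume "X 0 \<noteq> {}"
   then have "Suc q \<le> t" by (intro length_le_depth[OF K_res depth]) (use kX_q kX_n kD_q 1 Lmx X0 in \<open>auto simp: tp_def\<close>)
   then show False using t 1 by simp
  qed
  then show ?thesis by (intro pw_ext[OF cc C.M.zero_closed]) simp
 next
  case 2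
  \<comment> \<open>Otherwise a basis vector of L_0 would be a relation, although relations have
    entries in \<open>mx\<close>.\<close>
  have "X 0 = {}"
  proof (rule ccontr)
   assume "X 0 \<noteq> {}"
   then obtain x where x: "x \<in> X 0" by blast
   have "dC 0 (free_gen R x) = \<zero>[pw rm (X 1)]" using a0(1) 2 by (simp add: mm_def)
   then have "free_gen R x \<in> U 0" by (rule exact0[OF 2(2) gen_pw[OF x]])
   then show False using U0_mx[of _ x] gen_one[of x] by blast
  qed
  then show ?thesis by (intro pw_ext[OF cc C.M.zero_closed]) simp
 next
  case 3
  obtain B where B: "lin R (pw rm (X 1)) (pw rm (X 0)) B" "\<And>w. w \<in> vec rm (X 1) ==> dC 0 (B w) = w" by (rule splitting[OF 3(1)]) blast
  \<comment> \<open>The kernel of \<open>dC 0\<close> is \<open>U 0\<close>, inside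
    \<open>mx\<close> times L_0, so the section \<open>B\<close> is onto modulo \<open>mx\<close>
    and hence onto. A relation \<open>c\<close> is then \<open>B w\<close> with
    \<open>w = dC 0 c\<close>, which is zero.\<close>
  have "\<exists>w\<in>vec rm (X 1). c = B w"
  proof (rule pivot_mx[OF LX(3) B(1) rm.rmod_pw _ cc])
   fix v x assume v: "v \<in> vec rm (X 0)" "x \<in> X 0" "v x \<notin> mx" and im: "\<And>w. w \<in> vec rm (X 1) ==> dot (X 0) v (B w) \<in> mx"
   note e = gen_pw[OF v(2)]
   let ?w = "dC 0 (free_gen R x)" and ?k = "free_gen R x -[pw rm (X 0)] B (dC 0 (free_gen R x))"
   have w: "?w \<in> vec rm (X 1)" using lin_closed[OF dC e] by simp
   note Bw = lin_closed[OF B(1) w]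
   note k = sec_ker[OF B e]
   have kU: "?k \<in> U 0" by (rule exact0[OF 3(2) k])
   have l: "lin R (pw rm (X 0)) rm (\<lambda>u. dot (X 0) u v)" by (rule lc_lin[OF rmod_rm LX(3)]) (use v in simp)
   have "dot (X 0) ?k v \<in> mx" by (rule mx_vec) (use U0_mx[OF kU] v in auto)
   moreover have "dot (X 0) (B ?w) v \<in> mx" using im[OF w] lc_rm_comm[of v "X 0" "B ?w"] v Bw by simp
   ultimately have "dot (X 0) ?k v \<oplus> dot (X 0) (B ?w) v \<in> mx" by (rule mx_add)
   also have "dot (X 0) ?k v \<oplus> dot (X 0) (B ?w) v = dot (X 0) (?k +[pw rm (X 0)] B ?w) v" using lin_add[OF l k(1) Bw] by simp
   also have "?k +[pw rm (X 0)] B ?w = free_gen R x" unfolding a_minus_def using e Bw by (simp add: C.M.a_assoc C.M.l_neg del: pw_sel)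
   also have "dot (X 0) (free_gen R x) v = v x" by (rule rm.lc_gen[OF LX(3) v(2)]) (use v in simp)
   finally show False using v(3) by blast
  qed
  then obtain w where w: "w \<in> vec rm (X 1)" "c = B w" by blast
  then have "w = \<zero>[pw rm (X 1)]" using dC_U0[OF c] B(2) by metis
  then show ?thesis using w(2) lin_zero[OF rm.rmod_pw rm.rmod_pw B(1)] by simp
 next
  case 4
  obtain B where B: "lin R (pw rm (X 1)) (pw rm (X 0)) B" "\<And>w. w \<in> vec rm (X 1) ==> dC 0 (B w) = w" by (rule splitting[OF 4(1)]) blast
  let ?A = "mm rm (X 1) (D 0) (X 0)"
  have A: "lin R (pw rm (X 1)) (pw rm (X 0)) ?A" using rm.mm_lin[OF LX(3) LX(4)[of 0]] by simp
  have mA: "mat R (X 0) (X 1) (D 0)" using LX(4)[of 0] by simp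
  have adj: "dot (X 0) v (?A z) = dot (X 1) (dC 0 v) z" if "v \<in> vec rm (X 0)" "z \<in> vec rm (X 1)" for v z
   using dot_tp[OF LX(3) mA that] by simp
  \<comment> \<open>For \<open>r = 0\<close> the lemma \<open>exact\<close> gives no information,
    and exactness of K at the dual of L_0 is used instead: \<open>D 0\<close> is onto. Relations,
    being orthogonal to its image, are then zero.\<close>
  have surj: "\<exists>z\<in>vec rm (X 1). w = ?A z" if w: "w \<in> vec rm (X 0)" for w
  proof (rule pivot_mx[OF LX(3) A rm.rmod_pw _ w])
   fix v x assume v: "v \<in> vec rm (X 0)" "x \<in> X 0" "v x \<notin> mx" and im: "\<And>z. z \<in> vec rm (X 1) ==> dot (X 0) v (?A z) \<in> mx"
   have dv: "dC 0 v \<in> vec rm (X 1)" using lin_closed[OF dC v(1)] by simp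
   have dvm: "dC 0 v y \<in> mx" if y: "y \<in> X 1" for y
    using im[OF gen_pw[OF y]] adj[OF v(1) gen_pw[OF y]] lc_rm_comm[of "dC 0 v" "X 1" "free_gen R y"] rm.lc_gen[OF LX(3) y, of "dC 0 v"] dv gen_pw[OF y] by simp
   \<comment> \<open>Corrected so that \<open>dC 0\<close> kills it: the form now annihilates the
     image of \<open>?A\<close> exactly and not just modulo \<open>mx\<close>, and its entry at
     \<open>x\<close> is still a unit.\<close>
   let ?v = "v -[pw rm (X 0)] B (dC 0 v)"
   note k = sec_ker[OF B v(1)]
   have lx: "lin R (pw rm (X 0)) rm (\<lambda>u. u x)" by (rule linI) (auto intro: pwR)
   have "B (dC 0 v) x = dot (X 1) (dC 0 v) (\<lambda>y. B (free_gen R y) x)" by (rule lin_free_lc[OF rmod_rm LX(3) lin_comp[OF B(1) lx] dv])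
   also have "\<dots> \<in> mx" by (rule mx_vec) (use dvm pwR[OF lin_closed[OF B(1) gen_pw]] in auto)
   finally have Bm: "B (dC 0 v) x \<in> mx" .
   have Bc: "B (dC 0 v) \<in> vec rm (X 0)" by (rule lin_closed[OF B(1) dv])
   have "?v x \<notin> mx"
   proof
    assume "?v x \<in> mx"
    then have "?v x \<oplus> B (dC 0 v) x \<in> mx" using Bm by (rule mx_add)
    moreover have "?v +[pw rm (X 0)] B (dC 0 v) = v" unfolding a_minus_def using v(1) Bc by (simp add: C.M.a_assoc C.M.l_neg del: pw_sel)
    then have "?v x \<oplus> B (dC 0 v) x = v x" by (simp add: fun_eq_iff)
    ultimately show False using v(3) by simp
   qed
   then obtain b where b: "b \<in> carrier R" "b \<otimes> ?v x = \<one>" using unit_if_notin_mx[OF pwR[OF k(1)]] by blast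
   obtain xs u where xs: "length xs = t" "wreg R rm xs" "u \<in> carrier R" "u \<notin> seq_submodule R rm xs" "\<And>c. c \<in> mx ==> c \<otimes> u \<in> seq_submodule R rm xs"
    by (rule depth_socle[OF depth]) (rule that)
   have sR: "set xs \<subseteq> carrier R" by (rule rm.wreg_set[OF xs(2)])
   note sub = rm.seq_sub[OF sR]
   \<comment> \<open>By minimality of \<open>\<Lambda> 0\<close> this multiple of a basis vector is
     a cycle modulo \<open>xs\<close>. As \<open>xs\<close> has length \<open>t = q\<close>,
     exactness modulo \<open>xs\<close> survives at this place and makes it a value of
     \<open>?A\<close> modulo \<open>xs\<close>; pairing with \<open>?v\<close> puts u times a unit
     into (xs).\<close>
   let ?u = "u *[pw rm (X 0)] free_gen R x"
   have uc: "?u \<in> vec rm (X 0)" by (rule C.smult_closed[OF xs(3) gen_pw[OF v(2)]])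
   have "mm rm (X 0) (tp (\<Lambda> 0)) (lX 1) ?u y \<in> seq_submodule R rm xs" if y: "y \<in> lX 1" for y
   proof -
    have m: "mat R (lX 1) (X 0) (tp (\<Lambda> 0))" using LX(2)[of 0] X0 by simp
    have "mm rm (X 0) (tp (\<Lambda> 0)) (lX 1) ?u y = u \<otimes> \<Lambda> 0 x y"
     using lin_smult[OF rm.mm_lin[OF LX(3) m] xs(3) gen_pw[OF v(2)]] mm_gen[OF LX(3) m v(2) y] by (simp add: tp_def)
    also have "\<dots> = \<Lambda> 0 x y \<otimes> u" using m_comm[OF xs(3)] mx_sub[OF Lmx[of x 0 y]] v(2) X0 y by simp
    finally show ?thesis using xs(5)[OF Lmx[of x 0 y]] v(2) X0 y by simp
   qed
   then obtain z where z: "z \<in> vec rm (X 1)" "\<And>y. y \<in> X 0 ==> ?u y -[rm] ?A z y \<in> seq_submodule R rm xs"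
    using rm.reduce_mat[of kX kD 0 "Suc q" xs q ?u] K_res xs(1,2) t 4 uc unfolding res_def by (auto simp: kX_q kD_q)
   have Az: "?A z \<in> vec rm (X 0)" by (rule lin_closed[OF A z(1)])
   have "?u -[pw rm (X 0)] ?A z \<in> seq_submodule R (pw rm (X 0)) xs"
    using rm.seq_pw[OF sR C.M.minus_closed[OF uc Az]] z(2) fun_cong[OF rm.pw_minus[OF uc Az]] by simp
   then have "dot (X 0) (?u -[pw rm (X 0)] ?A z) ?v \<in> seq_submodule R rm xs"
    by (rule lin_seq[OF rm.rmod_pw rmod_rm lc_lin[OF rmod_rm LX(3)] sR, rotated]) (use k(1) in simp)
   moreover have l: "lin R (pw rm (X 0)) rm (\<lambda>w. dot (X 0) w ?v)" by (rule lc_lin[OF rmod_rm LX(3)]) (use k(1) in simp)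
   have "dot (X 0) (?u -[pw rm (X 0)] ?A z) ?v = u \<otimes> ?v x"
   proof -
    have "dot (X 0) (?A z) ?v = dot (X 1) (dC 0 ?v) z" using adj[OF k(1) z(1)] lc_rm_comm[of "?A z" "X 0" ?v] Az k(1) by simp
    also have "\<dots> = \<zero>" using k(2) lin_zero[OF rm.rmod_pw rmod_rm lc_lin[OF rmod_rm LX(3)[of 1]], of z] z(1) by simp
    finally have "dot (X 0) (?A z) ?v = \<zero>" .
    moreover have "dot (X 0) ?u ?v = u \<otimes> ?v x" using lin_smult[OF l xs(3) gen_pw[OF v(2)]] rm.lc_gen[OF LX(3) v(2), of ?v] k(1) by simp
    ultimately show ?thesis using lin_minus[OF rm.rmod_pw rmod_rm l uc Az] xs(3) pwR[OF k(1)] by (simp add: rm_neg a_minus_def)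
   qed
   ultimately have "b \<otimes> (u \<otimes> ?v x) \<in> seq_submodule R rm xs" using rm.sub_smult[OF sub b(1)] by simp
   moreover have "b \<otimes> (u \<otimes> ?v x) = u \<otimes> (b \<otimes> ?v x)" using b(1) xs(3) pwR[OF k(1)] by (simp only: m_lcomm)
   ultimately show False using b(2) xs(3,4) by simp
  qed
  show ?thesis
  proof (rule pw_ext[OF cc C.M.zero_closed])
   fix x assume x: "x \<in> X 0"
   obtain z where z: "z \<in> vec rm (X 1)" "free_gen R x = ?A z" using surj[OF gen_pw[OF x]] by blast
   have "c x = dot (X 0) c (?A z)" unfolding z(2)[symmetric] using lc_rm_comm[of c "X 0" "free_gen R x"] rm.lc_gen[OF LX(3) x, of c] cc gen_pw[OF x] by simp
   also have "\<dots> = dot (X 1) \<zero>[pw rm (X 1)] z" unfolding adj[OF cc z(1)] dC_U0[OF c] ..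
   also have "\<dots> = \<zero>" using lin_zero[OF rm.rmod_pw rmod_rm lc_lin[OF rmod_rm LX(3)[of 1]], of z] z(1) by simp
   finally show "c x = \<zero>[pw rm (X 0)] x" by simp
  qed
 qed
qed

lemma free: "free_module R M"
proof (rule free_moduleI[OF M LX(3)[of 0]])
 show "gens R M (X 0) \<mu>" using res by (simp add: res_of_def X0)
 show "c = \<zero>[pw rm (X 0)]" if "c \<in> vec rm (X 0)" "aug c = \<zero>[M]" for c by (rule U0_trivial) (simp add: U_def that)
qed

end

theorem corollary33:
  fixes R :: "'a ring" and M :: "('a, 'b) module" and N :: "('a, 'c) module" and p t r :: nat
  assumes "local_noetherian_ring R"
    and "Factorial_Ring.prime p" and "has_char R p"
    and "F_finite R p"
    and "depth R (ring_module R) = enat t"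
    and "module R M" and "finite_module R M"
    and "r \<le> t"
    and "S_tilde R r M"
    and "r < t \<Longrightarrow> \<forall>i. 1 \<le> i \<and> i \<le> t - r \<longrightarrow> zero_module (ext_module R i M (ring_module R))"
    and "module R N" and "finite_module R N" and "\<not> zero_module N"
    and "proj_dim R N \<le> enat (t - r)"
    and "(\<exists>l\<ge>1. infinite {e. e \<ge> 1 \<and> (\<forall>i\<in>{l..l + t}.
              zero_module (ext_module R i (hom_module R M N) (frobenius_module R p e)))})
         \<or> (\<exists>J Q :: nat. \<forall>j\<ge>J. \<forall>e\<ge>1. p ^ e \<ge> Q \<longrightarrow>
              zero_module (tor_module R j (hom_module R M N) (frobenius_module R p e)))"
  shows "free_module R M"
proof -
 interpret lnr R by (rule lnr.intro[OF assms(1)])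
 interpret rm: rmod R rm by (rule rmod_rm)
 interpret N: rmod R N by (rule rmod.intro[OF assms(11)])
 note M = rmod.intro[OF assms(6)] and N = rmod.intro[OF assms(11)]
 obtain lX \<mu> \<Lambda> where l: "res_of R M (lX :: nat => nat set) \<mu> \<Lambda>" and lm: "\<And>i y x. y \<in> lX i ==> x \<in> lX (Suc i) ==> \<Lambda> i y x \<in> mx"
  by (rule min_res[OF M assms(7)]) (rule that)
 obtain fX \<eta> F where F: "res_of R N (fX :: nat => nat set) \<eta> F" and Fm: "\<And>i y x. y \<in> fX i ==> x \<in> fX (Suc i) ==> F i y x \<in> mx"
  by (rule min_res[OF N assms(12)]) (rule that)
 have L: "finite (lX i)" "mat R (lX i) (lX (Suc i)) (\<Lambda> i)" for i using l by (auto simp: res_of_def res_def)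
 obtain X D where X: "res R X D" "X 0 = lX 0"
  "\<And>u. u \<in> {v \<in> vec rm (lX 0). mm rm (lX 0) (tp (\<Lambda> 0)) (lX 1) v = (\<lambda>_. \<zero>[R])} \<longleftrightarrow> (\<exists>v\<in>vec rm (X 1). u = mm rm (X 1) (D 0) (X 0) v)"
  "\<And>i y x. y \<in> X (Suc i) ==> x \<in> X (Suc (Suc i)) ==> D (Suc i) y x \<in> mx"
  by (rule res_tail[OF L(1) ker_sub[OF L(1)[of 0], of "lX 1" "tp (\<Lambda> 0)"]]) (use L(2)[of 0] in simp, rule that)
 \<comment> \<open>This is Ext in degree \<open>Suc i\<close>, at most \<open>t - r\<close>; for
   \<open>r = t\<close> the range is empty, in accordance with the guarded hypothesis.\<close>
 have ex: "exat rm (lX i) (tp (\<Lambda> i)) (lX (Suc i)) (tp (\<Lambda> (Suc i))) (lX (Suc (Suc i)))" if "i < t - r" for i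
  by (rule ext_zero_exact[OF M assms(7) l rmod_rm]) (use assms(10) that in simp)
 interpret dual R "t - r" lX \<Lambda> X D
  by (intro dual.intro dual_axioms.intro lnr_axioms X lm ex) (use l X(3) in \<open>simp_all add: res_of_def\<close>)
 \<comment> \<open>A nonzero module has a generator; this is what lets an empty degree of the total
   complex be detected on G.\<close>
 have F0: "fX 0 \<noteq> {}"
 proof
  assume "fX 0 = {}"
  then have "n = \<zero>[N]" if "n \<in> carrier N" for n using F that by (auto simp: res_of_def gens_def)
  then show False using assms(13) N.M.zero_closed unfolding zero_module_def by blast
 qed
 have b: "\<exists>a. X (Suc a) = {}"
 proof (rule dual_bounded[OF assms(2,3,5) M N l F _ _ F0 assms(15)])
  show "F i y x \<in> mx" if "y \<in> fX i" "x \<in> fX (Suc i)" for i y x by (rule Fm[OF that])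
  show "fX j = {}" if "t - r < j" for j by (rule proj_dim_empty[OF N F _ assms(14) that]) (rule Fm)
 qed
 interpret dual_module R "t - r" lX \<Lambda> X D M \<mu> t r
  by (intro dual_module.intro dual_axioms dual_module_axioms.intro M l assms(5) b S_tilde_wreg[OF M assms(9)]) (use assms(8) in simp_all)
 show ?thesis by (rule free)
qed

end
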